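(* (Provable in $\mathsf{S}$.) If $\mathsf{S}$ is consistent, then $\mathsf{S}$ is not finitely axiomatizable.
   Context: $\mathsf{S}$ is Zermelo–Fraenkel set theory $\mathsf{ZF}$ with the Axiom of Infinity omitted (not replaced by its negation). Finitely axiomatizable means there is a finite set of sentences with the same deductive closure as $\mathsf{S}$. *)

theory Defs
  imports Main
begin

section \<open>The language of set theory and first-order derivability\<close>

datatype fm = Mem nat nat | Eq nat nat | Neg fm | Imp fm fm | All nat fm

abbreviation "And \<phi> \<psi> \<equiv> Neg (Imp \<phi> (Neg \<psi>))"
abbreviation "Or \<phi> \<psi> \<equiv> Imp (Neg \<phi>) \<psi>"
abbreviation "Iff \<phi> \<psi> \<equiv> And (Imp \<phi> \<psi>) (Imp \<psi> \<phi>)"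
abbreviation "Exi x \<phi> \<equiv> Neg (All x (Neg \<phi>))"

primrec fv :: "fm \<Rightarrow> nat set" where
  "fv (Mem x y) = {x, y}"
| "fv (Eq x y) = {x, y}"
| "fv (Neg \<phi>) = fv \<phi>"
| "fv (Imp \<phi> \<psi>) = fv \<phi> \<union> fv \<psi>"
| "fv (All x \<phi>) = fv \<phi> - {x}"

text \<open>
  The Hilbert calculus below is the substitution-free axiomatization of classical first-order
  logic with equality (over nonempty domains) of Tarski, "A simplified formalization of
  predicate logic with identity" (1965), and Kalish and Montague. Tarski states \<open>Vacuous\<close> for
  variables that do not occur in the formula; the (equally sound) version for variables that
  are not free is used here. \<open>Gen\<close> applies to hypotheses as well, so hypotheses with free
  variables have the force of their universal closures.
\<close>

inductive derivable :: "fm set \<Rightarrow> fm \<Rightarrow> bool" (infix "\<turnstile>" 50) for T :: "fm set" where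
  Hyp: "\<phi> \<in> T \<Longrightarrow> T \<turnstile> \<phi>"
| MP: "T \<turnstile> \<phi> \<Longrightarrow> T \<turnstile> Imp \<phi> \<psi> \<Longrightarrow> T \<turnstile> \<psi>"
| Gen: "T \<turnstile> \<phi> \<Longrightarrow> T \<turnstile> All x \<phi>"
| P1: "T \<turnstile> Imp \<phi> (Imp \<psi> \<phi>)"
| P2: "T \<turnstile> Imp (Imp \<phi> (Imp \<psi> \<chi>)) (Imp (Imp \<phi> \<psi>) (Imp \<phi> \<chi>))"
| P3: "T \<turnstile> Imp (Imp (Neg \<phi>) (Neg \<psi>)) (Imp \<psi> \<phi>)"
| Distr: "T \<turnstile> Imp (All x (Imp \<phi> \<psi>)) (Imp (All x \<phi>) (All x \<psi>))"
| Spec: "T \<turnstile> Imp (All x \<phi>) \<phi>"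
| Vacuous: "x \<notin> fv \<phi> \<Longrightarrow> T \<turnstile> Imp \<phi> (All x \<phi>)"
| ExEq: "T \<turnstile> Exi x (Eq x y)"
| EqEq: "T \<turnstile> Imp (Eq x y) (Imp (Eq x z) (Eq y z))"
| EqMemL: "T \<turnstile> Imp (Eq x y) (Imp (Mem x z) (Mem y z))"
| EqMemR: "T \<turnstile> Imp (Eq x y) (Imp (Mem z x) (Mem z y))"

definition consistent :: "fm set \<Rightarrow> bool" where
  "consistent T \<longleftrightarrow> \<not> (\<exists>\<phi>. T \<turnstile> \<phi> \<and> T \<turnstile> Neg \<phi>)"

definition finitely_axiomatizable :: "fm set \<Rightarrow> bool" where
  "finitely_axiomatizable T \<longleftrightarrow>
     (\<exists>F. finite F \<and> (\<forall>\<phi>\<in>F. fv \<phi> = {}) \<and> (\<forall>\<phi>. F \<turnstile> \<phi> \<longleftrightarrow> T \<turnstile> \<phi>))"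


section \<open>Notation for concrete formulas\<close>

text \<open>
  A concrete formula is written as a function of the first variable index that is not yet in
  use. A quantifier takes that index for its bound variable and passes the next one on, so
  that bound variables of the formula become bound variables of the logic: for instance,
  \<open>(\<^bold>\<forall>x y. x \<^bold>\<in> y) 0\<close> is \<open>All 0 (All 1 (Mem 0 1))\<close>.
\<close>

type_synonym lfm = "nat \<Rightarrow> fm"

definition lMem :: "nat \<Rightarrow> nat \<Rightarrow> lfm" (infix "\<^bold>\<in>" 50) where "(x \<^bold>\<in> y) = (\<lambda>n. Mem x y)"
definition lEq :: "nat \<Rightarrow> nat \<Rightarrow> lfm" (infix "\<^bold>=" 50) where "(x \<^bold>= y) = (\<lambda>n. Eq x y)"
definition lNeg :: "lfm \<Rightarrow> lfm" ("\<^bold>\<not> _" [40] 40) where "(\<^bold>\<not> P) = (\<lambda>n. Neg (P n))"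
definition lImp :: "lfm \<Rightarrow> lfm \<Rightarrow> lfm" (infixr "\<^bold>\<longrightarrow>" 25) where "(P \<^bold>\<longrightarrow> Q) = (\<lambda>n. Imp (P n) (Q n))"
definition lAnd :: "lfm \<Rightarrow> lfm \<Rightarrow> lfm" (infixr "\<^bold>\<and>" 35) where "(P \<^bold>\<and> Q) = (\<lambda>n. And (P n) (Q n))"
definition lOr :: "lfm \<Rightarrow> lfm \<Rightarrow> lfm" (infixr "\<^bold>\<or>" 30) where "(P \<^bold>\<or> Q) = (\<lambda>n. Or (P n) (Q n))"
definition lIff :: "lfm \<Rightarrow> lfm \<Rightarrow> lfm" (infixr "\<^bold>\<longleftrightarrow>" 25) where "(P \<^bold>\<longleftrightarrow> Q) = (\<lambda>n. Iff (P n) (Q n))"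
definition lAll :: "(nat \<Rightarrow> lfm) \<Rightarrow> lfm" (binder "\<^bold>\<forall>" 10) where "lAll P = (\<lambda>n. All n (P n (Suc n)))"
definition lEx :: "(nat \<Rightarrow> lfm) \<Rightarrow> lfm" (binder "\<^bold>\<exists>" 10) where "lEx P = (\<lambda>n. Exi n (P n (Suc n)))"


section \<open>ZF without the Axiom of Infinity\<close>

definition extensionality_ax :: fm where
  "extensionality_ax = (\<^bold>\<forall>x y. (\<^bold>\<forall>z. z \<^bold>\<in> x \<^bold>\<longleftrightarrow> z \<^bold>\<in> y) \<^bold>\<longrightarrow> x \<^bold>= y) 0"

definition foundation_ax :: fm where
  "foundation_ax = (\<^bold>\<forall>x. (\<^bold>\<exists>y. y \<^bold>\<in> x) \<^bold>\<longrightarrow> (\<^bold>\<exists>y. y \<^bold>\<in> x \<^bold>\<and> (\<^bold>\<forall>z. z \<^bold>\<in> y \<^bold>\<longrightarrow> \<^bold>\<not> z \<^bold>\<in> x))) 0"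

definition pairing_ax :: fm where
  "pairing_ax = (\<^bold>\<forall>x y. \<^bold>\<exists>p. \<^bold>\<forall>z. z \<^bold>\<in> p \<^bold>\<longleftrightarrow> z \<^bold>= x \<^bold>\<or> z \<^bold>= y) 0"

definition union_ax :: fm where
  "union_ax = (\<^bold>\<forall>x. \<^bold>\<exists>u. \<^bold>\<forall>z. z \<^bold>\<in> u \<^bold>\<longleftrightarrow> (\<^bold>\<exists>y. z \<^bold>\<in> y \<^bold>\<and> y \<^bold>\<in> x)) 0"

definition power_ax :: fm where
  "power_ax = (\<^bold>\<forall>x. \<^bold>\<exists>p. \<^bold>\<forall>z. z \<^bold>\<in> p \<^bold>\<longleftrightarrow> (\<^bold>\<forall>w. w \<^bold>\<in> z \<^bold>\<longrightarrow> w \<^bold>\<in> x)) 0"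

definition separation_ax :: "nat \<Rightarrow> nat \<Rightarrow> nat \<Rightarrow> fm \<Rightarrow> fm" where
  "separation_ax x a b \<phi> = All a (Exi b (All x (Iff (Mem x b) (And (Mem x a) \<phi>))))"

text \<open>
  In the premise of Replacement, \<open>\<exists>z \<forall>y (\<phi>(x,y) \<longrightarrow> y = z)\<close> says that at most one \<open>y\<close>
  satisfies \<open>\<phi>(x,y)\<close>.
\<close>

definition replacement_ax :: "nat \<Rightarrow> nat \<Rightarrow> nat \<Rightarrow> nat \<Rightarrow> nat \<Rightarrow> fm \<Rightarrow> fm" where
  "replacement_ax x y z a b \<phi> =
     All a (Imp (All x (Imp (Mem x a) (Exi z (All y (Imp \<phi> (Eq y z))))))
                (Exi b (All y (Iff (Mem y b) (Exi x (And (Mem x a) \<phi>))))))"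

text \<open>
  The remaining free variables of \<open>\<phi>\<close> are the parameters of the schemes. No axiom asserting the
  existence of a set is needed, as the logic has nonempty domains.
\<close>

inductive_set ZF_minus_Inf :: "fm set" where
  Extensionality: "extensionality_ax \<in> ZF_minus_Inf"
| Foundation: "foundation_ax \<in> ZF_minus_Inf"
| Pairing: "pairing_ax \<in> ZF_minus_Inf"
| Union: "union_ax \<in> ZF_minus_Inf"
| Power: "power_ax \<in> ZF_minus_Inf"
| Separation: "distinct [x, a, b] \<Longrightarrow> b \<notin> fv \<phi> \<Longrightarrow> separation_ax x a b \<phi> \<in> ZF_minus_Inf"
| Replacement: "distinct [x, y, z, a, b] \<Longrightarrow> z \<notin> fv \<phi> \<Longrightarrow> b \<notin> fv \<phi> \<Longrightarrow>
    replacement_ax x y z a b \<phi> \<in> ZF_minus_Inf"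


section \<open>Syntax formalized in the language of set theory\<close>

text \<open>
  The notions above are now repeated inside the language of set theory. A set-theoretic term
  is represented by its graph: a \<open>trm\<close> \<open>t\<close> gives, for a variable \<open>c\<close>, the formula "\<open>c\<close> is the
  value of \<open>t\<close>".
\<close>

type_synonym trm = "nat \<Rightarrow> lfm"

definition iVar :: "nat \<Rightarrow> trm" where
  "iVar x = (\<lambda>c. c \<^bold>= x)"

definition iEmpty :: trm where
  "iEmpty = (\<lambda>c. \<^bold>\<forall>z. \<^bold>\<not> z \<^bold>\<in> c)"

definition iUpair :: "trm \<Rightarrow> trm \<Rightarrow> trm" where
  "iUpair s t = (\<lambda>c. \<^bold>\<exists>a b. s a \<^bold>\<and> t b \<^bold>\<and> (\<^bold>\<forall>z. z \<^bold>\<in> c \<^bold>\<longleftrightarrow> z \<^bold>= a \<^bold>\<or> z \<^bold>= b))"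

definition iPair :: "trm \<Rightarrow> trm \<Rightarrow> trm" where
  "iPair s t = iUpair (iUpair s s) (iUpair s t)"

definition iUnion :: "trm \<Rightarrow> trm \<Rightarrow> trm" where
  "iUnion s t = (\<lambda>c. \<^bold>\<exists>a b. s a \<^bold>\<and> t b \<^bold>\<and> (\<^bold>\<forall>z. z \<^bold>\<in> c \<^bold>\<longleftrightarrow> z \<^bold>\<in> a \<^bold>\<or> z \<^bold>\<in> b))"

definition iRemove :: "trm \<Rightarrow> trm \<Rightarrow> trm" where
  "iRemove s t = (\<lambda>c. \<^bold>\<exists>a b. s a \<^bold>\<and> t b \<^bold>\<and> (\<^bold>\<forall>z. z \<^bold>\<in> c \<^bold>\<longleftrightarrow> z \<^bold>\<in> a \<^bold>\<and> \<^bold>\<not> z \<^bold>= b))"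

definition iSucc :: "trm \<Rightarrow> trm" where
  "iSucc t = iUnion t (iUpair t t)"

primrec iNumeral :: "nat \<Rightarrow> trm" where
  "iNumeral 0 = iEmpty"
| "iNumeral (Suc k) = iSucc (iNumeral k)"

definition iTransitive :: "nat \<Rightarrow> lfm" where
  "iTransitive x = (\<^bold>\<forall>y z. z \<^bold>\<in> y \<^bold>\<longrightarrow> y \<^bold>\<in> x \<^bold>\<longrightarrow> z \<^bold>\<in> x)"

definition iOrd :: "nat \<Rightarrow> lfm" where
  "iOrd x = (iTransitive x \<^bold>\<and> (\<^bold>\<forall>y. y \<^bold>\<in> x \<^bold>\<longrightarrow> iTransitive y))"

text \<open>
  Natural numbers are the ordinals \<open>n\<close> such that every element of \<open>n \<union> {n}\<close> is zero or a
  successor. They need not form a set.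
\<close>

definition iNat :: "nat \<Rightarrow> lfm" where
  "iNat n = (iOrd n \<^bold>\<and>
     (\<^bold>\<forall>m. m \<^bold>\<in> n \<^bold>\<or> m \<^bold>= n \<^bold>\<longrightarrow> iEmpty m \<^bold>\<or> (\<^bold>\<exists>k. iSucc (iVar k) m)))"

text \<open>\<open>iAt s i v\<close> is \<open>(i,v) \<in> s\<close>; \<open>iSeq s n\<close> says that \<open>s\<close> is a function with domain \<open>n \<in> \<omega>\<close>.\<close>

definition iAt :: "nat \<Rightarrow> nat \<Rightarrow> nat \<Rightarrow> lfm" where
  "iAt s i v = (\<^bold>\<exists>p. iPair (iVar i) (iVar v) p \<^bold>\<and> p \<^bold>\<in> s)"

definition iSeq :: "nat \<Rightarrow> nat \<Rightarrow> lfm" where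
  "iSeq s n = (iNat n \<^bold>\<and>
     (\<^bold>\<forall>p. p \<^bold>\<in> s \<^bold>\<longrightarrow> (\<^bold>\<exists>i v. i \<^bold>\<in> n \<^bold>\<and> iPair (iVar i) (iVar v) p)) \<^bold>\<and>
     (\<^bold>\<forall>i. i \<^bold>\<in> n \<^bold>\<longrightarrow> (\<^bold>\<exists>v. iAt s i v \<^bold>\<and> (\<^bold>\<forall>w. iAt s i w \<^bold>\<longrightarrow> w \<^bold>= v))))"

definition iFinite :: "nat \<Rightarrow> lfm" where
  "iFinite F = (\<^bold>\<exists>n s. iSeq s n \<^bold>\<and>
     (\<^bold>\<forall>v. v \<^bold>\<in> F \<^bold>\<longleftrightarrow> (\<^bold>\<exists>i. i \<^bold>\<in> n \<^bold>\<and> iAt s i v)) \<^bold>\<and>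
     (\<^bold>\<forall>i j v. iAt s i v \<^bold>\<longrightarrow> iAt s j v \<^bold>\<longrightarrow> i \<^bold>= j))"

text \<open>
  Inductive generation: \<open>iGenerated R x\<close> says that \<open>x\<close> is an entry of a finite sequence each of
  whose entries \<open>v\<close> satisfies \<open>R prev v\<close>, where \<open>prev\<close> is the class of the earlier entries.
\<close>

definition iGenerated :: "((nat \<Rightarrow> lfm) \<Rightarrow> nat \<Rightarrow> lfm) \<Rightarrow> nat \<Rightarrow> lfm" where
  "iGenerated R x = (\<^bold>\<exists>n s. iSeq s n \<^bold>\<and>
     (\<^bold>\<exists>i. i \<^bold>\<in> n \<^bold>\<and> iAt s i x) \<^bold>\<and>
     (\<^bold>\<forall>i v. i \<^bold>\<in> n \<^bold>\<longrightarrow> iAt s i v \<^bold>\<longrightarrow> R (\<lambda>w. \<^bold>\<exists>j. j \<^bold>\<in> i \<^bold>\<and> iAt s j w) v))"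

text \<open>
  Formulas are coded by sets: the variable with index \<open>k\<close> by the von Neumann numeral \<open>k\<close>, and
  compound expressions by tagged pairs.
\<close>

definition cMem :: "trm \<Rightarrow> trm \<Rightarrow> trm" where "cMem s t = iPair (iNumeral 0) (iPair s t)"
definition cEq :: "trm \<Rightarrow> trm \<Rightarrow> trm" where "cEq s t = iPair (iNumeral 1) (iPair s t)"
definition cNeg :: "trm \<Rightarrow> trm" where "cNeg s = iPair (iNumeral 2) s"
definition cImp :: "trm \<Rightarrow> trm \<Rightarrow> trm" where "cImp s t = iPair (iNumeral 3) (iPair s t)"
definition cAll :: "trm \<Rightarrow> trm \<Rightarrow> trm" where "cAll s t = iPair (iNumeral 4) (iPair s t)"

abbreviation "cAnd s t \<equiv> cNeg (cImp s (cNeg t))"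
abbreviation "cIff s t \<equiv> cAnd (cImp s t) (cImp t s)"
abbreviation "cEx x t \<equiv> cNeg (cAll x (cNeg t))"

primrec quote :: "fm \<Rightarrow> trm" where
  "quote (Mem x y) = cMem (iNumeral x) (iNumeral y)"
| "quote (Eq x y) = cEq (iNumeral x) (iNumeral y)"
| "quote (Neg \<phi>) = cNeg (quote \<phi>)"
| "quote (Imp \<phi> \<psi>) = cImp (quote \<phi>) (quote \<psi>)"
| "quote (All x \<phi>) = cAll (iNumeral x) (quote \<phi>)"

text \<open>\<open>iFV c V\<close>: \<open>c\<close> codes a formula whose set of free variables is \<open>V\<close>.\<close>

definition iFV :: "nat \<Rightarrow> nat \<Rightarrow> lfm" where
  "iFV c V = (\<^bold>\<exists>p. iPair (iVar c) (iVar V) p \<^bold>\<and> iGenerated (\<lambda>prev q.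
     (\<^bold>\<exists>c V. iPair (iVar c) (iVar V) q \<^bold>\<and>
       ((\<^bold>\<exists>x y. iNat x \<^bold>\<and> iNat y \<^bold>\<and> (cMem (iVar x) (iVar y) c \<^bold>\<or> cEq (iVar x) (iVar y) c) \<^bold>\<and>
                iUpair (iVar x) (iVar y) V)
      \<^bold>\<or> (\<^bold>\<exists>a r. iPair (iVar a) (iVar V) r \<^bold>\<and> prev r \<^bold>\<and> cNeg (iVar a) c)
      \<^bold>\<or> (\<^bold>\<exists>a A b B r s. iPair (iVar a) (iVar A) r \<^bold>\<and> prev r \<^bold>\<and> iPair (iVar b) (iVar B) s \<^bold>\<and> prev s \<^bold>\<and>
                cImp (iVar a) (iVar b) c \<^bold>\<and> iUnion (iVar A) (iVar B) V)
      \<^bold>\<or> (\<^bold>\<exists>x a A r. iNat x \<^bold>\<and> iPair (iVar a) (iVar A) r \<^bold>\<and> prev r \<^bold>\<and>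
                cAll (iVar x) (iVar a) c \<^bold>\<and> iRemove (iVar A) (iVar x) V)))) p)"

definition iForm :: "nat \<Rightarrow> lfm" where
  "iForm c = (\<^bold>\<exists>V. iFV c V)"

definition iNotFree :: "nat \<Rightarrow> nat \<Rightarrow> lfm" where
  "iNotFree x c = (\<^bold>\<exists>V. iFV c V \<^bold>\<and> \<^bold>\<not> x \<^bold>\<in> V)"

definition iSentence :: "nat \<Rightarrow> lfm" where
  "iSentence c = (\<^bold>\<exists>V. iFV c V \<^bold>\<and> iEmpty V)"

definition iLogAx :: "nat \<Rightarrow> lfm" where
  "iLogAx c =
    ((\<^bold>\<exists>f g. iForm f \<^bold>\<and> iForm g \<^bold>\<and> cImp (iVar f) (cImp (iVar g) (iVar f)) c)
   \<^bold>\<or> (\<^bold>\<exists>f g h. iForm f \<^bold>\<and> iForm g \<^bold>\<and> iForm h \<^bold>\<and>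
        cImp (cImp (iVar f) (cImp (iVar g) (iVar h)))
             (cImp (cImp (iVar f) (iVar g)) (cImp (iVar f) (iVar h))) c)
   \<^bold>\<or> (\<^bold>\<exists>f g. iForm f \<^bold>\<and> iForm g \<^bold>\<and>
        cImp (cImp (cNeg (iVar f)) (cNeg (iVar g))) (cImp (iVar g) (iVar f)) c)
   \<^bold>\<or> (\<^bold>\<exists>x f g. iNat x \<^bold>\<and> iForm f \<^bold>\<and> iForm g \<^bold>\<and>
        cImp (cAll (iVar x) (cImp (iVar f) (iVar g)))
             (cImp (cAll (iVar x) (iVar f)) (cAll (iVar x) (iVar g))) c)
   \<^bold>\<or> (\<^bold>\<exists>x f. iNat x \<^bold>\<and> iForm f \<^bold>\<and> cImp (cAll (iVar x) (iVar f)) (iVar f) c)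
   \<^bold>\<or> (\<^bold>\<exists>x f. iNat x \<^bold>\<and> iNotFree x f \<^bold>\<and> cImp (iVar f) (cAll (iVar x) (iVar f)) c)
   \<^bold>\<or> (\<^bold>\<exists>x y. iNat x \<^bold>\<and> iNat y \<^bold>\<and> cEx (iVar x) (cEq (iVar x) (iVar y)) c)
   \<^bold>\<or> (\<^bold>\<exists>x y z. iNat x \<^bold>\<and> iNat y \<^bold>\<and> iNat z \<^bold>\<and>
        cImp (cEq (iVar x) (iVar y)) (cImp (cEq (iVar x) (iVar z)) (cEq (iVar y) (iVar z))) c)
   \<^bold>\<or> (\<^bold>\<exists>x y z. iNat x \<^bold>\<and> iNat y \<^bold>\<and> iNat z \<^bold>\<and>
        cImp (cEq (iVar x) (iVar y)) (cImp (cMem (iVar x) (iVar z)) (cMem (iVar y) (iVar z))) c)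
   \<^bold>\<or> (\<^bold>\<exists>x y z. iNat x \<^bold>\<and> iNat y \<^bold>\<and> iNat z \<^bold>\<and>
        cImp (cEq (iVar x) (iVar y)) (cImp (cMem (iVar z) (iVar x)) (cMem (iVar z) (iVar y))) c))"

text \<open>\<open>iDerivable A c\<close>: \<open>c\<close> has a derivation from hypotheses in the class \<open>A\<close>.\<close>

definition iDerivable :: "(nat \<Rightarrow> lfm) \<Rightarrow> nat \<Rightarrow> lfm" where
  "iDerivable A = iGenerated (\<lambda>prev v.
       A v
     \<^bold>\<or> iLogAx v
     \<^bold>\<or> (\<^bold>\<exists>a b. prev a \<^bold>\<and> prev b \<^bold>\<and> cImp (iVar a) (iVar v) b)
     \<^bold>\<or> (\<^bold>\<exists>x a. iNat x \<^bold>\<and> prev a \<^bold>\<and> cAll (iVar x) (iVar a) v))"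

definition iConsistent :: "(nat \<Rightarrow> lfm) \<Rightarrow> lfm" where
  "iConsistent A = (\<^bold>\<not> (\<^bold>\<exists>c d. iDerivable A c \<^bold>\<and> cNeg (iVar c) d \<^bold>\<and> iDerivable A d))"

definition iFinitelyAxiomatizable :: "(nat \<Rightarrow> lfm) \<Rightarrow> lfm" where
  "iFinitelyAxiomatizable A =
     (\<^bold>\<exists>F. iFinite F \<^bold>\<and> (\<^bold>\<forall>c. c \<^bold>\<in> F \<^bold>\<longrightarrow> iSentence c) \<^bold>\<and>
          (\<^bold>\<forall>c. iDerivable (\<lambda>v. v \<^bold>\<in> F) c \<^bold>\<longleftrightarrow> iDerivable A c))"

primrec iDistinctNats :: "nat list \<Rightarrow> lfm \<Rightarrow> lfm" where
  "iDistinctNats [] P = P"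
| "iDistinctNats (x # xs) P = (iNat x \<^bold>\<and> foldr (\<lambda>y Q. \<^bold>\<not> x \<^bold>= y \<^bold>\<and> Q) xs (iDistinctNats xs P))"

text \<open>
  \<open>iDistinctNats xs P\<close> is the conjunction of \<open>P\<close> with the statement that \<open>xs\<close> are pairwise
  distinct natural numbers. \<open>iZF_minus_Inf c\<close>: \<open>c\<close> codes an axiom of ZF without Infinity.
\<close>

definition iZF_minus_Inf :: "nat \<Rightarrow> lfm" where
  "iZF_minus_Inf c =
    (quote extensionality_ax c
   \<^bold>\<or> quote foundation_ax c
   \<^bold>\<or> quote pairing_ax c
   \<^bold>\<or> quote union_ax c
   \<^bold>\<or> quote power_ax c
   \<^bold>\<or> (\<^bold>\<exists>x a b f. iDistinctNats [x, a, b] (iNotFree b f) \<^bold>\<and>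
        cAll (iVar a) (cEx (iVar b) (cAll (iVar x)
          (cIff (cMem (iVar x) (iVar b)) (cAnd (cMem (iVar x) (iVar a)) (iVar f))))) c)
   \<^bold>\<or> (\<^bold>\<exists>x y z a b f. iDistinctNats [x, y, z, a, b] (iNotFree z f \<^bold>\<and> iNotFree b f) \<^bold>\<and>
        cAll (iVar a) (cImp
          (cAll (iVar x) (cImp (cMem (iVar x) (iVar a))
             (cEx (iVar z) (cAll (iVar y) (cImp (iVar f) (cEq (iVar y) (iVar z)))))))
          (cEx (iVar b) (cAll (iVar y) (cIff (cMem (iVar y) (iVar b))
             (cEx (iVar x) (cAnd (cMem (iVar x) (iVar a)) (iVar f))))))) c))"

text \<open>
  The sentence of set theory saying that, if ZF without Infinity is consistent, then it is not
  finitely axiomatizable.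
\<close>

definition con_imp_not_finitely_axiomatizable :: fm where
  "con_imp_not_finitely_axiomatizable =
     (iConsistent iZF_minus_Inf \<^bold>\<longrightarrow> \<^bold>\<not> iFinitelyAxiomatizable iZF_minus_Inf) 0"

end

theory Submission
  imports Defs "HOL-Library.Countable_Set"
begin

text \<open>
  Both parts follow from one semantic argument, carried out over an arbitrary world of
  hereditarily finite sets with a definable syntax: the standard one for the first part, and that
  of a countable model of ZF without Infinity for the second part, which then follows from the
  completeness theorem.

  Suppose that the consistent theory is axiomatized by a set \<open>F\<close> of bounded codes. Henkin's
  construction inside the world yields a model; let \<open>N\<close> be the hereditarily finite sets of that model.
  As \<open>F\<close> is bounded, \<open>N\<close> has a definable truth predicate \<open>T\<close> for all formulas that matter. Terms built
  from constants, one new element \<open>c\<close> and Skolem functions for \<open>T\<close> with least witnesses denote definable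
  functions of \<open>c\<close>. Deciding the atomic statements along the leftmost branch that is true for
  unboundedly many values of \<open>c\<close> gives a model \<open>H\<close> of terms, where Los's theorem holds for the
  formulas of \<open>F\<close>. So \<open>H\<close> satisfies the whole theory. But the terms are elements of \<open>N\<close>, which is an
  initial segment of \<open>H\<close>, and \<open>c\<close> is larger than all of them; evaluating terms inside \<open>H\<close>
  makes every element of \<open>H\<close> the value at \<open>c\<close> of an element below \<open>c\<close>, against Replacement.
\<close>

section \<open>Definable predicates and weak set theories\<close>

text \<open>The pattern is that of Ryll-Nardzewski's argument for arithmetic: bounded truth and one
  new element generate a model too small for the full scheme. Reflection, the usual route for ZF, is
  closed: in a world of hereditarily finite sets no set is a model, so \<open>N\<close> and
  \<open>H\<close> are classes of the world. They enter inductions only through names of elements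
  (\<open>nm\<close>) and codes of definable classes (\<open>R\<close>), and every induction needs a
  definability proof. Formulas and derivations may be nonstandard, and a set \<open>F\<close> that
  is finite inside may be infinite from outside. So finiteness is used as boundedness in the order,
  and substitution is expressed by quantification (\<open>sub\<close>, \<open>sb\<close>) instead of
  being performed on codes. Truth in \<open>N\<close> is definable in the world for all codes, but
  uniformly in \<open>N\<close> only below a bound. Hence Los's theorem reaches \<open>F\<close> and
  not the whole theory; every other theorem reaches \<open>H\<close> by a derivation from
  \<open>F\<close>, and this is where the finite axiomatization enters. The passage from a world to
  a structure is made twice, for \<open>N\<close> and again for \<open>H\<close>; therefore all
  carriers are renumbered by \<open>nat\<close>.\<close>

abbreviation scons :: "'a => (nat => 'a) => nat => 'a" (infixr "##" 65) where
  "a ## e \<equiv> case_nat a e"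

text \<open>
  \<open>df\<close> is a family of definable predicates on assignments. Abstracting from formulas, it only has the
  closure properties that the schemes of Separation, Replacement and induction need.
\<close>

locale dfl0 =
  fixes E :: "'a => 'a => bool" and df :: "((nat => 'a) => bool) => bool"
  assumes df_neg: "df P ==> df (\<lambda>e. \<not> P e)"
    and df_imp: "df P ==> df Q ==> df (\<lambda>e. P e --> Q e)"
    and df_all0: "df P ==> df (\<lambda>e. \<forall>v. P (v ## e))"
    and df_re: "df P ==> df (\<lambda>e. P (\<lambda>i. e (f i)))"
    and df_E0: "df (\<lambda>e. E (e 0) (e (Suc 0)))"
    and df_eq0: "df (\<lambda>e. e 0 = e (Suc 0))"
begin

text \<open>Functions are handled through their graphs: the value sits at index 0 and the arguments
  are shifted by one.\<close>

definition dt :: "((nat => 'a) => 'a) => bool" where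
  "dt t \<longleftrightarrow> df (\<lambda>e. e 0 = t (\<lambda>i. e (Suc i)))"

lemma df_all: "df (\<lambda>e. Q (\<lambda>i. e (Suc i)) (e 0)) ==> df (\<lambda>e. \<forall>v. Q e v)"
  using df_all0[of "\<lambda>e. Q (\<lambda>i. e (Suc i)) (e 0)"] by simp

lemma df_const: "df (\<lambda>e. b)"
proof -
  have "df (\<lambda>e. e 0 = e 0)" using df_re[OF df_eq0, of "\<lambda>i. 0"] by simp
  then have "df (\<lambda>e. True)" by simp
  then show ?thesis using df_neg[of "\<lambda>e. True"] by (cases b) simp_all
qed

lemma df_disj: "df P ==> df Q ==> df (\<lambda>e. P e \<or> Q e)"
  using df_imp[OF df_neg, of P Q] by (simp add: disj_imp)

lemma df_conj: "df P ==> df Q ==> df (\<lambda>e. P e \<and> Q e)"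
  using df_neg[OF df_imp[OF _ df_neg, of P Q]] by simp

lemma df_iff: "df P ==> df Q ==> df (\<lambda>e. P e = Q e)"
  using df_conj[OF df_imp[of P Q] df_imp[of Q P]] by (simp add: iff_conv_conj_imp)

lemma df_ex: "df (\<lambda>e. Q (\<lambda>i. e (Suc i)) (e 0)) ==> df (\<lambda>e. \<exists>v. Q e v)"
  using df_neg[OF df_all[OF df_neg, of Q]] by simp

lemma dt_weak: "dt t ==> dt (\<lambda>e. t (\<lambda>i. e (Suc i)))"
  unfolding dt_def using df_re[of "\<lambda>e. e 0 = t (\<lambda>i. e (Suc i))" "\<lambda>i. case i of 0 => 0 | Suc i => Suc (Suc i)"]
  by simp

lemma dt_var: "dt (\<lambda>e. e i)"
  unfolding dt_def using df_re[OF df_eq0, of "\<lambda>k. if k = 0 then 0 else Suc i"] by simp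

text \<open>Inserting a term costs one quantifier: \<open>P (s e)\<close> holds iff every
  \<open>v\<close> equal to \<open>s e\<close> satisfies \<open>P\<close>, so only the graph of
  \<open>s\<close> has to be definable. The versions with more arguments nest this device.\<close>

lemma df_comp1: "df (\<lambda>e. P (e 0)) ==> dt s ==> df (\<lambda>e. P (s e))"
proof -
  assume 1: "df (\<lambda>e. P (e 0))" and 2: "dt s"
  have "df (\<lambda>e. \<forall>v. v = s e --> P v)"
    by (intro df_all df_imp) (use 1 2 in \<open>simp_all add: dt_def\<close>)
  then show ?thesis by simp
qed

lemma df_comp2:
  assumes 1: "df (\<lambda>e. P (e 0) (e (Suc 0)))" and 2: "dt s" and 3: "dt t"
  shows "df (\<lambda>e. P (s e) (t e))"
proof -
  have "df (\<lambda>e. P (e (Suc 0)) (e 0))"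
    using df_re[OF 1, of "\<lambda>i. if i = 0 then Suc 0 else 0"] by simp
  then have "df (\<lambda>e. \<forall>v. v = s e --> (\<forall>w. w = t e --> P v w))"
    using 2 dt_weak[OF 3] by (intro df_all df_imp) (simp_all add: dt_def)
  then show ?thesis by simp
qed

lemma df_comp3:
  assumes 1: "df (\<lambda>e. P (e 0) (e (Suc 0)) (e (Suc (Suc 0))))" and 2: "dt s" and 3: "dt t" and 4: "dt u"
  shows "df (\<lambda>e. P (s e) (t e) (u e))"
proof -
  have a: "df (\<lambda>e. P (e (Suc (Suc 0))) (e (Suc 0)) (e 0))"
    using df_re[OF 1, of "\<lambda>i. if i = 0 then Suc (Suc 0) else if i = Suc 0 then Suc 0 else 0"] by simp
  have "df (\<lambda>e. \<forall>v. v = s e --> (\<forall>w. w = t e --> (\<forall>x. x = u e --> P v w x)))"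
    using 2 dt_weak[OF 3] dt_weak[OF dt_weak[OF 4]] a
    by (intro df_all df_imp) (simp_all add: dt_def)
  then show ?thesis by simp
qed

lemma df_comp4:
  assumes 1: "df (\<lambda>e. P (e 0) (e (Suc 0)) (e (Suc (Suc 0))) (e (Suc (Suc (Suc 0)))))"
    and 2: "dt s" and 3: "dt t" and 4: "dt u" and 5: "dt x"
  shows "df (\<lambda>e. P (s e) (t e) (u e) (x e))"
proof -
  have a: "df (\<lambda>e. P (e (Suc (Suc (Suc 0)))) (e (Suc (Suc 0))) (e (Suc 0)) (e 0))"
    using df_re[OF 1, of "\<lambda>i. if i = 0 then Suc (Suc (Suc 0)) else if i = Suc 0 then Suc (Suc 0)
      else if i = Suc (Suc 0) then Suc 0 else 0"] by simp
  have "df (\<lambda>e. \<forall>v. v = s e --> (\<forall>w. w = t e --> (\<forall>y. y = u e --> (\<forall>z. z = x e --> P v w y z))))"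
    using 2 dt_weak[OF 3] dt_weak[OF dt_weak[OF 4]] dt_weak[OF dt_weak[OF dt_weak[OF 5]]] a
    by (intro df_all df_imp) (simp_all add: dt_def)
  then show ?thesis by simp
qed

lemma dt_comp1:
  assumes "dt (\<lambda>e. f (e 0))" "dt s" shows "dt (\<lambda>e. f (s e))"
  using df_comp2[of "\<lambda>a y. y = f a" "\<lambda>e. s (\<lambda>i. e (Suc i))" "\<lambda>e. e 0"] dt_weak[OF assms(2)] dt_var[of 0]
    df_re[of "\<lambda>e. e 0 = f (e (Suc 0))" "\<lambda>i. if i = 0 then Suc 0 else 0"] assms(1)
  by (simp add: dt_def)

lemma dt_comp2:
  assumes "dt (\<lambda>e. f (e 0) (e (Suc 0)))" "dt s" "dt t" shows "dt (\<lambda>e. f (s e) (t e))"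
  using df_comp3[of "\<lambda>a b y. y = f a b" "\<lambda>e. s (\<lambda>i. e (Suc i))" "\<lambda>e. t (\<lambda>i. e (Suc i))" "\<lambda>e. e 0"]
    dt_weak[OF assms(2)] dt_weak[OF assms(3)] dt_var[of 0]
    df_re[of "\<lambda>e. e 0 = f (e (Suc 0)) (e (Suc (Suc 0)))"
      "\<lambda>i. if i = 0 then Suc (Suc 0) else if i = Suc 0 then 0 else Suc 0"] assms(1)
  by (simp add: dt_def)

lemma dt_comp3:
  assumes "dt (\<lambda>e. f (e 0) (e (Suc 0)) (e (Suc (Suc 0))))" "dt s" "dt t" "dt u"
  shows "dt (\<lambda>e. f (s e) (t e) (u e))"
  using df_comp4[of "\<lambda>a b c y. y = f a b c" "\<lambda>e. s (\<lambda>i. e (Suc i))" "\<lambda>e. t (\<lambda>i. e (Suc i))"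
      "\<lambda>e. u (\<lambda>i. e (Suc i))" "\<lambda>e. e 0"]
    dt_weak[OF assms(2)] dt_weak[OF assms(3)] dt_weak[OF assms(4)] dt_var[of 0]
    df_re[of "\<lambda>e. e 0 = f (e (Suc 0)) (e (Suc (Suc 0))) (e (Suc (Suc (Suc 0))))"
      "\<lambda>i. if i = 0 then Suc (Suc (Suc 0)) else if i = Suc 0 then 0 else if i = Suc (Suc 0) then Suc 0
        else Suc (Suc 0)"] assms(1)
  by (simp add: dt_def)

lemma df_E: "dt s ==> dt t ==> df (\<lambda>e. E (s e) (t e))"
  by (rule df_comp2[OF df_E0])

lemma df_eq: "dt s ==> dt t ==> df (\<lambda>e. s e = t e)"
  by (rule df_comp2[OF df_eq0])

lemmas dfs00 = df_const df_all df_ex df_neg df_imp df_conj df_disj df_iff df_E df_eq dt_var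

end

text \<open>Parameters are split off as \<open>df_inst\<close> because formulas without parameters
  form a \<open>dfl0\<close> first; closing such a family under parameters is a separate step
  (\<open>params_dfl\<close>).\<close>

locale dfl = dfl0 +
  assumes df_inst: "df P ==> df (\<lambda>e. P (c ## e))"
begin

lemma dt_const: "dt (\<lambda>e. c)"
  unfolding dt_def using df_re[OF df_inst[OF df_eq0, of c], of "\<lambda>i. 0"] by (simp add: eq_commute)

lemmas dfs0 = df_const df_all df_ex df_neg df_imp df_conj df_disj df_iff df_E df_eq dt_const dt_var

end

locale Z = dfl +
  assumes ext: "(\<And>z. E z x \<longleftrightarrow> E z y) ==> x = y"
    and found: "E y x ==> \<exists>y. E y x \<and> (\<forall>z. E z y --> \<not> E z x)"
    and pair_ex: "\<exists>p. \<forall>z. E z p \<longleftrightarrow> z = x \<or> z = y"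
    and union_ex: "\<exists>u. \<forall>z. E z u \<longleftrightarrow> (\<exists>y. E z y \<and> E y x)"
    and power_ex: "\<exists>p. \<forall>z. E z p \<longleftrightarrow> (\<forall>w. E w z --> E w x)"
    and sep: "df (\<lambda>e. Q (e 0)) ==> \<exists>b. \<forall>x. E x b \<longleftrightarrow> E x a \<and> Q x"
    and repl: "df (\<lambda>e. R (e 0) (e (Suc 0))) ==> (\<And>x y y'. E x a ==> R x y ==> R x y' ==> y = y') ==>
      \<exists>b. \<forall>y. E y b \<longleftrightarrow> (\<exists>x. E x a \<and> R x y)"

text \<open>Hereditarily finite sets axiomatized by adjunction, in the style of Tarski and Givant.
  This is easier to verify for a given structure than \<open>Z\<close>, and all of \<open>Z\<close>
  is recovered from it by induction below.\<close>

locale HFt = dfl +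
  assumes hext: "(\<And>z. E z x \<longleftrightarrow> E z y) ==> x = y"
    and hempty: "\<exists>z. \<forall>x. \<not> E x z"
    and hadj: "\<exists>v. \<forall>z. E z v \<longleftrightarrow> E z x \<or> z = y"
    and hinduct: "df (\<lambda>e. P (e 0)) ==> (\<And>z. (\<And>x. \<not> E x z) ==> P z) ==>
       (\<And>x y v. P x ==> P y ==> (\<And>z. E z v \<longleftrightarrow> E z x \<or> z = y) ==> P v) ==> P a"

section \<open>Finite and hereditarily finite sets\<close>

definition isemp where "isemp E z \<longleftrightarrow> (\<forall>x. \<not> E x z)"
definition isadj where "isadj E v x y \<longleftrightarrow> (\<forall>z. E z v \<longleftrightarrow> E z x \<or> z = y)"
definition subs where "subs E x y \<longleftrightarrow> (\<forall>z. E z x --> E z y)"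
definition trn where "trn E x \<longleftrightarrow> (\<forall>y z. E z y --> E y x --> E z x)"
text \<open>Kuratowski's notion of finiteness. It mentions no natural numbers, so induction over
  finite sets is available before any arithmetic.\<close>

definition fint where
  "fint E t \<longleftrightarrow> (\<forall>F. (\<forall>z. isemp E z --> E z F) -->
     (\<forall>u w v. E u F --> E w t --> isadj E v u w --> E v F) --> E t F)"
text \<open>A transitive finite superset is asked for, rather than a finite transitive closure,
  because transitive closures need not exist without Infinity.\<close>

definition hf where "hf E x \<longleftrightarrow> (\<exists>t. trn E t \<and> subs E x t \<and> fint E t)"

context dfl begin

lemma df_isemp: "dt s ==> df (\<lambda>e. isemp E (s e))"
  by (rule df_comp1) (unfold isemp_def, intro dfs0)
lemma df_isadj: "dt s ==> dt t ==> dt u ==> df (\<lambda>e. isadj E (s e) (t e) (u e))"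
  by (rule df_comp3) (unfold isadj_def, intro dfs0)
lemma df_subs: "dt s ==> dt t ==> df (\<lambda>e. subs E (s e) (t e))"
  by (rule df_comp2) (unfold subs_def, intro dfs0)
lemma df_trn: "dt s ==> df (\<lambda>e. trn E (s e))"
  by (rule df_comp1) (unfold trn_def, intro dfs0)
lemmas dfs1 = dfs0 df_isemp df_isadj df_subs df_trn
lemma df_fint: "dt s ==> df (\<lambda>e. fint E (s e))"
  by (rule df_comp1) (unfold fint_def, intro dfs1)
lemma df_hf: "dt s ==> df (\<lambda>e. hf E (s e))"
  by (rule df_comp1) (unfold hf_def, intro dfs1 df_fint)
lemmas dfs = dfs1 df_fint df_hf

end

context Z begin

lemma emp_ex: "\<exists>z. isemp E z"
  using sep[of "\<lambda>x. False" undefined, OF df_const] by (simp add: isemp_def)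

lemma sing_ex: "\<exists>p. \<forall>z. E z p \<longleftrightarrow> z = x"
  using pair_ex[of x x] by auto

lemma un_ex: "\<exists>u. \<forall>z. E z u \<longleftrightarrow> E z x \<or> E z y"
proof -
  obtain p where "\<forall>z. E z p \<longleftrightarrow> z = x \<or> z = y" using pair_ex by blast
  then show ?thesis using union_ex[of p] by (metis (full_types))
qed

lemma adj_ex: "\<exists>v. isadj E v x y"
proof -
  obtain p where "\<forall>z. E z p \<longleftrightarrow> z = y" using sing_ex by blast
  then show ?thesis using un_ex[of x p] by (auto simp: isadj_def)
qed

lemma irrefl: "\<not> E x x"
proof
  assume x: "E x x"
  obtain p where p: "\<forall>z. E z p \<longleftrightarrow> z = x" using sing_ex by blast
  then show False using found[of x p] x by auto
qed

text \<open>Separation inside the power set of \<open>t\<close> turns \<open>P\<close> into one of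
  the families \<open>F\<close> over which \<open>fint\<close> quantifies. This is why the step is
  required only for subsets of \<open>t\<close>.\<close>

lemma fint_induct:
  assumes "fint E t" "df (\<lambda>e. P (e 0))" "\<And>z. isemp E z ==> P z"
    "\<And>u w v. P u ==> subs E u t ==> E w t ==> isadj E v u w ==> P v"
  shows "P t"
proof -
  obtain p where p: "\<forall>z. E z p \<longleftrightarrow> subs E z t" using power_ex[of t] by (auto simp: subs_def)
  obtain F where F: "\<forall>x. E x F \<longleftrightarrow> E x p \<and> P x" using sep[OF assms(2)] by blast
  have "E t F" using assms(1) unfolding fint_def
  proof (elim allE impE)
    show "\<forall>z. isemp E z --> E z F" using F p assms(3) by (auto simp: isemp_def subs_def)
    show "\<forall>u w v. E u F --> E w t --> isadj E v u w --> E v F"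
      using F p assms(4) by (auto simp: isadj_def subs_def)
  qed
  then show ?thesis using F by blast
qed

lemma fint_emp: "isemp E z ==> fint E z"
  by (simp add: fint_def)

lemma fint_adj: assumes "fint E a" "isadj E v a b" shows "fint E v"
  unfolding fint_def
proof (intro allI impI)
  fix F assume F: "\<forall>z. isemp E z --> E z F" "\<forall>u w x. E u F --> E w v --> isadj E x u w --> E x F"
  have "E a F"
    using assms F unfolding fint_def by (metis isadj_def)
  moreover have "E b v" using assms(2) by (simp add: isadj_def)
  ultimately show "E v F" using F(2) assms(2) by blast
qed

text \<open>Induction over the superset \<open>t\<close>, following the finiteness of the
  intersection with \<open>x\<close> as \<open>t\<close> is built up.\<close>

lemma fint_subs: assumes "fint E t" "subs E x t" shows "fint E x"
proof -
  have "\<forall>i. (\<forall>z. E z i \<longleftrightarrow> E z x \<and> E z t) --> fint E i"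
    using assms(1)
  proof (rule fint_induct)
    show "df (\<lambda>e. \<forall>i. (\<forall>z. E z i \<longleftrightarrow> E z x \<and> E z (e 0)) --> fint E i)" by (intro dfs)
    show "\<And>z. isemp E z ==> \<forall>i. (\<forall>za. E za i \<longleftrightarrow> E za x \<and> E za z) --> fint E i"
      by (auto simp: isemp_def intro!: fint_emp)
    fix u w v assume IH: "\<forall>i. (\<forall>z. E z i \<longleftrightarrow> E z x \<and> E z u) --> fint E i" and v: "isadj E v u w"
    show "\<forall>i. (\<forall>z. E z i \<longleftrightarrow> E z x \<and> E z v) --> fint E i"
    proof (intro allI impI)
      fix i assume i: "\<forall>z. E z i \<longleftrightarrow> E z x \<and> E z v"
      obtain k where k: "\<forall>z. E z k \<longleftrightarrow> E z x \<and> E z u" using sep[of "\<lambda>z. E z u" x, OF df_E[OF dt_var dt_const]] by auto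
      then have fk: "fint E k" using IH by blast
      show "fint E i"
      proof (cases "E w x")
        case True then show ?thesis using fint_adj[OF fk, of i w] i k v by (auto simp: isadj_def)
      next
        case False then have "i = k" using i k v by (intro ext) (auto simp: isadj_def)
        then show ?thesis using fk by simp
      qed
    qed
  qed
  then show ?thesis using assms(2) by (auto simp: subs_def)
qed

lemma fint_un: assumes "fint E a" "fint E b" "\<forall>z. E z u \<longleftrightarrow> E z a \<or> E z b" shows "fint E u"
proof -
  have "\<forall>u. (\<forall>z. E z u \<longleftrightarrow> E z a \<or> E z b) --> fint E u"
    using assms(2)
  proof (rule fint_induct)
    show "df (\<lambda>e. \<forall>u. (\<forall>z. E z u \<longleftrightarrow> E z a \<or> E z (e 0)) --> fint E u)" by (intro dfs)
    show "\<And>z. isemp E z ==> \<forall>u. (\<forall>za. E za u \<longleftrightarrow> E za a \<or> E za z) --> fint E u"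
      using assms(1) ext by (metis isemp_def)
    fix u w v assume IH: "\<forall>x. (\<forall>z. E z x \<longleftrightarrow> E z a \<or> E z u) --> fint E x" and v: "isadj E v u w"
    show "\<forall>x. (\<forall>z. E z x \<longleftrightarrow> E z a \<or> E z v) --> fint E x"
    proof (intro allI impI)
      fix x assume x: "\<forall>z. E z x \<longleftrightarrow> E z a \<or> E z v"
      obtain k where k: "\<forall>z. E z k \<longleftrightarrow> E z a \<or> E z u" using un_ex by blast
      then show "fint E x" using IH fint_adj[of k x w] x v by (auto simp: isadj_def)
    qed
  qed
  then show ?thesis using assms(3) by blast
qed

lemma hf_emp: "isemp E z ==> hf E z"
  unfolding hf_def using fint_emp by (metis isemp_def subs_def trn_def)

lemma hf_elem: "hf E x ==> E y x ==> hf E y"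
  unfolding hf_def by (metis subs_def trn_def)

lemma hf_adj: assumes "hf E x" "hf E y" "isadj E v x y" shows "hf E v"
proof -
  obtain s t where s: "trn E s" "subs E x s" "fint E s" and t: "trn E t" "subs E y t" "fint E t"
    using assms unfolding hf_def by blast
  obtain u where u: "\<forall>z. E z u \<longleftrightarrow> E z s \<or> E z t" using un_ex by blast
  obtain w where w: "isadj E w u y" using adj_ex by blast
  have "fint E w" using fint_adj[OF fint_un[OF s(3) t(3) u] w] .
  moreover have "trn E w" using s t u w unfolding trn_def isadj_def subs_def by metis
  moreover have "subs E v w" using assms s u w by (auto simp: isadj_def subs_def)
  ultimately show ?thesis unfolding hf_def by blast
qed

text \<open>Foundation supplies a membership-minimal counterexample \<open>m\<close>. All elements
  of \<open>m\<close> satisfy \<open>P\<close> and \<open>m\<close> is finite, so building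
  \<open>m\<close> up by adjunction proves \<open>P m\<close>.\<close>

lemma hf_induct:
  assumes "hf E a" "df (\<lambda>e. P (e 0))" "\<And>z. isemp E z ==> P z"
    "\<And>x y v. hf E x ==> hf E y ==> P x ==> P y ==> isadj E v x y ==> P v"
  shows "P a"
proof (rule ccontr)
  assume na: "\<not> P a"
  obtain t where t: "trn E t" "subs E a t" "fint E t" using assms(1) unfolding hf_def by blast
  \<comment> \<open>Adjoining \<open>a\<close> to \<open>t\<close> makes the set of counterexamples
    nonempty; by transitivity of \<open>t\<close> its members are still subsets of
    \<open>t\<close>.\<close>
  obtain w where w: "isadj E w t a" using adj_ex by blast
  obtain s where s: "\<forall>x. E x s \<longleftrightarrow> E x w \<and> \<not> P x"
    using sep[of "\<lambda>x. \<not> P x" w] df_neg[OF assms(2)] by auto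
  have "E a s" using s w na by (auto simp: isadj_def)
  then obtain m where m: "E m s" "\<forall>z. E z m --> \<not> E z s" using found by blast
  have sub: "subs E m t" using m s w t unfolding isadj_def subs_def trn_def by metis
  then have el: "\<And>z. E z m ==> P z" using m s w by (auto simp: isadj_def subs_def)
  have hz: "\<And>z. E z t ==> hf E z" using t unfolding hf_def subs_def trn_def by metis
  have "P m \<and> hf E m"
    using fint_subs[OF t(3) sub]
  proof (rule fint_induct)
    show "df (\<lambda>e. P (e 0) \<and> hf E (e 0))" using assms(2) by (intro dfs) simp_all
    show "\<And>z. isemp E z ==> P z \<and> hf E z" using assms(3) hf_emp by blast
    show "\<And>u w v. P u \<and> hf E u ==> subs E u m ==> E w m ==> isadj E v u w ==> P v \<and> hf E v"
      using assms(4) el hz sub hf_adj unfolding subs_def by metis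
  qed
  then show False using m s by blast
qed

end

text \<open>The enumeration \<open>h\<close> turns a class into a full type. Quantifiers over the
  new type become quantifiers relativized to \<open>D\<close>, which is why \<open>D\<close> has to
  be definable.\<close>

locale restr = dfl E df for E :: "'a => 'a => bool" and df +
  fixes h :: "'b => 'a" and D :: "'a => bool"
  assumes h_inj: "inj h" and h_range: "range h = {x. D x}" and D_df: "df (\<lambda>e. D (e 0))"
begin

definition E' where "E' x y = E (h x) (h y)"
definition df' where "df' P \<longleftrightarrow> (\<exists>P0. df P0 \<and> (\<forall>e. P e = P0 (\<lambda>i. h (e i))))"

lemma all_D: "(\<forall>x. D x --> P x) \<longleftrightarrow> (\<forall>y. P (h y))"
proof -
  have "D x \<longleftrightarrow> (\<exists>y. x = h y)" for x using h_range by (auto simp: set_eq_iff)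
  then show ?thesis by (simp add: ) metis
qed

lemma h_cons: "(\<lambda>i. h ((v ## e) i)) = h v ## (\<lambda>i. h (e i))"
  by (auto split: nat.splits)

lemma dfl': "dfl E' df'"
proof
  fix P Q :: "(nat => 'b) => bool" and c :: 'b and f :: "nat => nat"
  show "df' (\<lambda>e. \<not> P e)" if P: "df' P"
  proof -
    obtain P0 where P0: "df P0" "\<forall>e. P e = P0 (\<lambda>i. h (e i))" using P df'_def by blast
    show ?thesis unfolding df'_def by (intro exI[of _ "\<lambda>e. \<not> P0 e"] conjI df_neg P0(1)) (simp add: P0(2))
  qed
  show "df' (\<lambda>e. P e --> Q e)" if "df' P" "df' Q"
  proof -
    obtain P0 where P0: "df P0" "\<forall>e. P e = P0 (\<lambda>i. h (e i))" using \<open>df' P\<close> df'_def by blast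
    obtain Q0 where Q0: "df Q0" "\<forall>e. Q e = Q0 (\<lambda>i. h (e i))" using \<open>df' Q\<close> df'_def by blast
    show ?thesis unfolding df'_def
      by (intro exI[of _ "\<lambda>e. P0 e --> Q0 e"] conjI df_imp P0(1) Q0(1)) (simp add: P0(2) Q0(2))
  qed
  show "df' (\<lambda>e. \<forall>v. P (v ## e))" if "df' P"
  proof -
    obtain P0 where P0: "df P0" "\<forall>e. P e = P0 (\<lambda>i. h (e i))" using \<open>df' P\<close> df'_def by blast
    have "df (\<lambda>e. \<forall>v. D v --> P0 (v ## e))"
      using df_all0[OF df_imp[OF D_df P0(1)]] by simp
    moreover have "\<forall>e. (\<forall>v. P (v ## e)) \<longleftrightarrow> (\<forall>v. D v --> P0 (v ## (\<lambda>i. h (e i))))"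
      unfolding all_D P0(2)[rule_format] h_cons by simp
    ultimately show ?thesis unfolding df'_def by blast
  qed
  show "df' (\<lambda>e. P (c ## e))" if "df' P"
  proof -
    obtain P0 where P0: "df P0" "\<forall>e. P e = P0 (\<lambda>i. h (e i))" using \<open>df' P\<close> df'_def by blast
    have "df (\<lambda>e. P0 (h c ## e))" using df_inst[OF P0(1)] .
    moreover have "\<forall>e. P (c ## e) = P0 (h c ## (\<lambda>i. h (e i)))" unfolding P0(2)[rule_format] h_cons by blast
    ultimately show ?thesis unfolding df'_def by blast
  qed
  show "df' (\<lambda>e. P (\<lambda>i. e (f i)))" if "df' P"
  proof -
    obtain P0 where P0: "df P0" "\<forall>e. P e = P0 (\<lambda>i. h (e i))" using \<open>df' P\<close> df'_def by blast
    show ?thesis unfolding df'_def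
      by (rule exI[of _ "\<lambda>e. P0 (\<lambda>i. e (f i))"]) (simp add: P0(2) df_re[OF P0(1)])
  qed
  show "df' (\<lambda>e. E' (e 0) (e (Suc 0)))" unfolding df'_def E'_def by (rule exI, rule conjI[OF df_E0]) simp
  show "df' (\<lambda>e. e 0 = e (Suc 0))" unfolding df'_def
    by (rule exI, rule conjI[OF df_eq0]) (simp add: h_inj inj_eq)
qed

lemma df'_1: assumes "df' (\<lambda>e. P (e 0))" shows "\<exists>P0. df (\<lambda>e. P0 (e 0)) \<and> (\<forall>x. P x = P0 (h x))"
proof -
  obtain P0 where P0: "df P0" "\<forall>e. P (e 0) = P0 (\<lambda>i. h (e i))" using assms df'_def by auto
  have "df (\<lambda>e. P0 (\<lambda>i. e 0))" using df_re[OF P0(1), of "\<lambda>i. 0"] by simp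
  moreover have "P x = P0 (\<lambda>i. h x)" for x using P0(2)[rule_format, of "\<lambda>i. x"] by simp
  ultimately show ?thesis by (intro exI[of _ "\<lambda>x. P0 (\<lambda>i. x)"]) simp
qed

end

lemma (in Z) HFt_restr:
  assumes "inj (h :: 'b => 'a)" "range h = {x. hf E x}"
  shows "HFt (restr.E' E h) (restr.df' df h)"
proof -
  interpret r: restr E df h "hf E"
    by unfold_locales (use assms in \<open>auto intro: dfs\<close>)
  interpret d: dfl r.E' r.df' by (rule r.dfl')
  have hD: "hf E (h x)" for x using assms(2) by blast
  have Dh: "hf E y ==> \<exists>x. y = h x" for y using assms(2) by blast
  show ?thesis
  proof
    fix x y assume a: "\<And>z. r.E' z x \<longleftrightarrow> r.E' z y"
    have "h x = h y" by (rule ext) (metis a r.E'_def Dh hD hf_elem)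
    then show "x = y" using assms(1) by (simp add: inj_eq)
  next
    show "\<exists>z. \<forall>x. \<not> r.E' x z" using emp_ex hf_emp Dh unfolding r.E'_def isemp_def by metis
  next
    fix x y
    obtain v where v: "isadj E v (h x) (h y)" using adj_ex by blast
    then obtain w where "v = h w" using hf_adj[OF hD hD v] Dh by blast
    then show "\<exists>v. \<forall>z. r.E' z v \<longleftrightarrow> r.E' z x \<or> z = y"
      using v assms(1) unfolding r.E'_def isadj_def by (metis inj_eq)
  next
    fix P a
    assume df: "r.df' (\<lambda>e. P (e 0))" and 1: "\<And>z. (\<And>x. \<not> r.E' x z) ==> P z"
      and 2: "\<And>x y v. P x ==> P y ==> (\<And>z. r.E' z v \<longleftrightarrow> r.E' z x \<or> z = y) ==> P v"
    obtain P0 where P0: "df (\<lambda>e. P0 (e 0))" "\<forall>x. P x = P0 (h x)" using r.df'_1[OF df] by blast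
    have "P0 (h a)" using hD[of a]
    proof (rule hf_induct)
      show "df (\<lambda>e. P0 (e 0))" by (rule P0)
      show "P0 z" if "isemp E z" for z using that 1 P0(2) Dh[OF hf_emp[OF that]]
        unfolding r.E'_def isemp_def by auto
      fix x y v assume h: "hf E x" "hf E y" "P0 x" "P0 y" "isadj E v x y"
      then obtain x' y' v' where "x = h x'" "y = h y'" "v = h v'" using Dh hf_adj by metis
      then show "P0 v" using 2[of x' y' v'] h P0(2) assms(1) unfolding r.E'_def isadj_def
        by (simp add: inj_eq)
    qed
    then show "P a" using P0(2) by blast
  qed
qed

section \<open>Pairs and other set operations\<close>

definition isup where "isup E p x y \<longleftrightarrow> (\<forall>z. E z p \<longleftrightarrow> z = x \<or> z = y)"
text \<open>Kuratowski pairs as a relation. In this form they are definable in every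
  \<open>dfl0\<close>, before any axiom provides the pair as an object.\<close>

definition ispr where "ispr E p x y \<longleftrightarrow> (\<exists>a b. isup E a x x \<and> isup E b x y \<and> isup E p a b)"

lemma (in dfl0) df_isup: "dt s ==> dt t ==> dt u ==> df (\<lambda>e. isup E (s e) (t e) (u e))"
  by (rule df_comp3) (unfold isup_def, intro dfs00)
lemma (in dfl0) df_ispr: "dt s ==> dt t ==> dt u ==> df (\<lambda>e. ispr E (s e) (t e) (u e))"
  by (rule df_comp3) (unfold ispr_def, intro dfs00 df_isup)
lemmas (in dfl) dfs2 = dfs df_isup df_ispr

context Z begin

definition emp where "emp = (THE z. \<forall>x. \<not> E x z)"
definition up where "up x y = (THE p. \<forall>z. E z p \<longleftrightarrow> z = x \<or> z = y)"
definition adj where "adj x y = (THE p. \<forall>z. E z p \<longleftrightarrow> E z x \<or> z = y)"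
definition un where "un x y = (THE p. \<forall>z. E z p \<longleftrightarrow> E z x \<or> E z y)"
definition pr where "pr x y = up (up x x) (up x y)"

lemma the_set: assumes "\<exists>s. \<forall>x. E x s \<longleftrightarrow> P x" shows "E x (THE s. \<forall>x. E x s \<longleftrightarrow> P x) \<longleftrightarrow> P x"
proof -
  have "\<exists>!s. \<forall>x. E x s \<longleftrightarrow> P x" using assms ext by metis
  from theI'[OF this] show ?thesis by blast
qed

lemma E_emp [simp]: "\<not> E x emp"
  unfolding emp_def using the_set[of "\<lambda>x. False"] emp_ex unfolding isemp_def by simp
lemma E_up [simp]: "E z (up x y) \<longleftrightarrow> z = x \<or> z = y"
  unfolding up_def by (rule the_set[OF pair_ex])
lemma E_adj [simp]: "E z (adj x y) \<longleftrightarrow> E z x \<or> z = y"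
  unfolding adj_def by (rule the_set[OF adj_ex[unfolded isadj_def]])
lemma E_un [simp]: "E z (un x y) \<longleftrightarrow> E z x \<or> E z y"
  unfolding un_def by (rule the_set[OF un_ex])

lemma eq_set: "(x = y) \<longleftrightarrow> (\<forall>z. E z x \<longleftrightarrow> E z y)"
  using ext by blast
lemma eq_emp: "(x = emp) \<longleftrightarrow> (\<forall>z. \<not> E z x)" by (simp add: eq_set)
lemma eq_up: "(p = up x y) \<longleftrightarrow> isup E p x y" by (simp add: eq_set isup_def)
lemma eq_adj: "(p = adj x y) \<longleftrightarrow> isadj E p x y" by (simp add: eq_set isadj_def)
lemma eq_un: "(p = un x y) \<longleftrightarrow> (\<forall>z. E z p \<longleftrightarrow> E z x \<or> E z y)" by (simp add: eq_set)
lemma eq_pr: "(p = pr x y) \<longleftrightarrow> ispr E p x y" by (simp add: ispr_def pr_def eq_up[symmetric])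

lemma isemp_iff: "isemp E z \<longleftrightarrow> z = emp" by (simp add: isemp_def eq_emp)
lemma isadj_iff: "isadj E v x y \<longleftrightarrow> v = adj x y" by (simp add: eq_adj)

lemma up_inj: "up a b = up c d \<longleftrightarrow> a = c \<and> b = d \<or> a = d \<and> b = c"
  unfolding eq_set[of "up a b"] E_up by metis
lemma pr_inj [simp]: "pr a b = pr c d \<longleftrightarrow> a = c \<and> b = d"
  unfolding pr_def up_inj by auto

lemma dt_emp: "dt (\<lambda>e. emp)" by (rule dt_const)
lemma dt_up: "dt s ==> dt t ==> dt (\<lambda>e. up (s e) (t e))"
  by (rule dt_comp2) (unfold dt_def eq_up, intro dfs2)
lemma dt_adj: "dt s ==> dt t ==> dt (\<lambda>e. adj (s e) (t e))"
  by (rule dt_comp2) (unfold dt_def eq_adj, intro dfs2)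
lemma dt_un: "dt s ==> dt t ==> dt (\<lambda>e. un (s e) (t e))"
  by (rule dt_comp2) (unfold dt_def eq_un, intro dfs2)
lemma dt_pr: "dt s ==> dt t ==> dt (\<lambda>e. pr (s e) (t e))"
  by (rule dt_comp2) (unfold dt_def eq_pr, intro dfs2)
lemmas dfs3 = dfs2 dt_up dt_adj dt_un dt_pr

lemma pr_elem: "E u (up u v)" "E v (up u v)" "E (up u v) (pr u v)" "E (up u u) (pr u v)"
  by (auto simp: pr_def)

text \<open>A Kuratowski pair over \<open>t\<close> is a set of subsets of \<open>t\<close>, hence
  lies in the double power set.\<close>

lemma prod_bound: "\<exists>s. \<forall>u v. E u t --> E v t --> E (pr u v) s"
proof -
  obtain p where p: "\<forall>z. E z p \<longleftrightarrow> (\<forall>w. E w z --> E w t)" using power_ex by blast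
  obtain q where q: "\<forall>z. E z q \<longleftrightarrow> (\<forall>w. E w z --> E w p)" using power_ex by blast
  show ?thesis by (rule exI[of _ q]) (auto simp: p q pr_def)
qed

text \<open>Foundation speaks about sets only, and without Infinity transitive closures may be
  missing; so membership induction is confined to those \<open>x\<close> that have a transitive
  superset.\<close>

lemma mem_induct:
  assumes "df (\<lambda>e. P (e 0))" "\<And>x. (\<And>y. E y x ==> P y) ==> P x" "\<exists>t. trn E t \<and> subs E x t"
  shows "P x"
proof (rule ccontr)
  assume n: "\<not> P x"
  obtain t where t: "trn E t" "subs E x t" using assms(3) by blast
  obtain b where b: "\<forall>y. E y b \<longleftrightarrow> E y (adj t x) \<and> \<not> P y"
    using sep[of "\<lambda>y. \<not> P y" "adj t x", OF df_neg[OF assms(1)]] by blast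
  then obtain y where y: "E y b" "\<forall>z. E z y --> \<not> E z b" using found[of x b] n by auto
  then have "P z" if "E z y" for z using t b that unfolding trn_def subs_def by (metis E_adj)
  then show False using assms(2) y b by blast
qed

end

section \<open>The axioms of set theory from adjunction induction\<close>

context HFt begin

lemma h_ind: "df (\<lambda>e. P (e 0)) ==> (\<And>z. isemp E z ==> P z) ==>
    (\<And>x y v. P x ==> P y ==> isadj E v x y ==> P v) ==> P a"
  unfolding isemp_def isadj_def by (rule hinduct) blast+

lemma h_adj: "\<exists>v. isadj E v x y" using hadj unfolding isadj_def by blast

lemma h_sep: assumes Q: "df (\<lambda>e. Q (e 0))" shows "\<exists>b. \<forall>x. E x b \<longleftrightarrow> E x a \<and> Q x"
proof (rule h_ind[of "\<lambda>a. \<exists>b. \<forall>x. E x b \<longleftrightarrow> E x a \<and> Q x" a])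
  show "df (\<lambda>e. \<exists>b. \<forall>x. E x b \<longleftrightarrow> E x (e 0) \<and> Q x)" by (intro dfs df_comp1[OF Q])
  show "\<exists>b. \<forall>x. E x b \<longleftrightarrow> E x z \<and> Q x" if "isemp E z" for z using that unfolding isemp_def by blast
  fix x y v assume "\<exists>b. \<forall>z. E z b \<longleftrightarrow> E z x \<and> Q z" and v: "isadj E v x y"
  then obtain b where b: "\<forall>z. E z b \<longleftrightarrow> E z x \<and> Q z" by blast
  obtain c where "isadj E c b y" using h_adj by blast
  then show "\<exists>b. \<forall>x. E x b \<longleftrightarrow> E x v \<and> Q x"
    using b v by (intro exI[of _ "if Q y then c else b"]) (auto simp: isadj_def)
qed

lemma h_un: "\<exists>u. \<forall>z. E z u \<longleftrightarrow> E z a \<or> E z b"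
proof (rule h_ind[of "\<lambda>b. \<exists>u. \<forall>z. E z u \<longleftrightarrow> E z a \<or> E z b" b])
  show "df (\<lambda>e. \<exists>u. \<forall>z. E z u \<longleftrightarrow> E z a \<or> E z (e 0))" by (intro dfs)
  show "\<exists>u. \<forall>za. E za u \<longleftrightarrow> E za a \<or> E za z" if "isemp E z" for z using that unfolding isemp_def by blast
  fix x y v assume "\<exists>u. \<forall>z. E z u \<longleftrightarrow> E z a \<or> E z x" and v: "isadj E v x y"
  then obtain u where u: "\<forall>z. E z u \<longleftrightarrow> E z a \<or> E z x" by blast
  obtain c where "isadj E c u y" using h_adj by blast
  then show "\<exists>u. \<forall>z. E z u \<longleftrightarrow> E z a \<or> E z v"
    using u v by (intro exI[of _ c]) (auto simp: isadj_def)
qed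

lemma h_repl: assumes R: "df (\<lambda>e. R (e 0) (e (Suc 0)))"
    and f: "\<And>x y y'. E x a ==> R x y ==> R x y' ==> y = y'"
  shows "\<exists>b. \<forall>y. E y b \<longleftrightarrow> (\<exists>x. E x a \<and> R x y)"
proof -
  let ?P = "\<lambda>a. (\<forall>x y y'. E x a --> R x y --> R x y' --> y = y') --> (\<exists>b. \<forall>y. E y b \<longleftrightarrow> (\<exists>x. E x a \<and> R x y))"
  have "?P a"
  proof (rule h_ind[of ?P a])
    show "df (\<lambda>e. ?P (e 0))" by (intro dfs df_comp2[OF R])
    show "?P z" if "isemp E z" for z using that unfolding isemp_def by blast
    fix x w v assume P: "?P x" and v: "isadj E v x w"
    show "?P v"
    proof
      assume f: "\<forall>x y y'. E x v --> R x y --> R x y' --> y = y'"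
      have "\<exists>b. \<forall>y. E y b \<longleftrightarrow> (\<exists>z. E z x \<and> R z y)" using P f v unfolding isadj_def by blast
      then obtain b where b: "\<forall>y. E y b \<longleftrightarrow> (\<exists>z. E z x \<and> R z y)" by blast
      show "\<exists>b. \<forall>y. E y b \<longleftrightarrow> (\<exists>x. E x v \<and> R x y)"
      proof (cases "\<exists>y. R w y")
        case True then obtain y where y: "R w y" by blast
        obtain c where c: "isadj E c b y" using h_adj by blast
        have "R w z \<longleftrightarrow> z = y" for z using f v y unfolding isadj_def by blast
        then show ?thesis using b c v unfolding isadj_def by (intro exI[of _ c]) metis
      next
        case False then show ?thesis using b v unfolding isadj_def by (intro exI[of _ b]) metis
      qed
    qed
  qed
  then show ?thesis using f by blast
qed

text \<open>Adjunction induction for the strengthened claim that \<open>P\<close> holds of a set and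
  of all its elements; both adjuncts then contribute.\<close>

lemma h_mem_ind:
  assumes P: "df (\<lambda>e. P (e 0))" and s: "\<And>x. (\<And>y. E y x ==> P y) ==> P x" shows "P x"
proof -
  have "P x \<and> (\<forall>y. E y x --> P y)"
  proof (rule h_ind[of "\<lambda>x. P x \<and> (\<forall>y. E y x --> P y)"])
    show "df (\<lambda>e. P (e 0) \<and> (\<forall>y. E y (e 0) --> P y))" by (intro dfs df_comp1[OF P])
    show "P z \<and> (\<forall>y. E y z --> P y)" if "isemp E z" for z using that s unfolding isemp_def by blast
    show "P v \<and> (\<forall>y. E y v --> P y)" if "P x \<and> (\<forall>y. E y x --> P y)" "P w \<and> (\<forall>y. E y w --> P y)" "isadj E v x w"
      for x w v using that s[of v] unfolding isadj_def by blast
  qed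
  then show ?thesis by blast
qed

sublocale Z
proof
  show "x = y" if "\<And>z. E z x \<longleftrightarrow> E z y" for x y using that hext by blast
  show "\<exists>y. E y x \<and> (\<forall>z. E z y --> \<not> E z x)" if "E y x" for x y
  proof (rule ccontr)
    assume n: "\<not> ?thesis"
    have "\<not> E z x" for z
      by (rule h_mem_ind[of "\<lambda>z. \<not> E z x"]) (intro dfs, use n in blast)
    then show False using that by blast
  qed
  show "\<exists>p. \<forall>z. E z p \<longleftrightarrow> z = x \<or> z = y" for x y
  proof -
    obtain z where z: "isemp E z" using hempty isemp_def by metis
    obtain a where a: "isadj E a z x" using h_adj by blast
    obtain b where "isadj E b a y" using h_adj by blast
    then show ?thesis using z a unfolding isadj_def isemp_def by (intro exI[of _ b]) blast
  qed
  show "\<exists>u. \<forall>z. E z u \<longleftrightarrow> (\<exists>y. E z y \<and> E y x)" for x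
  proof (rule h_ind[of "\<lambda>x. \<exists>u. \<forall>z. E z u \<longleftrightarrow> (\<exists>y. E z y \<and> E y x)"])
    show "df (\<lambda>e. \<exists>u. \<forall>z. E z u \<longleftrightarrow> (\<exists>y. E z y \<and> E y (e 0)))" by (intro dfs)
    show "\<exists>u. \<forall>za. E za u \<longleftrightarrow> (\<exists>y. E za y \<and> E y z)" if "isemp E z" for z using that unfolding isemp_def by blast
    fix x w v assume "\<exists>u. \<forall>z. E z u \<longleftrightarrow> (\<exists>y. E z y \<and> E y x)" and v: "isadj E v x w"
    then obtain u where u: "\<forall>z. E z u \<longleftrightarrow> (\<exists>y. E z y \<and> E y x)" by blast
    obtain c where c: "\<forall>z. E z c \<longleftrightarrow> E z u \<or> E z w" using h_un by blast
    show "\<exists>u. \<forall>z. E z u \<longleftrightarrow> (\<exists>y. E z y \<and> E y v)"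
      by (rule exI[of _ c]) (use c u v in \<open>auto simp: isadj_def\<close>)
  qed
  show "\<exists>b. \<forall>x. E x b \<longleftrightarrow> E x a \<and> Q x" if "df (\<lambda>e. Q (e 0))" for Q a using h_sep[OF that] .
  show "\<exists>b. \<forall>y. E y b \<longleftrightarrow> (\<exists>x. E x a \<and> R x y)" if "df (\<lambda>e. R (e 0) (e (Suc 0)))"
    "\<And>x y y'. E x a ==> R x y ==> R x y' ==> y = y'" for R a using h_repl that .
  show "\<exists>p. \<forall>z. E z p \<longleftrightarrow> (\<forall>w. E w z --> E w x)" for x
  proof (rule h_ind[of "\<lambda>x. \<exists>p. \<forall>z. E z p \<longleftrightarrow> (\<forall>w. E w z --> E w x)"])
    show "df (\<lambda>e. \<exists>p. \<forall>z. E z p \<longleftrightarrow> (\<forall>w. E w z --> E w (e 0)))" by (intro dfs)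
    fix z assume z: "isemp E z"
    obtain a where a: "isadj E a z z" using h_adj by blast
    have eq: "(\<forall>w. E w x --> E w z) \<longleftrightarrow> x = z" for x using z hext unfolding isemp_def by metis
    then show "\<exists>p. \<forall>x. E x p \<longleftrightarrow> (\<forall>w. E w x --> E w z)"
      using a z unfolding eq isadj_def isemp_def by (intro exI[of _ a]) simp
  next
    fix x w v assume "\<exists>p. \<forall>z. E z p \<longleftrightarrow> (\<forall>w. E w z --> E w x)" and v: "isadj E v x w"
    then obtain p where p: "\<forall>z. E z p \<longleftrightarrow> (\<forall>w. E w z --> E w x)" by blast
    \<comment> \<open>The subsets of \<open>v\<close> are the subsets of \<open>x\<close>, collected
      in \<open>p\<close>, and these with \<open>w\<close> adjoined, collected in
      \<open>q\<close>.\<close>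
    have "\<exists>q. \<forall>y. E y q \<longleftrightarrow> (\<exists>z. E z p \<and> isadj E y z w)"
      by (rule h_repl) (intro dfs2, auto simp: isadj_def intro: hext)
    then obtain q where q: "\<forall>y. E y q \<longleftrightarrow> (\<exists>z. E z p \<and> isadj E y z w)" by blast
    obtain c where c: "\<forall>z. E z c \<longleftrightarrow> E z p \<or> E z q" using h_un by blast
    have "(\<forall>y. E y z --> E y v) \<longleftrightarrow> E z p \<or> E z q" for z
    proof
      assume z: "\<forall>y. E y z --> E y v"
      obtain b where b: "\<forall>y. E y b \<longleftrightarrow> E y z \<and> y \<noteq> w"
        using h_sep[OF df_neg[OF df_eq[OF dt_var dt_const]]] by blast
      show "E z p \<or> E z q"
      proof (cases "E w z")
        case True
        have "isadj E z b w" using b True by (auto simp: isadj_def)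
        moreover have "E b p" using b z v p by (auto simp: isadj_def)
        ultimately show ?thesis using q by blast
      next
        case False then have "E z p" using z v p unfolding isadj_def by metis
        then show ?thesis ..
      qed
    qed (use p q v in \<open>auto simp: isadj_def\<close>)
    then show "\<exists>p. \<forall>z. E z p \<longleftrightarrow> (\<forall>w. E w z --> E w v)" using c by blast
  qed
qed

lemma h_all: "df (\<lambda>e. P (e 0)) ==> P emp ==> (\<And>x y. P x ==> P y ==> P (adj x y)) ==> P a"
  by (rule h_ind) (simp_all add: isemp_iff isadj_iff)

lemma hf_UNIV: "hf E x"
  by (rule h_ind[of "hf E"]) (intro dfs, auto intro: hf_emp hf_adj)

end

section \<open>A definable linear order of the hereditarily finite sets\<close>

text \<open>
  \<open>lam x y\<close>: the largest element in which \<open>x\<close> and \<open>y\<close> differ belongs to \<open>y\<close>. The recursion is resolved by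
  relations \<open>r\<close> that satisfy this on a transitive set \<open>t\<close>.
\<close>

definition rl where "rl E r x y \<longleftrightarrow> (\<exists>p. ispr E p x y \<and> E p r)"
definition lgood where
  "lgood E t r \<longleftrightarrow> trn E t \<and> (\<forall>u v. E u t --> E v t -->
     (rl E r u v \<longleftrightarrow> (\<exists>a. E a v \<and> \<not> E a u \<and> (\<forall>b. rl E r a b --> (E b u \<longleftrightarrow> E b v)))))"
definition lam where "lam E x y \<longleftrightarrow> (\<exists>t r. lgood E t r \<and> E x t \<and> E y t \<and> rl E r x y)"

context dfl begin
lemma df_rl: "dt s ==> dt t ==> dt u ==> df (\<lambda>e. rl E (s e) (t e) (u e))"
  by (rule df_comp3) (unfold rl_def, intro dfs2)
lemma df_lgood: "dt s ==> dt t ==> df (\<lambda>e. lgood E (s e) (t e))"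
  by (rule df_comp2) (unfold lgood_def, intro dfs2 df_rl)
lemma df_lam: "dt s ==> dt t ==> df (\<lambda>e. lam E (s e) (t e))"
  by (rule df_comp2) (unfold lam_def, intro dfs2 df_rl df_lgood)
end

context HFt begin

text \<open>A substitute for recursion on transitive closures: if \<open>K\<close>-sets can absorb
  their own subsets, they can absorb any set. Membership induction on \<open>s\<close>; an inner
  adjunction induction absorbs the elements of \<open>s\<close> one after another, after which
  \<open>s\<close> is a subset.\<close>

lemma grow:
  assumes K: "df (\<lambda>e. K (e 0))"
    and step: "\<And>t y. K t ==> subs E y t ==> \<exists>t'. K t' \<and> subs E t t' \<and> E y t'"
    and "K t"
  shows "\<exists>t'. K t' \<and> subs E t t' \<and> E s t'"
proof -
  let ?P = "\<lambda>s. \<forall>t. K t --> (\<exists>t'. K t' \<and> subs E t t' \<and> E s t')"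
  have "?P s"
  proof (rule h_mem_ind[of ?P])
    show dP: "df (\<lambda>e. ?P (e 0))" by (intro dfs df_comp1[OF K])
    fix s assume IH: "\<And>y. E y s ==> ?P y"
    let ?Q = "\<lambda>u. (\<forall>w. E w u --> ?P w) --> (\<forall>t. K t --> (\<exists>t'. K t' \<and> subs E t t' \<and> subs E u t'))"
    have "?Q s"
    proof (rule h_all[of ?Q])
      show "df (\<lambda>e. ?Q (e 0))" by (intro dfs df_comp1[OF K])
      show "?Q emp" by (auto simp: subs_def)
      fix u w assume Q: "?Q u"
      show "?Q (adj u w)"
      proof (intro impI allI)
        fix t assume a: "\<forall>x. E x (adj u w) --> ?P x" "K t"
        then obtain t1 where "K t1" "subs E t t1" "subs E u t1" using Q by auto
        moreover then obtain t2 where "K t2" "subs E t1 t2" "E w t2" using a by force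
        ultimately show "\<exists>t'. K t' \<and> subs E t t' \<and> subs E (adj u w) t'"
          unfolding subs_def by (intro exI[of _ t2]) auto
      qed
    qed
    then have Q: "\<exists>t'. K t' \<and> subs E t t' \<and> subs E s t'" if "K t" for t using IH that by blast
    show "?P s"
    proof (intro allI impI)
      fix t assume "K t"
      then obtain t1 where t1: "K t1" "subs E t t1" "subs E s t1" using Q by blast
      then obtain t2 where "K t2" "subs E t1 t2" "E s t2" using step by blast
      then show "\<exists>t'. K t' \<and> subs E t t' \<and> E s t'" using t1 unfolding subs_def by blast
    qed
  qed
  then show ?thesis using assms(3) by blast
qed

lemma rl_pr: "rl E r x y \<longleftrightarrow> E (pr x y) r" unfolding rl_def eq_pr[symmetric] by blast

text \<open>The elements of the compared sets lie in \<open>t\<close> already, and a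
  \<open>b\<close> outside \<open>t\<close> belongs to neither of them. So only the values of
  \<open>r\<close> on \<open>t\<close> are queried, and the extended relation can be read off from
  \<open>r\<close> in one stroke.\<close>

lemma lgood_step:
  assumes "lgood E t r" "subs E y t" shows "\<exists>r'. lgood E (adj t y) r'"
proof -
  obtain s where s: "\<forall>u v. E u (adj t y) --> E v (adj t y) --> E (pr u v) s" using prod_bound by blast
  let ?c = "\<lambda>u v. \<exists>a. E a v \<and> \<not> E a u \<and> (\<forall>b. rl E r a b --> (E b u \<longleftrightarrow> E b v))"
  have "df (\<lambda>e. \<exists>u v. e 0 = pr u v \<and> ?c u v)" by (intro dfs3 df_rl)
  from sep[OF this, of s] obtain r' where
    r': "\<forall>p. E p r' \<longleftrightarrow> E p s \<and> (\<exists>u v. p = pr u v \<and> ?c u v)" by blast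
  have r'iff: "rl E r' u v \<longleftrightarrow> ?c u v" if "E u (adj t y)" "E v (adj t y)" for u v
    unfolding rl_pr[of r'] using that r' s by auto
  have sub: "E a t" if "E a u" "E u (adj t y)" for a u
    using that assms unfolding lgood_def trn_def subs_def by auto
  have agree: "rl E r' u v \<longleftrightarrow> rl E r u v" if "E u t" "E v t" for u v
    using r'iff[of u v] that assms(1) unfolding lgood_def by auto
  have tr: "trn E (adj t y)" using assms unfolding lgood_def trn_def subs_def by auto
  have "rl E r' u v \<longleftrightarrow> (\<exists>a. E a v \<and> \<not> E a u \<and> (\<forall>b. rl E r' a b --> (E b u \<longleftrightarrow> E b v)))"
    if u: "E u (adj t y)" "E v (adj t y)" for u v
  proof -
    have "(\<forall>b. rl E r' a b --> (E b u \<longleftrightarrow> E b v)) \<longleftrightarrow> (\<forall>b. rl E r a b --> (E b u \<longleftrightarrow> E b v))" if "E a v" for a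
      using agree sub u that by meson
    then show ?thesis unfolding r'iff[OF u] by blast
  qed
  then show ?thesis unfolding lgood_def using tr by blast
qed

lemma lgood_ex: "\<exists>t r. lgood E t r \<and> E x t \<and> E y t"
proof -
  let ?K = "\<lambda>t. \<exists>r. lgood E t r"
  have g: "?K t ==> \<exists>t'. ?K t' \<and> subs E t t' \<and> E s t'" for t s
  proof (rule grow[of ?K])
    show "df (\<lambda>e. ?K (e 0))" by (intro dfs df_lgood)
    show "\<exists>t'. ?K t' \<and> subs E t t' \<and> E y t'" if "?K t" "subs E y t" for t y
      using lgood_step that by (metis E_adj subs_def)
  qed
  have "lgood E emp emp" by (simp add: lgood_def trn_def)
  then show ?thesis using g[of emp x] g[of _ y] unfolding subs_def by metis
qed

text \<open>Agreement on elements forces agreement on sets. Instead of an induction on pairs,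
  \<open>grow\<close> enlarges a transitive set on which \<open>r\<close> and \<open>r'\<close>
  agree until it contains both arguments.\<close>

lemma lgood_unique:
  assumes g: "lgood E t r" "lgood E t' r'" and "E x t" "E y t" "E x t'" "E y t'"
  shows "rl E r x y \<longleftrightarrow> rl E r' x y"
proof -
  let ?W = "\<lambda>u. E u t \<and> E u t'"
  let ?K = "\<lambda>w. trn E w \<and> (\<forall>u v. E u w --> E v w --> ?W u --> ?W v --> (rl E r u v \<longleftrightarrow> rl E r' u v))"
  have s: "?K w ==> \<exists>w'. ?K w' \<and> subs E w w' \<and> E s w'" for w s
  proof (rule grow[of ?K])
    show "df (\<lambda>e. ?K (e 0))" by (intro dfs df_rl)
    fix w y assume K: "?K w" and y: "subs E y w"
    have "rl E r u v \<longleftrightarrow> rl E r' u v" if u: "E u (adj w y)" "E v (adj w y)" "?W u" "?W v" for u v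
    proof -
      have el: "E a w" "?W a" if "E a v \<or> E a u" for a
        using that u K y g unfolding lgood_def trn_def subs_def E_adj by metis+
      have "(rl E r a b --> (E b u \<longleftrightarrow> E b v)) \<longleftrightarrow> (rl E r' a b --> (E b u \<longleftrightarrow> E b v))" if "E a v" for a b
        using K el that by blast
      moreover have "rl E r u v \<longleftrightarrow> (\<exists>a. E a v \<and> \<not> E a u \<and> (\<forall>b. rl E r a b --> (E b u \<longleftrightarrow> E b v)))"
        "rl E r' u v \<longleftrightarrow> (\<exists>a. E a v \<and> \<not> E a u \<and> (\<forall>b. rl E r' a b --> (E b u \<longleftrightarrow> E b v)))"
        using g u(3,4) unfolding lgood_def by blast+
      ultimately show ?thesis by blast
    qed
    moreover have "trn E (adj w y)" using K y unfolding trn_def subs_def by auto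
    ultimately show "\<exists>t'. ?K t' \<and> subs E w t' \<and> E y t'"
      by (intro exI[of _ "adj w y"]) (auto simp: subs_def)
  qed
  have "?K emp" by (simp add: trn_def)
  from s[OF this, of x] obtain w1 where w1: "?K w1" "E x w1" by blast
  from s[OF w1(1), of y] obtain w2 where "?K w2" "subs E w1 w2" "E y w2" by blast
  then show ?thesis using w1(2) assms unfolding subs_def by blast
qed

abbreviation "lt \<equiv> lam E"

lemma lam_good: "lgood E t r ==> E x t ==> E y t ==> lt x y \<longleftrightarrow> rl E r x y"
  unfolding lam_def using lgood_unique by blast

lemma lam_iff: "lt u v \<longleftrightarrow> (\<exists>a. E a v \<and> \<not> E a u \<and> (\<forall>b. lt a b --> (E b u \<longleftrightarrow> E b v)))"
proof -
  obtain t r where g: "lgood E t r" and t: "E u t" "E v t" using lgood_ex by blast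
  have el: "E a u \<or> E a v ==> E a t" for a using g t unfolding lgood_def trn_def by blast
  have 1: "lt u v \<longleftrightarrow> (\<exists>a. E a v \<and> \<not> E a u \<and> (\<forall>b. rl E r a b --> (E b u \<longleftrightarrow> E b v)))"
    unfolding lam_good[OF g t] using g t unfolding lgood_def by blast
  have "(lt a b --> (E b u \<longleftrightarrow> E b v)) \<longleftrightarrow> (rl E r a b --> (E b u \<longleftrightarrow> E b v))" if "E a v" for a b
    using lam_good[OF g, of a b] el that by blast
  then show ?thesis unfolding 1 by blast
qed

lemma lam_irrefl: "\<not> lt x x" using lam_iff[of x x] by blast

definition lin where
  "lin w \<longleftrightarrow> (\<forall>x y. E x w --> E y w --> x = y \<or> lt x y \<or> lt y x) \<and>
     (\<forall>x y z. E x w --> E y w --> E z w --> lt x y --> lt y z --> lt x z)"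

lemma df_lin: "dt s ==> df (\<lambda>e. lin (s e))"
  by (rule df_comp1) (unfold lin_def, intro dfs df_lam)

lemma lin_max: assumes "lin w" "subs E s w" "E x s" shows "\<exists>m. E m s \<and> (\<forall>y. E y s --> \<not> lt m y)"
proof -
  let ?P = "\<lambda>s. subs E s w --> (\<exists>x. E x s) --> (\<exists>m. E m s \<and> (\<forall>y. E y s --> \<not> lt m y))"
  have "?P s"
  proof (rule h_all[of ?P])
    show "df (\<lambda>e. ?P (e 0))" by (intro dfs df_lam)
    show "?P emp" by simp
    fix s v assume P: "?P s"
    show "?P (adj s v)"
    proof (intro impI)
      assume sub: "subs E (adj s v) w"
      show "\<exists>m. E m (adj s v) \<and> (\<forall>y. E y (adj s v) --> \<not> lt m y)"
      proof (cases "\<exists>x. E x s")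
        case True
        then obtain m where m: "E m s" "\<forall>y. E y s --> \<not> lt m y" using P sub unfolding subs_def by auto
        have l: "\<And>x y. E x (adj s v) ==> E y (adj s v) ==> x = y \<or> lt x y \<or> lt y x"
          "\<And>x y z. E x (adj s v) ==> E y (adj s v) ==> E z (adj s v) ==> lt x y ==> lt y z ==> lt x z"
          using assms(1) sub unfolding lin_def subs_def by blast+
        show ?thesis
        proof (cases "lt m v")
          case True
          have "\<not> lt v y" if "E y (adj s v)" for y
            using that m l(2)[of m v y] True lam_irrefl by auto
          then show ?thesis by auto
        next
          case False then show ?thesis using m by auto
        qed
      next
        case False then show ?thesis using lam_irrefl by auto
      qed
    qed
  qed
  then show ?thesis using assms by blast
qed

text \<open>Two subsets of \<open>w\<close> are compared at the largest element of their symmetric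
  difference, which exists because \<open>w\<close> is already linearly ordered. For transitivity,
  the larger of the two deciding elements \<open>a\<close> and \<open>c\<close> decides.\<close>

lemma lin_step: assumes l: "lin w" shows
  "subs E u w ==> subs E v w ==> u = v \<or> lt u v \<or> lt v u"
  "subs E u w ==> subs E v w ==> subs E x w ==> lt u v ==> lt v x ==> lt u x"
proof -
  have tot: "\<And>x y. E x w ==> E y w ==> x = y \<or> lt x y \<or> lt y x"
    and tra: "\<And>x y z. E x w ==> E y w ==> E z w ==> lt x y ==> lt y z ==> lt x z"
    using l unfolding lin_def by blast+
  show "u = v \<or> lt u v \<or> lt v u" if s: "subs E u w" "subs E v w"
  proof (cases "u = v")
    case False
    have "df (\<lambda>e. \<not> (E (e 0) u \<longleftrightarrow> E (e 0) v))" by (intro dfs)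
    from sep[OF this, of w] obtain d where d: "\<forall>x. E x d \<longleftrightarrow> E x w \<and> \<not> (E x u \<longleftrightarrow> E x v)" by blast
    obtain z where "\<not> (E z u \<longleftrightarrow> E z v)" using False ext by blast
    then have "E z d" using d s unfolding subs_def by blast
    from lin_max[OF l _ this] obtain m where m: "E m d" "\<forall>y. E y d --> \<not> lt m y"
      using d unfolding subs_def by blast
    have "E b u \<longleftrightarrow> E b v" if "lt m b" for b using m d that s unfolding subs_def by blast
    then have "E m v \<and> \<not> E m u ==> lt u v" "E m u \<and> \<not> E m v ==> lt v u"
      using lam_iff[of u v] lam_iff[of v u] by blast+
    then show ?thesis using m d by blast
  qed simp
  show "lt u x" if s: "subs E u w" "subs E v w" "subs E x w" and uv: "lt u v" "lt v x"
  proof -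
    obtain a where a: "E a v" "\<not> E a u" "\<And>b. lt a b ==> E b u \<longleftrightarrow> E b v" using uv(1) lam_iff[of u v] by blast
    obtain c where c: "E c x" "\<not> E c v" "\<And>b. lt c b ==> E b v \<longleftrightarrow> E b x" using uv(2) lam_iff[of v x] by blast
    have w: "E a w" "E c w" using a c s unfolding subs_def by blast+
    consider "lt a c" | "lt c a" using tot[OF w] a c by auto
    then show ?thesis
    proof cases
      case 1
      have "E b u \<longleftrightarrow> E b x" if "lt c b" for b
        using a(3)[of b] c(3)[OF that] tra[OF w(1) w(2), of b] 1 that s unfolding subs_def by blast
      then show ?thesis using lam_iff[of u x] a(3)[OF 1] c by blast
    next
      case 2
      have "E b u \<longleftrightarrow> E b x" if "lt a b" for b
        using a(3)[OF that] c(3)[of b] tra[OF w(2) w(1), of b] 2 that s unfolding subs_def by blast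
      then show ?thesis using lam_iff[of u x] c(3)[OF 2] a by blast
    qed
  qed
qed

lemma lin_ex: "\<exists>w. lin w \<and> E x w \<and> E y w \<and> E z w"
proof -
  let ?K = "\<lambda>w. trn E w \<and> lin w"
  have g: "?K w ==> \<exists>w'. ?K w' \<and> subs E w w' \<and> E s w'" for w s
  proof (rule grow[of ?K])
    show "df (\<lambda>e. ?K (e 0))" by (intro dfs df_lin)
    fix w y assume K: "?K w" and y: "subs E y w"
    have s: "E u (adj w y) ==> subs E u w" for u using K y unfolding trn_def subs_def by auto
    have "lin (adj w y)" unfolding lin_def using lin_step[of w] K s by blast
    moreover have "trn E (adj w y)" using K y unfolding trn_def subs_def by auto
    ultimately show "\<exists>t'. ?K t' \<and> subs E w t' \<and> E y t'"
      by (intro exI[of _ "adj w y"]) (auto simp: subs_def)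
  qed
  have "?K emp" by (simp add: trn_def lin_def)
  from g[OF this, of x] obtain w1 where w1: "?K w1" "E x w1" by blast
  from g[OF w1(1), of y] obtain w2 where w2: "?K w2" "subs E w1 w2" "E y w2" by blast
  from g[OF w2(1), of z] obtain w3 where "?K w3" "subs E w2 w3" "E z w3" by blast
  then show ?thesis using w1 w2 unfolding subs_def by blast
qed

lemma lam_total: "x = y \<or> lt x y \<or> lt y x" using lin_ex[of x y y] unfolding lin_def by blast
lemma lam_trans: "lt x y ==> lt y z ==> lt x z" using lin_ex[of x y z] unfolding lin_def by blast

text \<open>Otherwise \<open>y\<close> is below \<open>x\<close>, decided by some \<open>a\<close>
  in \<open>x\<close>. By induction \<open>a\<close> is below \<open>x\<close>, so \<open>y\<close>
  and \<open>x\<close> would agree about the element \<open>x\<close>, which lies in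
  \<open>y\<close> but not in itself.\<close>

lemma lam_mem: "E x y ==> lt x y"
proof -
  have "\<forall>x. E x y --> lt x y"
  proof (rule h_mem_ind[of "\<lambda>y. \<forall>x. E x y --> lt x y"])
    show "df (\<lambda>e. \<forall>x. E x (e 0) --> lt x (e 0))" by (intro dfs df_lam)
    fix y assume IH: "\<And>z. E z y ==> \<forall>x. E x z --> lt x z"
    show "\<forall>x. E x y --> lt x y"
    proof (intro allI impI)
      fix x assume x: "E x y"
      show "lt x y"
      proof (rule ccontr)
        assume "\<not> lt x y"
        then have "lt y x" using lam_total[of x y] x irrefl by blast
        then obtain a where a: "E a x" "\<not> E a y" "\<And>b. lt a b ==> E b y \<longleftrightarrow> E b x" using lam_iff[of y x] by blast
        have "lt a x" using IH[OF x] a by blast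
        then show False using a(3) x irrefl by blast
      qed
    qed
  qed
  then show "E x y ==> lt x y" by blast
qed

text \<open>The power set of a transitive, downward closed set is again of this kind, and so is a
  union of two. Hence every set belongs to one, and Separation cuts the segment out of it.\<close>

lemma lam_seg: "\<exists>s. \<forall>y. E y s \<longleftrightarrow> lt y x"
proof -
  let ?D = "\<lambda>t. trn E t \<and> (\<forall>y z. E y t --> lt z y --> E z t)"
  have pow: "\<exists>t'. ?D t' \<and> (\<forall>x. subs E x t --> E x t')" if D: "?D t" for t
  proof -
    obtain t' where t': "\<forall>z. E z t' \<longleftrightarrow> subs E z t" using power_ex[of t] unfolding subs_def by blast
    have "E b t" if h: "subs E x t" "lt z x" "E b z" for x z b
    proof (rule ccontr)
      assume nb: "\<not> E b t"
      obtain a where a: "E a x" "\<not> E a z" "\<And>b. lt a b ==> E b z \<longleftrightarrow> E b x" using h lam_iff[of z x] by blast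
      have "E a t" using a h unfolding subs_def by blast
      then have "\<not> lt b a" "b \<noteq> a" using D nb by blast+
      then have "lt a b" using lam_total by blast
      then show False using a(3) h nb unfolding subs_def by blast
    qed
    then have 1: "\<forall>y z. E y t' --> lt z y --> E z t'" unfolding t'[rule_format] unfolding subs_def by blast
    have "subs E z t" if "E z y" "subs E y t" for z y
    proof -
      have "E z t" using that unfolding subs_def by blast
      then show ?thesis using D unfolding trn_def subs_def by blast
    qed
    then have "trn E t'" unfolding trn_def t'[rule_format] by blast
    then show ?thesis using t' 1 by blast
  qed
  let ?Q = "\<lambda>x. \<exists>t. ?D t \<and> subs E x t"
  have "?Q x"
  proof (rule h_all[of ?Q])
    show "df (\<lambda>e. ?Q (e 0))" by (intro dfs df_lam)
    show "?Q emp" by (rule exI[of _ emp]) (simp add: trn_def subs_def)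
    fix x y assume "?Q x" "?Q y"
    then obtain t s where t: "?D t" "subs E x t" and s: "?D s" "subs E y s" by blast
    obtain s' where s': "?D s'" "E y s'" using pow s by blast
    have "?D (un t s')" using t(1) s'(1) unfolding trn_def E_un by blast
    moreover have "subs E (adj x y) (un t s')" using t s' unfolding subs_def by auto
    ultimately show "?Q (adj x y)" by blast
  qed
  then obtain t where t: "?D t" "E x t" using pow by blast
  have "df (\<lambda>e. lt (e 0) x)" by (intro df_lam dfs)
  from sep[OF this, of t] show ?thesis using t by blast
qed

end

text \<open>The order is kept abstract because the standard world uses \<open><\<close> on natural
  numbers, whereas a world inside a model only has \<open>lam\<close>.\<close>

locale W = HFt +
  fixes lt :: "'a => 'a => bool" (infix "\<prec>" 50)
  assumes df_lt0: "df (\<lambda>e. e 0 \<prec> e (Suc 0))"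
    and lt_irrefl [simp]: "\<not> x \<prec> x"
    and lt_trans: "x \<prec> y ==> y \<prec> z ==> x \<prec> z"
    and lt_total: "x = y \<or> x \<prec> y \<or> y \<prec> x"
    and E_lt: "E x y ==> x \<prec> y"
    and seg_ex: "\<exists>s. \<forall>y. E y s \<longleftrightarrow> y \<prec> x"

lemma (in HFt) W_lam: "W E df (lam E)"
  by unfold_locales
    (use lam_irrefl lam_trans lam_mem lam_seg lam_total df_lam[OF dt_var dt_var] in blast)+

context W begin

lemma df_lt: "dt s ==> dt t ==> df (\<lambda>e. s e \<prec> t e)"
  by (rule df_comp2[OF df_lt0])

lemma lt_asym: "x \<prec> y ==> \<not> y \<prec> x" using lt_trans lt_irrefl by blast

lemma min_ex: "E x s ==> \<exists>m. E m s \<and> (\<forall>y. E y s --> \<not> y \<prec> m)"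
proof -
  have "(\<exists>x. E x s) --> (\<exists>m. E m s \<and> (\<forall>y. E y s --> \<not> y \<prec> m))"
  proof (rule h_all[of "\<lambda>s. (\<exists>x. E x s) --> (\<exists>m. E m s \<and> (\<forall>y. E y s --> \<not> y \<prec> m))"])
    show "df (\<lambda>e. (\<exists>x. E x (e 0)) --> (\<exists>m. E m (e 0) \<and> (\<forall>y. E y (e 0) --> \<not> y \<prec> m)))"
      by (intro dfs df_lt)
    fix s v assume s: "(\<exists>x. E x s) --> (\<exists>m. E m s \<and> (\<forall>y. E y s --> \<not> y \<prec> m))"
    show "(\<exists>x. E x (adj s v)) --> (\<exists>m. E m (adj s v) \<and> (\<forall>y. E y (adj s v) --> \<not> y \<prec> m))"
    proof (cases "\<exists>x. E x s")
      case True
      then obtain m where m: "E m s" "\<forall>y. E y s --> \<not> y \<prec> m" using s by blast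
      show ?thesis
      proof (cases "v \<prec> m")
        case True then show ?thesis using m lt_trans by (intro impI exI[of _ v]) auto
      next
        case False then show ?thesis using m by (intro impI exI[of _ m]) auto
      qed
    qed auto
  qed auto
  then show "E x s ==> \<exists>m. E m s \<and> (\<forall>y. E y s --> \<not> y \<prec> m)" by blast
qed

lemma max_ex: "E x s ==> \<exists>m. E m s \<and> (\<forall>y. E y s --> \<not> m \<prec> y)"
proof -
  have "(\<exists>x. E x s) --> (\<exists>m. E m s \<and> (\<forall>y. E y s --> \<not> m \<prec> y))"
  proof (rule h_all[of "\<lambda>s. (\<exists>x. E x s) --> (\<exists>m. E m s \<and> (\<forall>y. E y s --> \<not> m \<prec> y))"])
    show "df (\<lambda>e. (\<exists>x. E x (e 0)) --> (\<exists>m. E m (e 0) \<and> (\<forall>y. E y (e 0) --> \<not> m \<prec> y)))"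
      by (intro dfs df_lt)
    fix s v assume s: "(\<exists>x. E x s) --> (\<exists>m. E m s \<and> (\<forall>y. E y s --> \<not> m \<prec> y))"
    show "(\<exists>x. E x (adj s v)) --> (\<exists>m. E m (adj s v) \<and> (\<forall>y. E y (adj s v) --> \<not> m \<prec> y))"
    proof (cases "\<exists>x. E x s")
      case True
      then obtain m where m: "E m s" "\<forall>y. E y s --> \<not> m \<prec> y" using s by blast
      show ?thesis
      proof (cases "m \<prec> v")
        case True then show ?thesis using m lt_trans by (intro impI exI[of _ v]) auto
      next
        case False then show ?thesis using m by (intro impI exI[of _ m]) auto
      qed
    qed auto
  qed auto
  then show "E x s ==> \<exists>m. E m s \<and> (\<forall>y. E y s --> \<not> m \<prec> y)" by blast
qed

lemma least:
  assumes P: "df (\<lambda>e. P (e 0))" and x: "P x" shows "\<exists>m. P m \<and> (\<forall>y. P y --> \<not> y \<prec> m)"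
proof -
  obtain s where s: "\<forall>y. E y s \<longleftrightarrow> y \<prec> x" using seg_ex by blast
  obtain b where b: "\<forall>y. E y b \<longleftrightarrow> E y (adj s x) \<and> P y" using sep[OF P, of "adj s x"] by blast
  then obtain m where m: "E m b" "\<forall>y. E y b --> \<not> y \<prec> m" using min_ex[of x b] x by auto
  have "\<not> y \<prec> m" if "P y" for y
    using that m b s lt_trans[of y m x] by auto
  then show ?thesis using m b by blast
qed

lemma lt_induct:
  assumes P: "df (\<lambda>e. P (e 0))" and s: "\<And>x. (\<And>y. y \<prec> x ==> P y) ==> P x" shows "P x"
proof (rule ccontr)
  assume "\<not> P x"
  from least[of "\<lambda>x. \<not> P x", OF df_neg[OF P] this] show False using s by blast
qed

text \<open>A nonempty segment is a set and has a maximum, so every element but the bottom has an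
  immediate predecessor \<open>p\<close>. The order thus admits induction by successor steps as on
  natural numbers, with no limit case.\<close>

lemma seg_induct:
  assumes P: "df (\<lambda>e. P (e 0))" and b: "\<And>b. (\<And>x. \<not> x \<prec> b) ==> P b"
    and s: "\<And>b p. (\<And>x. x \<prec> b \<longleftrightarrow> x \<prec> p \<or> x = p) ==> P p ==> P b"
  shows "P x"
proof (rule lt_induct[of P, OF P])
  fix x assume IH: "\<And>y. y \<prec> x ==> P y"
  show "P x"
  proof (cases "\<exists>y. y \<prec> x")
    case True
    obtain s' where s': "\<forall>y. E y s' \<longleftrightarrow> y \<prec> x" using seg_ex by blast
    then obtain p where p: "E p s'" "\<forall>y. E y s' --> \<not> p \<prec> y" using max_ex True by meson
    show ?thesis
    proof (rule s[of x p])
      show "y \<prec> x \<longleftrightarrow> y \<prec> p \<or> y = p" for y using p s' lt_total[of y p] lt_trans[of y p x] by blast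
      show "P p" using IH p s' by blast
    qed
  qed (use b in blast)
qed

definition lst where "lst P = (THE m. P m \<and> (\<forall>y. P y --> \<not> y \<prec> m))"

lemma lst_eq: "P m ==> (\<And>y. P y ==> \<not> y \<prec> m) ==> lst P = m"
  unfolding lst_def by (rule the_equality) (use lt_total in blast)+

lemma lst: assumes "df (\<lambda>e. P (e 0))" "P x" shows "P (lst P)" "P y ==> \<not> y \<prec> lst P"
  using least[of P, OF assms] lst_eq[of P] by metis+

section \<open>Functions as sets and recursion along the order\<close>

definition rs where "rs f s = (THE g. \<forall>q. E q g \<longleftrightarrow> E q f \<and> (\<exists>x y. q = pr x y \<and> x \<prec> s))"

lemma E_rs [simp]: "E q (rs f s) \<longleftrightarrow> E q f \<and> (\<exists>x y. q = pr x y \<and> x \<prec> s)"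
  unfolding rs_def by (rule the_set) (rule sep, intro dfs3 df_lt)

lemma dt_rs: "dt s ==> dt t ==> dt (\<lambda>e. rs (s e) (t e))"
  by (rule dt_comp2) (unfold dt_def eq_set E_rs, intro dfs3 df_lt)

text \<open>Application is made total so that it can occur in definable terms. The default
  \<open>emp\<close> is chosen to fit the evaluation of terms later, where \<open>emp\<close>
  denotes itself.\<close>

definition ap where
  "ap f x = (if \<exists>!y. E (pr x y) f then THE y. E (pr x y) f else emp)"

lemma eq_ap: "(y = ap f x) \<longleftrightarrow> (E (pr x y) f \<and> (\<forall>z. E (pr x z) f --> z = y)) \<or>
    (\<not> (\<exists>z. E (pr x z) f \<and> (\<forall>w. E (pr x w) f --> w = z)) \<and> y = emp)"
proof (cases "\<exists>!y. E (pr x y) f")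
  case True
  then have "E (pr x (ap f x)) f" using theI'[OF True] unfolding ap_def by simp
  then show ?thesis using True by auto
next
  case False then show ?thesis unfolding ap_def by auto
qed

lemma dt_ap: "dt s ==> dt t ==> dt (\<lambda>e. ap (s e) (t e))"
  by (rule dt_comp2) (unfold dt_def eq_ap, intro dfs3 dt_emp)

lemma ap_eq: assumes "E (pr x y) f" "\<And>z. E (pr x z) f ==> z = y" shows "ap f x = y"
proof -
  have "y = ap f x" unfolding eq_ap using assms by blast
  then show ?thesis by simp
qed
lemma ap_none: assumes "\<And>z. \<not> E (pr x z) f" shows "ap f x = emp"
proof -
  have "emp = ap f x" unfolding eq_ap using assms by blast
  then show ?thesis by simp
qed

definition upd where "upd f k z = (THE g. \<forall>q. E q g \<longleftrightarrow> E q f \<and> \<not> (\<exists>y. q = pr k y) \<or> q = pr k z)"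

lemma E_upd [simp]: "E q (upd f k z) \<longleftrightarrow> E q f \<and> \<not> (\<exists>y. q = pr k y) \<or> q = pr k z"
  unfolding upd_def
proof (rule the_set)
  have "df (\<lambda>e. \<not> (\<exists>y. e 0 = pr k y))" by (intro dfs3)
  from sep[OF this, of f] obtain b where "\<forall>x. E x b \<longleftrightarrow> E x f \<and> \<not> (\<exists>y. x = pr k y)" by blast
  then show "\<exists>g. \<forall>q. E q g \<longleftrightarrow> E q f \<and> \<not> (\<exists>y. q = pr k y) \<or> q = pr k z"
    by (intro exI[of _ "adj b (pr k z)"]) auto
qed

lemma ap_upd [simp]: "ap (upd f k z) x = (if x = k then z else ap f x)"
proof (cases "x = k")
  case True then show ?thesis by (auto intro: ap_eq)
next
  case False
  then have "E (pr x y) (upd f k z) \<longleftrightarrow> E (pr x y) f" for y by auto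
  then show ?thesis using False unfolding ap_def by simp
qed

lemma dt_upd: "dt s ==> dt t ==> dt u ==> dt (\<lambda>e. upd (s e) (t e) (u e))"
  by (rule dt_comp3) (unfold dt_def eq_set E_upd, intro dfs3)

lemmas dfs4 = dfs3 df_lt dt_rs dt_ap dt_upd dt_emp

lemma image_ex: assumes "dt (\<lambda>e. f (e 0))" shows "\<exists>b. \<forall>y. E y b \<longleftrightarrow> (\<exists>x. E x a \<and> y = f x)"
  by (rule repl) (intro dfs4 dt_comp1[OF assms], simp)

text \<open>\<open>G\<close> receives a fixed parameter \<open>p\<close>, the argument
  \<open>s\<close> and the table of values at arguments below \<open>s\<close>.\<close>

definition tabP where
  "tabP G p t f \<longleftrightarrow> (\<forall>q. E q f \<longleftrightarrow> (\<exists>s. s \<prec> t \<and> q = pr s (G p s (rs f s))))"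
definition tab where "tab G p t = (THE f. tabP G p t f)"
definition rec where "rec G p t = G p t (tab G p t)"

context
  fixes G assumes G: "dt (\<lambda>e. G (e 0) (e (Suc 0)) (e (Suc (Suc 0))))"
begin

lemma df_tabP: "dt s ==> dt t ==> dt u ==> df (\<lambda>e. tabP G (s e) (t e) (u e))"
  by (rule df_comp3) (unfold tabP_def, intro dfs4 dt_comp3[OF G])

lemma tabP_unique: assumes f: "tabP G p t f" and g: "tabP G p t g" shows "f = g"
proof -
  have r: "s \<prec> t --> rs f s = rs g s" for s
  proof (rule lt_induct[of "\<lambda>s. s \<prec> t --> rs f s = rs g s"])
    show "df (\<lambda>e. e 0 \<prec> t --> rs f (e 0) = rs g (e 0))" by (intro dfs4)
    fix s assume IH: "\<And>y. y \<prec> s ==> y \<prec> t --> rs f y = rs g y"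
    show "s \<prec> t --> rs f s = rs g s"
    proof
      assume "s \<prec> t"
      show "rs f s = rs g s"
      proof (rule ext)
        fix q
        have "E q (rs f s) \<longleftrightarrow> (\<exists>x. x \<prec> s \<and> x \<prec> t \<and> q = pr x (G p x (rs f x)))"
          using f unfolding tabP_def by auto
        also have "\<dots> \<longleftrightarrow> (\<exists>x. x \<prec> s \<and> x \<prec> t \<and> q = pr x (G p x (rs g x)))"
          using IH by metis
        also have "\<dots> \<longleftrightarrow> E q (rs g s)" using g unfolding tabP_def by auto
        finally show "E q (rs f s) \<longleftrightarrow> E q (rs g s)" .
      qed
    qed
  qed
  show ?thesis by (rule ext) (use f g r in \<open>auto simp: tabP_def\<close>)
qed

lemma rs_tabP: assumes f: "tabP G p t f" and s: "s \<prec> t" shows "tabP G p s (rs f s)"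
proof -
  have r: "rs (rs f s) x = rs f x" if "x \<prec> s" for x
    by (rule ext) (use that lt_trans in auto)
  show ?thesis unfolding tabP_def
  proof
    fix q
    have "E q (rs f s) \<longleftrightarrow> (\<exists>x. x \<prec> s \<and> x \<prec> t \<and> q = pr x (G p x (rs f x)))"
      using f unfolding tabP_def by auto
    also have "\<dots> \<longleftrightarrow> (\<exists>x. x \<prec> s \<and> q = pr x (G p x (rs (rs f s) x)))"
      using r s lt_trans by metis
    finally show "E q (rs f s) \<longleftrightarrow> (\<exists>x. x \<prec> s \<and> q = pr x (G p x (rs (rs f s) x)))" .
  qed
qed

text \<open>By uniqueness the tables below different \<open>s\<close> cohere, so Replacement can
  collect one entry for each \<open>s\<close> below \<open>t\<close>.\<close>

lemma tabP_ex: "\<exists>f. tabP G p t f"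
proof (rule lt_induct[of "\<lambda>t. \<exists>f. tabP G p t f"])
  show "df (\<lambda>e. \<exists>f. tabP G p (e 0) f)" by (intro dfs4 df_tabP)
  fix t assume IH: "\<And>s. s \<prec> t ==> \<exists>f. tabP G p s f"
  obtain S where S: "\<forall>y. E y S \<longleftrightarrow> y \<prec> t" using seg_ex by blast
  have "\<exists>b. \<forall>q. E q b \<longleftrightarrow> (\<exists>s. E s S \<and> (\<exists>g. tabP G p s g \<and> q = pr s (G p s g)))"
    by (rule repl) (intro dfs4 df_tabP dt_comp3[OF G], use tabP_unique in blast)
  then obtain f where f: "\<forall>q. E q f \<longleftrightarrow> (\<exists>s. s \<prec> t \<and> (\<exists>g. tabP G p s g \<and> q = pr s (G p s g)))"
    using S by auto
  have r: "rs f s = g" if "s \<prec> t" "tabP G p s g" for s g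
  proof (rule ext)
    fix q
    have "E q (rs f s) \<longleftrightarrow> (\<exists>x. x \<prec> s \<and> (\<exists>g. tabP G p x g \<and> q = pr x (G p x g)))"
      using f lt_trans[OF _ that(1)] by auto
    also have "\<dots> \<longleftrightarrow> (\<exists>x. x \<prec> s \<and> q = pr x (G p x (rs g x)))"
      using rs_tabP[OF that(2)] tabP_unique by blast
    also have "\<dots> \<longleftrightarrow> E q g" using that(2) unfolding tabP_def by blast
    finally show "E q (rs f s) \<longleftrightarrow> E q g" .
  qed
  have "tabP G p t f" unfolding tabP_def
  proof
    fix q
    have "E q f \<longleftrightarrow> (\<exists>s. s \<prec> t \<and> (\<exists>g. tabP G p s g \<and> q = pr s (G p s g)))" using f by blast
    also have "\<dots> \<longleftrightarrow> (\<exists>s. s \<prec> t \<and> q = pr s (G p s (rs f s)))" using r IH by metis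
    finally show "E q f \<longleftrightarrow> (\<exists>s. s \<prec> t \<and> q = pr s (G p s (rs f s)))" .
  qed
  then show "\<exists>f. tabP G p t f" by blast
qed

lemma tabP_tab: "tabP G p t (tab G p t)"
  unfolding tab_def using theI'[of "tabP G p t"] tabP_ex tabP_unique by blast

lemma eq_tab: "(f = tab G p t) \<longleftrightarrow> tabP G p t f" using tabP_tab tabP_unique by blast

lemma dt_tab: "dt s ==> dt t ==> dt (\<lambda>e. tab G (s e) (t e))"
  by (rule dt_comp2) (unfold dt_def eq_tab, intro dfs4 df_tabP)

lemma dt_rec: "dt s ==> dt t ==> dt (\<lambda>e. rec G (s e) (t e))"
  unfolding rec_def by (intro dt_comp3[OF G] dt_tab)

lemma E_tab: "E q (tab G p t) \<longleftrightarrow> (\<exists>s. s \<prec> t \<and> q = pr s (rec G p s))"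
proof -
  have "rs (tab G p t) s = tab G p s" if "s \<prec> t" for s
    using rs_tabP[OF tabP_tab that] eq_tab by blast
  then show ?thesis using tabP_tab[of p t] unfolding tabP_def rec_def by metis
qed

lemma ap_tab: "s \<prec> t ==> ap (tab G p t) s = rec G p s"
  by (rule ap_eq) (auto simp: E_tab)

end

end

section \<open>Structures with a truth predicate for all codes\<close>

primrec sat :: "('a => 'a => bool) => ('a => 'a => bool) => (nat => 'a) => fm => bool" where
  "sat E Q e (Mem x y) = E (e x) (e y)"
| "sat E Q e (Eq x y) = Q (e x) (e y)"
| "sat E Q e (Neg \<phi>) = (\<not> sat E Q e \<phi>)"
| "sat E Q e (Imp \<phi> \<psi>) = (sat E Q e \<phi> --> sat E Q e \<psi>)"
| "sat E Q e (All x \<phi>) = (\<forall>a. sat E Q (e(x := a)) \<phi>)"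

lemma lsat [simp]:
  "sat E Q e ((x \<^bold>\<in> y) n) \<longleftrightarrow> E (e x) (e y)"
  "sat E Q e ((x \<^bold>= y) n) \<longleftrightarrow> Q (e x) (e y)"
  "sat E Q e ((\<^bold>\<not> A) n) \<longleftrightarrow> \<not> sat E Q e (A n)"
  "sat E Q e ((A \<^bold>\<longrightarrow> B) n) \<longleftrightarrow> (sat E Q e (A n) --> sat E Q e (B n))"
  "sat E Q e ((A \<^bold>\<and> B) n) \<longleftrightarrow> (sat E Q e (A n) \<and> sat E Q e (B n))"
  "sat E Q e ((A \<^bold>\<or> B) n) \<longleftrightarrow> (sat E Q e (A n) \<or> sat E Q e (B n))"
  "sat E Q e ((A \<^bold>\<longleftrightarrow> B) n) \<longleftrightarrow> (sat E Q e (A n) \<longleftrightarrow> sat E Q e (B n))"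
  "sat E Q e (lAll C n) \<longleftrightarrow> (\<forall>a. sat E Q (e(n := a)) (C n (Suc n)))"
  "sat E Q e (lEx C n) \<longleftrightarrow> (\<exists>a. sat E Q (e(n := a)) (C n (Suc n)))"
  by (auto simp: lMem_def lEq_def lNeg_def lImp_def lAnd_def lOr_def lIff_def lAll_def lEx_def)

text \<open>Variables and formulas may be nonstandard; \<open>sv\<close> names the standard
  variables, so that \<open>cd\<close> can translate ordinary formulas. In \<open>fresh\<close>,
  finiteness is meant in the outer sense.\<close>

locale codes =
  fixes isv :: "'v => bool" and Form :: "'f => bool" and mem eq :: "'v => 'v => 'f"
    and neg :: "'f => 'f" and imp :: "'f => 'f => 'f" and all :: "'v => 'f => 'f"
    and fv :: "'f => 'v => bool" and sv :: "nat => 'v"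
  assumes F_mem: "isv x ==> isv y ==> Form (mem x y)"
    and F_eq: "isv x ==> isv y ==> Form (eq x y)"
    and F_neg: "Form \<phi> ==> Form (neg \<phi>)"
    and F_imp: "Form \<phi> ==> Form \<psi> ==> Form (imp \<phi> \<psi>)"
    and F_all: "isv x ==> Form \<phi> ==> Form (all x \<phi>)"
    and fv_mem: "isv x ==> isv y ==> fv (mem x y) v \<longleftrightarrow> v = x \<or> v = y"
    and fv_eq: "isv x ==> isv y ==> fv (eq x y) v \<longleftrightarrow> v = x \<or> v = y"
    and fv_neg: "Form \<phi> ==> fv (neg \<phi>) v \<longleftrightarrow> fv \<phi> v"
    and fv_imp: "Form \<phi> ==> Form \<psi> ==> fv (imp \<phi> \<psi>) v \<longleftrightarrow> fv \<phi> v \<or> fv \<psi> v"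
    and fv_all: "isv x ==> Form \<phi> ==> fv (all x \<phi>) v \<longleftrightarrow> fv \<phi> v \<and> v \<noteq> x"
    and sv_isv: "isv (sv i)" and sv_inj: "sv i = sv j \<longleftrightarrow> i = j"
    and fresh: "finite X ==> finite \<Phi> ==> (\<And>\<phi>. \<phi> \<in> \<Phi> ==> Form \<phi>) ==>
      \<exists>v. isv v \<and> v \<notin> X \<and> (\<forall>\<phi>\<in>\<Phi>. \<not> fv \<phi> v)"
begin

lemmas F_rules = F_mem F_eq F_neg F_imp F_all sv_isv
lemmas fv_rules = fv_mem fv_eq fv_neg fv_imp fv_all

abbreviation "cconj \<phi> \<psi> \<equiv> neg (imp \<phi> (neg \<psi>))"
abbreviation "ciff \<phi> \<psi> \<equiv> cconj (imp \<phi> \<psi>) (imp \<psi> \<phi>)"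
abbreviation "cexi x \<phi> \<equiv> neg (all x (neg \<phi>))"

primrec cd :: "fm => 'f" where
  "cd (Mem x y) = mem (sv x) (sv y)"
| "cd (Eq x y) = eq (sv x) (sv y)"
| "cd (Neg \<phi>) = neg (cd \<phi>)"
| "cd (Imp \<phi> \<psi>) = imp (cd \<phi>) (cd \<psi>)"
| "cd (All x \<phi>) = all (sv x) (cd \<phi>)"

lemma F_cd: "Form (cd \<phi>)" by (induction \<phi>) (auto intro: F_rules)

definition sepc where
  "sepc x a b \<phi> = all a (cexi b (all x (ciff (mem x b) (cconj (mem x a) \<phi>))))"
definition replc where
  "replc x y z a b \<phi> = all a (imp (all x (imp (mem x a) (cexi z (all y (imp \<phi> (eq y z))))))
     (cexi b (all y (ciff (mem y b) (cexi x (cconj (mem x a) \<phi>))))))"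

definition Sax where
  "Sax \<chi> \<longleftrightarrow> \<chi> \<in> cd ` {extensionality_ax, foundation_ax, pairing_ax, union_ax, power_ax} \<or>
    (\<exists>x a b \<phi>. isv x \<and> isv a \<and> isv b \<and> distinct [x, a, b] \<and> Form \<phi> \<and> \<not> fv \<phi> b \<and> \<chi> = sepc x a b \<phi>) \<or>
    (\<exists>x y z a b \<phi>. isv x \<and> isv y \<and> isv z \<and> isv a \<and> isv b \<and> distinct [x, y, z, a, b] \<and> Form \<phi> \<and>
       \<not> fv \<phi> z \<and> \<not> fv \<phi> b \<and> \<chi> = replc x y z a b \<phi>)"

lemma F_Sax: "Sax \<chi> ==> Form \<chi>"
  unfolding Sax_def sepc_def replc_def by (auto intro!: F_rules F_cd)

lemma freshlist: "finite X ==> finite \<Phi> ==> (\<And>\<phi>. \<phi> \<in> \<Phi> ==> Form \<phi>) ==>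
  \<exists>us. length us = n \<and> distinct us \<and> (\<forall>u\<in>set us. isv u \<and> u \<notin> X \<and> (\<forall>\<phi>\<in>\<Phi>. \<not> fv \<phi> u))"
proof (induction n)
  case (Suc n)
  then obtain us where us: "length us = n" "distinct us" "\<forall>u\<in>set us. isv u \<and> u \<notin> X \<and> (\<forall>\<phi>\<in>\<Phi>. \<not> fv \<phi> u)"
    by blast
  obtain v where "isv v" "v \<notin> X \<union> set us" "\<forall>\<phi>\<in>\<Phi>. \<not> fv \<phi> v"
    using fresh[of "X \<union> set us" \<Phi>] Suc.prems by auto
  then show ?case using us by (intro exI[of _ "v # us"]) auto
qed auto

end

text \<open>
  A structure with a truth predicate \<open>Tr\<close> for all codes, nonstandard ones included; \<open>Q\<close>
  interprets equality.
\<close>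

locale FT = codes isv Form mem eq neg imp all fv sv
  for isv :: "'v => bool" and Form :: "'f => bool" and mem eq neg imp all fv sv +
  fixes Asg :: "'g => bool" and look :: "'g => 'v => 'a" and md :: "'g => 'v => 'a => 'g"
    and Tr :: "'f => 'g => bool" and E Q :: "'a => 'a => bool" and g0 :: 'g
  assumes A_g0: "Asg g0" and A_md: "Asg g ==> isv x ==> Asg (md g x a)"
    and look_md: "Asg g ==> isv x ==> isv y ==> look (md g x a) y = (if y = x then a else look g y)"
    and Tr_mem: "Asg g ==> isv x ==> isv y ==> Tr (mem x y) g \<longleftrightarrow> E (look g x) (look g y)"
    and Tr_eq: "Asg g ==> isv x ==> isv y ==> Tr (eq x y) g \<longleftrightarrow> Q (look g x) (look g y)"
    and Tr_neg: "Asg g ==> Form \<phi> ==> Tr (neg \<phi>) g \<longleftrightarrow> \<not> Tr \<phi> g"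
    and Tr_imp: "Asg g ==> Form \<phi> ==> Form \<psi> ==> Tr (imp \<phi> \<psi>) g \<longleftrightarrow> (Tr \<phi> g --> Tr \<psi> g)"
    and Tr_all: "Asg g ==> isv x ==> Form \<phi> ==> Tr (all x \<phi>) g \<longleftrightarrow> (\<forall>a. Tr \<phi> (md g x a))"
    and Tr_cong: "Form \<phi> ==> Asg g ==> Asg g' ==> (\<And>x. isv x ==> fv \<phi> x ==> Q (look g x) (look g' x)) ==>
      Tr \<phi> g = Tr \<phi> g'"
    and Q_refl: "Q a a" and Q_sym: "Q a b ==> Q b a" and Q_trans: "Q a b ==> Q b c ==> Q a c"
    and E_cong: "Q a a' ==> Q b b' ==> E a b ==> E a' b'"
begin

lemmas Tr_rules = Tr_mem Tr_eq Tr_neg Tr_imp Tr_all A_md look_md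

lemma Tr_cd: "Asg g ==> Tr (cd \<phi>) g \<longleftrightarrow> sat E Q (\<lambda>i. look g (sv i)) \<phi>"
proof (induction \<phi> arbitrary: g)
  case (All x \<phi>)
  have "(\<lambda>i. look (md g (sv x) a) (sv i)) = (\<lambda>i. look g (sv i))(x := a)" for a
    using All.prems by (auto simp: look_md sv_isv sv_inj)
  then show ?case using All by (simp add: Tr_rules F_rules F_cd)
qed (simp_all add: Tr_rules F_rules F_cd)

definition valid where "valid \<phi> \<longleftrightarrow> (\<forall>g. Asg g --> Tr \<phi> g)"

lemma valid_cd: "valid (cd \<phi>) ==> \<exists>e. sat E Q e \<phi>"
  using Tr_cd[OF A_g0] A_g0 unfolding valid_def by blast

text \<open>Pairing and Union build a \<open>y\<close> that contains the finitely many members of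
  \<open>A\<close>. By Foundation \<open>y\<close> is no member of itself, so it is equivalent to
  none of them. The purpose is to enumerate the quotient by \<open>nat\<close>.\<close>

lemma infinite_classes:
  assumes S: "\<And>\<phi>. Sax \<phi> ==> valid \<phi>" and A: "finite A" shows "\<exists>y. \<forall>a\<in>A. \<not> Q a y"
proof -
  have ax: "\<exists>e. sat E Q e pairing_ax" "\<exists>e. sat E Q e union_ax" "\<exists>e. sat E Q e foundation_ax"
    by (rule valid_cd, rule S, simp add: Sax_def)+
  have pa: "\<exists>p. \<forall>z. E z p \<longleftrightarrow> Q z x \<or> Q z y" for x y
    using ax(1) unfolding pairing_ax_def by (simp add: fun_upd_def)
  have un: "\<exists>u. \<forall>z. E z u \<longleftrightarrow> (\<exists>y. E z y \<and> E y x)" for x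
    using ax(2) unfolding union_ax_def by (simp add: fun_upd_def)
  have fo: "E y x ==> \<exists>y. E y x \<and> (\<forall>z. E z y --> \<not> E z x)" for x y
    using ax(3) unfolding foundation_ax_def by (simp add: fun_upd_def) blast
  have "\<exists>y. \<forall>a\<in>A. E a y" using A
  proof induction
    case (insert a A)
    then obtain y where y: "\<forall>a\<in>A. E a y" by blast
    obtain s where s: "\<forall>z. E z s \<longleftrightarrow> Q z a \<or> Q z a" using pa by blast
    obtain p where p: "\<forall>z. E z p \<longleftrightarrow> Q z s \<or> Q z y" using pa by blast
    obtain u where u: "\<forall>z. E z u \<longleftrightarrow> (\<exists>y. E z y \<and> E y p)" using un by blast
    show ?case using y s p u Q_refl by (intro exI[of _ u]) blast
  qed simp
  then obtain y where y: "\<forall>a\<in>A. E a y" by blast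
  have "\<not> E y y"
  proof
    assume yy: "E y y"
    obtain s where s: "\<forall>z. E z s \<longleftrightarrow> Q z y \<or> Q z y" using pa by blast
    then obtain m where m: "E m s" "\<forall>z. E z m --> \<not> E z s" using fo Q_refl by blast
    then have "E m m" using E_cong[OF _ _ yy] s Q_sym by blast
    then show False using m by blast
  qed
  then show ?thesis using y E_cong[of _ y y y] Q_refl by blast
qed

text \<open>Truth is left as it was; only the values returned by assignments are renamed. In the
  quantifier clause \<open>Tr_cong\<close> exchanges a value for the representative of its
  class.\<close>

lemma quotient:
  fixes cls :: "'a => 'b"
  assumes c: "surj cls" "\<And>x y. cls x = cls y \<longleftrightarrow> Q x y"
  defines "rep \<equiv> inv cls"
  shows "FT isv Form mem eq neg imp all fv sv Asg (\<lambda>g x. cls (look g x)) (\<lambda>g x u. md g x (rep u)) Tr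
    (\<lambda>u v. E (rep u) (rep v)) (=) g0"
proof
  have cr [simp]: "cls (rep u) = u" for u unfolding rep_def using c(1) by (rule surj_f_inv_f)
  have rc: "Q (rep (cls x)) x" for x using c(2) cr by blast
  have EQ: "E (rep (cls x)) (rep (cls y)) \<longleftrightarrow> E x y" for x y
    using E_cong rc Q_sym by blast
  fix g g' x y \<phi> \<psi> and a :: 'b
  show "Asg g0" by (rule A_g0)
  show "Asg (md g x (rep a))" if "Asg g" "isv x" using that by (rule A_md)
  show "cls (look (md g x (rep a)) y) = (if y = x then a else cls (look g y))"
    if "Asg g" "isv x" "isv y" using that by (simp add: look_md)
  show "Tr (mem x y) g = E (rep (cls (look g x))) (rep (cls (look g y)))" if "Asg g" "isv x" "isv y"
    using that by (simp add: Tr_mem EQ)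
  show "Tr (eq x y) g = (cls (look g x) = cls (look g y))" if "Asg g" "isv x" "isv y"
    using that by (simp add: Tr_eq c(2))
  show "Tr (neg \<phi>) g = (\<not> Tr \<phi> g)" if "Asg g" "Form \<phi>" using that by (rule Tr_neg)
  show "Tr (imp \<phi> \<psi>) g = (Tr \<phi> g --> Tr \<psi> g)" if "Asg g" "Form \<phi>" "Form \<psi>" using that by (rule Tr_imp)
  show "Tr (all x \<phi>) g = (\<forall>a. Tr \<phi> (md g x (rep a)))" if h: "Asg g" "isv x" "Form \<phi>"
  proof -
    have "Tr \<phi> (md g x b) = Tr \<phi> (md g x (rep (cls b)))" for b
      by (rule Tr_cong) (use h rc Q_sym Q_refl in \<open>auto simp: Tr_rules\<close>)
    then show ?thesis unfolding Tr_all[OF h] by blast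
  qed
  show "Tr \<phi> g = Tr \<phi> g'" if "Form \<phi>" "Asg g" "Asg g'"
    "\<And>x. isv x ==> fv \<phi> x ==> cls (look g x) = cls (look g' x)"
    using that by (intro Tr_cong) (auto simp: c(2))
qed auto

end

text \<open>Keeping \<open>nat\<close> as carrier of the quotient lets the result be fed into the
  same locales again.\<close>

lemma countable_classes:
  fixes Q :: "nat => nat => bool"
  assumes "equivp Q" "\<And>A. finite A ==> \<exists>y. \<forall>a\<in>A. \<not> Q a y"
  shows "\<exists>cls :: nat => nat. surj cls \<and> (\<forall>x y. cls x = cls y \<longleftrightarrow> Q x y)"
proof -
  define least where "least x = (LEAST y. Q x y)" for x
  have l: "Q x (least x)" for x unfolding least_def using equivp_reflp[OF assms(1)] by (rule LeastI)
  have lQ: "least x = least y \<longleftrightarrow> Q x y" for x y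
  proof
    show "least x = least y ==> Q x y" using l[of x] l[of y] assms(1) by (metis equivp_symp equivp_transp)
    show "Q x y ==> least x = least y" unfolding least_def
      using assms(1) unfolding equivp_def by simp
  qed
  have inf: "infinite (range least)"
  proof
    assume "finite (range least)"
    then obtain y where "\<forall>a\<in>range least. \<not> Q a y" using assms(2) by blast
    then show False using l[of y] assms(1) by (metis equivp_symp rangeI)
  qed
  obtain r where r: "bij_betw r (range least) (UNIV :: nat set)"
    using inf countableE_infinite[of "range least"] by blast
  show ?thesis
  proof (intro exI conjI allI)
    show "surj (\<lambda>x. r (least x))" using r unfolding bij_betw_def by (metis image_image)
    show "r (least x) = r (least y) \<longleftrightarrow> Q x y" for x y
      unfolding lQ[symmetric] using r unfolding bij_betw_def by (auto dest: inj_onD)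
  qed
qed

definition pre :: "'a list => (nat => 'a) => nat => 'a" (infixr "@@" 65) where
  "(as @@ e) i = (if i < length as then as ! i else e (i - length as))"

lemma pre_snoc: "as @@ (c ## e) = (as @ [c]) @@ e"
proof
  fix i
  consider "i < length as" | "i = length as" | k where "i = Suc (length as + k)"
    by (metis less_iff_Suc_add linorder_less_linear)
  then show "(as @@ (c ## e)) i = ((as @ [c]) @@ e) i"
    by cases (simp_all add: pre_def nth_append)
qed

lemma pre_rot: "(\<lambda>i. (v ## (as @@ e)) (if i < length as then Suc i else if i = length as then 0 else i)) = as @@ (v ## e)"
proof
  fix i
  consider "i < length as" | "i = length as" | k where "i = Suc (length as + k)"
    by (metis less_iff_Suc_add linorder_less_linear)
  then show "(v ## (as @@ e)) (if i < length as then Suc i else if i = length as then 0 else i) = (as @@ (v ## e)) i"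
    by cases (simp_all add: pre_def)
qed

text \<open>Parameters form a prefix of the assignment. Implication concatenates two prefixes, and a
  quantified variable is moved past the prefix by reindexing.\<close>

lemma params_dfl:
  fixes df0 :: "((nat => 'a) => bool) => bool"
  assumes neg: "\<And>P. df0 P ==> df0 (\<lambda>e. \<not> P e)"
    and imp: "\<And>P Q. df0 P ==> df0 Q ==> df0 (\<lambda>e. P e --> Q e)"
    and all: "\<And>P. df0 P ==> df0 (\<lambda>e. \<forall>v. P (v ## e))"
    and re: "\<And>P f. df0 P ==> df0 (\<lambda>e. P (\<lambda>i. e (f i)))"
    and E: "df0 (\<lambda>e. E (e 0) (e (Suc 0)))" and eq: "df0 (\<lambda>e. e 0 = e (Suc 0))"
  shows "dfl E (\<lambda>P. \<exists>P0 as. df0 P0 \<and> (\<forall>e. P e = P0 (as @@ e)))"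
proof
  fix P Q :: "(nat => 'a) => bool" and c :: 'a and f :: "nat => nat"
  let ?df = "\<lambda>P. \<exists>P0 as. df0 P0 \<and> (\<forall>e. P e = P0 (as @@ e))"
  have nil: "[] @@ e = e" for e :: "nat => 'a" by (simp add: pre_def fun_eq_iff)
  show "?df (\<lambda>e. E (e 0) (e (Suc 0)))" "?df (\<lambda>e. e 0 = e (Suc 0))"
    by (rule exI, rule exI[of _ "[]"], rule conjI[OF E], simp add: nil)
      (rule exI, rule exI[of _ "[]"], rule conjI[OF eq], simp add: nil)
  assume "?df P"
  then obtain P0 as where P: "df0 P0" "\<And>e. P e = P0 (as @@ e)" by blast
  show "?df (\<lambda>e. \<not> P e)" using neg[OF P(1)] P(2) by blast
  show "?df (\<lambda>e. P (c ## e))"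
  proof (intro exI conjI allI)
    show "df0 P0" by (rule P)
    show "P (c ## e) = P0 ((as @ [c]) @@ e)" for e by (simp add: P(2) pre_snoc)
  qed
  show "?df (\<lambda>e. P (\<lambda>i. e (f i)))"
  proof (intro exI conjI allI)
    let ?f = "\<lambda>i. if i < length as then i else length as + f (i - length as)"
    show "df0 (\<lambda>e. P0 (\<lambda>i. e (?f i)))" by (rule re[OF P(1)])
    show "P (\<lambda>i. e (f i)) = P0 (\<lambda>i. (as @@ e) (?f i))" for e
      unfolding P(2) by (rule arg_cong[of _ _ P0]) (auto simp: pre_def fun_eq_iff)
  qed
  show "?df (\<lambda>e. \<forall>v. P (v ## e))"
  proof (intro exI conjI allI)
    let ?f = "\<lambda>i. if i < length as then Suc i else if i = length as then 0 else i"
    show "df0 (\<lambda>e. \<forall>v. P0 (\<lambda>i. (v ## e) (?f i)))" by (rule all[OF re[OF P(1)]])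
    show "(\<forall>v. P (v ## e)) = (\<forall>v. P0 (\<lambda>i. (v ## (as @@ e)) (?f i)))" for e
      unfolding P(2) pre_rot ..
  qed
  assume "?df Q"
  then obtain Q0 bs where Q: "df0 Q0" "\<And>e. Q e = Q0 (bs @@ e)" by blast
  show "?df (\<lambda>e. P e --> Q e)"
  proof (intro exI conjI allI)
    let ?f = "\<lambda>i. if i < length as then i else i + length bs" and ?g = "\<lambda>i. i + length as"
    show "df0 (\<lambda>e. P0 (\<lambda>i. e (?f i)) --> Q0 (\<lambda>i. e (?g i)))" by (rule imp[OF re[OF P(1)] re[OF Q(1)]])
    have "(\<lambda>i. ((as @ bs) @@ e) (?f i)) = as @@ e" "(\<lambda>i. ((as @ bs) @@ e) (?g i)) = bs @@ e" for e
      by (auto simp: pre_def fun_eq_iff nth_append)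
    then show "(P e --> Q e) = (P0 (\<lambda>i. ((as @ bs) @@ e) (?f i)) --> Q0 (\<lambda>i. ((as @ bs) @@ e) (?g i)))" for e
      by (simp add: P(2) Q(2))
  qed
qed

section \<open>Definable predicates of a structure with a truth predicate\<close>

locale FT0 = FT isv Form mem eq neg imp all fv sv Asg look md Tr E "(=)" g0
  for isv :: "'v => bool" and Form :: "'f => bool" and mem eq neg imp all fv sv
    and Asg :: "'g => bool" and look :: "'g => 'v => 'a" and md Tr E g0
begin

primrec mds :: "'g => 'v list => (nat => 'a) => 'g" where
  "mds g [] e = g"
| "mds g (v # vs) e = mds (md g v (e 0)) vs (\<lambda>i. e (Suc i))"

lemma A_mds: "Asg g ==> (\<forall>v\<in>set vs. isv v) ==> Asg (mds g vs e)"
  by (induction vs arbitrary: g e) (auto intro: A_md)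

lemma look_mds_out: "Asg g ==> (\<forall>v\<in>set vs. isv v) ==> isv x ==> x \<notin> set vs ==> look (mds g vs e) x = look g x"
  by (induction vs arbitrary: g e) (auto simp: A_md look_md)

lemma look_mds: "Asg g ==> (\<forall>v\<in>set vs. isv v) ==> distinct vs ==> i < length vs ==>
  look (mds g vs e) (vs ! i) = e i"
proof (induction vs arbitrary: g e i)
  case (Cons v vs)
  show ?case
  proof (cases i)
    case 0 then show ?thesis using Cons by (simp add: look_mds_out A_md look_md)
  next
    case (Suc j) then show ?thesis using Cons by (simp add: A_md)
  qed
qed simp

text \<open>Substitution expressed by quantification. Nothing is replaced inside the code, so
  variable capture does not arise and nonstandard codes cause no difficulty.\<close>

definition sub where "sub v u \<phi> = all v (imp (eq v u) \<phi>)"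

lemma F_sub: "Form \<phi> ==> isv v ==> isv u ==> Form (sub v u \<phi>)"
  unfolding sub_def by (intro F_rules)

lemma Tr_sub: "Asg g ==> Form \<phi> ==> isv v ==> isv u ==> u \<noteq> v ==> Tr (sub v u \<phi>) g \<longleftrightarrow> Tr \<phi> (md g v (look g u))"
  unfolding sub_def by (simp add: Tr_rules F_rules)

primrec subs where
  "subs [] \<phi> = \<phi>"
| "subs (p # L) \<phi> = sub (fst p) (snd p) (subs L \<phi>)"

lemma subs_correct:
  assumes "Form \<phi>" "\<forall>p\<in>set L. isv (fst p) \<and> isv (snd p) \<and> snd p \<notin> fst ` set L" "Asg g"
  shows "Form (subs L \<phi>) \<and> Tr (subs L \<phi>) g = Tr \<phi> (mds g (map fst L) (\<lambda>i. look g (snd (L ! i))))"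
  using assms(2,3)
proof (induction L arbitrary: g)
  case (Cons p L)
  let ?g = "md g (fst p) (look g (snd p))"
  have A: "Asg ?g" using Cons by (auto intro: A_md)
  have IH: "Form (subs L \<phi>)" "Tr (subs L \<phi>) ?g = Tr \<phi> (mds ?g (map fst L) (\<lambda>i. look ?g (snd (L ! i))))"
    using Cons.IH[OF _ A] Cons.prems by auto
  have "mds ?g (map fst L) (\<lambda>i. look ?g (snd (L ! i))) = mds ?g (map fst L) (\<lambda>i. look g (snd (L ! i)))"
  proof -
    have 1: "mds h (map fst L) e = mds h (map fst L) e'" if "\<forall>i<length L. e i = e' i" for h e e'
      using that
    proof (induction L arbitrary: h e e')
      case (Cons p L)
      have "e 0 = e' 0" "\<forall>i<length L. e (Suc i) = e' (Suc i)" using Cons.prems by auto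
      then show ?case using Cons.IH[of "\<lambda>i. e (Suc i)" "\<lambda>i. e' (Suc i)"] by simp
    qed simp
    have "look ?g (snd (L ! i)) = look g (snd (L ! i))" if "i < length L" for i
    proof -
      have "L ! i \<in> set L" using that by simp
      then show ?thesis using Cons.prems by (auto simp: look_md)
    qed
    then show ?thesis by (intro 1) simp
  qed
  then show ?case using IH Cons.prems by (auto simp: F_sub Tr_sub)
qed (use assms(1) in simp)

lemma fv_subs:
  assumes "Form \<phi>" "\<forall>p\<in>set L. isv (fst p) \<and> isv (snd p)"
  shows "Form (subs L \<phi>) \<and> (\<forall>v. fv (subs L \<phi>) v --> fv \<phi> v \<and> v \<notin> fst ` set L \<or> v \<in> snd ` set L)"
  using assms(2)
proof (induction L)
  case (Cons p L)
  then have "Form (subs L \<phi>)" "isv (fst p)" "isv (snd p)" by simp_all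
  then have "Form (subs (p # L) \<phi>)" "fv (subs (p # L) \<phi>) v \<longleftrightarrow> (v = snd p \<or> v = fst p \<or> fv (subs L \<phi>) v) \<and> v \<noteq> fst p" for v
    by (auto simp: sub_def fv_rules F_rules)
  then show ?case using Cons by auto
qed (use assms(1) in simp)

text \<open>No target variable is a source, so the nested single substitutions act simultaneously.
  The map \<open>f\<close> may permute or identify coordinates, as reindexing of assignments
  requires.\<close>

lemma ren:
  assumes "Form \<phi>" "\<forall>v\<in>set vs. isv v" "distinct vs" "distinct us"
    "\<forall>u\<in>set us. isv u \<and> u \<notin> set vs \<and> \<not> fv \<phi> u" "\<forall>i<length vs. f i < length us"
  shows "\<exists>\<phi>'. Form \<phi>' \<and> ((\<forall>v. fv \<phi> v --> v \<in> set vs) --> (\<forall>v. fv \<phi>' v --> v \<in> set us)) \<and>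
    (\<forall>g e. Asg g --> Tr \<phi>' (mds g us e) = Tr \<phi> (mds g vs (\<lambda>i. e (f i))))"
proof -
  let ?L = "zip vs (map (\<lambda>i. us ! f i) [0..<length vs])"
  have L: "map fst ?L = vs" by simp
  have Li: "snd (?L ! i) = us ! f i" if "i < length vs" for i using that by simp
  have ok: "\<forall>p\<in>set ?L. isv (fst p) \<and> isv (snd p) \<and> snd p \<notin> fst ` set ?L"
  proof
    fix p assume "p \<in> set ?L"
    then obtain i where "i < length vs" "p = (vs ! i, us ! f i)" by (auto simp: set_zip)
    then show "isv (fst p) \<and> isv (snd p) \<and> snd p \<notin> fst ` set ?L"
      using assms L by (metis fst_conv snd_conv nth_mem set_map)
  qed
  show ?thesis
  proof (intro exI conjI allI impI)
    show "Form (subs ?L \<phi>)" using subs_correct[OF assms(1) ok A_g0] by blast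
    show "v \<in> set us" if "\<forall>v. fv \<phi> v --> v \<in> set vs" "fv (subs ?L \<phi>) v" for v
    proof -
      have "fv \<phi> v \<and> v \<notin> fst ` set ?L \<or> v \<in> snd ` set ?L"
        using fv_subs[OF assms(1), of ?L] ok that(2) by blast
      moreover have "fst ` set ?L = set vs" using L by (metis set_map)
      moreover have "snd ` set ?L \<subseteq> set us" using assms(6) by (auto simp: set_zip)
      ultimately show ?thesis using that(1) by blast
    qed
    fix g e assume g: "Asg g"
    have A: "Asg (mds g us e)" using g assms by (simp add: A_mds)
    have "Tr (subs ?L \<phi>) (mds g us e) = Tr \<phi> (mds (mds g us e) vs (\<lambda>i. look (mds g us e) (snd (?L ! i))))"
      using subs_correct[OF assms(1) ok A] L by simp
    also have "\<dots> = Tr \<phi> (mds g vs (\<lambda>i. e (f i)))"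
    proof (rule Tr_cong[OF assms(1)])
      show "Asg (mds (mds g us e) vs (\<lambda>i. look (mds g us e) (snd (?L ! i))))" "Asg (mds g vs (\<lambda>i. e (f i)))"
        using A g assms by (simp_all add: A_mds)
      fix x assume x: "isv x" "fv \<phi> x"
      show "look (mds (mds g us e) vs (\<lambda>i. look (mds g us e) (snd (?L ! i)))) x = look (mds g vs (\<lambda>i. e (f i))) x"
      proof (cases "x \<in> set vs")
        case True
        then obtain i where i: "i < length vs" "x = vs ! i" by (metis in_set_conv_nth)
        have "f i < length us" using assms(6) i by blast
        then show ?thesis using i g A assms by (simp add: look_mds)
      next
        case False
        moreover have "x \<notin> set us" using assms(5) x by blast
        ultimately show ?thesis using x g A assms by (simp add: look_mds_out)
      qed
    qed
    finally show "Tr (subs ?L \<phi>) (mds g us e) = Tr \<phi> (mds g vs (\<lambda>i. e (f i)))" .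
  qed
qed

text \<open>Listing all free variables in \<open>vs\<close> keeps values of the base assignment
  \<open>g0\<close> from entering as hidden parameters.\<close>

definition df0 where
  "df0 P \<longleftrightarrow> (\<exists>\<phi> vs. Form \<phi> \<and> distinct vs \<and> (\<forall>v\<in>set vs. isv v) \<and>
     (\<forall>v. fv \<phi> v --> v \<in> set vs) \<and> (\<forall>e. P e = Tr \<phi> (mds g0 vs e)))"
definition df where "df P \<longleftrightarrow> (\<exists>P0 as. df0 P0 \<and> (\<forall>e. P e = P0 (as @@ e)))"

text \<open>Renaming into a longer list of fresh variables guarantees a variable for coordinate 0,
  which the quantifier step needs even when \<open>P\<close> ignores that coordinate.\<close>

lemma df0_re_long:
  assumes "df0 P" "finite X" "finite \<Phi>" "\<And>\<phi>. \<phi> \<in> \<Phi> ==> Form \<phi>"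
  shows "\<exists>\<phi> us. Form \<phi> \<and> distinct us \<and> (\<forall>v\<in>set us. isv v \<and> v \<notin> X \<and> (\<forall>\<phi>\<in>\<Phi>. \<not> fv \<phi> v)) \<and> length us \<ge> n \<and>
    (\<forall>v. fv \<phi> v --> v \<in> set us) \<and> (\<forall>e. P (\<lambda>i. e (f i)) = Tr \<phi> (mds g0 us e))"
proof -
  obtain \<phi> vs where p: "Form \<phi>" "distinct vs" "\<forall>v\<in>set vs. isv v" "\<forall>v. fv \<phi> v --> v \<in> set vs"
      "\<forall>e. P e = Tr \<phi> (mds g0 vs e)"
    using assms(1) unfolding df0_def by blast
  let ?N = "n + Suc (Max (insert 0 (f ` {..<length vs})))"
  obtain us where us: "length us = ?N" "distinct us"
    "\<forall>u\<in>set us. isv u \<and> u \<notin> X \<union> set vs \<and> (\<forall>\<psi>\<in>insert \<phi> \<Phi>. \<not> fv \<psi> u)"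
    using freshlist[of "X \<union> set vs" "insert \<phi> \<Phi>" ?N] assms p(1) by auto
  have "f i < length us" if "i < length vs" for i
  proof -
    have "f i \<le> Max (insert 0 (f ` {..<length vs}))" using that by (intro Max_ge) auto
    then show ?thesis using us(1) by simp
  qed
  then obtain \<phi>' where "Form \<phi>'" "\<forall>v. fv \<phi>' v --> v \<in> set us" "\<forall>g e. Asg g --> Tr \<phi>' (mds g us e) = Tr \<phi> (mds g vs (\<lambda>i. e (f i)))"
    using ren[OF p(1,3,2) us(2), of f] us(3) p(4) by auto
  then show ?thesis using p us A_g0 by (intro exI[of _ \<phi>'] exI[of _ us]) auto
qed

lemma dfl0_df0: "dfl0 E df0"
proof
  fix P Q :: "(nat => 'a) => bool" and f :: "nat => nat"
  show "df0 (\<lambda>e. \<not> P e)" if "df0 P"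
  proof -
    obtain \<phi> vs where "Form \<phi>" "distinct vs" "\<forall>v\<in>set vs. isv v" "\<forall>v. fv \<phi> v --> v \<in> set vs"
      "\<forall>e. P e = Tr \<phi> (mds g0 vs e)"
      using \<open>df0 P\<close> unfolding df0_def by blast
    then show ?thesis unfolding df0_def
      by (intro exI[of _ "neg \<phi>"] exI[of _ vs]) (simp add: F_rules Tr_rules fv_rules A_mds A_g0)
  qed
  show "df0 (\<lambda>e. P (\<lambda>i. e (f i)))" if "df0 P"
    using df0_re_long[OF that, of "{}" "{}" 0 f] unfolding df0_def by auto
  show "df0 (\<lambda>e. \<forall>v. P (v ## e))" if dP: "df0 P"
  proof -
    obtain \<phi> us where u: "Form \<phi>" "distinct us" "\<forall>v\<in>set us. isv v" "length us \<ge> 1"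
      "\<forall>v. fv \<phi> v --> v \<in> set us" "\<forall>e. P e = Tr \<phi> (mds g0 us e)"
      using df0_re_long[OF dP, of "{}" "{}" 1 "\<lambda>i. i"] by auto
    obtain v vs where v: "us = v # vs" using u(4) by (cases us) auto
    have "Tr (all v \<phi>) (mds g0 vs e) \<longleftrightarrow> (\<forall>a. Tr \<phi> (mds g0 us (a ## e)))" for e
    proof -
      have A: "Asg (mds g0 vs e)" using u v by (simp add: A_mds A_g0)
      have "Tr \<phi> (md (mds g0 vs e) v a) = Tr \<phi> (mds g0 us (a ## e))" for a
      proof (rule Tr_cong[OF u(1)])
        show "Asg (md (mds g0 vs e) v a)" "Asg (mds g0 us (a ## e))" using A u v by (simp_all add: A_mds A_md A_g0)
        fix x assume x: "isv x"
        show "look (md (mds g0 vs e) v a) x = look (mds g0 us (a ## e)) x"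
        proof (cases "x \<in> set us")
          case True
          then obtain i where i: "i < length us" "x = us ! i" by (metis in_set_conv_nth)
          have 1: "look (mds g0 us (a ## e)) x = (a ## e) i" unfolding i(2) using u i by (intro look_mds A_g0) auto
          show ?thesis
          proof (cases i)
            case 0 then show ?thesis unfolding 1 using A i v u by (simp add: look_md)
          next
            case (Suc j)
            then have "x = vs ! j" "j < length vs" "x \<noteq> v" using i v u(2) by auto
            then show ?thesis unfolding 1 using Suc A x u v by (simp add: look_md look_mds A_g0)
          qed
        next
          case False
          then show ?thesis using A x u v by (auto simp: look_md look_mds_out A_g0 A_md)
        qed
      qed
      then show ?thesis using A u v by (simp add: Tr_rules)
    qed
    then show ?thesis unfolding df0_def using u v
      by (intro exI[of _ "all v \<phi>"] exI[of _ vs]) (auto intro: F_rules simp: fv_rules)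
  qed
  show "df0 (\<lambda>e. P e --> Q e)" if PQ: "df0 P" "df0 Q"
  proof -
    obtain \<phi> vs where p: "Form \<phi>" "distinct vs" "\<forall>v\<in>set vs. isv v" "\<forall>e. P e = Tr \<phi> (mds g0 vs e)"
      "\<forall>v. fv \<phi> v --> v \<in> set vs"
      using PQ(1) unfolding df0_def by blast
    obtain \<psi> ws where q: "Form \<psi>" "distinct ws" "\<forall>v\<in>set ws. isv v" "\<forall>e. Q e = Tr \<psi> (mds g0 ws e)"
      "\<forall>v. fv \<psi> v --> v \<in> set ws"
      using PQ(2) unfolding df0_def by blast
    obtain us where us: "length us = length vs + length ws" "distinct us"
      "\<forall>u\<in>set us. isv u \<and> u \<notin> set vs \<union> set ws \<and> (\<forall>\<chi>\<in>{\<phi>, \<psi>}. \<not> fv \<chi> u)"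
      using freshlist[of "set vs \<union> set ws" "{\<phi>, \<psi>}" "length vs + length ws"] p(1) q(1) by auto
    obtain \<phi>' where p': "Form \<phi>'" "\<forall>v. fv \<phi>' v --> v \<in> set us" "\<forall>g e. Asg g --> Tr \<phi>' (mds g us e) = Tr \<phi> (mds g vs e)"
      using ren[OF p(1,3,2) us(2), of "\<lambda>i. i"] us p(5) by auto
    obtain \<psi>' where q': "Form \<psi>'" "\<forall>v. fv \<psi>' v --> v \<in> set us" "\<forall>g e. Asg g --> Tr \<psi>' (mds g us e) = Tr \<psi> (mds g ws e)"
      using ren[OF q(1,3,2) us(2), of "\<lambda>i. i"] us q(5) by auto
    have A: "Asg (mds g0 us e)" for e using us by (simp add: A_mds A_g0)
    show ?thesis unfolding df0_def
    proof (intro exI[of _ "imp \<phi>' \<psi>'"] exI[of _ us] conjI allI impI)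
      show "Form (imp \<phi>' \<psi>')" using p' q' by (simp add: F_rules)
      show "v \<in> set us" if "fv (imp \<phi>' \<psi>') v" for v using that p' q' fv_imp by blast
      show "(P e --> Q e) = Tr (imp \<phi>' \<psi>') (mds g0 us e)" for e
        using Tr_imp[OF A p'(1) q'(1)] p'(3) q'(3) p(4) q(4) A_g0 by simp
    qed (use us in auto)
  qed
  have v: "sv 0 \<noteq> sv 1" by (simp add: sv_inj)
  show "df0 (\<lambda>e. E (e 0) (e (Suc 0)))" unfolding df0_def
    by (rule exI[of _ "mem (sv 0) (sv 1)"], rule exI[of _ "[sv 0, sv 1]"])
      (simp add: F_rules Tr_rules fv_rules A_g0 sv_inj)
  show "df0 (\<lambda>e. e 0 = e (Suc 0))" unfolding df0_def
    by (rule exI[of _ "eq (sv 0) (sv 1)"], rule exI[of _ "[sv 0, sv 1]"])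
      (simp add: F_rules Tr_rules fv_rules A_g0 sv_inj)
qed

lemma dfl_df: "dfl E df"
proof -
  interpret d: dfl0 E df0 by (rule dfl0_df0)
  show ?thesis unfolding df_def[abs_def]
    by (rule params_dfl) (fact d.df_neg d.df_imp d.df_all0 d.df_re d.df_E0 d.df_eq0)+
qed

text \<open>Brings a definable relation into the shape that the axiom schemes expect: a code with
  two distinguished variables, all parameters being absorbed into the assignment
  \<open>g\<close>.\<close>

lemma rep2:
  assumes "df (\<lambda>e. R (e 0) (e (Suc 0)))"
  shows "\<exists>\<phi> x y g. Form \<phi> \<and> isv x \<and> isv y \<and> x \<noteq> y \<and> Asg g \<and> (\<forall>a b. R a b = Tr \<phi> (md (md g x a) y b))"
proof -
  obtain P0 as where P0: "df0 P0" "\<And>e. R (e 0) (e (Suc 0)) = P0 (as @@ e)" using assms unfolding df_def by blast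
  \<comment> \<open>Coordinates 0 and 1 carry the two arguments and the parameters come after them;
    every coordinate beyond these is sent to coordinate 0.\<close>
  let ?f = "\<lambda>i. if i < length as then Suc (Suc i) else if i = length as then 0 else if i = Suc (length as) then Suc 0 else 0"
  obtain \<phi> us where u: "Form \<phi>" "distinct us" "\<forall>v\<in>set us. isv v" "length us \<ge> 2"
    "\<And>e. P0 (\<lambda>i. e (?f i)) = Tr \<phi> (mds g0 us e)"
    using df0_re_long[OF P0(1), of "{}" "{}" 2 ?f] by auto
  obtain x us' where x: "us = x # us'" using u(4) by (cases us) auto
  obtain y vs where y: "us = x # y # vs" using u(4) x by (cases us') auto
  let ?e = "as @@ (\<lambda>i. undefined)"
  have A: "Asg (mds g0 vs ?e)" using u y by (simp add: A_mds A_g0)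
  have "R a b = Tr \<phi> (md (md (mds g0 vs ?e) x a) y b)" for a b
  proof -
    let ?ab = "a ## (b ## (\<lambda>i. a))"
    have "R a b = P0 (as @@ ?ab)" using P0(2)[of ?ab] by simp
    also have "as @@ ?ab = (\<lambda>i. (a ## (b ## ?e)) (?f i))"
      by (auto simp: pre_def fun_eq_iff split: nat.splits)
    also have "P0 \<dots> = Tr \<phi> (mds g0 us (a ## (b ## ?e)))" using u(5)[of "a ## (b ## ?e)"] by simp
    also have "\<dots> = Tr \<phi> (md (md (mds g0 vs ?e) x a) y b)"
    proof (rule Tr_cong[OF u(1)])
      show "Asg (mds g0 us (a ## b ## ?e))" "Asg (md (md (mds g0 vs ?e) x a) y b)"
        using A u y by (simp_all add: A_mds A_md A_g0)
      fix z assume z: "isv z"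
      show "look (mds g0 us (a ## b ## ?e)) z = look (md (md (mds g0 vs ?e) x a) y b) z"
      proof (cases "z \<in> set vs")
        case True
        then obtain i where "i < length vs" "z = vs ! i" by (metis in_set_conv_nth)
        then show ?thesis using z u A y by (auto simp: look_md look_mds A_g0 A_md)
      next
        case False then show ?thesis using z u A y by (auto simp: look_md look_mds_out A_g0 A_md)
      qed
    qed
    finally show ?thesis .
  qed
  then show ?thesis using u y A by (intro exI[of _ \<phi>] exI[of _ x] exI[of _ y] exI[of _ "mds g0 vs ?e"]) auto
qed

lemma rep1:
  assumes "df (\<lambda>e. P (e 0))"
  shows "\<exists>\<phi> x g. Form \<phi> \<and> isv x \<and> Asg g \<and> (\<forall>a. P a = Tr \<phi> (md g x a))"
proof -
  have "df (\<lambda>e. (\<lambda>a b. P a) (e 0) (e (Suc 0)))" using assms by simp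
  from rep2[OF this] obtain \<phi> x y g where h: "Form \<phi>" "isv x" "isv y" "x \<noteq> y" "Asg g"
    "\<And>a b. P a = Tr \<phi> (md (md g x a) y b)" by blast
  have "P a = Tr \<phi> (md (md g y a0) x a)" for a a0
    unfolding h(6)[of a a0] by (rule Tr_cong[OF h(1)]) (use h in \<open>auto simp: A_md look_md\<close>)
  then show ?thesis using h by (intro exI[of _ \<phi>] exI[of _ x] exI[of _ "md g y undefined"]) (auto intro: A_md)
qed

lemma Z_df: assumes S: "\<And>\<phi>. Sax \<phi> ==> valid \<phi>" shows "Z E df"
proof -
  interpret dfl E df by (rule dfl_df)
  have ax: "\<exists>e. sat E (=) e extensionality_ax" "\<exists>e. sat E (=) e foundation_ax" "\<exists>e. sat E (=) e pairing_ax"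
    "\<exists>e. sat E (=) e union_ax" "\<exists>e. sat E (=) e power_ax"
    by (rule valid_cd, rule S, simp add: Sax_def)+
  show ?thesis
  proof
    show "x = y" if "\<And>z. E z x = E z y" for x y
      using ax(1) that unfolding extensionality_ax_def by (simp add: fun_upd_def)
    show "\<exists>y. E y x \<and> (\<forall>z. E z y --> \<not> E z x)" if "E y x" for x y
      using ax(2) that unfolding foundation_ax_def by (simp add: fun_upd_def) blast
    show "\<exists>p. \<forall>z. E z p \<longleftrightarrow> z = x \<or> z = y" for x y
      using ax(3) unfolding pairing_ax_def by (simp add: fun_upd_def)
    show "\<exists>u. \<forall>z. E z u \<longleftrightarrow> (\<exists>y. E z y \<and> E y x)" for x
      using ax(4) unfolding union_ax_def by (simp add: fun_upd_def)
    show "\<exists>p. \<forall>z. E z p \<longleftrightarrow> (\<forall>w. E w z --> E w x)" for x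
      using ax(5) unfolding power_ax_def by (simp add: fun_upd_def)
  next
    fix P and a assume P: "df (\<lambda>e. P (e 0))"
    obtain \<phi> x g where p: "Form \<phi>" "isv x" "Asg g" "\<And>a. P a = Tr \<phi> (md g x a)" using rep1[OF P] by blast
    obtain us where us: "length us = Suc (Suc 0)" "distinct us" "\<forall>u\<in>set us. isv u \<and> u \<notin> {x} \<and> (\<forall>\<phi>\<in>{\<phi>}. \<not> fv \<phi> u)"
      using freshlist[of "{x}" "{\<phi>}"] p(1) by (metis finite.emptyI finite.insertI singletonD)
    then obtain u v where uv: "us = [u, v]" by (auto simp: length_Suc_conv)
    note f = p us(2,3)[unfolded uv]
    have "Sax (sepc x u v \<phi>)" unfolding Sax_def
      by (rule disjI2, rule disjI1, rule exI[of _ x], rule exI[of _ u], rule exI[of _ v], rule exI[of _ \<phi>]) (use f in auto)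
    then have "Tr (sepc x u v \<phi>) g" using S f unfolding valid_def by blast
    moreover have "Tr \<phi> (md (md (md g u a) v b) x c) = P c" for a b c
      unfolding p(4) by (rule Tr_cong[OF p(1)]) (use f in \<open>auto simp: A_md look_md\<close>)
    ultimately have "\<forall>a. \<exists>b. \<forall>c. E c b \<longleftrightarrow> E c a \<and> P c"
      using f unfolding sepc_def by (simp add: Tr_rules F_rules) metis
    then show "\<exists>b. \<forall>c. E c b \<longleftrightarrow> E c a \<and> P c" by blast
  next
    fix R and a assume R: "df (\<lambda>e. R (e 0) (e (Suc 0)))"
      and fn: "\<And>x y y'. E x a ==> R x y ==> R x y' ==> y = y'"
    obtain \<phi> x y g where p: "Form \<phi>" "isv x" "isv y" "x \<noteq> y" "Asg g"
      "\<And>a b. R a b = Tr \<phi> (md (md g x a) y b)" using rep2[OF R] by blast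
    obtain us where us: "length us = Suc (Suc (Suc 0))" "distinct us" "\<forall>u\<in>set us. isv u \<and> u \<notin> {x,y} \<and> (\<forall>\<phi>\<in>{\<phi>}. \<not> fv \<phi> u)"
      using freshlist[of "{x,y}" "{\<phi>}"] p(1) by (metis finite.emptyI finite.insertI singletonD)
    then obtain z u v where uv: "us = [z, u, v]" by (auto simp: length_Suc_conv)
    note f = p us(2,3)[unfolded uv]
    have "Sax (replc x y z u v \<phi>)" unfolding Sax_def
      by (rule disjI2, rule disjI2, rule exI[of _ x], rule exI[of _ y], rule exI[of _ z], rule exI[of _ u],
        rule exI[of _ v], rule exI[of _ \<phi>]) (use f in auto)
    then have 1: "Tr (replc x y z u v \<phi>) g" using S f unfolding valid_def by blast
    have 2: "Tr \<phi> (md (md (md (md g u a) x b) z c) y d) = R b d" for a b c d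
      unfolding p(6) by (rule Tr_cong[OF p(1)]) (use f in \<open>auto simp: A_md look_md\<close>)
    have 3: "Tr \<phi> (md (md (md (md g u a) v c) y d) x b) = R b d" for a b c d
      unfolding p(6) by (rule Tr_cong[OF p(1)]) (use f in \<open>auto simp: A_md look_md\<close>)
    have "\<forall>a. (\<forall>x. E x a --> (\<exists>z. \<forall>y. R x y --> y = z)) -->
        (\<exists>b. \<forall>y. (E y b --> (\<exists>x. E x a \<and> R x y)) \<and> ((\<forall>x. E x a --> \<not> R x y) \<or> E y b))"
      using 1 f(1-5) f(7-) unfolding replc_def by (simp add: Tr_rules F_rules 2 3)
    moreover have "\<forall>x. E x a --> (\<exists>z. \<forall>y. R x y --> y = z)" using fn by metis
    ultimately obtain b where "\<forall>y. (E y b --> (\<exists>x. E x a \<and> R x y)) \<and> ((\<forall>x. E x a --> \<not> R x y) \<or> E y b)"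
      by blast
    then show "\<exists>b. \<forall>y. E y b \<longleftrightarrow> (\<exists>x. E x a \<and> R x y)" by (intro exI[of _ b]) blast
  qed
qed

end

section \<open>First-order logic over codes\<close>

locale logic = codes isv Form mem eq neg imp all fv sv
  for isv :: "'v => bool" and Form :: "'f => bool" and mem eq neg imp all fv sv +
  fixes Th :: "'f => bool"
  assumes Th_F: "Th \<phi> ==> Form \<phi>"
    and MP: "Form \<phi> ==> Form \<psi> ==> Th \<phi> ==> Th (imp \<phi> \<psi>) ==> Th \<psi>"
    and Gen: "isv x ==> Th \<phi> ==> Th (all x \<phi>)"
    and L1: "Form \<phi> ==> Form \<psi> ==> Th (imp \<phi> (imp \<psi> \<phi>))"
    and L2: "Form \<phi> ==> Form \<psi> ==> Form \<chi> ==>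
      Th (imp (imp \<phi> (imp \<psi> \<chi>)) (imp (imp \<phi> \<psi>) (imp \<phi> \<chi>)))"
    and L3: "Form \<phi> ==> Form \<psi> ==> Th (imp (imp (neg \<phi>) (neg \<psi>)) (imp \<psi> \<phi>))"
    and Distr: "isv x ==> Form \<phi> ==> Form \<psi> ==> Th (imp (all x (imp \<phi> \<psi>)) (imp (all x \<phi>) (all x \<psi>)))"
    and Spec: "isv x ==> Form \<phi> ==> Th (imp (all x \<phi>) \<phi>)"
    and Vac: "isv x ==> Form \<phi> ==> \<not> fv \<phi> x ==> Th (imp \<phi> (all x \<phi>))"
    and ExEq: "isv x ==> isv y ==> Th (cexi x (eq x y))"
    and EqEq: "isv x ==> isv y ==> isv z ==> Th (imp (eq x y) (imp (eq x z) (eq y z)))"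
    and EqMemL: "isv x ==> isv y ==> isv z ==> Th (imp (eq x y) (imp (mem x z) (mem y z)))"
    and EqMemR: "isv x ==> isv y ==> isv z ==> Th (imp (eq x y) (imp (mem z x) (mem z y)))"
begin

lemmas [simp] = F_rules fv_rules

definition val where
  "val v \<longleftrightarrow> (\<forall>\<phi>. Form \<phi> --> v (neg \<phi>) = (\<not> v \<phi>)) \<and>
     (\<forall>\<phi> \<psi>. Form \<phi> --> Form \<psi> --> v (imp \<phi> \<psi>) = (v \<phi> --> v \<psi>))"

text \<open>Closure under modus ponens only, not under \<open>Gen\<close>. So adding a hypothesis
  amounts to \<open>plus\<close>, and the deduction theorem carries no condition on
  variables.\<close>

definition clo where
  "clo A \<longleftrightarrow> A \<subseteq> {\<phi>. Form \<phi>} \<and> {\<phi>. Th \<phi>} \<subseteq> A \<and>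
     (\<forall>\<phi> \<psi>. Form \<phi> --> Form \<psi> --> \<phi> \<in> A --> imp \<phi> \<psi> \<in> A --> \<psi> \<in> A)"

definition plus where "plus A \<phi> = {\<chi>. Form \<chi> \<and> imp \<phi> \<chi> \<in> A}"

lemma cloMP: "clo A ==> Form \<phi> ==> Form \<psi> ==> \<phi> \<in> A ==> imp \<phi> \<psi> \<in> A ==> \<psi> \<in> A" unfolding clo_def by blast
lemma cloTh: "clo A ==> Th \<phi> ==> \<phi> \<in> A" unfolding clo_def by blast
lemma cloF: "clo A ==> \<phi> \<in> A ==> Form \<phi>" unfolding clo_def by blast

lemma impI0: "clo A ==> Form \<phi> ==> \<chi> \<in> A ==> imp \<phi> \<chi> \<in> A"
  using cloF[of A \<chi>] by (intro cloMP[of A \<chi> "imp \<phi> \<chi>"]) (auto intro: cloTh L1)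

lemma id0: "Form \<phi> ==> Th (imp \<phi> \<phi>)"
  using MP[OF _ _ L1[of \<phi> \<phi>] MP[OF _ _ L1[of \<phi> "imp \<phi> \<phi>"] L2[of \<phi> "imp \<phi> \<phi>" \<phi>]]] by simp

lemma clo_plus: assumes A: "clo A" and F: "Form \<phi>" shows "clo (plus A \<phi>)" "A \<subseteq> plus A \<phi>" "\<phi> \<in> plus A \<phi>"
proof -
  show sub: "A \<subseteq> plus A \<phi>" unfolding plus_def using impI0[OF A F] cloF[OF A] by blast
  show "\<phi> \<in> plus A \<phi>" unfolding plus_def using F id0 cloTh[OF A] by blast
  show "clo (plus A \<phi>)" unfolding clo_def
  proof (intro conjI allI impI)
    show "plus A \<phi> \<subseteq> {\<phi>. Form \<phi>}" unfolding plus_def by blast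
    show "{\<phi>. Th \<phi>} \<subseteq> plus A \<phi>" using sub cloTh[OF A] by blast
    fix \<psi> \<chi> assume h: "Form \<psi>" "Form \<chi>" "\<psi> \<in> plus A \<phi>" "imp \<psi> \<chi> \<in> plus A \<phi>"
    have "imp (imp \<phi> \<psi>) (imp \<phi> \<chi>) \<in> A"
      by (rule cloMP[OF A _ _ _ cloTh[OF A L2[of \<phi> \<psi> \<chi>]]]) (use h F in \<open>auto simp: plus_def\<close>)
    then show "\<chi> \<in> plus A \<phi>" unfolding plus_def using cloMP[OF A, of "imp \<phi> \<psi>" "imp \<phi> \<chi>"] h F
      by (auto simp: plus_def)
  qed
qed

lemma explode: assumes A: "clo A" and F: "Form \<phi>" "Form \<chi>" and h: "\<phi> \<in> A" "neg \<phi> \<in> A" shows "\<chi> \<in> A"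
proof -
  have "imp (neg \<chi>) (neg \<phi>) \<in> A" using impI0[OF A _ h(2), of "neg \<chi>"] F by simp
  then have "imp \<phi> \<chi> \<in> A" using cloMP[OF A _ _ _ cloTh[OF A L3[of \<chi> \<phi>]]] F by simp
  then show ?thesis using cloMP[OF A _ _ h(1)] F by simp
qed

text \<open>Under the hypothesis \<open>neg \<phi>\<close> everything follows, in particular the
  negation of the theorem \<open>?T\<close>; contraposition by \<open>L3\<close> then leads from
  \<open>?T\<close> to \<open>\<phi>\<close>.\<close>

lemma clavius: assumes A: "clo A" and F: "Form \<phi>" and h: "imp (neg \<phi>) \<phi> \<in> A" shows "\<phi> \<in> A"
proof -
  let ?T = "imp \<phi> \<phi>"
  note B = clo_plus[OF A, of "neg \<phi>"]
  have "\<phi> \<in> plus A (neg \<phi>)" using h F by (simp add: plus_def)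
  then have "neg ?T \<in> plus A (neg \<phi>)" using explode[OF B(1), of \<phi> "neg ?T"] B(3) F by simp
  then have "imp (neg \<phi>) (neg ?T) \<in> A" by (simp add: plus_def)
  then have "imp ?T \<phi> \<in> A" using cloMP[OF A _ _ _ cloTh[OF A L3[of \<phi> ?T]]] F by simp
  then show ?thesis using cloMP[OF A _ _ cloTh[OF A id0[OF F]]] F by simp
qed

lemma cases0: assumes A: "clo A" and F: "Form \<phi>" "Form \<psi>"
  and h: "imp \<psi> \<phi> \<in> A" "imp (neg \<psi>) \<phi> \<in> A" shows "\<phi> \<in> A"
proof (rule clavius[OF A F(1)])
  let ?A = "plus A (neg \<phi>)"
  note A' = clo_plus[OF A, of "neg \<phi>"]
  have c: "clo ?A" using A' F by simp
  let ?B = "plus ?A (neg (neg \<psi>))"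
  have B: "clo ?B" "?A \<subseteq> ?B" "neg (neg \<psi>) \<in> ?B" using clo_plus[OF c, of "neg (neg \<psi>)"] F by simp_all
  let ?C = "plus ?B (neg \<psi>)"
  have C: "clo ?C" "?B \<subseteq> ?C" "neg \<psi> \<in> ?C" using clo_plus[OF B(1), of "neg \<psi>"] F by simp_all
  have "\<psi> \<in> ?C" using explode[OF C(1), of "neg \<psi>" \<psi>] B C F by auto
  then have "imp (neg \<psi>) \<psi> \<in> ?B" by (simp add: plus_def)
  then have "\<psi> \<in> ?B" using clavius[OF B(1)] F by simp
  moreover have "imp \<psi> \<phi> \<in> ?B" "neg \<phi> \<in> ?B" using h A' B F by auto
  ultimately have "\<phi> \<in> ?B" using cloMP[OF B(1)] F by blast
  then have "neg \<psi> \<in> ?B" using explode[OF B(1), of \<phi> "neg \<psi>"] \<open>neg \<phi> \<in> ?B\<close> F by simp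
  then have "imp (neg (neg \<psi>)) (neg \<psi>) \<in> ?A" by (simp add: plus_def)
  then have "neg \<psi> \<in> ?A" using clavius[OF c, of "neg \<psi>"] F by simp
  moreover have "imp (neg \<psi>) \<phi> \<in> ?A" using h A' F by auto
  ultimately have "\<phi> \<in> ?A" using cloMP[OF c, of "neg \<psi>" \<phi>] F by simp
  then show "imp (neg \<phi>) \<phi> \<in> A" by (simp add: plus_def)
qed

text \<open>Zorn's lemma yields a maximal closed set that omits \<open>\<phi>\<close>, and
  maximality makes it a two-valued valuation. Propositional steps can thus be checked semantically
  instead of being derived in the calculus.\<close>

lemma taut:
  assumes F: "Form \<phi>" and t: "\<And>v. val v ==> (\<And>\<psi>. Th \<psi> ==> v \<psi>) ==> v \<phi>" shows "Th \<phi>"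
proof (rule ccontr)
  assume n: "\<not> Th \<phi>"
  let ?S = "{A. clo A \<and> \<phi> \<notin> A}"
  have "{\<psi>. Th \<psi>} \<in> ?S" using n MP Th_F unfolding clo_def by blast
  then have "?S \<noteq> {}" by blast
  moreover have "\<Union>C \<in> ?S" if C: "C \<noteq> {}" "subset.chain ?S C" for C
  proof -
    have cl: "clo A" "\<phi> \<notin> A" if "A \<in> C" for A using that C(2) unfolding subset.chain_def by blast+
    have "clo (\<Union>C)" unfolding clo_def
    proof (intro conjI allI impI)
      show "\<Union>C \<subseteq> {\<phi>. Form \<phi>}" using cl cloF by blast
      show "{\<phi>. Th \<phi>} \<subseteq> \<Union>C" using cl cloTh C(1) by blast
      fix \<psi> \<chi> assume h: "Form \<psi>" "Form \<chi>" "\<psi> \<in> \<Union>C" "imp \<psi> \<chi> \<in> \<Union>C"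
      then obtain A B where AB: "A \<in> C" "\<psi> \<in> A" "B \<in> C" "imp \<psi> \<chi> \<in> B" by blast
      then have "A \<subseteq> B \<or> B \<subseteq> A" using C(2) unfolding subset.chain_def by blast
      then show "\<chi> \<in> \<Union>C" using AB h cl cloMP by (metis UnionI subsetD)
    qed
    then show ?thesis using cl by blast
  qed
  ultimately obtain A where A: "A \<in> ?S" "\<And>B. B \<in> ?S ==> A \<subseteq> B ==> B = A"
    using subset_Zorn_nonempty[of ?S] by blast
  have c: "clo A" and nA: "\<phi> \<notin> A" using A by auto
  have ex: "imp \<psi> \<phi> \<in> A" if "Form \<psi>" "\<psi> \<notin> A" for \<psi>
  proof (rule ccontr)
    assume "imp \<psi> \<phi> \<notin> A"
    then have "plus A \<psi> \<in> ?S" using clo_plus[OF c that(1)] by (simp add: plus_def)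
    then show False using A(2) clo_plus[OF c that(1)] that(2) by blast
  qed
  have neg: "neg \<psi> \<in> A \<longleftrightarrow> \<psi> \<notin> A" if "Form \<psi>" for \<psi>
    using that explode[OF c that F] nA cases0[OF c F that] ex[of \<psi>] ex[of "neg \<psi>"] by auto
  have "imp \<psi> \<chi> \<in> A \<longleftrightarrow> (\<psi> \<in> A --> \<chi> \<in> A)" if F: "Form \<psi>" "Form \<chi>" for \<psi> \<chi>
  proof
    show "imp \<psi> \<chi> \<in> A ==> \<psi> \<in> A --> \<chi> \<in> A" using cloMP[OF c] F by blast
    assume i: "\<psi> \<in> A --> \<chi> \<in> A"
    show "imp \<psi> \<chi> \<in> A"
    proof (cases "\<psi> \<in> A")
      case True then show ?thesis using i impI0[OF c F(1)] by blast
    next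
      case False
      then have "neg \<psi> \<in> plus A \<psi>" "\<psi> \<in> plus A \<psi>" using neg F clo_plus[OF c F(1)] by auto
      then show ?thesis using explode[OF clo_plus(1)[OF c F(1)] F] by (simp add: plus_def)
    qed
  qed
  then have "val (\<lambda>\<psi>. \<psi> \<in> A)" unfolding val_def using neg by blast
  then show False using t[of "\<lambda>\<psi>. \<psi> \<in> A"] cloTh[OF c] nA by blast
qed

lemma vN [simp]: "val v ==> Form \<phi> ==> v (neg \<phi>) = (\<not> v \<phi>)" unfolding val_def by blast
lemma vI [simp]: "val v ==> Form \<phi> ==> Form \<psi> ==> v (imp \<phi> \<psi>) = (v \<phi> --> v \<psi>)" unfolding val_def by blast

lemma taut1: "Th \<psi> ==> Form \<phi> ==> (\<And>v. val v ==> v \<psi> ==> v \<phi>) ==> Th \<phi>"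
  using taut[of \<phi>] by blast
lemma taut2: "Th \<psi> ==> Th \<chi> ==> Form \<phi> ==> (\<And>v. val v ==> v \<psi> ==> v \<chi> ==> v \<phi>) ==> Th \<phi>"
  using taut[of \<phi>] by blast
lemma taut3: "Th \<psi> ==> Th \<chi> ==> Th \<theta> ==> Form \<phi> ==>
    (\<And>v. val v ==> v \<psi> ==> v \<chi> ==> v \<theta> ==> v \<phi>) ==> Th \<phi>"
  using taut[of \<phi>] by blast

lemma taut4: "Th \<psi> ==> Th \<chi> ==> Th \<theta> ==> Th \<eta> ==> Form \<phi> ==>
    (\<And>v. val v ==> v \<psi> ==> v \<chi> ==> v \<theta> ==> v \<eta> ==> v \<phi>) ==> Th \<phi>"
  using taut[of \<phi>] by blast

lemma all_intro:
  assumes "Form A" "Form B" "isv x" "Th (imp B A)" "\<not> fv B x" shows "Th (imp B (all x A))"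
  by (rule taut2[OF MP[OF _ _ Gen[OF assms(3,4)] Distr[of x B A]] Vac[of x B]]) (use assms in simp_all)

lemma ex_elim:
  assumes "Form A" "Form B" "isv x" "Th (imp A B)" "\<not> fv B x" shows "Th (imp (cexi x A) B)"
proof -
  have "Th (imp (neg B) (neg A))" by (rule taut1[OF assms(4)]) (use assms in auto)
  then have "Th (imp (neg B) (all x (neg A)))" using assms by (intro all_intro) auto
  then show ?thesis by (rule taut1) (use assms in auto)
qed

lemma ex_eq_elim:
  assumes "Form B" "isv x" "isv y" "Th (imp (eq x y) B)" "\<not> fv B x" shows "Th B"
  using MP[OF _ _ ExEq[OF assms(2,3)] ex_elim[OF _ assms(1,2,4,5)]] assms by simp

lemma Eq_refl: assumes "isv x" shows "Th (eq x x)"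
proof -
  obtain y where y: "isv y" "y \<noteq> x" using fresh[of "{x}" "{}"] by auto
  have "Th (imp (eq y x) (eq x x))" by (rule taut1[OF EqEq[of y x x]]) (use assms y in auto)
  then show ?thesis using ex_eq_elim[of "eq x x" y x] assms y by simp
qed

lemma Eq_sym: assumes "isv x" "isv y" shows "Th (imp (eq x y) (eq y x))"
  by (rule taut2[OF EqEq[of x y x] Eq_refl[of x]]) (use assms in auto)

lemma Eq_trans: assumes "isv x" "isv y" "isv z" shows "Th (imp (eq x y) (imp (eq y z) (eq x z)))"
  by (rule taut2[OF EqEq[of y x z] Eq_sym[of x y]]) (use assms in auto)

text \<open>The device of \<open>sub\<close> on the side of provability, where its laws have to be
  derived from the axioms of quantification and equality.\<close>

definition sb where "sb v u \<phi> = all v (imp (eq v u) \<phi>)"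

lemma F_sb [simp]: "Form \<phi> ==> isv v ==> isv u ==> Form (sb v u \<phi>)" unfolding sb_def by simp
lemma fv_sb [simp]: "Form \<phi> ==> isv v ==> isv u ==> fv (sb v u \<phi>) x \<longleftrightarrow> (x = u \<or> fv \<phi> x) \<and> x \<noteq> v"
  unfolding sb_def by auto

context
  fixes v u assumes vu: "isv v" "isv u" "u \<noteq> v"
begin

lemma sb_spec: "Form \<phi> ==> Th (imp (eq v u) (imp (sb v u \<phi>) \<phi>))"
  by (rule taut1[OF Spec[of v "imp (eq v u) \<phi>"]]) (use vu in \<open>auto simp: sb_def\<close>)

lemma sb_Th: "Th \<phi> ==> Th (sb v u \<phi>)"
  unfolding sb_def by (rule Gen[OF vu(1)], rule taut1[of \<phi>]) (use vu Th_F in auto)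

lemma sb_imp: "Form \<phi> ==> Form \<psi> ==> Th (imp (sb v u (imp \<phi> \<psi>)) (imp (sb v u \<phi>) (sb v u \<psi>)))"
proof -
  assume F: "Form \<phi>" "Form \<psi>"
  have "Th (imp (imp (eq v u) (imp \<phi> \<psi>)) (imp (imp (eq v u) \<phi>) (imp (eq v u) \<psi>)))"
    using F vu by (intro L2) auto
  from MP[OF _ _ Gen[OF vu(1) this] Distr[of v]] have
    1: "Th (imp (sb v u (imp \<phi> \<psi>)) (all v (imp (imp (eq v u) \<phi>) (imp (eq v u) \<psi>))))"
    unfolding sb_def using F vu by simp
  have "Th (imp (all v (imp (imp (eq v u) \<phi>) (imp (eq v u) \<psi>))) (imp (sb v u \<phi>) (sb v u \<psi>)))"
    unfolding sb_def using F vu by (intro Distr) auto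
  then show ?thesis by (rule taut2[OF 1]) (use F vu in auto)
qed

lemma sb_mono: "Form \<phi> ==> Form \<psi> ==> Th (imp \<phi> \<psi>) ==> Th (imp (sb v u \<phi>) (sb v u \<psi>))"
  by (rule MP[OF _ _ sb_Th[of "imp \<phi> \<psi>"] sb_imp[of \<phi> \<psi>]]) (use vu in auto)

lemma sb_intro: "Form \<chi> ==> Form \<phi> ==> \<not> fv \<chi> v ==> Th (imp \<chi> (imp (eq v u) \<phi>)) ==> Th (imp \<chi> (sb v u \<phi>))"
  unfolding sb_def using vu by (intro all_intro) auto

lemma sb_negE: "Form \<phi> ==> Th (imp (sb v u (neg \<phi>)) (neg (sb v u \<phi>)))"
proof -
  assume F: "Form \<phi>"
  show ?thesis
    by (rule ex_eq_elim[of _ v u], simp_all add: F vu, rule taut2[OF sb_spec[OF F] sb_spec[of "neg \<phi>"]])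
      (use F vu in auto)
qed

lemma sb_elim: "Form \<phi> ==> \<not> fv \<phi> v ==> Th (imp (sb v u \<phi>) \<phi>)"
  by (rule ex_eq_elim[of _ v u]) (use vu sb_spec in auto)

lemma sb_vac: "Form \<phi> ==> \<not> fv \<phi> v ==> Th (imp \<phi> (sb v u \<phi>))"
  by (rule sb_intro) (use vu in \<open>auto intro: L1\<close>)

text \<open>Leibniz's law for \<open>\<phi>\<close>. With \<open>sb_spec\<close> it makes
  \<open>sb v u\<close> commute with the connectives. The induction passes quantifiers over
  variables other than \<open>u\<close>, which is ensured later by taking \<open>u\<close> above
  \<open>\<phi>\<close>.\<close>

definition Lz where "Lz \<phi> \<longleftrightarrow> Th (imp (eq v u) (imp \<phi> (sb v u \<phi>)))"

lemma sb_negI: assumes F: "Form \<phi>" and L: "Lz \<phi>" shows "Th (imp (neg (sb v u \<phi>)) (sb v u (neg \<phi>)))"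
  by (rule sb_intro) (use F vu in simp_all, rule taut1[OF L[unfolded Lz_def]], use F vu in auto)

lemma Lz_neg: assumes F: "Form \<phi>" and L: "Lz \<phi>" shows "Lz (neg \<phi>)"
  unfolding Lz_def
  by (rule taut2[OF sb_negI[OF F L] sb_spec[OF F]]) (use F vu in auto)

lemma Lz_imp: assumes F: "Form \<phi>" "Form \<psi>" and L: "Lz \<phi>" "Lz \<psi>" shows "Lz (imp \<phi> \<psi>)"
proof -
  have 1: "Th (imp (sb v u (neg \<phi>)) (sb v u (imp \<phi> \<psi>)))"
    by (rule sb_mono) (use F in simp_all, rule taut, use F in auto)
  have 2: "Th (imp (sb v u \<psi>) (sb v u (imp \<phi> \<psi>)))"
    by (rule sb_mono) (use F in simp_all, rule taut, use F in auto)
  show ?thesis unfolding Lz_def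
    by (rule taut4[OF 1 2 Lz_neg[OF F(1) L(1), unfolded Lz_def] L(2)[unfolded Lz_def]]) (use F vu in auto)
qed

lemma Lz_all_same: "Form \<psi> ==> Lz (all v \<psi>)"
  unfolding Lz_def using sb_vac[of "all v \<psi>"] vu by (auto intro: taut1)

lemma sb_all:
  assumes x: "isv x" "x \<noteq> v" "x \<noteq> u" and F: "Form \<psi>"
  shows "Th (imp (all x (sb v u \<psi>)) (sb v u (all x \<psi>)))"
proof -
  let ?C = "all x (sb v u \<psi>)"
  have 1: "Th (imp (neg (imp ?C (neg (eq v u)))) \<psi>)"
    by (rule taut2[OF Spec[of x "sb v u \<psi>"] sb_spec[OF F]]) (use x vu F in auto)
  have "Th (imp (neg (imp ?C (neg (eq v u)))) (all x \<psi>))"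
    by (rule all_intro[OF _ _ _ 1]) (use x vu F in auto)
  then have "Th (imp ?C (imp (eq v u) (all x \<psi>)))"
    by (rule taut1) (use x vu F in auto)
  then show ?thesis by (intro sb_intro) (use x vu F in auto)
qed

lemma Lz_all:
  assumes x: "isv x" "x \<noteq> v" "x \<noteq> u" and F: "Form \<psi>" and L: "Lz \<psi>" shows "Lz (all x \<psi>)"
proof -
  let ?B = "neg (imp (eq v u) (neg (all x \<psi>)))"
  have "Th (imp ?B (sb v u \<psi>))"
    by (rule taut2[OF Spec[of x \<psi>] L[unfolded Lz_def]]) (use x vu F in auto)
  then have "Th (imp ?B (all x (sb v u \<psi>)))" by (intro all_intro) (use x vu F in auto)
  from taut2[OF this sb_all[OF x F]] show ?thesis unfolding Lz_def using x vu F by auto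
qed

lemma Lz_atom:
  assumes R: "\<And>x y. isv x ==> isv y ==> Form (R x y)"
    "\<And>x y z. isv x ==> isv y ==> fv (R x y) z \<longleftrightarrow> z = x \<or> z = y"
    "\<And>x y z. isv x ==> isv y ==> isv z ==> Th (imp (eq x y) (imp (R x z) (R y z)))"
    "\<And>x y z. isv x ==> isv y ==> isv z ==> Th (imp (eq x y) (imp (R z x) (R z y)))"
    and x: "isv x" "isv y" "x \<noteq> u" "y \<noteq> u"
  shows "Lz (R x y)"
proof -
  \<comment> \<open>\<open>R x' y'\<close> is the atom after the replacement; it no longer contains
    \<open>v\<close>, so \<open>sb_intro\<close> applies to it.\<close>
  define x' y' where "x' = (if x = v then u else x)" and "y' = (if y = v then u else y)"
  have v': "isv x'" "isv y'" "x' \<noteq> v" "y' \<noteq> v" using x vu by (auto simp: x'_def y'_def)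
  have e: "Th (imp (eq v u) (eq x x'))" "Th (imp (eq v u) (eq x' x))"
    "Th (imp (eq v u) (eq y y'))" "Th (imp (eq v u) (eq y' y))"
    using x vu id0[of "eq v u"] Eq_sym[of v u] taut1[OF Eq_refl[of x], of "imp (eq v u) (eq x x)"]
      taut1[OF Eq_refl[of y], of "imp (eq v u) (eq y y)"] by (auto simp: x'_def y'_def)
  have 1: "Th (imp (eq v u) (imp (R x y) (R x' y')))"
    by (rule taut4[OF R(3)[of x x' y] R(4)[of y y' x'] e(1,3)]) (use x vu v' R(1) in auto)
  have 2: "Th (imp (R x' y') (imp (eq v u) (R x y)))"
    by (rule taut4[OF R(3)[of x' x y] R(4)[of y' y x'] e(2,4)]) (use x vu v' R(1) in auto)
  have "Th (imp (R x' y') (sb v u (R x y)))"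
    by (rule sb_intro[OF _ _ _ 2]) (use x vu v' R in auto)
  from taut2[OF 1 this] show ?thesis unfolding Lz_def using x vu v' R(1) by auto
qed

lemma Lz_mem: "isv x ==> isv y ==> x \<noteq> u ==> y \<noteq> u ==> Lz (mem x y)"
  by (rule Lz_atom) (auto intro: EqMemL EqMemR)
lemma Lz_eq: "isv x ==> isv y ==> x \<noteq> u ==> y \<noteq> u ==> Lz (eq x y)"
proof (rule Lz_atom)
  show "Th (imp (eq x y) (imp (eq z x) (eq z y)))" if "isv x" "isv y" "isv z" for x y z
    by (rule taut1[OF Eq_trans[of z x y]]) (use that in auto)
qed (auto intro: EqEq)

end

lemma sb_swap:
  assumes "isv v" "isv u" "isv x" "isv w" "x \<noteq> v" "x \<noteq> u" "v \<noteq> w" "u \<noteq> v" "w \<noteq> x" "Form \<psi>"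
  shows "Th (imp (sb v u (sb x w \<psi>)) (sb x w (sb v u \<psi>)))"
proof -
  have "Th (imp (sb v u (sb x w \<psi>)) (imp (eq v u) (imp (eq x w) \<psi>)))"
    by (rule taut2[OF sb_spec[of v u "sb x w \<psi>"] sb_spec[of x w \<psi>]]) (use assms in auto)
  then have "Th (imp (neg (imp (sb v u (sb x w \<psi>)) (neg (eq x w)))) (imp (eq v u) \<psi>))"
    by (rule taut1) (use assms in auto)
  then have "Th (imp (neg (imp (sb v u (sb x w \<psi>)) (neg (eq x w)))) (sb v u \<psi>))"
    by (intro sb_intro) (use assms in auto)
  then have "Th (imp (sb v u (sb x w \<psi>)) (imp (eq x w) (sb v u \<psi>)))"
    by (rule taut1) (use assms in auto)
  then show ?thesis by (intro sb_intro) (use assms in auto)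
qed

lemma sb_name:
  assumes "isv v" "isv u" "isv w" "v \<noteq> u" "v \<noteq> w" "Form \<psi>"
  shows "Th (imp (eq u w) (imp (sb v u \<psi>) (sb v w \<psi>)))"
proof -
  have "Th (imp (neg (imp (eq u w) (neg (sb v u \<psi>)))) (imp (eq v w) \<psi>))"
    by (rule taut3[OF Eq_trans[of v w u] Eq_sym[of u w] sb_spec[of v u \<psi>]]) (use assms in auto)
  then have "Th (imp (neg (imp (eq u w) (neg (sb v u \<psi>)))) (sb v w \<psi>))"
    by (intro sb_intro) (use assms in auto)
  then show ?thesis by (rule taut1) (use assms in auto)
qed

text \<open>A new variable behaves like a constant: generalize over \<open>w\<close>, then
  specialize \<open>w\<close> to \<open>v\<close>. This lets variables serve as Henkin
  constants.\<close>

lemma henkin_con: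
  assumes v: "isv v" "isv w" "w \<noteq> v" and F: "Form \<gamma>" "Form \<psi>" "\<not> fv \<gamma> w" "\<not> fv \<psi> w"
    and h: "Th (imp \<gamma> (sb v w \<psi>))"
  shows "Th (imp \<gamma> (all v \<psi>))"
proof -
  let ?X = "all w (sb v w \<psi>)"
  have 1: "Th (imp \<gamma> ?X)" using all_intro[OF _ F(1) v(2) h] v F by simp
  have 2: "Th (imp (eq w v) (imp ?X \<psi>))"
    by (rule taut3[OF Spec[of w "sb v w \<psi>"] sb_spec[of v w \<psi>] Eq_sym[of w v]]) (use v F in auto)
  have "Th (imp ?X \<psi>)" by (rule ex_eq_elim[of _ w v, OF _ _ _ 2]) (use v F in auto)
  then have "Th (imp ?X (all v \<psi>))" by (intro all_intro) (use v F in auto)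
  from taut2[OF 1 this] show ?thesis using v F by auto
qed

end

section \<open>Henkin's construction inside a world\<close>

context W begin

definition lstd where "lstd P = (if \<exists>x. P x then lst P else emp)"

lemma eq_lstd: assumes P: "df (\<lambda>e. P (e 0))"
  shows "(y = lstd P) \<longleftrightarrow> (P y \<and> (\<forall>z. P z --> \<not> z \<prec> y)) \<or> ((\<forall>x. \<not> P x) \<and> y = emp)"
proof (cases "\<exists>x. P x")
  case True
  then obtain x where x: "P x" by blast
  show ?thesis unfolding lstd_def using lst[of P, OF P x] lst_eq[of P y] True by auto
qed (auto simp: lstd_def)

lemma lstd: assumes P: "df (\<lambda>e. P (e 0))" and x: "P x" shows "P (lstd P)" "P y ==> \<not> y \<prec> lstd P"
  using eq_lstd[OF P, of "lstd P"] x by auto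

lemma lstd_none: "(\<And>x. \<not> P x) ==> lstd P = emp" by (simp add: lstd_def)

text \<open>The value of \<open>f\<close> at the immediate predecessor of \<open>t\<close>, with
  \<open>a\<close> as the initial value. It turns course-of-values recursion into recursion by
  successor steps.\<close>

definition prvP where
  "prvP a t f y \<longleftrightarrow> (\<exists>p. p \<prec> t \<and> (\<forall>s. s \<prec> t --> \<not> p \<prec> s) \<and> y = ap f p) \<or> ((\<forall>s. \<not> s \<prec> t) \<and> y = a)"
definition prv where "prv a t f = (THE y. prvP a t f y)"

lemma prvP_unique: "prvP a t f y ==> prvP a t f z ==> y = z"
  unfolding prvP_def using lt_total by metis

lemma prvP_ex: "\<exists>y. prvP a t f y"
proof (cases "\<exists>s. s \<prec> t")
  case True
  obtain s where s: "\<forall>y. E y s \<longleftrightarrow> y \<prec> t" using seg_ex by blast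
  then show ?thesis using True max_ex[of _ s] unfolding prvP_def by metis
qed (auto simp: prvP_def)

lemma eq_prv: "(y = prv a t f) \<longleftrightarrow> prvP a t f y"
proof -
  have "prvP a t f (prv a t f)" unfolding prv_def using prvP_ex prvP_unique by (metis theI)
  then show ?thesis using prvP_unique by blast
qed

lemma dt_prv: "dt s ==> dt t ==> dt (\<lambda>e. prv a (s e) (t e))"
  by (rule dt_comp2) (unfold dt_def eq_prv prvP_def, intro dfs4)

lemma prv_none: "(\<And>s. \<not> s \<prec> t) ==> prv a t f = a"
  using eq_prv[of a a t f] unfolding prvP_def by simp

lemma prv_suc: "(\<And>x. x \<prec> t \<longleftrightarrow> x \<prec> p \<or> x = p) ==> prv a t f = ap f p"
  using eq_prv[of "ap f p" a t f] lt_asym unfolding prvP_def by metis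

end

text \<open>Codes may be nonstandard, so \<open>F_induct\<close> is restricted to definable
  predicates. \<open>sub_lt\<close> and \<open>fv_lt\<close> tie the syntax to the order: a variable
  above a code is not free in it.\<close>

locale Syn = W E df lt + logic isv Form mem eq neg imp all fv sv Th
  for E :: "'a => 'a => bool" and df and lt (infix "\<prec>" 50)
    and isv Form :: "'a => bool" and mem eq :: "'a => 'a => 'a" and neg imp all fv sv Th +
  assumes df_isv0: "df (\<lambda>e. isv (e 0))" and df_Form0: "df (\<lambda>e. Form (e 0))"
    and df_fv0: "df (\<lambda>e. fv (e 0) (e (Suc 0)))" and df_Th0: "df (\<lambda>e. Th (e 0))"
    and dt_mem0: "dt (\<lambda>e. mem (e 0) (e (Suc 0)))" and dt_eq0: "dt (\<lambda>e. eq (e 0) (e (Suc 0)))"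
    and dt_neg0: "dt (\<lambda>e. neg (e 0))" and dt_imp0: "dt (\<lambda>e. imp (e 0) (e (Suc 0)))"
    and dt_all0: "dt (\<lambda>e. all (e 0) (e (Suc 0)))"
    and sub_lt: "x \<prec> mem x y" "y \<prec> mem x y" "x \<prec> eq x y" "y \<prec> eq x y" "\<phi> \<prec> neg \<phi>"
      "\<phi> \<prec> imp \<phi> \<psi>" "\<psi> \<prec> imp \<phi> \<psi>" "x \<prec> all x \<phi>" "\<phi> \<prec> all x \<phi>"
    and F_induct: "df (\<lambda>e. P (e 0)) ==> Form \<phi> ==>
      (\<And>x y. isv x ==> isv y ==> P (mem x y)) ==> (\<And>x y. isv x ==> isv y ==> P (eq x y)) ==>
      (\<And>\<phi>. Form \<phi> ==> P \<phi> ==> P (neg \<phi>)) ==>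
      (\<And>\<phi> \<psi>. Form \<phi> ==> Form \<psi> ==> P \<phi> ==> P \<psi> ==> P (imp \<phi> \<psi>)) ==>
      (\<And>x \<phi>. isv x ==> Form \<phi> ==> P \<phi> ==> P (all x \<phi>)) ==> P \<phi>"
    and c_inj: "mem x y = mem x' y' \<longleftrightarrow> x = x' \<and> y = y'" "eq x y = eq x' y' \<longleftrightarrow> x = x' \<and> y = y'"
      "neg \<phi> = neg \<phi>' \<longleftrightarrow> \<phi> = \<phi>'" "imp \<phi> \<psi> = imp \<phi>' \<psi>' \<longleftrightarrow> \<phi> = \<phi>' \<and> \<psi> = \<psi>'"
      "all x \<phi> = all x' \<phi>' \<longleftrightarrow> x = x' \<and> \<phi> = \<phi>'"
    and c_dist: "mem x y \<noteq> eq x' y'" "mem x y \<noteq> neg \<phi>" "mem x y \<noteq> imp \<phi> \<psi>" "mem x y \<noteq> all x' \<phi>"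
      "eq x y \<noteq> neg \<phi>" "eq x y \<noteq> imp \<phi> \<psi>" "eq x y \<noteq> all x' \<phi>" "neg \<chi> \<noteq> imp \<phi> \<psi>" "neg \<chi> \<noteq> all x' \<phi>"
      "imp \<chi> \<eta> \<noteq> all x' \<phi>"
    and fv_lt: "Form \<phi> ==> fv \<phi> v ==> isv v \<and> v \<prec> \<phi>"
    and isv_unb: "\<exists>v. isv v \<and> b \<prec> v"
begin

lemmas sdfs = dfs4 df_comp1[OF df_isv0] df_comp1[OF df_Form0] df_comp2[OF df_fv0] df_comp1[OF df_Th0]
  dt_comp2[OF dt_mem0] dt_comp2[OF dt_eq0] dt_comp1[OF dt_neg0] dt_comp2[OF dt_imp0] dt_comp2[OF dt_all0]

lemma dt_sb: "dt s ==> dt t ==> dt u ==> dt (\<lambda>e. sb (s e) (t e) (u e))"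
  unfolding sb_def by (intro sdfs)

lemmas hdfs = sdfs dt_sb

text \<open>The bound \<open>\<phi> \<prec> u\<close> passes to subformulas and keeps
  \<open>u\<close> from being one of the quantified variables.\<close>

lemma Lz_Form:
  assumes "Form \<phi>" shows "isv v ==> isv u ==> u \<noteq> v ==> \<phi> \<prec> u ==> Th (imp (eq v u) (imp \<phi> (sb v u \<phi>)))"
proof -
  let ?P = "\<lambda>\<phi>. \<forall>v u. isv v --> isv u --> u \<noteq> v --> \<phi> \<prec> u --> Th (imp (eq v u) (imp \<phi> (sb v u \<phi>)))"
  have "?P \<phi>"
  proof (rule F_induct[of ?P, OF _ assms])
    show "df (\<lambda>e. ?P (e 0))" by (intro hdfs)
    show "?P (mem x y)" if "isv x" "isv y" for x y
    proof (intro allI impI)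
      fix v u assume v: "isv v" "isv u" "u \<noteq> v" "mem x y \<prec> u"
      have "x \<noteq> u" "y \<noteq> u" using v(4) sub_lt(1,2) lt_asym by blast+
      then show "Th (imp (eq v u) (imp (mem x y) (sb v u (mem x y))))"
        using Lz_mem[OF v(1-3)] that unfolding Lz_def[OF v(1-3)] by blast
    qed
    show "?P (eq x y)" if "isv x" "isv y" for x y
    proof (intro allI impI)
      fix v u assume v: "isv v" "isv u" "u \<noteq> v" "eq x y \<prec> u"
      have "x \<noteq> u" "y \<noteq> u" using v(4) sub_lt(3,4) lt_asym by blast+
      then show "Th (imp (eq v u) (imp (eq x y) (sb v u (eq x y))))"
        using Lz_eq[OF v(1-3)] that unfolding Lz_def[OF v(1-3)] by blast
    qed
    show "?P (neg \<phi>)" if "Form \<phi>" "?P \<phi>" for \<phi>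
    proof (intro allI impI)
      fix v u assume v: "isv v" "isv u" "u \<noteq> v" "neg \<phi> \<prec> u"
      have "\<phi> \<prec> u" using v(4) sub_lt(5) lt_trans by blast
      then show "Th (imp (eq v u) (imp (neg \<phi>) (sb v u (neg \<phi>))))"
        using Lz_neg[OF v(1-3) that(1)] that v unfolding Lz_def[OF v(1-3)] by blast
    qed
    show "?P (imp \<phi> \<psi>)" if "Form \<phi>" "Form \<psi>" "?P \<phi>" "?P \<psi>" for \<phi> \<psi>
    proof (intro allI impI)
      fix v u assume v: "isv v" "isv u" "u \<noteq> v" "imp \<phi> \<psi> \<prec> u"
      have "\<phi> \<prec> u" "\<psi> \<prec> u" using v(4) sub_lt(6,7) lt_trans by blast+
      then show "Th (imp (eq v u) (imp (imp \<phi> \<psi>) (sb v u (imp \<phi> \<psi>))))"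
        using Lz_imp[OF v(1-3) that(1,2)] that v unfolding Lz_def[OF v(1-3)] by blast
    qed
    show "?P (all x \<phi>)" if "isv x" "Form \<phi>" "?P \<phi>" for x \<phi>
    proof (intro allI impI)
      fix v u assume v: "isv v" "isv u" "u \<noteq> v" "all x \<phi> \<prec> u"
      have "\<phi> \<prec> u" "x \<noteq> u" using v(4) sub_lt(8,9) lt_trans lt_asym by blast+
      then show "Th (imp (eq v u) (imp (all x \<phi>) (sb v u (all x \<phi>))))"
        using Lz_all[OF v(1-3), of x \<phi>] Lz_all_same[OF v(1-3), of \<phi>] that v
        unfolding Lz_def[OF v(1-3)] by blast
    qed
  qed
  then show "isv v ==> isv u ==> u \<noteq> v ==> \<phi> \<prec> u ==> Th (imp (eq v u) (imp \<phi> (sb v u \<phi>)))" by blast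
qed

lemma not_fv_lt: "Form \<phi> ==> \<phi> \<prec> w ==> \<not> fv \<phi> w"
  using fv_lt lt_asym by blast

lemma fin_bound: "finite X ==> \<exists>b. \<forall>x\<in>X. x \<prec> b"
proof (induction rule: finite_induct)
  case (insert x X)
  then obtain b where b: "\<forall>x\<in>X. x \<prec> b" by blast
  have "x \<prec> up x b" "b \<prec> up x b" by (auto intro: E_lt)
  then show ?case using b lt_trans by blast
qed simp

lemma big_var: assumes "finite X" shows "\<exists>v. isv v \<and> v \<notin> X \<and> (\<forall>x\<in>X. x \<prec> v)"
proof -
  obtain b where b: "\<forall>x\<in>X. x \<prec> b" using fin_bound[OF assms] by blast
  obtain v where v: "isv v" "b \<prec> v" using isv_unb by blast
  then have "\<forall>x\<in>X. x \<prec> v" using b lt_trans by blast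
  then show ?thesis using v by (metis lt_irrefl)
qed

section \<open>A complete theory with witnesses\<close>

definition con where "con s \<longleftrightarrow> Form s \<and> \<not> Th (neg s)"
text \<open>Variables serve as Henkin constants, so the language never changes. The bound
  \<open>t \<prec> w\<close> on the witness is what later yields arbitrarily large names for each
  element.\<close>

definition gd where
  "gd t s r \<longleftrightarrow> con r \<and> Th (imp r s) \<and> (Form t --> Th (imp r t) \<or> Th (imp r (neg t))) \<and>
     (\<forall>v \<psi>. isv v --> Form \<psi> --> t = neg (all v \<psi>) --> Th (imp r t) -->
        (\<exists>w. isv w \<and> t \<prec> w \<and> Th (imp r (neg (sb v w \<psi>)))))"

lemma df_con: "dt s ==> df (\<lambda>e. con (s e))"
  by (rule df_comp1) (unfold con_def, intro hdfs)
lemma df_gd: "dt s ==> dt t ==> dt u ==> df (\<lambda>e. gd (s e) (t e) (u e))"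
  by (rule df_comp3) (unfold gd_def, intro hdfs df_con)

lemma con_not_both: "con r ==> Form t ==> Th (imp r t) ==> Th (imp r (neg t)) ==> False"
  unfolding con_def using taut2[of "imp r t" "imp r (neg t)" "neg r"] by auto

lemma gd_ex: assumes s: "con s" shows "\<exists>r. gd t s r"
proof (cases "Form t")
  case False
  then have "gd t s s" unfolding gd_def using s id0 by (auto simp: con_def)
  then show ?thesis ..
next
  case t: True
  have Fs: "Form s" using s con_def by blast
  show ?thesis
  proof (cases "con (cconj s t)")
    case True
    show ?thesis
    proof (cases "\<exists>v \<psi>. isv v \<and> Form \<psi> \<and> t = neg (all v \<psi>)")
      case False
      have "gd t s (cconj s t)" unfolding gd_def using True False
        by (auto intro!: taut[of "imp (cconj s t) s"] taut[of "imp (cconj s t) t"] simp: Fs t)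
      then show ?thesis ..
    next
      case ex: True
      then obtain v \<psi> where v: "isv v" "Form \<psi>" "t = neg (all v \<psi>)" by blast
      let ?g = "cconj s t"
      \<comment> \<open>Above \<open>t\<close> and \<open>?g\<close>, the variable \<open>w\<close>
        differs from \<open>v\<close> and is free neither in \<open>?g\<close> nor in
        \<open>\<psi>\<close>, as \<open>henkin_con\<close> demands.\<close>
      obtain w where w: "isv w" "t \<prec> w" "s \<prec> w" "?g \<prec> w" using big_var[of "{t, s, ?g}"] by auto
      have "\<psi> \<prec> w" "v \<prec> w" using w(2) v(3) sub_lt(5,8,9) lt_trans by metis+
      then have wv: "w \<noteq> v" "\<not> fv \<psi> w" using not_fv_lt v by auto
      let ?r = "cconj ?g (neg (sb v w \<psi>))"
      \<comment> \<open>Otherwise \<open>?g\<close> proves the generic instance, hence by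
        \<open>henkin_con\<close> the universal formula that its conjunct \<open>t\<close>
        denies.\<close>
      have "con ?r"
      proof (rule ccontr)
        assume "\<not> con ?r"
        then have "Th (neg ?r)" unfolding con_def using v w Fs by simp
        then have "Th (imp ?g (sb v w \<psi>))" by (rule taut1) (use v w Fs in auto)
        then have "Th (imp ?g (all v \<psi>))"
          using henkin_con[OF v(1) w(1) wv(1), of ?g \<psi>] v wv not_fv_lt[OF _ w(4)] Fs by simp
        then have "Th (neg ?g)" by (rule taut1) (use v Fs in auto)
        then show False using True con_def by blast
      qed
      moreover have "Th (imp ?r s)" "Th (imp ?r t)" "Th (imp ?r (neg (sb v w \<psi>)))"
        by (rule taut, use v w Fs in auto)+
      moreover have "\<forall>v' \<psi>'. t = neg (all v' \<psi>') --> v' = v \<and> \<psi>' = \<psi>" using v(3) c_inj by auto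
      ultimately have "gd t s ?r" unfolding gd_def using w by blast
      then show ?thesis ..
    qed
  next
    case False
    then have F: "Th (neg (cconj s t))" unfolding con_def using Fs t by simp
    let ?r = "cconj s (neg t)"
    have c: "con ?r"
    proof (rule ccontr)
      assume "\<not> con ?r"
      then have "Th (neg ?r)" unfolding con_def using Fs t by simp
      from taut2[OF this F] have "Th (neg s)" using Fs t by auto
      then show False using s con_def by blast
    qed
    have 1: "Th (imp ?r s)" "Th (imp ?r (neg t))" by (rule taut, use Fs t in auto)+
    then have "\<not> Th (imp ?r t)" using con_not_both[OF c t] by blast
    then have "gd t s ?r" unfolding gd_def using c 1 by blast
    then show ?thesis ..
  qed
qed

definition "tt = eq (sv 0) (sv 0)"
definition stG where "stG p t f = lstd (gd t (prv tt t f))"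
text \<open>A stage is a single formula, the conjunction of all decisions so far, and thus an
  element of the world. So the construction is an ordinary recursion, and its limit \<open>D\<close>
  is definable.\<close>

definition st where "st t = rec stG emp t"

lemma dt_stG: "dt (\<lambda>e. stG (e 0) (e (Suc 0)) (e (Suc (Suc 0))))"
proof -
  have 1: "df (\<lambda>e. gd t s (e 0))" for t s by (intro df_gd hdfs)
  show ?thesis unfolding dt_def stG_def eq_lstd[OF 1] by (intro hdfs df_gd dt_prv)
qed

lemma dt_st: "dt s ==> dt (\<lambda>e. st (s e))" unfolding st_def by (intro dt_rec[OF dt_stG] hdfs)

definition D where "D \<phi> \<longleftrightarrow> Form \<phi> \<and> (\<exists>x. Th (imp (st x) \<phi>))"

lemma df_D: "dt s ==> df (\<lambda>e. D (s e))"
  by (rule df_comp1) (unfold D_def, intro hdfs dt_st)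

context
  assumes consistent: "\<exists>\<phi>. Form \<phi> \<and> \<not> Th \<phi>"
begin

lemma con_tt: "con tt"
proof (rule ccontr)
  assume "\<not> con tt"
  then have "Th (neg tt)" unfolding con_def tt_def by simp
  then have "Th \<phi>" if "Form \<phi>" for \<phi>
    using taut2[OF _ Eq_refl[of "sv 0"], of "neg tt" \<phi>] that unfolding tt_def by auto
  then show False using consistent by blast
qed

lemma st_step:
  "con (prv tt t (tab stG emp t)) ==> gd t (prv tt t (tab stG emp t)) (st t)"
  unfolding st_def rec_def stG_def
  using lstd[of "gd t (prv tt t (tab (\<lambda>p t f. lstd (gd t (prv tt t f))) emp t))"]
    gd_ex[of "prv tt t (tab (\<lambda>p t f. lstd (gd t (prv tt t f))) emp t)" t] df_gd[OF dt_const dt_const dt_var]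
  by blast

lemma st_ok: "con (st t) \<and> (\<exists>s. gd t s (st t)) \<and> (\<forall>x. x \<prec> t --> Form (st x) \<and> Th (imp (st t) (st x)))"
  (is "?P t")
proof (rule seg_induct[of ?P])
  show "df (\<lambda>e. ?P (e 0))" by (intro hdfs df_con df_gd dt_st)
  show "?P b" if b: "\<And>x. \<not> x \<prec> b" for b
    using st_step[of b] con_tt b prv_none[OF b] unfolding gd_def by metis
  show "?P b" if b: "\<And>x. x \<prec> b \<longleftrightarrow> x \<prec> p \<or> x = p" and p: "?P p" for b p
  proof -
    have "p \<prec> b" using b by blast
    then have "prv tt b (tab stG emp b) = st p"
      unfolding prv_suc[OF b] st_def by (rule ap_tab[OF dt_stG])
    then have g: "gd b (st p) (st b)" using st_step[of b] p by simp
    have bp: "Th (imp (st b) (st p))" "con (st b)" using g unfolding gd_def by blast+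
    have F: "Form (st b)" "Form (st p)" using bp p unfolding con_def by blast+
    have "Form (st x) \<and> Th (imp (st b) (st x))" if x: "x \<prec> p" for x
    proof -
      have "Form (st x)" "Th (imp (st p) (st x))" using p x by blast+
      with taut2[OF bp(1) this(2), of "imp (st b) (st x)"] show ?thesis using F by auto
    qed
    then show ?thesis using g bp b F by blast
  qed
qed

lemma F_st: "Form (st t)" using st_ok[of t] con_def by blast

lemma st_mono: "x \<prec> t \<or> x = t ==> Form \<phi> ==> Th (imp (st x) \<phi>) ==> Th (imp (st t) \<phi>)"
  using st_ok[of t] taut2[of "imp (st t) (st x)" "imp (st x) \<phi>" "imp (st t) \<phi>"] F_st by auto

lemma D_Th: "Th \<phi> ==> D \<phi>"
  unfolding D_def using taut1[of \<phi> "imp (st emp) \<phi>"] F_st Th_F by auto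

lemma D_joint: assumes "D \<phi>" "D \<psi>" shows "\<exists>t. Th (imp (st t) \<phi>) \<and> Th (imp (st t) \<psi>)"
proof -
  obtain x y where xy: "Th (imp (st x) \<phi>)" "Th (imp (st y) \<psi>)" using assms unfolding D_def by blast
  have F: "Form \<phi>" "Form \<psi>" using assms unfolding D_def by blast+
  consider "x \<prec> y \<or> x = y" | "y \<prec> x" using lt_total by blast
  then show ?thesis using st_mono[of x y \<phi>] st_mono[of y x \<psi>] F xy by cases blast+
qed

lemma D_MP: assumes "D \<phi>" "D (imp \<phi> \<psi>)" "Form \<psi>" shows "D \<psi>"
proof -
  obtain t where t: "Th (imp (st t) \<phi>)" "Th (imp (st t) (imp \<phi> \<psi>))" using D_joint[OF assms(1,2)] by blast
  have "Th (imp (st t) \<psi>)" by (rule taut2[OF t]) (use assms F_st in \<open>auto simp: D_def\<close>)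
  then show ?thesis using assms unfolding D_def by blast
qed

lemma D_neg: assumes F: "Form \<phi>" shows "D (neg \<phi>) \<longleftrightarrow> \<not> D \<phi>"
proof
  show "\<not> D \<phi>" if n: "D (neg \<phi>)"
  proof
    assume "D \<phi>"
    from D_joint[OF this n] show False using con_not_both[OF _ F] st_ok by blast
  qed
  show "\<not> D \<phi> ==> D (neg \<phi>)" using st_ok[of \<phi>] F unfolding gd_def D_def by auto
qed

lemma D_henkin0: assumes "isv v" "Form \<psi>" "D (neg (all v \<psi>))"
  shows "\<exists>w. isv w \<and> neg (all v \<psi>) \<prec> w \<and> D (neg (sb v w \<psi>))"
proof -
  let ?t = "neg (all v \<psi>)"
  have F: "Form ?t" using assms by simp
  obtain s where g: "gd ?t s (st ?t)" using st_ok[of ?t] by blast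
  have "Th (imp (st ?t) ?t) \<or> Th (imp (st ?t) (neg ?t))" using g F unfolding gd_def by blast
  moreover have "\<not> Th (imp (st ?t) (neg ?t))" using assms(3) D_neg[OF F] F unfolding D_def by auto
  ultimately obtain w where w: "isv w" "?t \<prec> w" "Th (imp (st ?t) (neg (sb v w \<psi>)))"
    using g assms(1,2) unfolding gd_def by blast
  then have "D (neg (sb v w \<psi>))" unfolding D_def using assms by auto
  then show ?thesis using w by blast
qed

text \<open>Witnesses are demanded above every bound \<open>b\<close> because the theories obtained
  from \<open>D\<close> by reassigning variables must be able to avoid finitely many
  variables.\<close>

definition cht where
  "cht A \<longleftrightarrow> (\<forall>\<phi>. A \<phi> --> Form \<phi>) \<and> (\<forall>\<phi>. Th \<phi> --> A \<phi>) \<and>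
     (\<forall>\<phi> \<psi>. Form \<psi> --> A \<phi> --> A (imp \<phi> \<psi>) --> A \<psi>) \<and> (\<forall>\<phi>. Form \<phi> --> (A (neg \<phi>) \<longleftrightarrow> \<not> A \<phi>)) \<and>
     (\<forall>v \<psi> b. isv v --> Form \<psi> --> A (neg (all v \<psi>)) --> (\<exists>w. isv w \<and> b \<prec> w \<and> A (neg (sb v w \<psi>))))"

lemma chtD:
  assumes "cht A"
  shows "A \<phi> ==> Form \<phi>" "Th \<phi> ==> A \<phi>" "A \<phi> ==> A (imp \<phi> \<psi>) ==> Form \<psi> ==> A \<psi>"
    "Form \<phi> ==> A (neg \<phi>) \<longleftrightarrow> \<not> A \<phi>"
    "isv v ==> Form \<psi> ==> A (neg (all v \<psi>)) ==> \<exists>w. isv w \<and> b \<prec> w \<and> A (neg (sb v w \<psi>))"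
  using assms unfolding cht_def by blast+

lemma cht_th: "cht A ==> Th (imp \<phi> \<psi>) ==> Form \<psi> ==> A \<phi> ==> A \<psi>"
  using chtD(2,3) by blast
lemma cht_th2: "cht A ==> Th (imp \<phi> (imp \<psi> \<chi>)) ==> Form \<psi> ==> Form \<chi> ==> A \<phi> ==> A \<psi> ==> A \<chi>"
  by (rule chtD(3)[of A \<psi>]) (auto intro: cht_th)

lemma imp_clause:
  assumes m: "\<And>\<phi> \<psi>. Form \<psi> ==> A \<phi> ==> A (imp \<phi> \<psi>) ==> A \<psi>" and t: "\<And>\<phi>. Th \<phi> ==> A \<phi>"
    and n: "\<And>\<phi>. Form \<phi> ==> A (neg \<phi>) \<longleftrightarrow> \<not> A \<phi>" and F: "Form \<phi>" "Form \<psi>"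
  shows "A (imp \<phi> \<psi>) \<longleftrightarrow> (A \<phi> --> A \<psi>)"
proof
  show "A (imp \<phi> \<psi>) ==> A \<phi> --> A \<psi>" using m F by blast
  have "Th (imp (neg \<phi>) (imp \<phi> \<psi>))" by (rule taut) (use F in auto)
  moreover have "Th (imp \<psi> (imp \<phi> \<psi>))" using L1 F by blast
  ultimately show "A \<phi> --> A \<psi> ==> A (imp \<phi> \<psi>)" using m t n F by (metis F_imp)
qed

lemma name_th:
  assumes "isv a" "isv w" "isv v" "v \<noteq> a" "v \<noteq> w"
  shows "Th (imp (neg (sb v w (neg (eq v a)))) (eq a w))"
proof -
  have "Th (imp (neg (eq a w)) (imp (eq v w) (neg (eq v a))))"
    by (rule taut1[OF EqEq[of v a w]]) (use assms in auto)
  then have "Th (imp (neg (eq a w)) (sb v w (neg (eq v a))))"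
    by (intro sb_intro) (use assms in auto)
  then show ?thesis by (rule taut1) (use assms in auto)
qed

text \<open>The Henkin witness for the existence of a \<open>v\<close> equal to \<open>a\<close>
  lies above \<open>v\<close>, and \<open>v\<close> was taken above \<open>b\<close>.\<close>

lemma D_name: assumes a: "isv a" shows "\<exists>w. isv w \<and> b \<prec> w \<and> D (eq a w)"
proof -
  obtain v where v: "isv v" "v \<noteq> a" "b \<prec> v" using big_var[of "{a, b}"] by auto
  have "D (neg (all v (neg (eq v a))))" using D_Th ExEq v a by blast
  from D_henkin0[OF v(1) _ this] obtain w where
    w: "isv w" "neg (all v (neg (eq v a))) \<prec> w" "D (neg (sb v w (neg (eq v a))))" using v a by auto
  have "v \<prec> w" using w(2) sub_lt(5,8) lt_trans by blast
  then have "b \<prec> w" "v \<noteq> w" using v(3) lt_trans by auto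
  then show ?thesis using w D_MP[OF w(3) D_Th[OF name_th[OF a w(1) v(1,2)]]] a by auto
qed

text \<open>The witness provided by \<open>D_henkin0\<close> is exchanged for a provably equal
  variable above the required bound.\<close>

lemma cht_D: "cht D"
  unfolding cht_def
proof (intro conjI allI impI)
  fix v \<psi> b assume h: "isv v" "Form \<psi>" "D (neg (all v \<psi>))"
  obtain u where u: "isv u" "neg (all v \<psi>) \<prec> u" "D (neg (sb v u \<psi>))" using D_henkin0[OF h] by blast
  obtain w where w: "isv w" "up v b \<prec> w" "D (eq u w)" using D_name[OF u(1)] by blast
  have "v \<prec> up v b" "b \<prec> up v b" by (auto intro: E_lt)
  then have "v \<prec> w" "b \<prec> w" using w(2) lt_trans by blast+
  then have vw: "v \<noteq> w" "b \<prec> w" by auto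
  have "v \<prec> u" using u(2) sub_lt(5,8) lt_trans by blast
  then have vu: "v \<noteq> u" by auto
  have "Th (imp (eq u w) (imp (neg (sb v u \<psi>)) (neg (sb v w \<psi>))))"
    by (rule taut2[OF sb_name[of v w u \<psi>] Eq_sym[of u w]]) (use h u w vw vu in auto)
  then have "D (imp (neg (sb v u \<psi>)) (neg (sb v w \<psi>)))" using D_MP[OF w(3) D_Th] h u w by simp
  then show "\<exists>w. isv w \<and> b \<prec> w \<and> D (neg (sb v w \<psi>))" using D_MP[OF u(3)] h w vw by auto
next
  show "\<And>\<phi>. D \<phi> ==> Form \<phi>" unfolding D_def by blast
qed (rule D_Th D_MP D_neg, assumption+)+

end

end

section \<open>Truth under assignments in the Henkin model\<close>

context Syn begin

context
  assumes consistent: "\<exists>\<phi>. Form \<phi> \<and> \<not> Th \<phi>"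
begin

lemmas hchtD = chtD[OF consistent] and hcht_th = cht_th[OF consistent]
  and hcht_th2 = cht_th2[OF consistent] and himp_clause = imp_clause[OF consistent]

text \<open>The elements of the Henkin model are variables; whatever is not a variable stands for
  \<open>sv 0\<close>, so that the carrier is the full type.\<close>

definition va where "va a = (if isv a then a else sv 0)"
definition hQ where "hQ a b \<longleftrightarrow> D (eq (va a) (va b))"
definition hE where "hE a b \<longleftrightarrow> D (mem (va a) (va b))"

lemma va_isv [simp]: "isv (va a)" by (simp add: va_def)
lemma va_id [simp]: "isv a ==> va a = a" by (simp add: va_def)

lemma DI: "Th \<phi> ==> D \<phi>" using D_Th[OF consistent] .
lemma chD: "cht D" using cht_D[OF consistent] .

lemma hQ_refl: "hQ a a" unfolding hQ_def by (intro DI Eq_refl) simp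
lemma hQ_sym: "hQ a b ==> hQ b a"
  unfolding hQ_def using hcht_th[OF chD Eq_sym[of "va a" "va b"]] by simp
lemma hQ_trans: "hQ a b ==> hQ b c ==> hQ a c"
  unfolding hQ_def using hcht_th2[OF chD Eq_trans[of "va a" "va b" "va c"]] by simp
lemma hE_cong: assumes "hQ a a'" "hQ b b'" "hE a b" shows "hE a' b'"
proof -
  have "D (mem (va a') (va b))" using hcht_th2[OF chD EqMemL[of "va a" "va a'" "va b"]] assms
    unfolding hQ_def hE_def by simp
  then show ?thesis using hcht_th2[OF chD EqMemR[of "va b" "va b'" "va a'"]] assms
    unfolding hQ_def hE_def by simp
qed

text \<open>An assignment is represented by the complete theory \<open>A\<close> of the formulas
  true under it. Variables outside the outer-finite set \<open>X\<close> still denote themselves,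
  those in \<open>X\<close> have been reassigned, and \<open>lk\<close> records all values. This
  replaces a simultaneous substitution into possibly nonstandard codes.\<close>

definition Inv where
  "Inv A X lk \<longleftrightarrow> cht A \<and> finite X \<and> (\<forall>\<phi>. Form \<phi> --> (\<forall>x\<in>X. \<not> fv \<phi> x) --> A \<phi> = D \<phi>) \<and>
     (\<forall>x w. isv x --> isv w --> w \<notin> X --> A (eq x w) = hQ (lk x) w)"

text \<open>The value \<open>a\<close> is given to \<open>v\<close> by substituting one of its
  names. A name outside \<open>X\<close> still denotes itself in \<open>A\<close>, and it must
  differ from \<open>v\<close> for \<open>sb\<close> to act as a substitution.\<close>

definition mA where
  "mA A X v a \<phi> \<longleftrightarrow> Form \<phi> \<and> (\<exists>w. isv w \<and> w \<notin> insert v X \<and> hQ a w \<and> A (sb v w \<phi>))"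

lemma name_ex: assumes "finite X" shows "\<exists>w. isv w \<and> w \<notin> X \<and> b \<prec> w \<and> hQ a w"
proof -
  obtain c where c: "\<forall>x\<in>insert b X. x \<prec> c" using fin_bound[of "insert b X"] assms by auto
  obtain w where w: "isv w" "c \<prec> w" "D (eq (va a) w)" using D_name[OF consistent va_isv, of c a] by blast
  then have "\<forall>x\<in>insert b X. x \<prec> w" using c lt_trans by blast
  then show ?thesis using w unfolding hQ_def by (intro exI[of _ w]) auto
qed

text \<open>Two names of \<open>a\<close> outside \<open>X\<close> are equal according to
  \<open>D\<close>, hence according to \<open>A\<close>, and \<open>sb_name\<close> exchanges
  them.\<close>

lemma mA_eq:
  assumes I: "Inv A X lk" and v: "isv v" and w: "isv w" "w \<notin> insert v X" "hQ a w" and F: "Form \<phi>"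
  shows "mA A X v a \<phi> \<longleftrightarrow> A (sb v w \<phi>)"
proof -
  have "A (sb v w \<phi>)" if u: "isv u" "u \<notin> insert v X" "hQ a u" "A (sb v u \<phi>)" for u
  proof -
    have "hQ u w" using hQ_trans[OF hQ_sym] u w by blast
    moreover have "A (eq u w) = D (eq u w)"
    proof -
      have "\<forall>x\<in>X. \<not> fv (eq u w) x" using u w by auto
      then show ?thesis using I u w unfolding Inv_def by (metis F_eq)
    qed
    ultimately have "A (eq u w)" using u w unfolding hQ_def by simp
    then show ?thesis using hcht_th2[OF _ sb_name[of v u w \<phi>], of A] I u v w F unfolding Inv_def by auto
  qed
  then show ?thesis unfolding mA_def using w F by blast
qed

lemma mA_ex:
  assumes I: "Inv A X lk" shows "\<exists>w. isv w \<and> w \<notin> insert v X \<and> b \<prec> w \<and> hQ a w"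
  using name_ex[of "insert v X" b a] I unfolding Inv_def by auto

text \<open>Different clauses call for different names of \<open>a\<close>: a fixed
  \<open>w0\<close> where any name works, and one above the formula at hand where Leibniz's law is
  used. \<open>mA_eq\<close> permits changing the name in between.\<close>

lemma Inv_md:
  assumes I: "Inv A X lk" and v: "isv v" shows "Inv (mA A X v a) (insert v X) (lk(v := a))"
proof -
  let ?A = "mA A X v a"
  have cA: "cht A" and fX: "finite X" and ag: "\<And>\<phi>. Form \<phi> ==> (\<forall>x\<in>X. \<not> fv \<phi> x) ==> A \<phi> = D \<phi>"
    and lk: "\<And>x w. isv x ==> isv w ==> w \<notin> X ==> A (eq x w) = hQ (lk x) w"
    using I unfolding Inv_def by blast+
  obtain w0 where w0: "isv w0" "w0 \<notin> insert v X" "hQ a w0" using mA_ex[OF I] by blast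
  then have w0v: "w0 \<noteq> v" by blast
  have mw0: "?A \<phi> \<longleftrightarrow> A (sb v w0 \<phi>)" if "Form \<phi>" for \<phi> using mA_eq[OF I v w0 that] .
  have F: "?A \<phi> ==> Form \<phi>" for \<phi> unfolding mA_def by blast
  have Th: "?A \<phi>" if "Th \<phi>" for \<phi>
    using mw0[OF Th_F[OF that]] sb_Th[OF v w0(1) w0v that] hchtD(2)[OF cA] by blast
  have MPA: "?A \<psi>" if "Form \<psi>" "?A \<phi>" "?A (imp \<phi> \<psi>)" for \<phi> \<psi>
  proof -
    have "A (sb v w0 \<phi>)" "A (sb v w0 (imp \<phi> \<psi>))" using that mw0 F by auto
    then show ?thesis using hcht_th2[OF cA sb_imp[OF v w0(1) w0v, of \<phi> \<psi>]] that mw0 F v w0 by auto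
  qed
  have ng: "?A (neg \<phi>) \<longleftrightarrow> \<not> ?A \<phi>" if F: "Form \<phi>" for \<phi>
  proof -
    obtain w where w: "isv w" "w \<notin> insert v X" "\<phi> \<prec> w" "hQ a w" using mA_ex[OF I] by blast
    then have wv: "w \<noteq> v" by blast
    have L: "Lz v w \<phi>" unfolding Lz_def[OF v w(1) wv] using Lz_Form[OF F v w(1) wv w(3)] .
    have "A (sb v w (neg \<phi>)) \<longleftrightarrow> \<not> A (sb v w \<phi>)"
      using hcht_th[OF cA sb_negE[OF v w(1) wv F]] hcht_th[OF cA sb_negI[OF v w(1) wv F L]]
        hchtD(4)[OF cA, of "sb v w \<phi>"] F v w by auto
    then show ?thesis using mA_eq[OF I v w(1,2,4)] F by simp
  qed
  have hk: "\<exists>u. isv u \<and> b \<prec> u \<and> ?A (neg (sb x u \<psi>))" if h: "isv x" "Form \<psi>" "?A (neg (all x \<psi>))" for x \<psi> b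
  proof -
    obtain w where w: "isv w" "w \<notin> insert v X" "all x \<psi> \<prec> w" "hQ a w" using mA_ex[OF I] by blast
    then have wv: "w \<noteq> v" by blast
    have "x \<prec> w" using w(3) sub_lt(8) lt_trans by blast
    then have xw: "x \<noteq> w" by auto
    have nA: "\<not> A (sb v w (all x \<psi>))" using h ng[of "all x \<psi>"] mA_eq[OF I v w(1,2,4)] by simp
    obtain b' where b': "\<forall>y\<in>insert b (insert v (insert x (insert w X))). y \<prec> b'"
      using fin_bound[of "insert b (insert v (insert x (insert w X)))"] fX by auto
    show ?thesis
    proof (cases "x = v")
      case True
      have "\<not> A (all v \<psi>)"
        using nA hcht_th[OF cA sb_vac[OF v w(1) wv, of "all v \<psi>"]] h w True by auto
      then have "A (neg (all v \<psi>))" using hchtD(4)[OF cA, of "all v \<psi>"] h v by simp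
      from hchtD(5)[OF cA v h(2) this] obtain u where u: "isv u" "b' \<prec> u" "A (neg (sb v u \<psi>))" by blast
      then have bu: "\<forall>y\<in>insert b (insert v (insert x (insert w X))). y \<prec> u" using b' lt_trans by blast
      then have uv: "u \<noteq> v" by auto
      have "A (sb v w0 (neg (sb v u \<psi>)))"
        using hcht_th[OF cA sb_vac[OF v w0(1) w0v, of "neg (sb v u \<psi>)"]] u h v uv w0 by auto
      then show ?thesis using mw0 u bu h True v by auto
    next
      case False
      have "\<not> A (all x (sb v w \<psi>))"
        using nA hcht_th[OF cA sb_all[OF v w(1) wv h(1) False xw h(2)]] h w v by auto
      then have "A (neg (all x (sb v w \<psi>)))" using hchtD(4)[OF cA, of "all x (sb v w \<psi>)"] h v w by simp
      from hchtD(5)[OF cA h(1) _ this] obtain u where u: "isv u" "b' \<prec> u" "A (neg (sb x u (sb v w \<psi>)))"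
        using h v w by auto
      then have bu: "\<forall>y\<in>insert b (insert v (insert x (insert w X))). y \<prec> u" using b' lt_trans by blast
      then have uu: "u \<noteq> v" "u \<noteq> x" "u \<noteq> w" by auto
      have "\<not> A (sb x u (sb v w \<psi>))" using u hchtD(4)[OF cA] h v w by auto
      then have "\<not> A (sb v w (sb x u \<psi>))"
        using hcht_th[OF cA sb_swap[of v w x u \<psi>]] uu False xw wv h v w u by auto
      then have "\<not> ?A (sb x u \<psi>)" using mA_eq[OF I v w(1,2,4)] h u by simp
      then show ?thesis using ng h u bu by auto
    qed
  qed
  have "cht ?A" unfolding cht_def[OF consistent]
  proof (intro conjI allI impI)
    show "\<And>\<phi> \<psi>. Form \<psi> ==> ?A \<phi> ==> ?A (imp \<phi> \<psi>) ==> ?A \<psi>" by (rule MPA)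
  qed (rule F Th ng hk, assumption+)+
  moreover have "?A \<phi> = D \<phi>" if h: "Form \<phi>" "\<forall>x\<in>insert v X. \<not> fv \<phi> x" for \<phi>
  proof -
    have "A (sb v w0 \<phi>) = A \<phi>"
      using hcht_th[OF cA sb_elim[OF v w0(1) w0v h(1)]] hcht_th[OF cA sb_vac[OF v w0(1) w0v h(1)]] h v w0 by auto
    then show ?thesis using mw0 ag h by auto
  qed
  moreover have "?A (eq x w) = hQ ((lk(v := a)) x) w" if h: "isv x" "isv w" "w \<notin> insert v X" for x w
  proof (cases "x = v")
    case True
    have wv: "w \<noteq> v" using h by blast
    have "A (sb v w0 (eq v w)) \<longleftrightarrow> A (eq w0 w)"
    proof -
      have "Th (imp (eq w0 w) (sb v w0 (eq v w)))"
      proof (rule sb_intro[OF v w0(1) w0v])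
        show "Th (imp (eq w0 w) (imp (eq v w0) (eq v w)))"
          by (rule taut1[OF Eq_trans[of v w0 w]]) (use h v w0 in auto)
      qed (use h v w0 wv w0v in auto)
      moreover have "Th (imp (sb v w0 (eq v w)) (eq w0 w))"
      proof (rule ex_eq_elim[of _ v w0])
        show "Th (imp (eq v w0) (imp (sb v w0 (eq v w)) (eq w0 w)))"
          by (rule taut2[OF sb_spec[OF v w0(1) w0v, of "eq v w"] EqEq[of v w0 w]]) (use h v w0 in auto)
      qed (use h v w0 wv w0v in auto)
      ultimately show ?thesis using hcht_th[OF cA] h v w0 by auto
    qed
    also have "\<dots> \<longleftrightarrow> hQ w0 w" using ag[of "eq w0 w"] h w0 unfolding hQ_def by auto
    also have "\<dots> \<longleftrightarrow> hQ a w" using hQ_trans hQ_sym w0 by blast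
    finally show ?thesis using mw0 True h by simp
  next
    case False
    have "\<not> fv (eq x w) v" using False h v by auto
    then have "A (sb v w0 (eq x w)) = A (eq x w)"
      using hcht_th[OF cA sb_elim[OF v w0(1) w0v, of "eq x w"]] hcht_th[OF cA sb_vac[OF v w0(1) w0v, of "eq x w"]]
        h v w0 by auto
    then show ?thesis using mw0 lk False h by simp
  qed
  ultimately show ?thesis unfolding Inv_def using fX by blast
qed

lemma Inv_D: "Inv D {} (\<lambda>x. x)"
  unfolding Inv_def hQ_def using chD by auto

text \<open>For the converse, a Henkin counterexample \<open>w\<close> is taken above
  \<open>X\<close>. It still denotes itself, so assigning the element \<open>w\<close> to
  \<open>x\<close> would make the instance true as well.\<close>

lemma Inv_all:
  assumes I: "Inv A X lk" and x: "isv x" and F: "Form \<phi>"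
  shows "A (all x \<phi>) \<longleftrightarrow> (\<forall>a. mA A X x a \<phi>)"
proof
  have cA: "cht A" and fX: "finite X" using I unfolding Inv_def by blast+
  show "\<forall>a. mA A X x a \<phi>" if "A (all x \<phi>)"
  proof
    fix a
    obtain w where w: "isv w" "w \<notin> insert x X" "hQ a w" using mA_ex[OF I] by blast
    have "Th (imp (all x \<phi>) (sb x w \<phi>))"
    proof (rule sb_intro[OF x w(1)])
      show "Th (imp (all x \<phi>) (imp (eq x w) \<phi>))" by (rule taut1[OF Spec[of x \<phi>]]) (use w x F in auto)
    qed (use w x F in auto)
    then show "mA A X x a \<phi>" using mA_eq[OF I x w F] hcht_th[OF cA _ _ that] F w x by auto
  qed
  show "A (all x \<phi>)" if h: "\<forall>a. mA A X x a \<phi>"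
  proof (rule ccontr)
    assume "\<not> A (all x \<phi>)"
    obtain b where b: "\<forall>y\<in>insert x X. y \<prec> b" using fin_bound[of "insert x X"] fX by auto
    obtain w where w: "isv w" "b \<prec> w" "A (neg (sb x w \<phi>))"
      using hchtD(4)[OF cA] hchtD(5)[OF cA x F] \<open>\<not> A (all x \<phi>)\<close> x F by (metis F_all)
    then have "\<forall>y\<in>insert x X. y \<prec> w" using b lt_trans by blast
    then have "w \<notin> insert x X" by auto
    then have "A (sb x w \<phi>)" using h mA_eq[OF I x w(1) _ hQ_refl F] by blast
    then show False using w hchtD(4)[OF cA, of "sb x w \<phi>"] x F by simp
  qed
qed

text \<open>Induction on the set of free variables that occur in \<open>X \<union> Y\<close>: one of
  them is replaced, in both theories, by a common fresh name of its value. Once none is left, both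
  theories agree with \<open>D\<close>.\<close>

lemma Inv_free:
  assumes I: "Inv A X lk" and J: "Inv B Y lk'" and F: "Form \<phi>"
    and c: "\<And>x. isv x ==> fv \<phi> x ==> hQ (lk x) (lk' x)"
  shows "A \<phi> = B \<phi>"
proof -
  have cA: "cht A" "cht B" and fX: "finite X" "finite Y" using I J unfolding Inv_def by blast+
  have lkw: "hQ (lk w) w" "hQ (lk' w) w" if "isv w" "w \<notin> X" "w \<notin> Y" for w
  proof -
    have "A (eq w w)" "B (eq w w)" using hchtD(2)[OF cA(1)] hchtD(2)[OF cA(2)] Eq_refl that by auto
    then show "hQ (lk w) w" "hQ (lk' w) w" using I J that unfolding Inv_def by blast+
  qed
  have "\<forall>\<phi>. Form \<phi> --> {x \<in> X \<union> Y. fv \<phi> x} = S --> (\<forall>x. isv x --> fv \<phi> x --> hQ (lk x) (lk' x)) --> A \<phi> = B \<phi>"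
    if "finite S" for S using that
  proof (induction S)
    case empty
    show ?case
    proof (intro allI impI)
      fix \<phi> assume "Form \<phi>" "{x \<in> X \<union> Y. fv \<phi> x} = {}"
      then have "A \<phi> = D \<phi>" "B \<phi> = D \<phi>" using I J unfolding Inv_def by blast+
      then show "A \<phi> = B \<phi>" by simp
    qed
  next
    case (insert x S)
    show ?case
    proof (intro allI impI)
      fix \<phi> assume F: "Form \<phi>" and S: "{x \<in> X \<union> Y. fv \<phi> x} = insert x S"
        and c: "\<forall>x. isv x --> fv \<phi> x --> hQ (lk x) (lk' x)"
      have x: "isv x" "fv \<phi> x" "x \<in> X \<union> Y" using S fv_lt[OF F] by blast+
      obtain w where w: "isv w" "w \<notin> X \<union> Y" "\<phi> \<prec> w" "hQ (lk x) w" using name_ex[of "X \<union> Y" \<phi> "lk x"] fX by auto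
      have wx: "w \<noteq> x" using w x by blast
      have w': "hQ (lk' x) w" using c x w hQ_trans hQ_sym by blast
      have e: "A (eq x w)" "B (eq x w)" using I J w w' x unfolding Inv_def by blast+
      let ?s = "sb x w \<phi>"
      have 1: "A \<phi> = A ?s" "B \<phi> = B ?s"
        using hcht_th2[OF cA(1) Lz_Form[OF F x(1) w(1) wx w(3)] F _ e(1)] hcht_th2[OF cA(1) sb_spec[OF x(1) w(1) wx F] _ F e(1)]
          hcht_th2[OF cA(2) Lz_Form[OF F x(1) w(1) wx w(3)] F _ e(2)] hcht_th2[OF cA(2) sb_spec[OF x(1) w(1) wx F] _ F e(2)]
          F x w by auto
      have "{y \<in> X \<union> Y. fv ?s y} = S" using S insert.hyps F x w by auto
      moreover have "\<forall>y. isv y --> fv ?s y --> hQ (lk y) (lk' y)"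
        using c F x w lkw hQ_trans hQ_sym by (metis UnI1 UnI2 fv_sb)
      ultimately have "A ?s = B ?s" using insert.IH F x w by auto
      then show "A \<phi> = B \<phi>" using 1 by simp
    qed
  qed
  from this[of "{x \<in> X \<union> Y. fv \<phi> x}"] show ?thesis using F c fX by auto
qed

abbreviation "hAsg \<equiv> \<lambda>g. Inv (fst g) (fst (snd g)) (snd (snd g))"
abbreviation "hlook \<equiv> \<lambda>g. snd (snd g)"
abbreviation "hmd \<equiv> \<lambda>g v a. (mA (fst g) (fst (snd g)) v a, insert v (fst (snd g)), (snd (snd g))(v := a))"
abbreviation "hTr \<equiv> \<lambda>\<phi> g. fst g \<phi>"
abbreviation "hg0 \<equiv> (D, {} :: 'a set, \<lambda>x::'a. x)"

lemma FT_henkin: "FT isv Form mem eq neg imp all fv sv hAsg hlook hmd hTr hE hQ hg0"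
proof
  fix g g' :: "('a => bool) \<times> 'a set \<times> ('a => 'a)" and x y \<phi> \<psi> a
  obtain A X lk where g: "g = (A, X, lk)" by (cases g)
  show "hAsg hg0" using Inv_D by simp
  show "hAsg (hmd g x a)" if "hAsg g" "isv x" using Inv_md that by simp
  show "hlook (hmd g x a) y = (if y = x then a else hlook g y)" by simp
  show "hTr (neg \<phi>) g \<longleftrightarrow> \<not> hTr \<phi> g" if h: "hAsg g" "Form \<phi>"
  proof -
    have "cht (fst g)" using h unfolding Inv_def by blast
    from hchtD(4)[OF this] show ?thesis using h by blast
  qed
  show "hTr (imp \<phi> \<psi>) g \<longleftrightarrow> (hTr \<phi> g --> hTr \<psi> g)" if "hAsg g" "Form \<phi>" "Form \<psi>"
  proof -
    have c: "cht (fst g)" using that unfolding Inv_def by blast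
    show ?thesis by (rule himp_clause[of "fst g"]) (use hchtD(2-4)[OF c] that in blast)+
  qed
  show "hTr (all x \<phi>) g \<longleftrightarrow> (\<forall>a. hTr \<phi> (hmd g x a))" if "hAsg g" "isv x" "Form \<phi>"
    using Inv_all that by simp
  show "hTr \<phi> g = hTr \<phi> g'" if "Form \<phi>" "hAsg g" "hAsg g'"
    "\<And>x. isv x ==> fv \<phi> x ==> hQ (hlook g x) (hlook g' x)"
    using Inv_free[OF that(2,3,1)] that(4) by blast
  show "hQ a a" by (rule hQ_refl)
  assume I: "hAsg g" and xy: "isv x" "isv y"
  have cA: "cht A" and fX: "finite X" using I unfolding g Inv_def by auto
  \<comment> \<open>Atoms are reduced to names outside \<open>X\<close>, where \<open>A\<close> and
    \<open>D\<close> agree.\<close>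
  obtain u where u: "isv u" "u \<notin> X" "hQ (lk x) u" using name_ex[OF fX] by blast
  obtain w where w: "isv w" "w \<notin> X" "hQ (lk y) w" using name_ex[OF fX] by blast
  have e: "A (eq x u)" "A (eq y w)" using I u w xy unfolding g Inv_def by auto
  have e': "A (eq u x)" "A (eq w y)"
    using hcht_th[OF cA Eq_sym[of x u] _ e(1)] hcht_th[OF cA Eq_sym[of y w] _ e(2)] xy u w by auto
  have ag: "A (mem u w) \<longleftrightarrow> hE u w" "A (eq u w) \<longleftrightarrow> hQ u w"
  proof -
    have "\<forall>x\<in>X. \<not> fv (mem u w) x" "\<forall>x\<in>X. \<not> fv (eq u w) x" using u w by auto
    then have "A (mem u w) = D (mem u w)" "A (eq u w) = D (eq u w)"
      using I u w unfolding g Inv_def fst_conv snd_conv by (metis F_mem, metis F_eq)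
    then show "A (mem u w) \<longleftrightarrow> hE u w" "A (eq u w) \<longleftrightarrow> hQ u w" unfolding hE_def hQ_def using u w by simp_all
  qed
  have "A (mem x y) \<longleftrightarrow> A (mem u y)"
    using hcht_th2[OF cA EqMemL[of x u y] _ _ e(1)] hcht_th2[OF cA EqMemL[of u x y] _ _ e'(1)] xy u w by auto
  also have "\<dots> \<longleftrightarrow> A (mem u w)"
    using hcht_th2[OF cA EqMemR[of y w u] _ _ e(2)] hcht_th2[OF cA EqMemR[of w y u] _ _ e'(2)] xy u w by auto
  finally show "hTr (mem x y) g \<longleftrightarrow> hE (hlook g x) (hlook g y)"
    using ag u w hE_cong hQ_sym unfolding g fst_conv snd_conv by blast
  have "A (eq x y) \<longleftrightarrow> A (eq u y)"
    using hcht_th2[OF cA EqEq[of x u y] _ _ e(1)] hcht_th2[OF cA EqEq[of u x y] _ _ e'(1)] xy u w by auto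
  also have "\<dots> \<longleftrightarrow> A (eq u w)"
    using hcht_th2[OF cA Eq_trans[of u y w] _ _ _ e(2)] hcht_th2[OF cA Eq_trans[of u w y] _ _ _ e'(2)] xy u w by auto
  finally show "hTr (eq x y) g \<longleftrightarrow> hQ (hlook g x) (hlook g y)"
    using ag u w hQ_trans hQ_sym unfolding g fst_conv snd_conv by blast
qed (use hQ_sym hQ_trans hE_cong in blast)+

end

end

section \<open>Naming elements of an internal model\<close>

lemma (in dfl0) dt_re: "dt t ==> dt (\<lambda>e. t (\<lambda>i. e (f i)))"
  unfolding dt_def using df_re[of "\<lambda>e. e 0 = t (\<lambda>i. e (Suc i))" "\<lambda>i. case i of 0 => 0 | Suc i => Suc (f i)"]
  by simp

lemma (in Z) hf_infinite: "infinite {x. hf E x}"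
proof
  have "\<exists>y. hf E y \<and> (\<forall>x\<in>A. E x y)" if "finite A" "A \<subseteq> {x. hf E x}" for A using that
  proof (induction rule: finite_induct)
    case empty then show ?case using hf_emp[of emp] by (auto simp: isemp_iff)
  next
    case (insert x A)
    then obtain y where y: "hf E y" "\<forall>x\<in>A. E x y" by blast
    then have "hf E (adj y x)" using insert.prems hf_adj[of y x] by (auto simp: isadj_iff)
    then show ?case using y by (intro exI[of _ "adj y x"]) auto
  qed
  moreover assume "finite {x. hf E x}"
  ultimately show False using irrefl by blast
qed

text \<open>\<open>fm\<close>-version of the statement that every set is hereditarily finite. Its
  truth carries over from \<open>N\<close> to the term model, so that the restriction made in
  \<open>to_L\<close> keeps every element there.\<close>

definition hfF :: fm where
  "hfF = (\<^bold>\<forall>x. \<^bold>\<exists>t. (\<^bold>\<forall>y z. z \<^bold>\<in> y \<^bold>\<longrightarrow> y \<^bold>\<in> t \<^bold>\<longrightarrow> z \<^bold>\<in> t) \<^bold>\<and> (\<^bold>\<forall>z. z \<^bold>\<in> x \<^bold>\<longrightarrow> z \<^bold>\<in> t) \<^bold>\<and>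
     (\<^bold>\<forall>F. (\<^bold>\<forall>z. (\<^bold>\<forall>w. \<^bold>\<not> w \<^bold>\<in> z) \<^bold>\<longrightarrow> z \<^bold>\<in> F) \<^bold>\<longrightarrow>
       (\<^bold>\<forall>u w v. u \<^bold>\<in> F \<^bold>\<longrightarrow> w \<^bold>\<in> t \<^bold>\<longrightarrow> (\<^bold>\<forall>z. z \<^bold>\<in> v \<^bold>\<longleftrightarrow> z \<^bold>\<in> u \<^bold>\<or> z \<^bold>= w) \<^bold>\<longrightarrow> v \<^bold>\<in> F) \<^bold>\<longrightarrow> t \<^bold>\<in> F)) 0"

lemma sat_hfF: "sat E (=) e hfF \<longleftrightarrow> (\<forall>x. hf E x)"
  by (simp add: hfF_def hf_def trn_def subs_def fint_def isemp_def isadj_def)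

definition mdl where "mdl md ps g = fold (\<lambda>p g. md g (fst p) (snd p)) ps g"

text \<open>
  The interface between a world \<open>M\<close> and a structure \<open>N\<close> that \<open>M\<close> can talk about: elements of
  \<open>N\<close> have names in \<open>M\<close>, and unary definable predicates of \<open>N\<close> have codes in \<open>M\<close>.
\<close>

locale L = Syn E df lt isv Form mem eq neg imp all fv sv Th + N: HFt EN dfN
  for E :: "'a => 'a => bool" and df and lt (infix "\<prec>" 50)
    and isv Form :: "'a => bool" and mem eq :: "'a => 'a => 'a" and neg imp all fv sv Th
    and EN :: "'n => 'n => bool" and dfN +
  fixes nm :: "'a => 'n" and R :: "'a => 'n => bool"
  assumes nm_surj: "\<exists>a. nm a = x"
    and pull: "dfN P ==> df (\<lambda>e. P (\<lambda>i. nm (e i)))"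
    and R_ex: "dfN (\<lambda>e. U (e 0)) ==> \<exists>c. \<forall>x. R c x = U x"
    and R_dfN: "dfN (\<lambda>e. R c (e 0))"
    and df_R0: "df (\<lambda>e. R (e 0) (nm (e (Suc 0))))"

text \<open>\<open>MD\<close> makes truth definable in the world while the code and the names of the
  assigned values vary; the list of reassigned variables stays fixed.\<close>

locale FTM = Syn E df lt isv Form mem eq neg imp all fv sv Th +
  J: FT isv Form mem eq neg imp all fv sv Asg look md Tr EJ Q g0
  for E :: "'a => 'a => bool" and df and lt (infix "\<prec>" 50)
    and isv Form :: "'a => bool" and mem eq :: "'a => 'a => 'a" and neg imp all fv sv Th
    and Asg :: "'g => bool" and look :: "'g => 'a => nat" and md Tr EJ Q g0 +
  fixes nm0 :: "'a => nat"
  assumes nm0_surj: "\<exists>a. Q (nm0 a) x"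
    and MD: "(\<And>v t. (v, t) \<in> set ps ==> isv v \<and> dt t) ==> dt s ==>
      df (\<lambda>e. Tr (s e) (mdl md (map (\<lambda>p. (fst p, nm0 (snd p e))) ps) g0))"
    and Sv: "Sax \<phi> ==> J.valid \<phi>"
begin

text \<open>Divide by \<open>Q\<close>, pass to the hereditarily finite sets of the quotient, and
  enumerate them by \<open>nat\<close>. If the structure believes \<open>hfF\<close>, the second
  step loses nothing, and \<open>\<kappa>\<close> identifies the result with the whole
  quotient.\<close>

lemma to_L:
  "\<exists>(EN :: nat => nat => bool) dfN nm R (\<kappa> :: nat => nat).
    L E df lt isv Form mem eq neg imp all fv sv Th EN dfN nm R \<and>
    (J.valid (cd hfF) --> surj \<kappa> \<and> (\<forall>x y. \<kappa> x = \<kappa> y \<longleftrightarrow> Q x y) \<and> (\<forall>x y. EN (\<kappa> x) (\<kappa> y) \<longleftrightarrow> EJ x y) \<and>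
      (\<forall>a. nm a = \<kappa> (nm0 a)) \<and>
      (\<forall>P. dfN P --> (\<exists>\<phi> vs as. Form \<phi> \<and> (\<forall>v\<in>set vs. isv v) \<and>
         (\<forall>e. P (\<lambda>i. \<kappa> (e i)) = Tr \<phi> (mdl md (map (\<lambda>i. (vs ! i, (as @@ e) i)) [0..<length vs]) g0)))))"
proof -
  have "equivp Q" by (intro equivpI reflpI sympI transpI) (fact J.Q_refl J.Q_sym J.Q_trans)+
  then obtain cls :: "nat => nat" where cls: "surj cls" "\<And>x y. cls x = cls y \<longleftrightarrow> Q x y"
    using countable_classes[of Q] J.infinite_classes[OF Sv] by blast
  define rep where "rep = inv cls"
  define EZ where "EZ u v \<longleftrightarrow> EJ (rep u) (rep v)" for u v
  have "FT isv Form mem eq neg imp all fv sv Asg (\<lambda>g x. cls (look g x)) (\<lambda>g x u. md g x (rep u)) Tr EZ (=) g0"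
    using J.quotient[OF cls] unfolding rep_def EZ_def .
  then interpret q: FT0 isv Form mem eq neg imp all fv sv Asg "\<lambda>g x. cls (look g x)" "\<lambda>g x u. md g x (rep u)" Tr EZ g0
    unfolding FT0_def .
  have Zq: "Z EZ q.df" by (rule q.Z_df) (use Sv in \<open>auto simp: q.valid_def J.valid_def\<close>)
  then interpret z: Z EZ q.df .
  have cr [simp]: "cls (rep u) = u" for u unfolding rep_def using cls(1) by (rule surj_f_inv_f)
  have rc: "Q (rep (cls x)) x" for x using cls(2) cr by blast
  have EZc: "EZ (cls x) (cls y) \<longleftrightarrow> EJ x y" for x y
    unfolding EZ_def using J.E_cong rc J.Q_sym by blast
  note inf = z.hf_infinite
  obtain h :: "nat => nat" where h: "inj h" "range h = {x. hf EZ x}"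
    using inf countableE_infinite[of "{x. hf EZ x}"] bij_betw_from_nat_into[of "{x. hf EZ x}"]
    unfolding bij_betw_def by auto
  interpret r: restr EZ q.df h "hf EZ" by unfold_locales (use h in \<open>auto intro: z.dfs\<close>)
  interpret N: HFt r.E' r.df' by (rule z.HFt_restr[OF h])
  let ?c = "\<lambda>a. cls (nm0 a)"
  have c_surj: "\<exists>a. ?c a = u" for u
  proof -
    obtain a where "Q (nm0 a) (rep u)" using nm0_surj by blast
    then show ?thesis using cls(2) cr by metis
  qed
  have mds: "Asg (q.mds g (map fst ps) (\<lambda>i. cls (snd (ps ! i)))) \<and> Asg (mdl md ps g') \<and>
     (\<forall>x. isv x --> Q (look (q.mds g (map fst ps) (\<lambda>i. cls (snd (ps ! i)))) x) (look (mdl md ps g') x))"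
    if "Asg g" "Asg g'" "\<forall>x. isv x --> Q (look g x) (look g' x)" "\<forall>p\<in>set ps. isv (fst p)" for g g' ps
    using that
  proof (induction ps arbitrary: g g')
    case (Cons p ps)
    let ?h = "md g (fst p) (rep (cls (snd p)))" and ?h' = "md g' (fst p) (snd p)"
    have "Asg ?h" "Asg ?h'" using Cons.prems J.A_md by auto
    moreover have "\<forall>x. isv x --> Q (look ?h x) (look ?h' x)"
      using Cons.prems rc by (auto simp: J.look_md)
    ultimately show ?case using Cons.IH[of ?h ?h'] Cons.prems by (simp add: mdl_def)
  qed (simp add: mdl_def)
  have me: "q.mds g vs a = q.mds g vs b" if "\<forall>i<length vs. a i = b i" for g a b vs
    using that
  proof (induction vs arbitrary: g a b)
    case (Cons v vs)
    have "a 0 = b 0" "\<forall>i<length vs. a (Suc i) = b (Suc i)" using Cons.prems by auto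
    then show ?case using Cons.IH[of "\<lambda>i. a (Suc i)" "\<lambda>i. b (Suc i)"] by simp
  qed simp
  have mdsl: "Tr \<phi> (mdl md (map (\<lambda>i. (vs ! i, a i)) [0..<length vs]) g0) = Tr \<phi> (q.mds g0 vs (\<lambda>i. cls (a i)))"
    if F: "Form \<phi>" and vs: "\<forall>v\<in>set vs. isv v" for \<phi> vs a
  proof -
    let ?p = "map (\<lambda>i. (vs ! i, a i)) [0..<length vs]"
    have p: "map fst ?p = vs" by (simp add: map_nth comp_def)
    have e: "q.mds g0 vs (\<lambda>i. cls (a i)) = q.mds g0 vs (\<lambda>i. cls (snd (?p ! i)))"
      by (rule me) simp
    have "\<forall>x. isv x --> Q (look g0 x) (look g0 x)" "\<forall>q\<in>set ?p. isv (fst q)" using J.Q_refl vs by auto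
    note m = mds[OF J.A_g0 J.A_g0 this, unfolded p]
    show ?thesis unfolding e using m J.Q_sym by (intro J.Tr_cong[OF F]) simp_all
  qed
  have MDq: "df (\<lambda>e. Tr (s e) (q.mds g0 vs (\<lambda>i. ?c (t i e))))"
    if vs: "\<forall>v\<in>set vs. isv v" and t: "\<And>i. dt (t i)" and s: "dt s" and F: "\<And>e. Form (s e)" for s vs t
  proof -
    let ?ps = "map (\<lambda>i. (vs ! i, t i)) [0..<length vs]"
    have "df (\<lambda>e. Tr (s e) (mdl md (map (\<lambda>p. (fst p, nm0 (snd p e))) ?ps) g0))"
      by (rule MD) (use vs t s in auto)
    moreover have "Tr (s e) (mdl md (map (\<lambda>p. (fst p, nm0 (snd p e))) ?ps) g0) =
        Tr (s e) (q.mds g0 vs (\<lambda>i. ?c (t i e)))" for e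
      using mdsl[OF F vs, of _ "\<lambda>i. nm0 (t i e)"] by (simp add: comp_def)
    ultimately show ?thesis by simp
  qed
  have PB: "df (\<lambda>e. P (\<lambda>i. ?c (t i e)))" if P: "q.df P" and t: "\<And>i. dt (t i)" for P t
  proof -
    obtain P0 as where P0: "q.df0 P0" "\<And>e. P e = P0 (as @@ e)" using P unfolding q.df_def by blast
    obtain \<phi> vs where p: "Form \<phi>" "\<forall>v\<in>set vs. isv v" "\<And>e. P0 e = Tr \<phi> (q.mds g0 vs e)"
      using P0(1) unfolding q.df0_def by blast
    define pa where "pa i = (SOME a. ?c a = as ! i)" for i
    have pa: "?c (pa i) = as ! i" for i unfolding pa_def using someI_ex[OF c_surj] .
    let ?t = "\<lambda>i. if i < length as then (\<lambda>e. pa i) else t (i - length as)"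
    have "(\<lambda>i. ?c (?t i e)) = as @@ (\<lambda>i. ?c (t i e))" for e by (auto simp: pre_def pa fun_eq_iff)
    then have "P (\<lambda>i. ?c (t i e)) = Tr \<phi> (q.mds g0 vs (\<lambda>i. ?c (?t i e)))" for e
      unfolding P0(2) p(3) by simp
    moreover have "df (\<lambda>e. Tr \<phi> (q.mds g0 vs (\<lambda>i. ?c (?t i e))))"
      by (rule MDq[of vs ?t "\<lambda>e. \<phi>", OF p(2)]) (use t p(1) dt_const in auto)
    ultimately show ?thesis by simp
  qed
  obtain c0 where c0: "?c c0 = z.emp" using c_surj by blast
  \<comment> \<open>Names of elements that are not hereditarily finite are redirected to
    \<open>c0\<close>, a name of the empty set; this keeps \<open>nm\<close> total.\<close>
  define \<rho> where "\<rho> a = (if hf EZ (?c a) then a else c0)" for a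
  have hfe: "hf EZ z.emp" using z.hf_emp[of z.emp] by (simp add: z.isemp_iff)
  have \<rho>hf: "hf EZ (?c (\<rho> a))" for a unfolding \<rho>_def using hfe c0 by simp
  have dt_\<rho>0: "dt (\<lambda>e. \<rho> (e 0))"
  proof -
    have "df (\<lambda>e. hf EZ (?c (e (Suc 0))))"
      using PB[OF z.df_hf[OF z.dt_var[of 0]], of "\<lambda>i e. e (Suc 0)"] dt_var by simp
    moreover have "(y = \<rho> a) \<longleftrightarrow> (hf EZ (?c a) \<and> y = a) \<or> (\<not> hf EZ (?c a) \<and> y = c0)" for y a
      by (auto simp: \<rho>_def)
    ultimately show ?thesis unfolding dt_def by (simp only:) (intro hdfs)
  qed
  have dt_\<rho>: "dt t ==> dt (\<lambda>e. \<rho> (t e))" for t by (rule dt_comp1[OF dt_\<rho>0])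
  define nm where "nm a = inv h (?c (\<rho> a))" for a
  have hnm: "h (nm a) = ?c (\<rho> a)" for a
    unfolding nm_def using \<rho>hf h(2) by (intro f_inv_into_f) auto
  \<comment> \<open>A code of a class consists of a formula and the name of one parameter:
    \<open>sv 0\<close> holds the argument and \<open>sv 1\<close> the parameter.\<close>
  define RR where "RR c x \<longleftrightarrow> (\<exists>\<phi> p. c = pr \<phi> p \<and> Form \<phi> \<and> (\<forall>v. fv \<phi> v --> v = sv 0 \<or> v = sv 1) \<and>
      Tr \<phi> (q.mds g0 [sv 1, sv 0] (?c p ## (\<lambda>i. h x))))" for c x
  have "L E df lt isv Form mem eq neg imp all fv sv Th r.E' r.df' nm RR"
  proof unfold_locales
    fix x
    obtain a where a: "?c a = h x" using c_surj by blast
    have "hf EZ (h x)" using h(2) by blast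
    then have "h (nm a) = h x" using a hnm \<rho>_def by simp
    then show "\<exists>a. nm a = x" using h(1) by (metis injD)
  next
    fix P assume "r.df' P"
    then obtain P0 where P0: "q.df P0" "\<And>e. P e = P0 (\<lambda>i. h (e i))" unfolding r.df'_def by blast
    show "df (\<lambda>e. P (\<lambda>i. nm (e i)))" unfolding P0(2) hnm
      by (rule PB[OF P0(1)]) (intro dt_\<rho> dt_var)
  next
    fix P assume "r.df' (\<lambda>e. P (e 0))"
    then obtain P1 where P1: "q.df (\<lambda>e. P1 (e 0))" "\<And>x. P x = P1 (h x)" using r.df'_1 by blast
    then obtain P0 as where P0: "q.df0 P0" "\<And>e. P1 (e 0) = P0 (as @@ e)" unfolding q.df_def by blast
    interpret d0: dfl0 EZ q.df0 by (rule q.dfl0_df0)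
    \<comment> \<open>Packs a list of parameters into a single one by iterated pairing, as the shape
      of \<open>RR\<close> requires.\<close>
    have "\<exists>P' c. q.df0 P' \<and> (\<forall>e. P0 (as @@ e) = P' (c ## e))" using P0(1)
    proof (induction as arbitrary: P0)
      case Nil
      have "[] @@ e = e" for e :: "nat => nat" by (simp add: pre_def fun_eq_iff)
      then show ?case using d0.df_re[OF Nil, of Suc] by (intro exI[of _ "\<lambda>e. P0 (\<lambda>i. e (Suc i))"]) simp
    next
      case (Cons c as)
      let ?n = "length as"
      let ?f = "\<lambda>i. case i of 0 => ?n | Suc i => if i < ?n then i else Suc i"
      have rot: "P0 ((c # as) @@ e) = P0 (\<lambda>i. (as @@ (c ## e)) (?f i))" for e
        by (rule arg_cong[of _ _ P0]) (auto simp: pre_def fun_eq_iff Suc_diff_le split: nat.splits)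
      obtain P2 d where P2: "q.df0 P2" "\<And>e. P0 (\<lambda>i. (as @@ e) (?f i)) = P2 (d ## e)"
        using Cons.IH[OF d0.df_re[OF Cons.prems, of ?f]] by blast
      let ?P = "\<lambda>e. \<exists>x y. ispr EZ (e 0) x y \<and> P2 (x ## (y ## (\<lambda>i. e (Suc i))))"
      let ?g = "\<lambda>i. case i of 0 => Suc 0 | Suc i => (case i of 0 => 0 | Suc i => Suc (Suc (Suc i)))"
      have "q.df0 (\<lambda>e. P2 (\<lambda>i. e (?g i)))" by (rule d0.df_re[OF P2(1)])
      moreover have "(\<lambda>i. e (?g i)) = e (Suc 0) ## (e 0 ## (\<lambda>i. e (Suc (Suc (Suc i)))))" for e :: "nat => nat"
        by (auto simp: fun_eq_iff split: nat.splits)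
      ultimately have 1: "q.df0 (\<lambda>e. P2 (e (Suc 0) ## (e 0 ## (\<lambda>i. e (Suc (Suc (Suc i)))))))" by simp
      have "q.df0 ?P" by (rule d0.df_ex, rule d0.df_ex, rule d0.df_conj, intro d0.df_ispr d0.dt_var) (use 1 in simp)
      moreover have "P0 ((c # as) @@ e) = ?P (z.pr d c ## e)" for e
        unfolding rot P2(2) by (simp add: z.eq_pr[symmetric])
      ultimately show ?case by blast
    qed
    then obtain P' c where P': "q.df0 P'" "\<And>e. P0 (as @@ e) = P' (c ## e)" by blast
    obtain \<phi> us where u: "Form \<phi>" "distinct us" "\<forall>v\<in>set us. isv v \<and> v \<notin> {sv 0, sv 1}"
      "\<forall>v. fv \<phi> v --> v \<in> set us" "\<And>e. P' (\<lambda>i. e (if i = 0 then 0 else 1)) = Tr \<phi> (q.mds g0 us e)"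
      using q.df0_re_long[OF P'(1), of "{sv 0, sv 1}" "{}" 0 "\<lambda>i. if i = 0 then 0 else 1"] by auto
    have nv: "sv 0 \<notin> set us" "sv 1 \<notin> set us" using u(3) by auto
    then have nf: "\<not> fv \<phi> (sv 0)" "\<not> fv \<phi> (sv 1)" using u(4) by auto
    have "\<exists>\<phi>'. Form \<phi>' \<and> ((\<forall>v. fv \<phi> v --> v \<in> set us) --> (\<forall>v. fv \<phi>' v --> v \<in> set [sv 1, sv 0])) \<and>
        (\<forall>g e. Asg g --> Tr \<phi>' (q.mds g [sv 1, sv 0] e) = Tr \<phi> (q.mds g us (\<lambda>i. e (if i = 0 then 0 else 1))))"
      by (rule q.ren) (use u nv nf sv_inj sv_isv in auto)
    then obtain \<phi>' where p': "Form \<phi>'" "\<forall>v. fv \<phi>' v --> v \<in> set [sv 1, sv 0]"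
      "\<And>e. Tr \<phi>' (q.mds g0 [sv 1, sv 0] e) = Tr \<phi> (q.mds g0 us (\<lambda>i. e (if i = 0 then 0 else 1)))"
      using u(4) J.A_g0 by blast
    obtain p where p: "?c p = c" using c_surj by blast
    have "P x = RR (pr \<phi>' p) x" for x
    proof -
      let ?e = "\<lambda>i. h x"
      have "P x = P' (c ## ?e)" using P1(2) P0(2)[of ?e] P'(2) by simp
      also have "c ## ?e = (\<lambda>i. (\<lambda>i::nat. (c ## ?e) (if i = 0 then 0 else 1)) (if i = 0 then 0 else 1))"
        by (auto simp: fun_eq_iff split: nat.splits)
      also have "P' \<dots> = Tr \<phi> (q.mds g0 us (\<lambda>i. (c ## ?e) (if i = 0 then 0 else 1)))" by (rule u(5))
      also have "\<dots> = Tr \<phi>' (q.mds g0 [sv 1, sv 0] (c ## ?e))" by (rule p'(3)[symmetric])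
      finally show ?thesis unfolding RR_def using p' p by auto
    qed
    then show "\<exists>c. \<forall>x. RR c x = P x" by blast
  next
    fix c
    show "r.df' (\<lambda>e. RR c (e 0))"
    proof (cases "\<exists>\<phi> p. c = pr \<phi> p \<and> Form \<phi> \<and> (\<forall>v. fv \<phi> v --> v = sv 0 \<or> v = sv 1)")
      case False
      then have "RR c x = False" for x unfolding RR_def by blast
      then show ?thesis using N.df_const by simp
    next
      case True
      then obtain \<phi> p where p: "c = pr \<phi> p" "Form \<phi>" "\<forall>v. fv \<phi> v --> v = sv 0 \<or> v = sv 1" by blast
      have "q.df0 (\<lambda>e. Tr \<phi> (q.mds g0 [sv 1, sv 0] e))" unfolding q.df0_def
        by (rule exI[of _ \<phi>], rule exI[of _ "[sv 1, sv 0]"]) (use p in \<open>auto simp: sv_isv sv_inj\<close>)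
      then have "q.df (\<lambda>e. Tr \<phi> (q.mds g0 [sv 1, sv 0] ([?c p] @@ e)))" unfolding q.df_def by blast
      then have "r.df' (\<lambda>e. Tr \<phi> (q.mds g0 [sv 1, sv 0] ([?c p] @@ (\<lambda>i. h (e i)))))" unfolding r.df'_def by blast
      moreover have "RR c x = Tr \<phi> (q.mds g0 [sv 1, sv 0] ([?c p] @@ (\<lambda>i. h x)))" for x
        unfolding RR_def p(1) using p(2,3) by (simp add: pre_def)
      moreover have "Tr \<phi> (q.mds g0 [sv 1, sv 0] ([?c p] @@ (\<lambda>i. h (e i)))) =
          Tr \<phi> (q.mds g0 [sv 1, sv 0] ([?c p] @@ (\<lambda>i. h (e 0))))" for e by (simp add: pre_def)
      ultimately show ?thesis by simp
    qed
  next
    \<comment> \<open>Non-formulas are replaced by \<open>tt\<close>, because \<open>MDq\<close>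
      asks for a formula under every assignment.\<close>
    let ?s = "\<lambda>\<phi>. if Form \<phi> then \<phi> else tt"
    have ds: "dt (\<lambda>e. ?s (e i))" for i
    proof -
      have "(y = ?s a) \<longleftrightarrow> (Form a \<and> y = a) \<or> (\<not> Form a \<and> y = tt)" for y a by auto
      then show ?thesis unfolding dt_def by (simp only:) (intro hdfs)
    qed
    have 1: "df (\<lambda>e. Tr (?s (e (Suc 0))) (q.mds g0 [sv 1, sv 0] (\<lambda>i. ?c (case i of 0 => e 0 | Suc _ => \<rho> (e (Suc (Suc (Suc 0))))))))"
    proof -
      have 2: "dt (\<lambda>e. case i of 0 => e 0 | Suc _ => \<rho> (e (Suc (Suc (Suc 0)))))" for i
        by (cases i) (auto intro: dt_var dt_\<rho>)
      show ?thesis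
        by (rule MDq[of "[sv 1, sv 0]" "\<lambda>i e. case i of 0 => e 0 | Suc _ => \<rho> (e (Suc (Suc (Suc 0))))"
              "\<lambda>e. ?s (e (Suc 0))", OF _ 2 ds])
          (auto simp: tt_def sv_isv intro: F_eq)
    qed
    have eq: "RR c (nm a) \<longleftrightarrow> (\<exists>\<phi> p. c = pr \<phi> p \<and> Form \<phi> \<and> (\<forall>v. fv \<phi> v --> v = sv 0 \<or> v = sv 1) \<and>
        Tr (?s \<phi>) (q.mds g0 [sv 1, sv 0] (\<lambda>i. ?c (case i of 0 => p | Suc _ => \<rho> a))))" for c a
      unfolding RR_def hnm by (auto)
    show "df (\<lambda>e. RR (e 0) (nm (e (Suc 0))))" unfolding eq
      by (rule df_ex, rule df_ex, rule df_conj, intro hdfs, rule df_conj, intro hdfs, rule df_conj, intro hdfs)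
        (use 1 in simp)
  qed
  moreover have "surj \<kappa> \<and> (\<forall>x y. \<kappa> x = \<kappa> y \<longleftrightarrow> Q x y) \<and> (\<forall>x y. r.E' (\<kappa> x) (\<kappa> y) \<longleftrightarrow> EJ x y) \<and>
      (\<forall>a. nm a = \<kappa> (nm0 a)) \<and>
      (\<forall>P. r.df' P --> (\<exists>\<phi> vs as. Form \<phi> \<and> (\<forall>v\<in>set vs. isv v) \<and>
         (\<forall>e. P (\<lambda>i. \<kappa> (e i)) = Tr \<phi> (mdl md (map (\<lambda>i. (vs ! i, (as @@ e) i)) [0..<length vs]) g0))))"
    if v: "J.valid (cd hfF)" and k: "\<kappa> = (\<lambda>x. inv h (cls x))" for \<kappa>
  proof -
    have "sat EZ (=) (\<lambda>i. cls (look g0 (sv i))) hfF" using q.Tr_cd[OF J.A_g0] v J.A_g0 unfolding J.valid_def by blast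
    then have all: "hf EZ x" for x using sat_hfF by metis
    then have hs: "surj h" using h(2) by auto
    have hk: "h (\<kappa> x) = cls x" for x unfolding k using hs by (rule surj_f_inv_f)
    have "surj \<kappa>" unfolding surj_def
    proof
      fix y
      obtain x where "h y = cls x" using cls(1) by (metis surjD)
      then show "\<exists>x. y = \<kappa> x" using hk h(1) by (metis injD)
    qed
    moreover have "\<kappa> x = \<kappa> y \<longleftrightarrow> Q x y" for x y using hk cls(2) h(1) by (metis injD)
    moreover have "r.E' (\<kappa> x) (\<kappa> y) \<longleftrightarrow> EJ x y" for x y unfolding r.E'_def hk EZc ..
    moreover have "nm a = \<kappa> (nm0 a)" for a unfolding nm_def k \<rho>_def using all by simp
    moreover have "\<exists>\<phi> vs as. Form \<phi> \<and> (\<forall>v\<in>set vs. isv v) \<and>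
         (\<forall>e. P (\<lambda>i. \<kappa> (e i)) = Tr \<phi> (mdl md (map (\<lambda>i. (vs ! i, (as @@ e) i)) [0..<length vs]) g0))"
      if P: "r.df' P" for P
    proof -
      obtain P0 where P0: "q.df P0" "\<And>e. P e = P0 (\<lambda>i. h (e i))" using P unfolding r.df'_def by blast
      obtain P1 as where P1: "q.df0 P1" "\<And>e. P0 e = P1 (as @@ e)" using P0(1) unfolding q.df_def by blast
      obtain \<phi> vs where p: "Form \<phi>" "\<forall>v\<in>set vs. isv v" "\<And>e. P1 e = Tr \<phi> (q.mds g0 vs e)"
        using P1(1) unfolding q.df0_def by blast
      have "P (\<lambda>i. \<kappa> (e i)) = Tr \<phi> (mdl md (map (\<lambda>i. (vs ! i, (map rep as @@ e) i)) [0..<length vs]) g0)" for e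
      proof -
        have "as @@ (\<lambda>i. cls (e i)) = (\<lambda>i. cls ((map rep as @@ e) i))" by (auto simp: pre_def fun_eq_iff)
        then show ?thesis unfolding P0(2) hk P1(2) p(3) mdsl[OF p(1,2)] by simp
      qed
      then show ?thesis using p by blast
    qed
    ultimately show ?thesis by blast
  qed
  ultimately show ?thesis
    by (rule_tac exI[of _ r.E'], rule_tac exI[of _ r.df'], rule_tac exI[of _ nm], rule_tac exI[of _ RR],
      rule_tac exI[of _ "\<lambda>x. inv h (cls x)"]) simp
qed

end

section \<open>Internal satisfaction\<close>

context L begin

sublocale N: W EN dfN "lam EN" by (rule N.W_lam)

text \<open>The analogue of \<open>dt\<close> for values in \<open>N\<close>, which the world sees
  only through their names.\<close>

definition dn :: "((nat => 'a) => 'n) => bool" where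
  "dn s \<longleftrightarrow> df (\<lambda>e. nm (e 0) = s (\<lambda>i. e (Suc i)))"

lemma df_alln: "df (\<lambda>e. P (\<lambda>i. e (Suc i)) (nm (e 0))) ==> df (\<lambda>e. \<forall>z. P e z)"
proof -
  assume "df (\<lambda>e. P (\<lambda>i. e (Suc i)) (nm (e 0)))"
  then have "df (\<lambda>e. \<forall>a. P e (nm a))" by (rule df_all)
  moreover have "(\<forall>z. P e z) \<longleftrightarrow> (\<forall>a. P e (nm a))" for e using nm_surj by metis
  ultimately show ?thesis by simp
qed

lemma df_exn: "df (\<lambda>e. P (\<lambda>i. e (Suc i)) (nm (e 0))) ==> df (\<lambda>e. \<exists>z. P e z)"
  using df_neg[OF df_alln[of "\<lambda>e z. \<not> P e z"]] df_neg by simp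

lemma dn_weak: "dn t ==> dn (\<lambda>e. t (\<lambda>i. e (Suc i)))"
  unfolding dn_def using df_re[of "\<lambda>e. nm (e 0) = t (\<lambda>i. e (Suc i))" "\<lambda>i. case i of 0 => 0 | Suc i => Suc (Suc i)"]
  by simp

lemma dn_nm: "dt t ==> dn (\<lambda>e. nm (t e))"
  unfolding dn_def using df_comp2[of "\<lambda>a b. nm a = nm b", OF pull[OF N.df_eq0] dt_var dt_weak] .

lemma dn_const: "dn (\<lambda>e. c)"
  using nm_surj[of c] dn_nm[OF dt_const] by blast

lemma dfn1: assumes "dfN (\<lambda>e. P (e 0))" "dn s" shows "df (\<lambda>e. P (s e))"
proof -
  have "df (\<lambda>e. \<exists>a. nm a = s e \<and> P (nm a))"
    by (intro df_ex df_conj) (use assms(2) pull[OF assms(1)] in \<open>simp_all add: dn_def\<close>)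
  moreover have "P (s e) \<longleftrightarrow> (\<exists>a. nm a = s e \<and> P (nm a))" for e using nm_surj by metis
  ultimately show ?thesis by simp
qed

lemma dfn2: assumes "dfN (\<lambda>e. P (e 0) (e (Suc 0)))" "dn s" "dn t" shows "df (\<lambda>e. P (s e) (t e))"
proof -
  have 1: "df (\<lambda>e. P (nm (e (Suc 0))) (nm (e 0)))"
    using df_re[OF pull[OF assms(1)], of "\<lambda>i. if i = 0 then Suc 0 else 0"] by simp
  have "df (\<lambda>e. \<exists>a. nm a = s e \<and> (\<exists>b. nm b = t e \<and> P (nm a) (nm b)))"
    by (intro df_ex df_conj) (use assms(2) dn_weak[OF assms(3)] 1 in \<open>simp_all add: dn_def\<close>)
  moreover have "P (s e) (t e) \<longleftrightarrow> (\<exists>a. nm a = s e \<and> (\<exists>b. nm b = t e \<and> P (nm a) (nm b)))" for e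
    using nm_surj by metis
  ultimately show ?thesis by simp
qed

lemma dfn3: assumes "dfN (\<lambda>e. P (e 0) (e (Suc 0)) (e (Suc (Suc 0))))" "dn s" "dn t" "dn u"
  shows "df (\<lambda>e. P (s e) (t e) (u e))"
proof -
  have 1: "df (\<lambda>e. P (nm (e (Suc (Suc 0)))) (nm (e (Suc 0))) (nm (e 0)))"
    using df_re[OF pull[OF assms(1)], of "\<lambda>i. if i = 0 then Suc (Suc 0) else if i = Suc 0 then Suc 0 else 0"] by simp
  have "df (\<lambda>e. \<exists>a. nm a = s e \<and> (\<exists>b. nm b = t e \<and> (\<exists>c. nm c = u e \<and> P (nm a) (nm b) (nm c))))"
    by (intro df_ex df_conj)
      (use assms(2) dn_weak[OF assms(3)] dn_weak[OF dn_weak[OF assms(4)]] 1 in \<open>simp_all add: dn_def\<close>)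
  moreover have "P (s e) (t e) (u e) \<longleftrightarrow>
      (\<exists>a. nm a = s e \<and> (\<exists>b. nm b = t e \<and> (\<exists>c. nm c = u e \<and> P (nm a) (nm b) (nm c))))" for e
    using nm_surj by metis
  ultimately show ?thesis by simp
qed

lemma dnf2: assumes "N.dt (\<lambda>e. f (e 0) (e (Suc 0)))" "dn s" "dn t" shows "dn (\<lambda>e. f (s e) (t e))"
  unfolding dn_def
  by (rule dfn3[of "\<lambda>y a b. y = f a b", OF _ dn_nm[OF dt_var] dn_weak[OF assms(2)] dn_weak[OF assms(3)]])
    (use assms(1) in \<open>simp add: N.dt_def\<close>)
lemma dnf3: assumes "N.dt (\<lambda>e. f (e 0) (e (Suc 0)) (e (Suc (Suc 0))))" "dn s" "dn t" "dn u"
  shows "dn (\<lambda>e. f (s e) (t e) (u e))"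
proof -
  \<comment> \<open>Pairing the last two arguments reduces the four-place graph to the three-place
    rule \<open>dfn3\<close>.\<close>
  let ?f = "\<lambda>y a p. \<exists>b c. p = N.pr b c \<and> y = f a b c"
  have 1: "dfN (\<lambda>e. e 0 = f (e (Suc 0)) (e (Suc (Suc 0))) (e (Suc (Suc (Suc 0)))))"
    using assms(1) by (simp add: N.dt_def)
  have "dfN (\<lambda>e. ?f (e 0) (e (Suc 0)) (e (Suc (Suc 0))))"
    by (intro N.dfs4 N.df_comp4[of "\<lambda>y a b c. y = f a b c", OF 1])
  from dfn3[of ?f, OF this dn_nm[OF dt_var[of 0]] dn_weak[OF assms(2)]
    dnf2[of N.pr, OF N.dt_pr[OF N.dt_var N.dt_var] dn_weak[OF assms(3)] dn_weak[OF assms(4)]]]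
  show ?thesis unfolding dn_def by simp
qed

lemma df_R: assumes "dt c" "dn s" shows "df (\<lambda>e. R (c e) (s e))"
proof -
  have 1: "df (\<lambda>e. R (e (Suc 0)) (nm (e 0)))"
    using df_re[OF df_R0, of "\<lambda>i. if i = 0 then Suc 0 else 0"] by simp
  have "df (\<lambda>e. \<exists>a. nm a = s e \<and> R (c e) (nm a))"
    by (intro df_ex df_conj)
      (use assms(2) df_comp2[OF df_R0 dt_weak[OF assms(1)] dt_var] in \<open>simp_all add: dn_def\<close>)
  moreover have "R (c e) (s e) \<longleftrightarrow> (\<exists>a. nm a = s e \<and> R (c e) (nm a))" for e using nm_surj by metis
  ultimately show ?thesis by simp
qed

lemmas ndfs = hdfs df_alln df_exn dn_nm dn_const df_R
  dfn2[of EN, OF N.df_E0] dfn2[of "(=)", OF N.df_eq0] dnf2[of N.ap, OF N.dt_ap[OF N.dt_var N.dt_var]]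
  dnf3[of N.upd, OF N.dt_upd[OF N.dt_var N.dt_var N.dt_var]] dnf2[of N.pr, OF N.dt_pr[OF N.dt_var N.dt_var]]

text \<open>The canonical image of an element of \<open>M\<close> in \<open>N\<close>.\<close>

definition numG where "numG p t f = lstd (\<lambda>a. \<forall>z. EN z (nm a) \<longleftrightarrow> (\<exists>y. E y t \<and> z = nm (ap f y)))"
definition num where "num t = nm (rec numG emp t)"

lemma df_numG: "df (\<lambda>e. \<forall>z. EN z (nm (e 0)) \<longleftrightarrow> (\<exists>y. E y t \<and> z = nm (ap f y)))"
  by (intro ndfs)

lemma dt_numG: "dt (\<lambda>e. numG (e 0) (e (Suc 0)) (e (Suc (Suc 0))))"
  unfolding dt_def numG_def eq_lstd[OF df_numG] by (intro ndfs)

lemma dn_num: "dt t ==> dn (\<lambda>e. num (t e))"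
  unfolding num_def by (intro dn_nm dt_rec[OF dt_numG] dt_const)

text \<open>That the image set exists in \<open>N\<close> is shown by adjunction induction in the
  world, although the claim is about \<open>N\<close>; the recursion then picks the least name of
  this set.\<close>

lemma E_num: "EN z (num t) \<longleftrightarrow> (\<exists>y. E y t \<and> z = num y)"
proof -
  have "\<exists>x. \<forall>z. EN z x \<longleftrightarrow> (\<exists>y. E y u \<and> z = num y)" for u
  proof (rule h_all[of "\<lambda>u. \<exists>x. \<forall>z. EN z x \<longleftrightarrow> (\<exists>y. E y u \<and> z = num y)"])
    show "df (\<lambda>e. \<exists>x. \<forall>z. EN z x \<longleftrightarrow> (\<exists>y. E y (e 0) \<and> z = num y))" by (intro ndfs dn_num)
    show "\<exists>x. \<forall>z. EN z x \<longleftrightarrow> (\<exists>y. E y emp \<and> z = num y)" by (rule exI[of _ N.emp]) simp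
    fix u w assume "\<exists>x. \<forall>z. EN z x \<longleftrightarrow> (\<exists>y. E y u \<and> z = num y)"
    then obtain x where "\<forall>z. EN z x \<longleftrightarrow> (\<exists>y. E y u \<and> z = num y)" by blast
    then show "\<exists>x. \<forall>z. EN z x \<longleftrightarrow> (\<exists>y. E y (adj u w) \<and> z = num y)"
      by (intro exI[of _ "N.adj x (num w)"]) auto
  qed
  then obtain x where x: "\<forall>z. EN z x \<longleftrightarrow> (\<exists>y. E y t \<and> z = num y)" by blast
  obtain a where a: "nm a = x" using nm_surj by blast
  have tb: "nm (ap (tab numG emp t) y) = num y" if "E y t" for y
    unfolding num_def using ap_tab[OF dt_numG E_lt[OF that]] by simp
  let ?P = "\<lambda>a. \<forall>z. EN z (nm a) \<longleftrightarrow> (\<exists>y. E y t \<and> z = nm (ap (tab numG emp t) y))"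
  have "?P a" using a x tb by metis
  then have "?P (rec numG emp t)" unfolding rec_def numG_def[of emp t]
    using lstd(1)[of ?P a, OF df_numG] by blast
  then show ?thesis using tb unfolding num_def[of t] by metis
qed

lemma num_inj [simp]: "num s = num t \<longleftrightarrow> s = t"
proof -
  have "\<forall>t. num s = num t --> s = t"
  proof (rule h_mem_ind[of "\<lambda>s. \<forall>t. num s = num t --> s = t"])
    show "df (\<lambda>e. \<forall>t. num (e 0) = num t --> e 0 = t)" by (intro ndfs dn_num)
    fix s assume IH: "\<And>y. E y s ==> \<forall>t. num y = num t --> y = t"
    show "\<forall>t. num s = num t --> s = t"
    proof (intro allI impI)
      fix t assume eq: "num s = num t"
      show "s = t" by (rule ext) (metis E_num IH eq)
    qed
  qed
  then show ?thesis by blast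
qed

lemmas mdfs = ndfs dn_num

context
  fixes EJ QJ :: "'n => 'n => bool"
  assumes EJ: "dfN (\<lambda>e. EJ (e 0) (e (Suc 0)))" and QJ: "dfN (\<lambda>e. QJ (e 0) (e (Suc 0)))"
begin

lemmas jdfs = mdfs dfn2[of EJ, OF EJ] dfn2[of QJ, OF QJ]
lemmas jdfN = N.dfs4 N.df_comp2[OF EJ] N.df_comp2[OF QJ] N.df_comp1[OF R_dfN]

text \<open>Tarski's clauses for one code. The entry \<open>ap h \<psi>\<close> is an
  \<open>R\<close>-code for the class of assignments in \<open>N\<close> that satisfy
  \<open>\<psi>\<close>; the class need not be a set, but its code is an element of the world and
  can be tabulated.\<close>

definition cla where
  "cla h \<psi> \<longleftrightarrow>
    (\<forall>x y. isv x --> isv y --> \<psi> = mem x y --> (\<forall>e. R (ap h \<psi>) e \<longleftrightarrow> EJ (N.ap e (num x)) (N.ap e (num y)))) \<and>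
    (\<forall>x y. isv x --> isv y --> \<psi> = eq x y --> (\<forall>e. R (ap h \<psi>) e \<longleftrightarrow> QJ (N.ap e (num x)) (N.ap e (num y)))) \<and>
    (\<forall>\<phi>. Form \<phi> --> \<psi> = neg \<phi> --> (\<forall>e. R (ap h \<psi>) e \<longleftrightarrow> \<not> R (ap h \<phi>) e)) \<and>
    (\<forall>\<phi> \<chi>. Form \<phi> --> Form \<chi> --> \<psi> = imp \<phi> \<chi> --> (\<forall>e. R (ap h \<psi>) e \<longleftrightarrow> (R (ap h \<phi>) e --> R (ap h \<chi>) e))) \<and>
    (\<forall>x \<phi>. isv x --> Form \<phi> --> \<psi> = all x \<phi> --> (\<forall>e. R (ap h \<psi>) e \<longleftrightarrow> (\<forall>z. R (ap h \<phi>) (N.upd e (num x) z))))"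

definition coh where "coh h b \<longleftrightarrow> (\<forall>\<psi>. Form \<psi> --> \<psi> \<prec> b --> cla h \<psi>)"

lemma df_coh: "dt s ==> dt t ==> df (\<lambda>e. coh (s e) (t e))"
  by (rule df_comp2) (unfold coh_def cla_def, intro jdfs)

lemma coh_clauses:
  assumes "coh h b"
  shows "isv x ==> isv y ==> mem x y \<prec> b ==> R (ap h (mem x y)) e \<longleftrightarrow> EJ (N.ap e (num x)) (N.ap e (num y))"
    and "isv x ==> isv y ==> eq x y \<prec> b ==> R (ap h (eq x y)) e \<longleftrightarrow> QJ (N.ap e (num x)) (N.ap e (num y))"
    and "Form \<phi> ==> neg \<phi> \<prec> b ==> R (ap h (neg \<phi>)) e \<longleftrightarrow> \<not> R (ap h \<phi>) e"
    and "Form \<phi> ==> Form \<chi> ==> imp \<phi> \<chi> \<prec> b ==> R (ap h (imp \<phi> \<chi>)) e \<longleftrightarrow> (R (ap h \<phi>) e --> R (ap h \<chi>) e)"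
    and "isv x ==> Form \<phi> ==> all x \<phi> \<prec> b ==> R (ap h (all x \<phi>)) e \<longleftrightarrow> (\<forall>z. R (ap h \<phi>) (N.upd e (num x) z))"
proof -
  have cl: "cla h \<psi>" if "Form \<psi>" "\<psi> \<prec> b" for \<psi> using assms that unfolding coh_def by blast
  note d = cl[unfolded cla_def]
  show "isv x ==> isv y ==> mem x y \<prec> b ==> R (ap h (mem x y)) e \<longleftrightarrow> EJ (N.ap e (num x)) (N.ap e (num y))"
    by (rule d[THEN conjunct1, rule_format, OF F_mem _ _ _ refl])
  show "isv x ==> isv y ==> eq x y \<prec> b ==> R (ap h (eq x y)) e \<longleftrightarrow> QJ (N.ap e (num x)) (N.ap e (num y))"
    by (rule d[THEN conjunct2, THEN conjunct1, rule_format, OF F_eq _ _ _ refl])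
  show "Form \<phi> ==> neg \<phi> \<prec> b ==> R (ap h (neg \<phi>)) e \<longleftrightarrow> \<not> R (ap h \<phi>) e"
    by (rule d[THEN conjunct2, THEN conjunct2, THEN conjunct1, rule_format, OF F_neg _ _ refl])
  show "Form \<phi> ==> Form \<chi> ==> imp \<phi> \<chi> \<prec> b ==> R (ap h (imp \<phi> \<chi>)) e \<longleftrightarrow> (R (ap h \<phi>) e --> R (ap h \<chi>) e)"
    by (rule d[THEN conjunct2, THEN conjunct2, THEN conjunct2, THEN conjunct1, THEN spec, THEN spec, THEN mp, THEN mp, THEN mp, THEN spec, OF F_imp _ _ _ refl])
  show "isv x ==> Form \<phi> ==> all x \<phi> \<prec> b ==> R (ap h (all x \<phi>)) e \<longleftrightarrow> (\<forall>z. R (ap h \<phi>) (N.upd e (num x) z))"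
    by (rule d[THEN conjunct2, THEN conjunct2, THEN conjunct2, THEN conjunct2, THEN spec, THEN spec, THEN mp, THEN mp, THEN mp, THEN spec, OF F_all _ _ _ refl])
qed

lemma coh_unique:
  assumes h: "coh h b" "coh h' b'" and F: "Form \<psi>"
  shows "\<psi> \<prec> b ==> \<psi> \<prec> b' ==> R (ap h \<psi>) e \<longleftrightarrow> R (ap h' \<psi>) e"
proof -
  let ?P = "\<lambda>\<psi>. \<psi> \<prec> b --> \<psi> \<prec> b' --> (\<forall>e. R (ap h \<psi>) e \<longleftrightarrow> R (ap h' \<psi>) e)"
  have "?P \<psi>"
  proof (rule F_induct[of ?P, OF _ F])
    show "df (\<lambda>e. ?P (e 0))" by (intro jdfs)
    note c = coh_clauses[OF h(1)] coh_clauses[OF h(2)]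
    show "?P (mem x y)" "?P (eq x y)" if "isv x" "isv y" for x y using that c by simp_all
    show "?P (neg \<phi>)" if "Form \<phi>" "?P \<phi>" for \<phi>
    proof (intro impI allI)
      fix e assume l: "neg \<phi> \<prec> b" "neg \<phi> \<prec> b'"
      have "\<phi> \<prec> b" "\<phi> \<prec> b'" using l sub_lt(5) lt_trans by blast+
      then have "R (ap h \<phi>) e = R (ap h' \<phi>) e" using that(2) by blast
      then show "R (ap h (neg \<phi>)) e = R (ap h' (neg \<phi>)) e" unfolding c(3)[OF that(1) l(1)] c(8)[OF that(1) l(2)] by simp
    qed
    show "?P (imp \<phi> \<psi>)" if F: "Form \<phi>" "Form \<psi>" "?P \<phi>" "?P \<psi>" for \<phi> \<psi>
    proof (intro impI allI)
      fix e assume l: "imp \<phi> \<psi> \<prec> b" "imp \<phi> \<psi> \<prec> b'"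
      have "\<phi> \<prec> b" "\<phi> \<prec> b'" "\<psi> \<prec> b" "\<psi> \<prec> b'" using l sub_lt(6,7) lt_trans by blast+
      then have "R (ap h \<phi>) e = R (ap h' \<phi>) e" "R (ap h \<psi>) e = R (ap h' \<psi>) e" using F(3,4) by blast+
      then show "R (ap h (imp \<phi> \<psi>)) e = R (ap h' (imp \<phi> \<psi>)) e"
        unfolding c(4)[OF F(1,2) l(1)] c(9)[OF F(1,2) l(2)] by simp
    qed
    show "?P (all x \<phi>)" if F: "isv x" "Form \<phi>" "?P \<phi>" for x \<phi>
    proof (intro impI allI)
      fix e assume l: "all x \<phi> \<prec> b" "all x \<phi> \<prec> b'"
      have "\<phi> \<prec> b" "\<phi> \<prec> b'" using l sub_lt(9) lt_trans by blast+
      then have "R (ap h \<phi>) e = R (ap h' \<phi>) e" for e using F(3) by blast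
      then show "R (ap h (all x \<phi>)) e = R (ap h' (all x \<phi>)) e"
        unfolding c(5)[OF F(1,2) l(1)] c(10)[OF F(1,2) l(2)] by simp
    qed
  qed
  then show "\<psi> \<prec> b ==> \<psi> \<prec> b' ==> R (ap h \<psi>) e \<longleftrightarrow> R (ap h' \<psi>) e" by blast
qed

text \<open>A successor step along the order. The class that the clause prescribes for the next
  formula is definable in \<open>N\<close> from classes already coded, so \<open>R_ex\<close>
  provides an entry for it.\<close>

lemma coh_ex: "\<exists>h. coh h b"
proof (rule seg_induct[of "\<lambda>b. \<exists>h. coh h b"])
  show "df (\<lambda>e. \<exists>h. coh h (e 0))" by (intro jdfs df_coh)
  show "\<exists>h. coh h b" if "\<And>x. \<not> x \<prec> b" for b using that unfolding coh_def by blast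
  fix b p assume b: "\<And>x. x \<prec> b \<longleftrightarrow> x \<prec> p \<or> x = p" and "\<exists>h. coh h p"
  then obtain h where h: "coh h p" by blast
  show "\<exists>h. coh h b"
  proof (cases "Form p")
    case False
    then have "coh h b" using h b unfolding coh_def by blast
    then show ?thesis ..
  next
    case True
    have "\<exists>c. cla (upd h p c) p" using True
    proof (rule F_induct[of "\<lambda>p. \<exists>c. cla (upd h p c) p", rotated 1])
      show "df (\<lambda>e. \<exists>c. cla (upd h (e 0) c) (e 0))" unfolding cla_def by (intro jdfs)
      show "\<exists>c. cla (upd h (mem x y) c) (mem x y)" if "isv x" "isv y" for x y
      proof -
        have "dfN (\<lambda>e. EJ (N.ap (e 0) (num x)) (N.ap (e 0) (num y)))" by (intro jdfN)
        from R_ex[OF this] show ?thesis unfolding cla_def by (auto simp: c_inj c_dist)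
      qed
      show "\<exists>c. cla (upd h (eq x y) c) (eq x y)" if "isv x" "isv y" for x y
      proof -
        have "dfN (\<lambda>e. QJ (N.ap (e 0) (num x)) (N.ap (e 0) (num y)))" by (intro jdfN)
        from R_ex[OF this] show ?thesis unfolding cla_def by (auto simp: c_inj c_dist[symmetric] c_dist)
      qed
      show "\<exists>c. cla (upd h (neg \<phi>) c) (neg \<phi>)" if "Form \<phi>" for \<phi>
      proof -
        have "dfN (\<lambda>e. \<not> R (ap h \<phi>) (e 0))" by (intro jdfN)
        moreover have "\<phi> \<noteq> neg \<phi>" using sub_lt(5)[of \<phi>] by (metis lt_irrefl)
        ultimately show ?thesis using R_ex[of "\<lambda>e. \<not> R (ap h \<phi>) e"] unfolding cla_def
          by (auto simp: c_inj c_dist c_dist[symmetric])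
      qed
      show "\<exists>c. cla (upd h (imp \<phi> \<psi>) c) (imp \<phi> \<psi>)" if "Form \<phi>" "Form \<psi>" for \<phi> \<psi>
      proof -
        have "dfN (\<lambda>e. R (ap h \<phi>) (e 0) --> R (ap h \<psi>) (e 0))" by (intro jdfN)
        moreover have "\<phi> \<noteq> imp \<phi> \<psi>" "\<psi> \<noteq> imp \<phi> \<psi>"
          using sub_lt(6)[of \<phi> \<psi>] sub_lt(7)[of \<psi> \<phi>] by (metis lt_irrefl)+
        ultimately show ?thesis using R_ex[of "\<lambda>e. R (ap h \<phi>) e --> R (ap h \<psi>) e"] unfolding cla_def
          by (auto simp: c_inj c_dist c_dist[symmetric])
      qed
      show "\<exists>c. cla (upd h (all x \<phi>) c) (all x \<phi>)" if "isv x" "Form \<phi>" for x \<phi>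
      proof -
        have "dfN (\<lambda>e. \<forall>z. R (ap h \<phi>) (N.upd (e 0) (num x) z))" by (intro jdfN)
        moreover have "\<phi> \<noteq> all x \<phi>" using sub_lt(9)[of \<phi> x] by (metis lt_irrefl)
        ultimately show ?thesis using R_ex[of "\<lambda>e. \<forall>z. R (ap h \<phi>) (N.upd e (num x) z)"] unfolding cla_def
          by (auto simp: c_inj c_dist c_dist[symmetric])
      qed
    qed
    then obtain c where c: "cla (upd h p c) p" by blast
    have "cla (upd h p c) \<psi>" if "Form \<psi>" "\<psi> \<prec> p" for \<psi>
    proof -
      have ne: "\<phi> \<noteq> p" if "\<phi> \<prec> \<psi> \<or> \<phi> = \<psi>" for \<phi> using that \<open>\<psi> \<prec> p\<close> lt_trans lt_irrefl by blast
      have sub: "\<psi> = neg \<phi> ==> \<phi> \<noteq> p" "\<psi> = imp \<phi> \<chi> ==> \<phi> \<noteq> p \<and> \<chi> \<noteq> p" "\<psi> = all x \<phi> ==> \<phi> \<noteq> p" for \<phi> \<chi> x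
        using ne[of \<phi>] ne[of \<chi>] sub_lt(5)[of \<phi>] sub_lt(6)[of \<phi> \<chi>] sub_lt(7)[of \<chi> \<phi>] sub_lt(9)[of \<phi> x]
        by (simp_all add: disjI1)
      have "cla h \<psi>" using h that unfolding coh_def by blast
      then show ?thesis unfolding cla_def using sub ne[of \<psi>] by simp
    qed
    then have "coh (upd h p c) b" unfolding coh_def b using c by blast
    then show ?thesis ..
  qed
qed

text \<open>Definable in the world for all codes together, but in \<open>N\<close> only for one code
  at a time (\<open>TrJ_dfN\<close>). \<open>T_ex\<close> bridges this gap below a bound.\<close>

definition TrJ where "TrJ \<psi> e \<longleftrightarrow> (\<exists>h b. coh h b \<and> \<psi> \<prec> b \<and> R (ap h \<psi>) e)"

lemma df_TrJ: "dt s ==> dn t ==> df (\<lambda>e. TrJ (s e) (t e))"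
proof -
  assume s: "dt s" "dn t"
  have "df (\<lambda>e. TrJ (e (Suc 0)) (nm (e 0)))" unfolding TrJ_def by (intro jdfs df_coh)
  from df_comp2[of "\<lambda>a b. TrJ b (nm a)" "\<lambda>e. e 0", OF this dt_var dt_weak[OF s(1)]]
  have "df (\<lambda>e. nm (e 0) = t (\<lambda>i. e (Suc i)) \<and> TrJ (s (\<lambda>i. e (Suc i))) (nm (e 0)))"
    using s(2) unfolding dn_def by (rule df_conj[rotated])
  then have "df (\<lambda>e. \<exists>a. nm a = t e \<and> TrJ (s e) (nm a))" by (rule df_ex)
  moreover have "TrJ (s e) (t e) \<longleftrightarrow> (\<exists>a. nm a = t e \<and> TrJ (s e) (nm a))" for e using nm_surj by metis
  ultimately show ?thesis by simp
qed

lemma TrJ_table: assumes "Form \<psi>" shows "\<exists>h b. coh h b \<and> \<psi> \<prec> b \<and> (\<forall>\<phi> e. Form \<phi> --> \<phi> \<prec> b --> TrJ \<phi> e = R (ap h \<phi>) e)"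
proof -
  obtain b where "\<psi> \<prec> b" using E_lt[of \<psi> "up \<psi> \<psi>"] by auto
  moreover obtain h where "coh h b" using coh_ex by blast
  ultimately show ?thesis unfolding TrJ_def using coh_unique by blast
qed

lemma TrJ_dfN: assumes F: "Form \<psi>" shows "dfN (\<lambda>e. TrJ \<psi> (e 0))"
proof -
  obtain h b where "\<psi> \<prec> b" "\<forall>\<phi> e. Form \<phi> --> \<phi> \<prec> b --> TrJ \<phi> e = R (ap h \<phi>) e" using TrJ_table[OF F] by blast
  then show ?thesis using R_dfN[of "ap h \<psi>"] F by simp
qed

lemma TrJ_clauses:
  "isv x ==> isv y ==> TrJ (mem x y) e \<longleftrightarrow> EJ (N.ap e (num x)) (N.ap e (num y))"
  "isv x ==> isv y ==> TrJ (eq x y) e \<longleftrightarrow> QJ (N.ap e (num x)) (N.ap e (num y))"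
  "Form \<phi> ==> TrJ (neg \<phi>) e \<longleftrightarrow> \<not> TrJ \<phi> e"
  "Form \<phi> ==> Form \<chi> ==> TrJ (imp \<phi> \<chi>) e \<longleftrightarrow> (TrJ \<phi> e --> TrJ \<chi> e)"
  "isv x ==> Form \<phi> ==> TrJ (all x \<phi>) e \<longleftrightarrow> (\<forall>z. TrJ \<phi> (N.upd e (num x) z))"
proof -
  have t: "\<exists>h b. coh h b \<and> \<psi> \<prec> b \<and> (\<forall>\<phi> e. Form \<phi> --> \<phi> \<prec> \<psi> \<or> \<phi> = \<psi> --> TrJ \<phi> e = R (ap h \<phi>) e)" if "Form \<psi>" for \<psi>
    using TrJ_table[OF that] lt_trans by metis
  show "isv x ==> isv y ==> TrJ (mem x y) e \<longleftrightarrow> EJ (N.ap e (num x)) (N.ap e (num y))"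
    using t[of "mem x y"] coh_clauses(1) by (metis F_mem)
  show "isv x ==> isv y ==> TrJ (eq x y) e \<longleftrightarrow> QJ (N.ap e (num x)) (N.ap e (num y))"
    using t[of "eq x y"] coh_clauses(2) by (metis F_eq)
  show "Form \<phi> ==> TrJ (neg \<phi>) e \<longleftrightarrow> \<not> TrJ \<phi> e"
    using t[of "neg \<phi>"] coh_clauses(3) sub_lt(5) by (metis F_neg)
  show "Form \<phi> ==> Form \<chi> ==> TrJ (imp \<phi> \<chi>) e \<longleftrightarrow> (TrJ \<phi> e --> TrJ \<chi> e)"
    using t[of "imp \<phi> \<chi>"] coh_clauses(4) sub_lt(6,7) by (metis F_imp)
  show "isv x ==> Form \<phi> ==> TrJ (all x \<phi>) e \<longleftrightarrow> (\<forall>z. TrJ \<phi> (N.upd e (num x) z))"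
    using t[of "all x \<phi>"] coh_clauses(5) sub_lt(9) by (metis F_all)
qed

definition isT where
  "isT k T \<longleftrightarrow> (\<forall>\<phi> e. Form \<phi> --> \<phi> \<prec> k --> (T (num \<phi>) e \<longleftrightarrow> TrJ \<phi> e)) \<and>
     (\<forall>u e. T u e --> (\<exists>\<phi>. Form \<phi> \<and> \<phi> \<prec> k \<and> u = num \<phi>))"

text \<open>Formulas are added one at a time up to \<open>k\<close>, each by its satisfaction class,
  which is definable in \<open>N\<close>. The growing predicate is represented by an
  \<open>R\<close>-code, so the induction takes place in the world.\<close>

lemma T_ex: "\<exists>T. dfN (\<lambda>e. T (e 0) (e (Suc 0))) \<and> isT k T"
proof -
  let ?P = "\<lambda>k. \<exists>c. (\<forall>\<phi> e. Form \<phi> --> \<phi> \<prec> k --> (R c (N.pr (num \<phi>) e) \<longleftrightarrow> TrJ \<phi> e)) \<and>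
     (\<forall>u e. R c (N.pr u e) --> (\<exists>\<phi>. Form \<phi> \<and> \<phi> \<prec> k \<and> u = num \<phi>))"
  have "?P k"
  proof (rule seg_induct[of ?P])
    show "df (\<lambda>e. ?P (e 0))" by (intro jdfs df_TrJ)
    show "?P b" if "\<And>x. \<not> x \<prec> b" for b using R_ex[OF N.df_const[of False]] that by auto
    fix b p assume b: "\<And>x. x \<prec> b \<longleftrightarrow> x \<prec> p \<or> x = p" and "?P p"
    then obtain c where c: "\<And>\<phi> e. Form \<phi> ==> \<phi> \<prec> p ==> (R c (N.pr (num \<phi>) e) \<longleftrightarrow> TrJ \<phi> e)"
      "\<And>u e. R c (N.pr u e) ==> \<exists>\<phi>. Form \<phi> \<and> \<phi> \<prec> p \<and> u = num \<phi>" by blast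
    show "?P b"
    proof (cases "Form p")
      case False
      then show ?thesis using c b by (intro exI[of _ c]) metis
    next
      case True
      have "dfN (\<lambda>e. R c (e 0) \<or> (\<exists>x. e 0 = N.pr (num p) x \<and> TrJ p x))"
        by (intro jdfN N.df_comp1[OF TrJ_dfN[OF True]])
      from R_ex[OF this] obtain d where d: "\<And>z. R d z \<longleftrightarrow> R c z \<or> (\<exists>x. z = N.pr (num p) x \<and> TrJ p x)" by blast
      have "\<not> R c (N.pr (num p) e)" for e using c(2)[of "num p" e] by auto
      note nR = this
      show ?thesis
      proof (rule exI[of _ d], intro conjI allI impI)
        fix \<phi> e assume p: "Form \<phi>" "\<phi> \<prec> b"
        show "R d (N.pr (num \<phi>) e) = TrJ \<phi> e"
        proof (cases "\<phi> = p")
          case True then show ?thesis using nR d by simp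
        next
          case False then show ?thesis using c(1)[OF p(1)] p(2) b d by simp
        qed
      next
        fix u e assume "R d (N.pr u e)"
        then have "R c (N.pr u e) \<or> u = num p" unfolding d by auto
        then show "\<exists>\<phi>. Form \<phi> \<and> \<phi> \<prec> b \<and> u = num \<phi>" using c(2)[of u e] b True by blast
      qed
    qed
  qed
  then obtain c where "(\<forall>\<phi> e. Form \<phi> --> \<phi> \<prec> k --> (R c (N.pr (num \<phi>) e) \<longleftrightarrow> TrJ \<phi> e)) \<and>
     (\<forall>u e. R c (N.pr u e) --> (\<exists>\<phi>. Form \<phi> \<and> \<phi> \<prec> k \<and> u = num \<phi>))" by blast
  moreover have "dfN (\<lambda>e. R c (N.pr (e 0) (e (Suc 0))))" by (intro jdfN)
  ultimately show ?thesis unfolding isT_def by (intro exI[of _ "\<lambda>u e. R c (N.pr u e)"]) blast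
qed

lemma FT_J:
  assumes "\<And>a. QJ a a" "\<And>a b. QJ a b ==> QJ b a" "\<And>a b c. QJ a b ==> QJ b c ==> QJ a c"
    "\<And>a b c d. QJ a c ==> QJ b d ==> EJ a b ==> EJ c d"
  shows "FT isv Form mem eq neg imp all fv sv (\<lambda>g. True) (\<lambda>g x. N.ap g (num x)) (\<lambda>g x a. N.upd g (num x) a)
    TrJ EJ QJ N.emp"
proof
  fix g g' :: 'n and \<phi> assume F: "Form \<phi>" and c: "\<And>x. isv x ==> fv \<phi> x ==> QJ (N.ap g (num x)) (N.ap g' (num x))"
  let ?P = "\<lambda>\<phi>. \<forall>g g'. (\<forall>x. isv x --> fv \<phi> x --> QJ (N.ap g (num x)) (N.ap g' (num x))) --> (TrJ \<phi> g \<longleftrightarrow> TrJ \<phi> g')"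
  have "?P \<phi>"
  proof (rule F_induct[of ?P, OF _ F])
    show "df (\<lambda>e. ?P (e 0))" by (intro jdfs df_TrJ)
    show "?P (mem x y)" if v: "isv x" "isv y" for x y
    proof (intro allI impI)
      fix g g' assume "\<forall>z. isv z --> fv (mem x y) z --> QJ (N.ap g (num z)) (N.ap g' (num z))"
      then have q: "QJ (N.ap g (num x)) (N.ap g' (num x))" "QJ (N.ap g (num y)) (N.ap g' (num y))"
        using v fv_mem by auto
      show "TrJ (mem x y) g = TrJ (mem x y) g'"
        unfolding TrJ_clauses(1)[OF v] using assms(4)[OF q] assms(4)[OF q[THEN assms(2)]] by blast
    qed
    show "?P (eq x y)" if v: "isv x" "isv y" for x y
    proof (intro allI impI)
      fix g g' assume "\<forall>z. isv z --> fv (eq x y) z --> QJ (N.ap g (num z)) (N.ap g' (num z))"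
      then have q: "QJ (N.ap g (num x)) (N.ap g' (num x))" "QJ (N.ap g (num y)) (N.ap g' (num y))"
        using v fv_eq by auto
      show "TrJ (eq x y) g = TrJ (eq x y) g'"
        unfolding TrJ_clauses(2)[OF v]
        using assms(3)[OF assms(3)[OF assms(2)[OF q(1)]] q(2)] assms(3)[OF assms(3)[OF q(1)] assms(2)[OF q(2)]] by blast
    qed
    show "?P (neg \<phi>)" if "Form \<phi>" "?P \<phi>" for \<phi> using that by (simp add: TrJ_clauses fv_neg)
    show "?P (imp \<phi> \<psi>)" if "Form \<phi>" "Form \<psi>" "?P \<phi>" "?P \<psi>" for \<phi> \<psi>
      using that by (simp add: TrJ_clauses fv_imp) meson
    show "?P (all x \<phi>)" if h: "isv x" "Form \<phi>" "?P \<phi>" for x \<phi>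
    proof (intro allI impI)
      fix g g' assume c: "\<forall>y. isv y --> fv (all x \<phi>) y --> QJ (N.ap g (num y)) (N.ap g' (num y))"
      have "TrJ \<phi> (N.upd g (num x) z) = TrJ \<phi> (N.upd g' (num x) z)" for z
      proof -
        have "\<forall>y. isv y --> fv \<phi> y --> QJ (N.ap (N.upd g (num x) z) (num y)) (N.ap (N.upd g' (num x) z) (num y))"
          using c h assms(1) by (auto simp: fv_all)
        then show ?thesis using h(3) by blast
      qed
      then show "TrJ (all x \<phi>) g = TrJ (all x \<phi>) g'" using h by (simp add: TrJ_clauses)
    qed
  qed
  then show "TrJ \<phi> g = TrJ \<phi> g'" using c by blast
qed (simp_all add: TrJ_clauses assms(1), (use assms(2) in blast), (use assms(3) in blast), (use assms(4) in blast))

end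

end

lemma (in dfl) df_finite: "finite X ==> dt s ==> df (\<lambda>e. s e \<in> X)"
proof (induction X rule: finite_induct)
  case (insert x X)
  then have "df (\<lambda>e. s e = x \<or> s e \<in> X)" by (intro dfs0)
  then show ?case by simp
qed (simp add: df_const)

context Syn begin

context
  assumes consistent: "\<exists>\<phi>. Form \<phi> \<and> \<not> Th \<phi>"
begin

lemma dt_va: "dt s ==> dt (\<lambda>e. va (s e))"
proof (rule dt_comp1[of va])
  have "(y = va a) \<longleftrightarrow> (isv a \<and> y = a) \<or> (\<not> isv a \<and> y = sv 0)" for y a by (auto simp: va_def[OF consistent])
  then show "dt (\<lambda>e. va (e 0))" unfolding dt_def by (simp only:) (intro hdfs)
qed

text \<open>The reassignments unfold into finitely many uses of \<open>mA\<close>, each a definable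
  condition on names. The first conjunct records that \<open>X\<close> does not vary with the names,
  so avoiding \<open>X\<close> is definable too.\<close>

lemma henkin_MD:
  assumes "\<forall>p\<in>set ps. isv (fst p) \<and> dt (snd p)"
  shows "fst (snd (mdl hmd (map (\<lambda>p. (fst p, snd p e)) ps) hg0)) = fst ` set ps \<and>
    (\<forall>s f. dt s --> df (\<lambda>e. hTr (s e) (mdl hmd (map (\<lambda>p. (fst p, snd p (\<lambda>i. e (f i)))) ps) hg0)))"
  using assms
proof (induction ps arbitrary: e rule: rev_induct)
  case Nil
  then show ?case using df_D by (simp add: mdl_def)
next
  case (snoc p ps)
  let ?G = "\<lambda>e. mdl hmd (map (\<lambda>p. (fst p, snd p e)) ps) hg0"
  have G: "mdl hmd (map (\<lambda>p. (fst p, snd p e)) (ps @ [p])) hg0 = hmd (?G e) (fst p) (snd p e)" for e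
    by (simp add: mdl_def)
  have ok: "\<forall>p\<in>set ps. isv (fst p) \<and> dt (snd p)" using snoc.prems by auto
  have X: "fst (snd (?G e)) = fst ` set ps" for e using snoc.IH[OF ok] by blast
  have IH: "dt s ==> df (\<lambda>e. fst (?G (\<lambda>i. e (f i))) (s e))" for s f using snoc.IH[OF ok] by blast
  have p: "isv (fst p)" "dt (snd p)" using snoc.prems by auto
  show ?case unfolding G
  proof (intro conjI allI impI)
    show "fst (snd (hmd (?G e) (fst p) (snd p e))) = fst ` set (ps @ [p])" for e using X by simp
    fix s f assume s: "dt s"
    have "df (\<lambda>e. Form (s e) \<and> (\<exists>w. isv w \<and> w \<notin> insert (fst p) (fst ` set ps) \<and>
        D (eq (va (snd p (\<lambda>i. e (f i)))) (va w)) \<and> fst (?G (\<lambda>i. e (f i))) (sb (fst p) w (s e))))"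
      by (intro df_conj df_ex df_neg df_finite finite_insert[THEN iffD2] finite_imageI finite_set
          df_comp1[OF df_Form0] df_comp1[OF df_isv0] s dt_var df_D dt_comp2[OF dt_eq0] dt_va
          dt_re[OF p(2)] IH dt_sb dt_const dt_weak)
    then show "df (\<lambda>e. hTr (s e) (hmd (?G (\<lambda>i. e (f i))) (fst p) (snd p (\<lambda>i. e (f i)))))"
      unfolding fst_conv X mA_def[OF consistent] hQ_def[OF consistent] .
  qed
qed

end

end

lemma Syn_to_L:
  fixes E :: "nat => nat => bool"
  assumes "Syn E df lt isv Form mem eq neg imp all fvc sv Th" and con: "\<exists>\<phi>. Form \<phi> \<and> \<not> Th \<phi>"
    and S: "\<And>\<phi>. codes.Sax isv Form mem eq neg imp all fvc sv \<phi> ==> Th \<phi>"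
  shows "\<exists>(EN :: nat => nat => bool) dfN nm R. L E df lt isv Form mem eq neg imp all fvc sv Th EN dfN nm R"
proof -
  interpret Syn E df lt isv Form mem eq neg imp all fvc sv Th by fact
  interpret J: FT isv Form mem eq neg imp all fvc sv hAsg hlook hmd hTr hE hQ hg0
    using FT_henkin[OF con] .
  \<comment> \<open>Elements of the Henkin model are elements of the world, so each names
    itself.\<close>
  interpret FTM E df lt isv Form mem eq neg imp all fvc sv Th hAsg hlook hmd hTr hE hQ hg0 "\<lambda>x. x"
  proof
    show "\<exists>a. hQ a x" for x using hQ_refl[OF con] by blast
    show "J.valid \<phi>" if "Sax \<phi>" for \<phi>
      unfolding J.valid_def using chtD(2)[OF con] S[OF that] Inv_def[OF con] by blast
    show "df (\<lambda>e. hTr (s e) (mdl hmd (map (\<lambda>p. (fst p, snd p e)) ps) hg0))"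
      if "\<And>v t. (v, t) \<in> set ps ==> isv v \<and> dt t" "dt s" for ps s
      using henkin_MD[OF con, of ps, THEN conjunct2, rule_format, of s "\<lambda>i. i"] that by auto
  qed
  from to_L show ?thesis by (elim exE conjE) (intro exI, assumption)
qed

section \<open>Values of terms and decisions\<close>

context L begin

abbreviation "one \<equiv> N.up N.emp N.emp"

lemma pr_ne [simp]: "N.pr a b \<noteq> N.emp" "N.emp \<noteq> N.pr a b" "one \<noteq> N.emp" "N.emp \<noteq> one"
  "N.pr a b \<noteq> one" "one \<noteq> N.pr a b"
  using N.pr_elem[of a b] by (metis N.E_emp N.E_up)+

definition evA where
  "evA f e = (THE g. \<forall>q. EN q g \<longleftrightarrow> (\<exists>x s. EN (N.pr x s) e \<and> q = N.pr x (N.ap f (N.ap e x))))"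

lemma E_evA: "EN q (evA f e) \<longleftrightarrow> (\<exists>x s. EN (N.pr x s) e \<and> q = N.pr x (N.ap f (N.ap e x)))"
  unfolding evA_def
proof (rule N.the_set)
  have "\<exists>b. \<forall>q. EN q b \<longleftrightarrow> (\<exists>p. EN p e \<and> (\<exists>x s. p = N.pr x s \<and> q = N.pr x (N.ap f (N.ap e x))))"
    by (rule N.repl) (intro N.dfs4, auto)
  moreover have "(\<exists>p. EN p e \<and> (\<exists>x s. p = N.pr x s \<and> q = N.pr x (N.ap f (N.ap e x)))) \<longleftrightarrow>
      (\<exists>x s. EN (N.pr x s) e \<and> q = N.pr x (N.ap f (N.ap e x)))" for q by blast
  ultimately show "\<exists>s. \<forall>q. EN q s \<longleftrightarrow> (\<exists>x s. EN (N.pr x s) e \<and> q = N.pr x (N.ap f (N.ap e x)))" by simp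
qed

lemma dt_evA: "N.dt s ==> N.dt t ==> N.dt (\<lambda>e. evA (s e) (t e))"
  by (rule N.dt_comp2) (unfold N.dt_def N.eq_set E_evA, intro N.dfs4)

context
  fixes T :: "'n => 'n => bool"
  assumes T: "dfN (\<lambda>e. T (e 0) (e (Suc 0)))"
begin

lemmas df_T = N.df_comp2[of T, OF T]

lemma df_skol0: "dfN (\<lambda>a. \<not> T u (N.upd g k (a 0)))" by (intro N.dfs4 df_T)

text \<open>
  An element of \<open>N\<close> is a term: the empty set denotes itself, \<open>(\<emptyset>, x)\<close> is the constant for \<open>x\<close>, the
  tuple \<open>(one, u, k, e)\<close> is the Skolem term for the least counterexample to \<open>T u\<close> at the variable \<open>k\<close>
  under the assignment \<open>e\<close> of terms to variables, and everything else is the new element \<open>c\<close>.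
  \<open>evP n t f y\<close> says that \<open>t\<close> has value \<open>y\<close> when \<open>c\<close> is \<open>n\<close> and \<open>f\<close> is the table of earlier values.
\<close>

definition evP where
  "evP n t f y \<longleftrightarrow> (t = N.emp \<and> y = N.emp) \<or> (t = N.pr N.emp y) \<or>
    (\<exists>u k e. t = N.pr one (N.pr u (N.pr k e)) \<and> y = N.lstd (\<lambda>z. \<not> T u (N.upd (evA f e) k z))) \<or>
    (t \<noteq> N.emp \<and> (\<forall>x. t \<noteq> N.pr N.emp x) \<and> (\<forall>u k e. t \<noteq> N.pr one (N.pr u (N.pr k e))) \<and> y = n)"

definition evG where "evG n t f = (THE y. evP n t f y)"

lemma evP_ex1: "\<exists>!y. evP n t f y"
proof -
  consider "t = N.emp" | x where "t = N.pr N.emp x" | u k e where "t = N.pr one (N.pr u (N.pr k e))"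
    | "t \<noteq> N.emp" "\<forall>x. t \<noteq> N.pr N.emp x" "\<forall>u k e. t \<noteq> N.pr one (N.pr u (N.pr k e))" by blast
  then show ?thesis by cases (simp_all add: evP_def)
qed

lemma eq_evG: "(y = evG n t f) \<longleftrightarrow> evP n t f y"
  unfolding evG_def using theI'[OF evP_ex1] evP_ex1 by metis

lemma dt_evG: "N.dt (\<lambda>e. evG (e 0) (e (Suc 0)) (e (Suc (Suc 0))))"
  unfolding N.dt_def eq_evG evP_def N.eq_lstd[OF df_skol0] by (intro N.dfs4 df_T dt_evA)

definition eval where "eval t n = N.rec evG n t"
definition eA where "eA e n = (THE g. \<forall>q. EN q g \<longleftrightarrow> (\<exists>x s. EN (N.pr x s) e \<and> q = N.pr x (eval (N.ap e x) n)))"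

lemma dt_eval: "N.dt s ==> N.dt t ==> N.dt (\<lambda>e. eval (s e) (t e))"
  unfolding eval_def by (intro N.dt_rec[OF dt_evG])

lemma E_eA: "EN q (eA e n) \<longleftrightarrow> (\<exists>x s. EN (N.pr x s) e \<and> q = N.pr x (eval (N.ap e x) n))"
  unfolding eA_def
proof (rule N.the_set)
  have "\<exists>b. \<forall>q. EN q b \<longleftrightarrow> (\<exists>p. EN p e \<and> (\<exists>x s. p = N.pr x s \<and> q = N.pr x (eval (N.ap e x) n)))"
    by (rule N.repl) (intro N.dfs4 dt_eval, auto)
  moreover have "(\<exists>p. EN p e \<and> (\<exists>x s. p = N.pr x s \<and> q = N.pr x (eval (N.ap e x) n))) \<longleftrightarrow>
      (\<exists>x s. EN (N.pr x s) e \<and> q = N.pr x (eval (N.ap e x) n))" for q by blast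
  ultimately show "\<exists>s. \<forall>q. EN q s \<longleftrightarrow> (\<exists>x s. EN (N.pr x s) e \<and> q = N.pr x (eval (N.ap e x) n))" by simp
qed

lemma dt_eA: "N.dt s ==> N.dt t ==> N.dt (\<lambda>e. eA (s e) (t e))"
  by (rule N.dt_comp2) (unfold N.dt_def N.eq_set E_eA, intro N.dfs4 dt_eval)

lemma evP_eval: "evP n t (N.tab evG n t) (eval t n)"
  unfolding eq_evG[symmetric] eval_def N.rec_def ..

lemma eval_emp [simp]: "eval N.emp n = N.emp"
  using evP_eval[of n N.emp] by (simp add: evP_def)

lemma eval_const [simp]: "eval (N.pr N.emp x) n = x"
  using evP_eval[of n "N.pr N.emp x"] by (simp add: evP_def)

lemma eval_other: "t \<noteq> N.emp ==> (\<And>x. t \<noteq> N.pr N.emp x) ==> (\<And>u k e. t \<noteq> N.pr one (N.pr u (N.pr k e))) ==> eval t n = n"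
  using evP_eval[of n t] by (simp add: evP_def)

lemma ap_eA: "N.ap (eA e n) x = eval (N.ap e x) n"
proof (cases "\<exists>s. EN (N.pr x s) e")
  case True then show ?thesis by (intro N.ap_eq) (auto simp: E_eA)
next
  case False
  then have "N.ap e x = N.emp" "N.ap (eA e n) x = N.emp" by (intro N.ap_none, simp add: E_eA)+
  then show ?thesis by simp
qed

lemma eA_upd: "eA (N.upd e x t) n = N.upd (eA e n) x (eval t n)"
proof (rule N.ext)
  fix q
  have "EN q (eA (N.upd e x t) n) \<longleftrightarrow> (\<exists>y. (y = x \<or> (\<exists>s. EN (N.pr y s) e)) \<and> q = N.pr y (eval (if y = x then t else N.ap e y) n))"
    unfolding E_eA by auto
  also have "\<dots> \<longleftrightarrow> EN q (N.upd (eA e n) x (eval t n))" by (auto simp: E_eA)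
  finally show "EN q (eA (N.upd e x t) n) \<longleftrightarrow> EN q (N.upd (eA e n) x (eval t n))" .
qed

lemma lt_in_pr: "lam EN a (N.pr a b)" "lam EN b (N.pr a b)"
  by (rule N.lt_trans[OF N.E_lt N.E_lt], rule N.pr_elem(1), rule N.pr_elem(3))
    (rule N.lt_trans[OF N.E_lt N.E_lt], rule N.pr_elem(2), rule N.pr_elem(3))

text \<open>Makes the evaluation of Skolem terms a recursion along the order: the terms in an
  assignment are smaller than the Skolem term, apart from the default \<open>emp\<close>, whose
  value is fixed.\<close>

lemma ap_lt: "N.ap e x = N.emp \<or> lam EN (N.ap e x) e"
proof (cases "\<exists>!y. EN (N.pr x y) e")
  case True
  then have "EN (N.pr x (N.ap e x)) e" unfolding N.ap_def using theI'[OF True] by simp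
  then show ?thesis using N.lt_trans[OF lt_in_pr(2) N.E_lt] by blast
qed (simp add: N.ap_def)

lemma ap_tab_le:
  assumes "s = N.emp \<or> lam EN s t" shows "N.ap (N.tab evG n t) s = eval s n"
proof (cases "lam EN s t")
  case True then show ?thesis unfolding eval_def by (rule N.ap_tab[OF dt_evG])
next
  case False
  then have "N.ap (N.tab evG n t) s = N.emp" by (intro N.ap_none) (auto simp: N.E_tab[OF dt_evG])
  then show ?thesis using False assms by simp
qed

lemma sk_lt: "lam EN e (N.pr one (N.pr u (N.pr k e)))"
  by (rule N.lt_trans[OF lt_in_pr(2) N.lt_trans[OF lt_in_pr(2) lt_in_pr(2)]])

lemma eval_sk: "eval (N.pr one (N.pr u (N.pr k e))) n = N.lstd (\<lambda>z. \<not> T u (N.upd (eA e n) k z))"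
proof -
  let ?t = "N.pr one (N.pr u (N.pr k e))"
  have "N.ap (N.tab evG n ?t) (N.ap e x) = eval (N.ap e x) n" for x
    by (rule ap_tab_le) (use ap_lt[of e x] N.lt_trans[OF _ sk_lt[of e u k]] in blast)
  then have "evA (N.tab evG n ?t) e = eA e n" by (intro N.ext) (simp add: E_evA E_eA)
  moreover have "eval ?t n = N.lstd (\<lambda>z. \<not> T u (N.upd (evA (N.tab evG n ?t) e) k z))"
    using evP_eval[of n ?t] by (auto simp: evP_def)
  ultimately show ?thesis by simp
qed

text \<open>An atomic statement is a pair of a code and an assignment of terms; its truth depends on
  the value \<open>n\<close> given to the new element.\<close>

definition holds where "holds a n \<longleftrightarrow> (\<exists>u e. a = N.pr u e \<and> T u (eA e n))"

lemma holds_pr [simp]: "holds (N.pr u e) n \<longleftrightarrow> T u (eA e n)" by (simp add: holds_def)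

lemma df_holds: "N.dt s ==> N.dt t ==> dfN (\<lambda>e. holds (s e) (t e))"
  by (rule N.df_comp2) (unfold holds_def, intro N.dfs4 df_T dt_eA)

text \<open>
  The decisions follow the leftmost branch along which the pattern of decided atoms is realized
  by unboundedly many \<open>n\<close>, so \<open>decd\<close> behaves like an ultrafilter on atoms.
\<close>

definition decP where
  "decP a f \<longleftrightarrow> (\<forall>m. \<exists>n. lam EN m n \<and> (\<forall>b. lam EN b a --> (holds b n \<longleftrightarrow> N.ap f b = one)) \<and> holds a n)"
definition decG where "decG (p :: 'n) a f = (if decP a f then one else N.emp)"
definition decd where "decd a \<longleftrightarrow> N.rec decG N.emp a = one"

lemma dt_decG: "N.dt (\<lambda>e. decG (e 0) (e (Suc 0)) (e (Suc (Suc 0))))"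
proof -
  have "(y = decG p a f) \<longleftrightarrow> (decP a f \<and> y = one) \<or> (\<not> decP a f \<and> y = N.emp)" for y p a f by (simp add: decG_def)
  then show ?thesis unfolding N.dt_def by (simp only: decP_def) (intro N.dfs4 df_holds)
qed

lemma df_decd: "N.dt s ==> dfN (\<lambda>e. decd (s e))"
  unfolding decd_def by (intro N.dfs4 N.dt_rec[OF dt_decG])

lemma decd_iff: "decd a \<longleftrightarrow> (\<forall>m. \<exists>n. lam EN m n \<and> (\<forall>b. lam EN b a --> (holds b n \<longleftrightarrow> decd b)) \<and> holds a n)"
proof -
  have "decd a \<longleftrightarrow> decP a (N.tab decG N.emp a)" unfolding decd_def N.rec_def decG_def by simp
  moreover have "N.ap (N.tab decG N.emp a) b = N.rec decG N.emp b" if "lam EN b a" for b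
    using N.ap_tab[OF dt_decG that] .
  ultimately show ?thesis unfolding decP_def decd_def by (metis (no_types, lifting))
qed

text \<open>If \<open>p\<close> is decided negatively, then above some \<open>m0\<close> no
  \<open>n\<close> that follows the branch so far satisfies \<open>p\<close>; an \<open>n\<close>
  above both \<open>m\<close> and \<open>m0\<close> therefore continues the branch.\<close>

lemma decd_agree: "\<exists>n. lam EN m n \<and> (\<forall>b. lam EN b a --> (holds b n \<longleftrightarrow> decd b))"
proof -
  let ?P = "\<lambda>a. \<forall>m. \<exists>n. lam EN m n \<and> (\<forall>b. lam EN b a --> (holds b n \<longleftrightarrow> decd b))"
  have "?P a"
  proof (rule N.seg_induct[of ?P])
    show "dfN (\<lambda>e. ?P (e 0))" by (intro N.dfs4 df_holds df_decd)
    show "?P b" if "\<And>x. \<not> lam EN x b" for b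
    proof
      fix m
      have "lam EN m (N.up m m)" by (rule N.E_lt) simp
      then show "\<exists>n. lam EN m n \<and> (\<forall>x. lam EN x b --> (holds x n \<longleftrightarrow> decd x))" using that by blast
    qed
    fix b p assume b: "\<And>x. lam EN x b \<longleftrightarrow> lam EN x p \<or> x = p" and IH: "?P p"
    show "?P b"
    proof (cases "decd p")
      case True
      then have "\<forall>m. \<exists>n. lam EN m n \<and> (\<forall>b. lam EN b p --> (holds b n \<longleftrightarrow> decd b)) \<and> holds p n"
        unfolding decd_iff[of p] .
      then show ?thesis unfolding b using True by blast
    next
      case False
      then have "\<not> (\<forall>m. \<exists>n. lam EN m n \<and> (\<forall>b. lam EN b p --> (holds b n \<longleftrightarrow> decd b)) \<and> holds p n)"
        unfolding decd_iff[of p] .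
      then obtain m0 where m0: "\<And>n. lam EN m0 n ==> (\<forall>b. lam EN b p --> (holds b n \<longleftrightarrow> decd b)) ==> \<not> holds p n"
        by blast
      show ?thesis
      proof
        fix m
        obtain n where n: "lam EN (N.up m m0) n" "\<forall>b. lam EN b p --> (holds b n \<longleftrightarrow> decd b)" using IH by blast
        have "lam EN m (N.up m m0)" "lam EN m0 (N.up m m0)" by (simp_all add: N.E_lt)
        then have "lam EN m n" "lam EN m0 n" using N.lt_trans[OF _ n(1)] by blast+
        then show "\<exists>n. lam EN m n \<and> (\<forall>x. lam EN x b --> (holds x n \<longleftrightarrow> decd x))"
          using m0[of n, OF _ n(2)] n(2) b False by (intro exI[of _ n]) auto
      qed
    qed
  qed
  then show ?thesis by blast
qed

text \<open>The form of the finite intersection property used from now on: a claim about several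
  decisions is checked at one value \<open>n\<close> where they all agree with actual truth.\<close>

lemma decd_fin: assumes "finite A" shows "\<exists>n. lam EN m n \<and> (\<forall>b\<in>A. holds b n \<longleftrightarrow> decd b)"
proof -
  have "\<exists>s. \<forall>b\<in>A. EN b s" using assms
  proof induction
    case (insert a A)
    then obtain s where "\<forall>b\<in>A. EN b s" by blast
    then show ?case by (intro exI[of _ "N.adj s a"]) auto
  qed simp
  then obtain s where "\<forall>b\<in>A. EN b s" by blast
  then show ?thesis using decd_agree[of m s] N.E_lt by blast
qed

end

end

text \<open>The order as a formula in the variables 0 and 1, so that Los's theorem also covers
  comparisons of terms.\<close>

definition lamF :: fm where
  "lamF = (let
      up = (\<lambda>c a b. \<^bold>\<forall>z. z \<^bold>\<in> c \<^bold>\<longleftrightarrow> z \<^bold>= a \<^bold>\<or> z \<^bold>= b);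
      rel = (\<lambda>r x y. \<^bold>\<exists>p. (\<^bold>\<exists>a b. up a x x \<^bold>\<and> up b x y \<^bold>\<and> up p a b) \<^bold>\<and> p \<^bold>\<in> r)
    in (\<^bold>\<exists>t r. ((\<^bold>\<forall>y z. z \<^bold>\<in> y \<^bold>\<longrightarrow> y \<^bold>\<in> t \<^bold>\<longrightarrow> z \<^bold>\<in> t) \<^bold>\<and>
        (\<^bold>\<forall>u v. u \<^bold>\<in> t \<^bold>\<longrightarrow> v \<^bold>\<in> t \<^bold>\<longrightarrow>
          (rel r u v \<^bold>\<longleftrightarrow> (\<^bold>\<exists>a. a \<^bold>\<in> v \<^bold>\<and> \<^bold>\<not> a \<^bold>\<in> u \<^bold>\<and> (\<^bold>\<forall>b. rel r a b \<^bold>\<longrightarrow> (b \<^bold>\<in> u \<^bold>\<longleftrightarrow> b \<^bold>\<in> v)))))) \<^bold>\<and>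
        0 \<^bold>\<in> t \<^bold>\<and> Suc 0 \<^bold>\<in> t \<^bold>\<and> rel r 0 (Suc 0)) 2)"

lemma sat_lamF: "sat E (=) e lamF \<longleftrightarrow> lam E (e 0) (e (Suc 0))"
  by (simp add: lamF_def Let_def lam_def lgood_def trn_def rl_def ispr_def isup_def)

lemma sat_hom:
  assumes "surj \<kappa>" "\<And>x y. \<kappa> x = \<kappa> y \<longleftrightarrow> Q x y" "\<And>x y. EH (\<kappa> x) (\<kappa> y) \<longleftrightarrow> EJ x y"
  shows "sat EJ Q e \<phi> \<longleftrightarrow> sat EH (=) (\<lambda>i. \<kappa> (e i)) \<phi>"
proof (induction \<phi> arbitrary: e)
  case (All x \<phi>)
  have "(\<lambda>i. \<kappa> ((e(x := a)) i)) = (\<lambda>i. \<kappa> (e i))(x := \<kappa> a)" for a by auto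
  then have "sat EJ Q (e(x := a)) \<phi> \<longleftrightarrow> sat EH (=) ((\<lambda>i. \<kappa> (e i))(x := \<kappa> a)) \<phi>" for a using All by metis
  then show ?case using assms(1) by (simp add: surj_def) metis
qed (simp_all add: assms)

text \<open>Soundness stated as closure of validity under the calculus. The induction on
  derivations, which may be nonstandard, is left to the induction principles assumed for
  \<open>Th\<close>.\<close>

lemma (in FT) logic_valid: "logic isv Form mem eq neg imp all fv sv (\<lambda>\<phi>. Form \<phi> \<and> valid \<phi>)"
proof unfold_locales
  fix \<phi> x assume h: "isv x" "Form \<phi>"
  have "Tr \<phi> g" if "Asg g" "\<forall>a. Tr \<phi> (md g x a)" for g
  proof -
    have "Tr \<phi> (md g x (look g x)) = Tr \<phi> g"
      by (rule Tr_cong) (use h that in \<open>auto simp: Tr_rules Q_refl\<close>)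
    then show ?thesis using that by blast
  qed
  then show "Form (imp (all x \<phi>) \<phi>) \<and> valid (imp (all x \<phi>) \<phi>)"
    using h by (simp add: F_rules valid_def Tr_rules)
  assume f: "\<not> fv \<phi> x"
  have "Tr \<phi> (md g x a)" if "Asg g" "Tr \<phi> g" for g a
  proof -
    have "Tr \<phi> (md g x a) = Tr \<phi> g"
      by (rule Tr_cong) (use h that f Q_refl in \<open>auto simp: Tr_rules\<close>)
    then show ?thesis using that by blast
  qed
  then show "Form (imp \<phi> (all x \<phi>)) \<and> valid (imp \<phi> (all x \<phi>))"
    using h by (simp add: F_rules valid_def Tr_rules)
next
  fix x y assume h: "isv x" "isv y"
  have "\<exists>a. Q (look (md g x a) x) (look (md g x a) y)" if "Asg g" for g
    using h that by (intro exI[of _ "look g y"]) (simp add: look_md Q_refl)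
  then show "Form (cexi x (eq x y)) \<and> valid (cexi x (eq x y))"
    using h by (simp add: F_rules valid_def Tr_neg Tr_all Tr_eq A_md)
next
  fix x y z assume h: "isv x" "isv y" "isv z"
  show "Form (imp (eq x y) (imp (eq x z) (eq y z))) \<and> valid (imp (eq x y) (imp (eq x z) (eq y z)))"
    using h by (auto simp: F_rules valid_def Tr_rules intro: Q_trans[OF Q_sym])
  show "Form (imp (eq x y) (imp (mem x z) (mem y z))) \<and> valid (imp (eq x y) (imp (mem x z) (mem y z)))"
    using h E_cong[OF _ Q_refl] by (auto simp: F_rules valid_def Tr_rules)
  show "Form (imp (eq x y) (imp (mem z x) (mem z y))) \<and> valid (imp (eq x y) (imp (mem z x) (mem z y)))"
    using h E_cong[OF Q_refl] by (auto simp: F_rules valid_def Tr_rules)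
qed (auto simp: F_rules valid_def Tr_rules)

section \<open>Truth of the axioms in \<open>N\<close>\<close>

context L begin

abbreviation "TN \<equiv> TrJ EN (=)"

lemmas TN_cl = TrJ_clauses[OF N.df_E0 N.df_eq0]

lemma JN: "FT isv Form mem eq neg imp all fv sv (\<lambda>g. True) (\<lambda>g x. N.ap g (num x)) (\<lambda>g x a. N.upd g (num x) a)
    TN EN (=) N.emp"
  by (rule FT_J[OF N.df_E0 N.df_eq0]) auto

sublocale JN: FT isv Form mem eq neg imp all fv sv "\<lambda>g. True" "\<lambda>g x. N.ap g (num x)" "\<lambda>g x a. N.upd g (num x) a"
  TN EN "(=)" N.emp by (rule JN)

lemma df_TN: "Form \<phi> ==> N.dt s ==> dfN (\<lambda>e. TN \<phi> (s e))"
  by (rule N.df_comp1[OF TrJ_dfN[OF N.df_E0 N.df_eq0]])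

lemma TN_cong: "Form \<phi> ==> (\<And>x. isv x ==> fv \<phi> x ==> N.ap g (num x) = N.ap g' (num x)) ==> TN \<phi> g = TN \<phi> g'"
  by (rule JN.Tr_cong) auto

text \<open>At a fixed code, even a nonstandard one, \<open>TN\<close> is definable in
  \<open>N\<close>; so the coded instance reduces to Separation in \<open>N\<close>.\<close>

lemma sepc_valid:
  assumes v: "isv x" "isv a" "isv b" "distinct [x, a, b]" and F: "Form \<phi>" "\<not> fv \<phi> b"
  shows "JN.valid (sepc x a b \<phi>)"
proof -
  let ?u = "\<lambda>g x a. N.upd g (num x) a"
  have "\<exists>B. \<forall>X. EN X B \<longleftrightarrow> EN X A \<and> TN \<phi> (?u (?u (?u g a A) b B) x X)" for g A
  proof -
    have "\<exists>B. \<forall>X. EN X B \<longleftrightarrow> EN X A \<and> TN \<phi> (?u (?u g a A) x X)"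
      by (rule N.sep) (intro df_TN F N.dfs4)
    moreover have "TN \<phi> (?u (?u (?u g a A) b B) x X) = TN \<phi> (?u (?u g a A) x X)" for B X
      by (rule TN_cong[OF F(1)]) (use F in auto)
    ultimately show ?thesis by simp
  qed
  then show ?thesis unfolding JN.valid_def sepc_def using v F by (simp add: TN_cl F_rules) blast
qed

lemma replc_valid:
  assumes v: "isv x" "isv y" "isv z" "isv a" "isv b" "distinct [x, y, z, a, b]"
    and F: "Form \<phi>" "\<not> fv \<phi> z" "\<not> fv \<phi> b"
  shows "JN.valid (replc x y z a b \<phi>)"
proof -
  let ?u = "\<lambda>g x a. N.upd g (num x) a"
  have "\<exists>B. \<forall>Y. EN Y B \<longleftrightarrow> (\<exists>X. EN X A \<and> TN \<phi> (?u (?u (?u (?u g a A) b B) y Y) x X))"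
    if h: "\<forall>X. EN X A --> (\<exists>Z. \<forall>Y. TN \<phi> (?u (?u (?u (?u g a A) x X) z Z) y Y) --> Y = Z)" for g A
  proof -
    have 1: "TN \<phi> (?u (?u (?u (?u g a A) x X) z Z) y Y) = TN \<phi> (?u (?u (?u g a A) x X) y Y)" for X Y Z
      by (rule TN_cong[OF F(1)]) (use F in auto)
    have 2: "TN \<phi> (?u (?u (?u (?u g a A) b B) y Y) x X) = TN \<phi> (?u (?u (?u g a A) x X) y Y)" for X Y B
      by (rule TN_cong[OF F(1)]) (use F v in auto)
    have "\<exists>B. \<forall>Y. EN Y B \<longleftrightarrow> (\<exists>X. EN X A \<and> TN \<phi> (?u (?u (?u g a A) x X) y Y))"
      by (rule N.repl) (intro df_TN F N.dfs4, use h[unfolded 1] in blast)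
    then show ?thesis unfolding 2 .
  qed
  note main = this
  have "TN (replc x y z a b \<phi>) g \<longleftrightarrow> (\<forall>A.
      (\<forall>X. EN X A --> (\<exists>Z. \<forall>Y. TN \<phi> (?u (?u (?u (?u g a A) x X) z Z) y Y) --> Y = Z)) -->
      (\<exists>B. \<forall>Y. EN Y B \<longleftrightarrow> (\<exists>X. EN X A \<and> TN \<phi> (?u (?u (?u (?u g a A) b B) y Y) x X))))" for g
  proof -
    have ne: "x \<noteq> y" "x \<noteq> z" "x \<noteq> a" "x \<noteq> b" "y \<noteq> z" "y \<noteq> a" "y \<noteq> b" "z \<noteq> a" "z \<noteq> b" "a \<noteq> b"
      "y \<noteq> x" "z \<noteq> x" "a \<noteq> x" "b \<noteq> x" "z \<noteq> y" "a \<noteq> y" "b \<noteq> y" "a \<noteq> z" "b \<noteq> z" "b \<noteq> a" using v(6) by auto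
    have ci: "TN (ciff P Q) g \<longleftrightarrow> (TN P g \<longleftrightarrow> TN Q g)" if "Form P" "Form Q" for P Q g
      using that by (auto simp: TN_cl F_rules)
    have cj: "TN (cconj P Q) g \<longleftrightarrow> TN P g \<and> TN Q g" if "Form P" "Form Q" for P Q g
      using that by (auto simp: TN_cl F_rules)
    have ce: "TN (cexi v P) g \<longleftrightarrow> (\<exists>w. TN P (?u g v w))" if "isv v" "Form P" for v P g
      using that by (auto simp: TN_cl F_rules)
    show ?thesis
      unfolding replc_def
      by (simp only: TN_cl(1,2,4,5) ci cj ce F_rules v(1-5) F(1) N.ap_upd num_inj ne if_False if_True simp_thms
            iff_conv_conj_imp[of "EN p q" for p q])
  qed
  then show ?thesis unfolding JN.valid_def using main by (simp only: True_implies_equals simp_thms) (intro allI impI)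
qed

lemma Sax_valid: "Sax \<phi> ==> JN.valid \<phi>"
proof -
  assume "Sax \<phi>"
  then consider "\<phi> \<in> cd ` {extensionality_ax, foundation_ax, pairing_ax, union_ax, power_ax}"
    | "\<phi> \<notin> cd ` {extensionality_ax, foundation_ax, pairing_ax, union_ax, power_ax}" by blast
  then show ?thesis
  proof cases
    case 1
    have "sat EN (=) e \<chi>" if "\<chi> \<in> {extensionality_ax, foundation_ax, pairing_ax, union_ax, power_ax}" for e \<chi>
      using that
    proof (elim insertE emptyE)
      show "\<chi> = extensionality_ax ==> sat EN (=) e \<chi>" by (simp add: extensionality_ax_def N.ext)
      show "\<chi> = foundation_ax ==> sat EN (=) e \<chi>"
        using N.found by (simp add: foundation_ax_def) metis
      show "\<chi> = pairing_ax ==> sat EN (=) e \<chi>" by (simp add: pairing_ax_def N.pair_ex)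
      show "\<chi> = union_ax ==> sat EN (=) e \<chi>" by (simp add: union_ax_def N.union_ex)
      show "\<chi> = power_ax ==> sat EN (=) e \<chi>" by (simp add: power_ax_def N.power_ex)
    qed
    then show ?thesis using 1 unfolding JN.valid_def by (auto simp: JN.Tr_cd)
  next
    case 2
    then show ?thesis using \<open>Sax \<phi>\<close> sepc_valid replc_valid unfolding Sax_def by blast
  qed
qed

end

section \<open>The term model\<close>

text \<open>\<open>ind_S\<close> and \<open>ind_F\<close> express that \<open>Th\<close> is what the
  calculus derives from either axiom system. They are restricted to definable predicates because
  derivations may be nonstandard.\<close>

locale Main = L E df lt isv Form mem eq neg imp all fv sv Th EN dfN nm R
  for E :: "'a => 'a => bool" and df and lt (infix "\<prec>" 50)
    and isv Form :: "'a => bool" and mem eq :: "'a => 'a => 'a" and neg imp all fv sv Th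
    and EN :: "nat => nat => bool" and dfN nm R +
  fixes F :: "'a => bool" and b :: 'a
  assumes F_lt: "F \<phi> ==> \<phi> \<prec> b" and F_Th: "F \<phi> ==> Th \<phi>" and S_Th: "Sax \<phi> ==> Th \<phi>"
    and ind_S: "df (\<lambda>e. P (e 0)) ==> logic isv Form mem eq neg imp all fv sv P ==> (\<And>\<phi>. Sax \<phi> ==> P \<phi>) ==> Th \<phi> ==> P \<phi>"
    and ind_F: "df (\<lambda>e. P (e 0)) ==> logic isv Form mem eq neg imp all fv sv P ==> (\<And>\<phi>. F \<phi> ==> P \<phi>) ==> Th \<phi> ==> P \<phi>"
begin

lemma Th_valid: assumes "Th \<phi>" shows "JN.valid \<phi>"
proof -
  have "df (\<lambda>e. Form (e 0) \<and> (\<forall>g. True --> TN (e 0) g))"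
    by (intro mdfs df_TrJ[OF N.df_E0 N.df_eq0])
  then have "df (\<lambda>e. Form (e 0) \<and> JN.valid (e 0))" unfolding JN.valid_def .
  from ind_S[of "\<lambda>\<phi>. Form \<phi> \<and> JN.valid \<phi>", OF this JN.logic_valid _ assms] show ?thesis
    using Sax_valid F_Sax by blast
qed

end

text \<open>\<open>k\<close> bounds the codes for which Los's theorem is wanted: those of
  \<open>F\<close>, and the concrete formulas for membership, equality, the order and
  \<open>hfF\<close>.\<close>

locale MainT = Main +
  fixes T :: "nat => nat => bool" and k :: 'a
  assumes T: "dfN (\<lambda>e. T (e 0) (e (Suc 0)))" and kT: "isT EN (=) k T"
    and kF: "F \<phi> ==> \<phi> \<prec> k" and kl: "cd lamF \<prec> k" and kh: "cd hfF \<prec> k"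
    and km: "cd (Mem 0 1) \<prec> k" and ke: "cd (Eq 0 1) \<prec> k"
begin

abbreviation "ev \<equiv> eval T"
abbreviation "eva \<equiv> eA T"
abbreviation "hol \<equiv> holds T"
abbreviation "dec \<equiv> decd T"

lemmas evr = eval_emp[OF T] eval_const[OF T] ap_eA[OF T] eA_upd[OF T]
lemmas ddfs = N.dfs4 dt_eval[OF T] dt_eA[OF T] df_holds[OF T] df_decd[OF T]

lemma T_Tr: "Form \<phi> ==> \<phi> \<prec> k ==> T (num \<phi>) e \<longleftrightarrow> TN \<phi> e"
  using kT unfolding isT_def[OF N.df_E0 N.df_eq0] by blast

lemma T_dom: "T u e ==> \<exists>\<phi>. Form \<phi> \<and> \<phi> \<prec> k \<and> u = num \<phi>"
  using kT unfolding isT_def[OF N.df_E0 N.df_eq0] by blast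

definition at where "at \<phi> e = N.pr (num \<phi>) e"
definition s2 where "s2 s t = N.upd (N.upd N.emp (num (sv 0)) s) (num (sv 1)) t"
definition aM where "aM s t = at (cd (Mem 0 1)) (s2 s t)"
definition aQ where "aQ s t = at (cd (Eq 0 1)) (s2 s t)"
definition aL where "aL s t = at (cd lamF) (s2 s t)"

lemma dt_at: "N.dt t ==> N.dt (\<lambda>e. at c (t e))"
  unfolding at_def by (intro N.dfs4 N.dt_const)
lemma dt_s2: "N.dt s ==> N.dt t ==> N.dt (\<lambda>e. s2 (s e) (t e))"
  unfolding s2_def by (intro N.dfs4 N.dt_const)
lemma dt_a: "N.dt s ==> N.dt t ==> N.dt (\<lambda>e. aM (s e) (t e))" "N.dt s ==> N.dt t ==> N.dt (\<lambda>e. aQ (s e) (t e))"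
    "N.dt s ==> N.dt t ==> N.dt (\<lambda>e. aL (s e) (t e))"
  unfolding aM_def aQ_def aL_def by (intro dt_at dt_s2, assumption+)+

lemma hol_at: "Form \<phi> ==> \<phi> \<prec> k ==> hol (at \<phi> e) n \<longleftrightarrow> TN \<phi> (eva e n)"
  unfolding at_def by (simp add: holds_pr[OF T] T_Tr)

lemma hol_s2:
  assumes "cd \<phi> \<prec> k"
  shows "hol (at (cd \<phi>) (s2 s t)) n \<longleftrightarrow> sat EN (=) (\<lambda>i. if i = 0 then ev s n else if i = 1 then ev t n else N.emp) \<phi>"
proof -
  have "N.ap (eva (s2 s t) n) (num (sv i)) = (if i = 0 then ev s n else if i = 1 then ev t n else N.emp)" for i
  proof -
    have "N.ap N.emp x = N.emp" for x by (rule N.ap_none) simp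
    then show ?thesis unfolding s2_def by (auto simp: evr sv_inj)
  qed
  then show ?thesis using assms by (simp add: hol_at F_cd JN.Tr_cd)
qed

lemma hol_a: "hol (aM s t) n \<longleftrightarrow> EN (ev s n) (ev t n)" "hol (aQ s t) n \<longleftrightarrow> ev s n = ev t n"
    "hol (aL s t) n \<longleftrightarrow> lam EN (ev s n) (ev t n)"
  unfolding aM_def aQ_def aL_def hol_s2[OF km] hol_s2[OF ke] hol_s2[OF kl] sat_lamF by simp_all

definition EJ where "EJ s t \<longleftrightarrow> dec (aM s t)"
definition QJ where "QJ s t \<longleftrightarrow> dec (aQ s t)"

lemma EJ: "dfN (\<lambda>e. EJ (e 0) (e (Suc 0)))" unfolding EJ_def by (intro ddfs dt_a)
lemma QJ: "dfN (\<lambda>e. QJ (e 0) (e (Suc 0)))" unfolding QJ_def by (intro ddfs dt_a)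

lemma agree1: "\<exists>n. lam EN m n \<and> (hol a n \<longleftrightarrow> dec a)"
  using decd_fin[OF T, of "{a}" m] by simp
lemma agree2: "\<exists>n. lam EN m n \<and> (hol a n \<longleftrightarrow> dec a) \<and> (hol b' n \<longleftrightarrow> dec b')"
  using decd_fin[OF T, of "{a, b'}" m] by simp
lemma agree3: "\<exists>n. lam EN m n \<and> (hol a n \<longleftrightarrow> dec a) \<and> (hol b' n \<longleftrightarrow> dec b') \<and> (hol c n \<longleftrightarrow> dec c)"
  using decd_fin[OF T, of "{a, b', c}" m] by simp
lemma agree4: "\<exists>n. (hol a n \<longleftrightarrow> dec a) \<and> (hol b' n \<longleftrightarrow> dec b') \<and> (hol c n \<longleftrightarrow> dec c) \<and> (hol d n \<longleftrightarrow> dec d)"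
  using decd_fin[OF T, of "{a, b', c, d}"] by auto

lemma QJ_refl: "QJ s s" using agree1[of undefined "aQ s s"] unfolding QJ_def hol_a by blast
lemma QJ_sym: "QJ s t ==> QJ t s" using agree2[of undefined "aQ s t" "aQ t s"] unfolding QJ_def hol_a by metis
lemma QJ_trans: "QJ s t ==> QJ t u ==> QJ s u"
  using agree3[of undefined "aQ s t" "aQ t u" "aQ s u"] unfolding QJ_def hol_a by metis
lemma EJ_cong: "QJ s s' ==> QJ t t' ==> EJ s t ==> EJ s' t'"
  using agree4[of "aQ s s'" "aQ t t'" "aM s t" "aM s' t'"] unfolding QJ_def EJ_def hol_a by metis

abbreviation "TH \<equiv> TrJ EJ QJ"
lemmas TH_cl = TrJ_clauses[OF EJ QJ]

lemma JH: "FT isv Form mem eq neg imp all fv sv (\<lambda>g. True) (\<lambda>g x. N.ap g (num x)) (\<lambda>g x a. N.upd g (num x) a)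
    TH EJ QJ N.emp"
  by (rule FT_J[OF EJ QJ]) (fact QJ_refl QJ_sym QJ_trans EJ_cong)+

text \<open>Induction on the code. Connectives are checked at a value \<open>n\<close> where the
  decisions involved agree with truth. For a quantifier, the Skolem term is a counterexample at
  every \<open>n\<close> that has one.\<close>

lemma Los: assumes "Form \<phi>" "\<phi> \<prec> k" shows "TH \<phi> e \<longleftrightarrow> dec (at \<phi> e)"
proof -
  let ?P = "\<lambda>\<phi>. \<phi> \<prec> k --> (\<forall>e. TH \<phi> e \<longleftrightarrow> dec (at \<phi> e))"
  have "?P \<phi>"
  proof (rule F_induct[of ?P, OF _ assms(1)])
    have d: "df (\<lambda>e. dec (N.pr (num (e 0)) (nm (e (Suc 0)))))" 
      by (rule dfn1[of dec]) (intro ddfs, intro mdfs)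
    have "df (\<lambda>e. \<forall>a. TH (e 0) (nm a) \<longleftrightarrow> dec (N.pr (num (e 0)) (nm a)))"
      by (intro mdfs df_TrJ[OF EJ QJ] dfn1[of dec, OF df_decd[OF T N.dt_var]])
    then have "df (\<lambda>e. e 0 \<prec> k --> (\<forall>a. TH (e 0) (nm a) \<longleftrightarrow> dec (N.pr (num (e 0)) (nm a))))"
      by (rule df_imp[rotated]) (intro mdfs)
    moreover have "(\<forall>a. TH \<phi> (nm a) \<longleftrightarrow> dec (N.pr (num \<phi>) (nm a))) \<longleftrightarrow> (\<forall>e. TH \<phi> e \<longleftrightarrow> dec (at \<phi> e))" for \<phi>
      unfolding at_def using nm_surj by metis
    ultimately show "df (\<lambda>e. ?P (e 0))" by simp
    show "?P (mem x y)" if v: "isv x" "isv y" for x y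
    proof (intro impI allI)
      fix e assume l: "mem x y \<prec> k"
      have "hol (at (mem x y) e) n \<longleftrightarrow> hol (aM (N.ap e (num x)) (N.ap e (num y))) n" for n
        unfolding hol_a hol_at[OF F_mem[OF v] l] TN_cl(1)[OF v] evr ..
      then show "TH (mem x y) e \<longleftrightarrow> dec (at (mem x y) e)"
        unfolding TH_cl(1)[OF v] EJ_def using agree2[of undefined "at (mem x y) e" "aM (N.ap e (num x)) (N.ap e (num y))"] by metis
    qed
    show "?P (eq x y)" if v: "isv x" "isv y" for x y
    proof (intro impI allI)
      fix e assume l: "eq x y \<prec> k"
      have "hol (at (eq x y) e) n \<longleftrightarrow> hol (aQ (N.ap e (num x)) (N.ap e (num y))) n" for n
        unfolding hol_a hol_at[OF F_eq[OF v] l] TN_cl(2)[OF v] evr ..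
      then show "TH (eq x y) e \<longleftrightarrow> dec (at (eq x y) e)"
        unfolding TH_cl(2)[OF v] QJ_def using agree2[of undefined "at (eq x y) e" "aQ (N.ap e (num x)) (N.ap e (num y))"] by metis
    qed
    show "?P (neg \<phi>)" if h: "Form \<phi>" "?P \<phi>" for \<phi>
    proof (intro impI allI)
      fix e assume l: "neg \<phi> \<prec> k"
      have l1: "\<phi> \<prec> k" by (rule lt_trans[OF sub_lt(5) l])
      have "hol (at (neg \<phi>) e) n \<longleftrightarrow> \<not> hol (at \<phi> e) n" for n
        unfolding hol_at[OF F_neg[OF h(1)] l] hol_at[OF h(1) l1] TN_cl(3)[OF h(1)] ..
      then have "dec (at (neg \<phi>) e) \<longleftrightarrow> \<not> dec (at \<phi> e)" using agree2[of undefined "at (neg \<phi>) e" "at \<phi> e"] by metis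
      then show "TH (neg \<phi>) e \<longleftrightarrow> dec (at (neg \<phi>) e)" unfolding TH_cl(3)[OF h(1)] using h(2) l1 by blast
    qed
    show "?P (imp \<phi> \<psi>)" if h: "Form \<phi>" "Form \<psi>" "?P \<phi>" "?P \<psi>" for \<phi> \<psi>
    proof (intro impI allI)
      fix e assume l: "imp \<phi> \<psi> \<prec> k"
      have l1: "\<phi> \<prec> k" "\<psi> \<prec> k" by (rule lt_trans[OF _ l], rule sub_lt)+
      have "hol (at (imp \<phi> \<psi>) e) n \<longleftrightarrow> (hol (at \<phi> e) n --> hol (at \<psi> e) n)" for n
        unfolding hol_at[OF F_imp[OF h(1,2)] l] hol_at[OF h(1) l1(1)] hol_at[OF h(2) l1(2)] TN_cl(4)[OF h(1,2)] ..
      then have "dec (at (imp \<phi> \<psi>) e) \<longleftrightarrow> (dec (at \<phi> e) --> dec (at \<psi> e))"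
        using agree3[of undefined "at (imp \<phi> \<psi>) e" "at \<phi> e" "at \<psi> e"] by metis
      then show "TH (imp \<phi> \<psi>) e \<longleftrightarrow> dec (at (imp \<phi> \<psi>) e)" unfolding TH_cl(4)[OF h(1,2)] using h l1 by blast
    qed
    show "?P (all x \<phi>)" if h: "isv x" "Form \<phi>" "?P \<phi>" for x \<phi>
    proof (intro impI allI)
      fix e assume l: "all x \<phi> \<prec> k"
      have l1: "\<phi> \<prec> k" by (rule lt_trans[OF sub_lt(9) l])
      have ha: "hol (at (all x \<phi>) e) n \<longleftrightarrow> (\<forall>z. TN \<phi> (N.upd (eva e n) (num x) z))" for n
        unfolding hol_at[OF F_all[OF h(1,2)] l] TN_cl(5)[OF h(1,2)] ..
      have hu: "hol (at \<phi> (N.upd e (num x) t)) n \<longleftrightarrow> TN \<phi> (N.upd (eva e n) (num x) (ev t n))" for t n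
        unfolding hol_at[OF h(2) l1] evr ..
      let ?sk = "N.pr one (N.pr (num \<phi>) (N.pr (num x) e))"
      have "hol (at (all x \<phi>) e) n" if hs: "hol (at \<phi> (N.upd e (num x) ?sk)) n" for n
      proof (rule ccontr)
        assume "\<not> hol (at (all x \<phi>) e) n"
        then obtain z where "\<not> T (num \<phi>) (N.upd (eva e n) (num x) z)" unfolding ha T_Tr[OF h(2) l1] by blast
        then have "\<not> T (num \<phi>) (N.upd (eva e n) (num x) (ev ?sk n))"
          unfolding eval_sk[OF T] by (rule N.lstd(1)[OF df_skol0[OF T]])
        then show False using hs unfolding hu T_Tr[OF h(2) l1] by blast
      qed
      then have 1: "dec (at \<phi> (N.upd e (num x) ?sk)) ==> dec (at (all x \<phi>) e)"
        using agree2[of undefined "at (all x \<phi>) e" "at \<phi> (N.upd e (num x) ?sk)"] by blast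
      have 2: "dec (at \<phi> (N.upd e (num x) t))" if "dec (at (all x \<phi>) e)" for t
        using agree2[of undefined "at (all x \<phi>) e" "at \<phi> (N.upd e (num x) t)"] that ha hu by metis
      show "TH (all x \<phi>) e \<longleftrightarrow> dec (at (all x \<phi>) e)"
        unfolding TH_cl(5)[OF h(1,2)] using 1 2 h(3) l1 by blast
    qed
  qed
  then show ?thesis using assms by blast
qed

lemma Los_valid: assumes "Form \<phi>" "\<phi> \<prec> k" "JN.valid \<phi>" shows "TH \<phi> e"
proof -
  have "hol (at \<phi> e) n" for n using assms unfolding hol_at[OF assms(1,2)] JN.valid_def by blast
  then show ?thesis unfolding Los[OF assms(1,2)] using agree1[of undefined "at \<phi> e"] by blast
qed

text \<open>Los's theorem reaches only codes below \<open>k\<close>, so it is applied to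
  \<open>F\<close> alone; \<open>ind_F\<close> then carries truth along derivations to theorems of
  every size, in particular to all instances of the schemes.\<close>

lemma Th_H: assumes "Th \<phi>" shows "TH \<phi> e"
proof -
  interpret JH: FT isv Form mem eq neg imp all fv sv "\<lambda>g. True" "\<lambda>g x. N.ap g (num x)" "\<lambda>g x a. N.upd g (num x) a"
    TH EJ QJ N.emp by (rule JH)
  have "df (\<lambda>e. Form (e 0) \<and> (\<forall>g. True --> TH (e 0) g))"
    by (intro mdfs df_TrJ[OF EJ QJ])
  then have "df (\<lambda>e. Form (e 0) \<and> JH.valid (e 0))" unfolding JH.valid_def .
  moreover have "Form \<phi> \<and> JH.valid \<phi>" if "F \<phi>" for \<phi>
    using that Los_valid kF F_Th Th_F Th_valid unfolding JH.valid_def by blast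
  ultimately have "Form \<phi> \<and> JH.valid \<phi>"
    using ind_F[of "\<lambda>\<phi>. Form \<phi> \<and> JH.valid \<phi>", OF _ JH.logic_valid _ assms] by blast
  then show ?thesis unfolding JH.valid_def by blast
qed

abbreviation "hm \<equiv> \<lambda>g x a. N.upd g (num x) a"

lemma dn_mdl: "\<forall>p\<in>set ps. dn (snd p) ==> dn (\<lambda>e. mdl hm (map (\<lambda>p. (fst p, snd p e)) ps) N.emp)"
proof (induction ps rule: rev_induct)
  case (snoc p ps)
  then have "dn (\<lambda>e. mdl hm (map (\<lambda>p. (fst p, snd p e)) ps) N.emp)" "dn (snd p)" by auto
  then have "dn (\<lambda>e. N.upd (mdl hm (map (\<lambda>p. (fst p, snd p e)) ps) N.emp) (num (fst p)) (snd p e))"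
    by (intro mdfs)
  then show ?case by (simp add: mdl_def)
qed (simp add: mdl_def dn_const)

lemma dtN_mdl: "\<forall>p\<in>set ps. N.dt (snd p) ==> N.dt (\<lambda>e. mdl hm (map (\<lambda>p. (fst p, snd p e)) ps) N.emp)"
proof (induction ps rule: rev_induct)
  case (snoc p ps)
  then have "N.dt (\<lambda>e. mdl hm (map (\<lambda>p. (fst p, snd p e)) ps) N.emp)" "N.dt (snd p)" by auto
  then have "N.dt (\<lambda>e. N.upd (mdl hm (map (\<lambda>p. (fst p, snd p e)) ps) N.emp) (num (fst p)) (snd p e))"
    by (intro N.dfs4 N.dt_const)
  then show ?case by (simp add: mdl_def)
qed (simp add: mdl_def N.dt_const)

text \<open>Los's theorem gives \<open>hfF\<close> in the term model, so \<open>to_L\<close> merely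
  divides by \<open>QJ\<close>. Predicates definable in the quotient become definable in
  \<open>N\<close>, because truth at a fixed code is.\<close>

lemma H_L:
  "\<exists>(EH :: nat => nat => bool) dfH nmH RH (\<kappa> :: nat => nat).
    L E df lt isv Form mem eq neg imp all fv sv Th EH dfH nmH RH \<and>
    surj \<kappa> \<and> (\<forall>x y. \<kappa> x = \<kappa> y \<longleftrightarrow> QJ x y) \<and> (\<forall>x y. EH (\<kappa> x) (\<kappa> y) \<longleftrightarrow> EJ x y) \<and> (\<forall>a. nmH a = \<kappa> (nm a)) \<and>
    (\<forall>P. dfH P --> dfN (\<lambda>e. P (\<lambda>i. \<kappa> (e i))))"
proof -
  interpret JH: FT isv Form mem eq neg imp all fv sv "\<lambda>g. True" "\<lambda>g x. N.ap g (num x)" hm TH EJ QJ N.emp by (rule JH)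
  interpret FTM E df lt isv Form mem eq neg imp all fv sv Th "\<lambda>g. True" "\<lambda>g x. N.ap g (num x)" hm TH EJ QJ N.emp nm
  proof
    show "\<exists>a. QJ (nm a) x" for x using nm_surj QJ_refl by metis
    show "JH.valid \<phi>" if "Sax \<phi>" for \<phi> unfolding JH.valid_def using Th_H[OF S_Th[OF that]] by blast
    show "df (\<lambda>e. TH (s e) (mdl hm (map (\<lambda>p. (fst p, nm (snd p e))) ps) N.emp))"
      if ps: "\<And>v t. (v, t) \<in> set ps ==> isv v \<and> dt t" and s: "dt s" for ps s
    proof -
      have "dn (\<lambda>e. mdl hm (map (\<lambda>p. (fst p, snd p e)) (map (\<lambda>p. (fst p, \<lambda>e. nm (snd p e))) ps)) N.emp)"
        by (rule dn_mdl) (use ps dn_nm in auto)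
      then have "dn (\<lambda>e. mdl hm (map (\<lambda>p. (fst p, nm (snd p e))) ps) N.emp)" by (simp add: comp_def)
      then show ?thesis using df_TrJ[OF EJ QJ s] by blast
    qed
  qed
  have "JH.valid (cd hfF)" unfolding JH.valid_def
    using Los_valid[OF F_cd kh] N.hf_UNIV by (simp add: JN.valid_def JN.Tr_cd sat_hfF)
  note v = eqTrueI[OF this]
  have TI: "(True --> P) = P" for P by simp
  obtain EH :: "nat => nat => bool" and dfH nmH RH and \<kappa> :: "nat => nat" where H: "L E df lt isv Form mem eq neg imp all fv sv Th EH dfH nmH RH \<and>
      surj \<kappa> \<and> (\<forall>x y. \<kappa> x = \<kappa> y \<longleftrightarrow> QJ x y) \<and> (\<forall>x y. EH (\<kappa> x) (\<kappa> y) \<longleftrightarrow> EJ x y) \<and> (\<forall>a. nmH a = \<kappa> (nm a)) \<and>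
      (\<forall>P. dfH P --> (\<exists>\<phi> vs as. Form \<phi> \<and> Ball (set vs) isv \<and>
         (\<forall>e. P (\<lambda>i. \<kappa> (e i)) = TH \<phi> (mdl hm (map (\<lambda>i. (vs ! i, (as @@ e) i)) [0..<length vs]) N.emp))))"
    using to_L[unfolded v TI] by (elim exE) (rule that)
  have "dfN (\<lambda>e. P (\<lambda>i. \<kappa> (e i)))" if P: "dfH P" for P
  proof -
    obtain \<phi> vs as where p: "Form \<phi>" "\<And>e. P (\<lambda>i. \<kappa> (e i)) = TH \<phi> (mdl hm (map (\<lambda>i. (vs ! i, (as @@ e) i)) [0..<length vs]) N.emp)"
      using H P by blast
    have "N.dt (\<lambda>e. mdl hm (map (\<lambda>p. (fst p, snd p e)) (map (\<lambda>i. (vs ! i, \<lambda>e. (as @@ e) i)) [0..<length vs])) N.emp)"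
    proof (rule dtN_mdl)
      have "N.dt (\<lambda>e. (as @@ e) i)" for i
        by (cases "i < length as") (simp_all add: pre_def N.dt_const N.dt_var)
      then show "\<forall>p\<in>set (map (\<lambda>i. (vs ! i, \<lambda>e. (as @@ e) i)) [0..<length vs]). N.dt (snd p)" by auto
    qed
    then have "N.dt (\<lambda>e. mdl hm (map (\<lambda>i. (vs ! i, (as @@ e) i)) [0..<length vs]) N.emp)" by (simp add: comp_def)
    then show ?thesis unfolding p(2) by (rule N.df_comp1[OF TrJ_dfN[OF EJ QJ p(1)]])
  qed
  then show ?thesis using H
    by (intro exI[of _ EH] exI[of _ dfH] exI[of _ nmH] exI[of _ RH] exI[of _ \<kappa>]) simp
qed

end

section \<open>The term model seen from inside\<close>

locale MainH = MainT +
  H: L E df lt isv Form mem eq neg imp all fv sv Th EH dfH nmH RH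
  for EH :: "nat => nat => bool" and dfH nmH RH +
  fixes \<kappa> :: "nat => nat"
  assumes k_surj: "surj \<kappa>" and k_eq: "\<kappa> x = \<kappa> y \<longleftrightarrow> QJ x y" and k_mem: "EH (\<kappa> x) (\<kappa> y) \<longleftrightarrow> EJ x y"
    and k_nm: "nmH a = \<kappa> (nm a)" and k_df: "dfH P ==> dfN (\<lambda>e. P (\<lambda>i. \<kappa> (e i)))"
begin

lemma k_eqI: "(\<And>n. ev s n = ev t n) ==> \<kappa> s = \<kappa> t"
  unfolding k_eq QJ_def using agree1[of undefined "aQ s t"] hol_a by blast

text \<open>\<open>lamF\<close> lies below \<open>k\<close>, so Los's theorem evaluates it in the
  term model, and \<open>\<kappa>\<close> preserves satisfaction.\<close>

lemma k_lam: "lam EH (\<kappa> s) (\<kappa> t) \<longleftrightarrow> dec (aL s t)"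
proof -
  interpret JH: FT isv Form mem eq neg imp all fv sv "\<lambda>g. True" "\<lambda>g x. N.ap g (num x)" hm TH EJ QJ N.emp by (rule JH)
  have "dec (aL s t) \<longleftrightarrow> sat EJ QJ (\<lambda>i. N.ap (s2 s t) (num (sv i))) lamF"
    unfolding aL_def Los[OF F_cd kl, symmetric] by (simp add: JH.Tr_cd)
  also have "\<dots> \<longleftrightarrow> lam EH (\<kappa> s) (\<kappa> t)"
    unfolding sat_hom[of \<kappa> QJ EH EJ, OF k_surj k_eq k_mem] sat_lamF by (simp add: s2_def sv_inj)
  finally show ?thesis by simp
qed

definition j where "j x = \<kappa> (N.pr N.emp x)"

lemma dt_j: "N.dt s ==> N.dt (\<lambda>e. N.pr N.emp (s e))" by (intro ddfs)

lemma ev_j [simp]: "ev (N.pr N.emp x) n = x" by (simp add: evr)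

text \<open>The statements that \<open>t\<close> equals the constant for \<open>y\<close>, for all
  \<open>y\<close> in \<open>s\<close>, form a set in \<open>N\<close>. So one \<open>n\<close>
  agrees with the decisions on all of them and on \<open>a\<close>, and the value of
  \<open>t\<close> at this \<open>n\<close> is the required \<open>y\<close>.\<close>

lemma bounded_const:
  assumes d: "dec a" and s: "\<And>n. hol a n ==> EN (ev t n) s"
  shows "\<exists>y. EN y s \<and> \<kappa> t = j y"
proof (rule ccontr)
  assume c: "\<not> (\<exists>y. EN y s \<and> \<kappa> t = j y)"
  have "N.dt (\<lambda>e. aQ t (N.pr N.emp (e 0)))" by (intro dt_a ddfs)
  from N.image_ex[of "\<lambda>y. aQ t (N.pr N.emp y)", OF this, of s] obtain b'
    where b': "\<And>x. EN x b' \<longleftrightarrow> (\<exists>y. EN y s \<and> x = aQ t (N.pr N.emp y))" by blast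
  obtain n where n: "\<And>x. lam EN x (N.adj b' a) ==> hol x n \<longleftrightarrow> dec x"
    using decd_agree[OF T, of undefined "N.adj b' a"] by blast
  have "hol a n" using n[of a] d N.E_lt[of a "N.adj b' a"] by simp
  then have y: "EN (ev t n) s" by (rule s)
  let ?q = "aQ t (N.pr N.emp (ev t n))"
  have "EN ?q (N.adj b' a)" using b' y by auto
  then have "hol ?q n \<longleftrightarrow> dec ?q" using n N.E_lt by blast
  then have "\<kappa> t = j (ev t n)" unfolding j_def k_eq QJ_def hol_a by simp
  then show False using c y by blast
qed

text \<open>By \<open>bounded_const\<close> every element of a constant is a constant, so the image
  of \<open>j\<close> is closed under elements; this makes \<open>N\<close> an initial part of the
  term model.\<close>

lemma E_j: "EH z (j x) \<longleftrightarrow> (\<exists>y. EN y x \<and> z = j y)"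
proof
  obtain t where t: "z = \<kappa> t" using k_surj by (metis surjD)
  assume "EH z (j x)"
  then have "dec (aM t (N.pr N.emp x))" unfolding t j_def k_mem EJ_def .
  from bounded_const[OF this] show "\<exists>y. EN y x \<and> z = j y" unfolding t by (simp add: hol_a)
next
  assume "\<exists>y. EN y x \<and> z = j y"
  then obtain y where y: "EN y x" "z = j y" by blast
  have "dec (aM (N.pr N.emp y) (N.pr N.emp x))"
    using agree1[of undefined "aM (N.pr N.emp y) (N.pr N.emp x)"] y unfolding hol_a by simp
  then show "EH z (j x)" unfolding y j_def k_mem EJ_def .
qed

lemma j_inj [simp]: "j x = j y \<longleftrightarrow> x = y"
  unfolding j_def k_eq QJ_def
  using agree1[of undefined "aQ (N.pr N.emp x) (N.pr N.emp y)"] unfolding hol_a by auto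

lemma j_emp: "j N.emp = H.N.emp" by (rule H.N.ext) (simp add: E_j)
lemma j_up: "j (N.up x y) = H.N.up (j x) (j y)" by (rule H.N.ext) (auto simp: E_j)
lemma j_pr: "j (N.pr x y) = H.N.pr (j x) (j y)" unfolding N.pr_def H.N.pr_def j_up ..
lemma j_one: "j one = H.one" unfolding j_up j_emp ..

lemma j_pr_inv: assumes "H.N.pr p q = j t" shows "\<exists>x y. p = j x \<and> q = j y \<and> t = N.pr x y"
proof -
  have "EH (H.N.up p q) (j t)" using H.N.pr_elem(3)[of p q] assms by simp
  then obtain w where w: "H.N.up p q = j w" unfolding E_j by blast
  obtain x where x: "p = j x" using H.N.pr_elem(1)[of p q] unfolding w E_j by blast
  obtain y where y: "q = j y" using H.N.pr_elem(2)[of q p] unfolding w E_j by blast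
  have "j t = j (N.pr x y)" using assms unfolding j_pr x y by simp
  then show ?thesis using x y by auto
qed

text \<open>The image of \<open>j\<close> is closed under elements and pairs, so the definition of
  application, with its default, means the same on both sides.\<close>

lemma j_ap: "H.N.ap (j e) (j x) = j (N.ap e x)"
proof -
  have P: "EH (H.N.pr (j x) z) (j e) \<longleftrightarrow> (\<exists>y. z = j y \<and> EN (N.pr x y) e)" for z
  proof
    assume "EH (H.N.pr (j x) z) (j e)"
    then obtain w where w: "EN w e" "H.N.pr (j x) z = j w" unfolding E_j by blast
    from j_pr_inv[OF w(2)] show "\<exists>y. z = j y \<and> EN (N.pr x y) e" using w(1) by auto
  next
    assume "\<exists>y. z = j y \<and> EN (N.pr x y) e"
    then show "EH (H.N.pr (j x) z) (j e)" by (auto simp: j_pr[symmetric] E_j)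
  qed
  have "j (N.ap e x) = H.N.ap (j e) (j x)" unfolding H.N.eq_ap P
  proof -
    consider y where "EN (N.pr x y) e" "\<And>z. EN (N.pr x z) e ==> z = y"
      | "\<not> (\<exists>z. EN (N.pr x z) e \<and> (\<forall>w. EN (N.pr x w) e --> w = z))" by blast
    then show "((\<exists>y. j (N.ap e x) = j y \<and> EN (N.pr x y) e) \<and> (\<forall>z. (\<exists>y. z = j y \<and> EN (N.pr x y) e) --> z = j (N.ap e x))) \<or>
      (\<not> (\<exists>z. (\<exists>y. z = j y \<and> EN (N.pr x y) e) \<and> (\<forall>w. (\<exists>y. w = j y \<and> EN (N.pr x y) e) --> w = z)) \<and> j (N.ap e x) = H.N.emp)"
    proof cases
      case 1
      have y: "N.ap e x = y" using 1 by (rule N.ap_eq)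
      have "\<exists>y'. j y = j y' \<and> EN (N.pr x y') e" using 1(1) by blast
      moreover have "\<forall>z. (\<exists>y. z = j y \<and> EN (N.pr x y) e) --> z = j y" using 1(2) by blast
      ultimately show ?thesis unfolding y by blast
    next
      case 2
      then have "N.emp = N.ap e x" unfolding N.eq_ap by blast
      then have "j (N.ap e x) = H.N.emp" using j_emp by simp
      moreover have "\<not> (\<exists>z. (\<exists>y. z = j y \<and> EN (N.pr x y) e) \<and> (\<forall>w. (\<exists>y. w = j y \<and> EN (N.pr x y) e) --> w = z))"
      proof
        assume "\<exists>z. (\<exists>y. z = j y \<and> EN (N.pr x y) e) \<and> (\<forall>w. (\<exists>y. w = j y \<and> EN (N.pr x y) e) --> w = z)"
        then obtain y where "EN (N.pr x y) e" "\<And>w. EN (N.pr x w) e ==> j w = j y" by blast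
        then show False using 2 unfolding j_inj by blast
      qed
      ultimately show ?thesis by blast
    qed
  qed
  then show ?thesis by simp
qed

lemma dn_k: "dn s ==> H.dn (\<lambda>e. \<kappa> (s e))"
  unfolding H.dn_def k_nm k_eq by (rule dfn2[of QJ, OF QJ dn_nm[OF dt_var] dn_weak])

lemma num_j: "H.num x = j (num x)"
proof (rule h_mem_ind[of "\<lambda>x. H.num x = j (num x)"])
  show "df (\<lambda>e. H.num (e 0) = j (num (e 0)))" unfolding j_def
    by (rule H.dfn2[of "(=)", OF H.N.df_eq0 H.dn_num[OF dt_var] dn_k]) (intro mdfs)
  fix x assume "\<And>y. E y x ==> H.num y = j (num y)"
  then show "H.num x = j (num x)" by (intro H.N.ext) (auto simp: H.E_num E_j E_num)
qed

context
  fixes T'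
  assumes T': "dfH (\<lambda>e. T' (e 0) (e (Suc 0)))" and kT': "H.isT EH (=) k T'"
begin

lemma T'_Tr: "Form \<phi> ==> \<phi> \<prec> k ==> T' (j (num \<phi>)) e \<longleftrightarrow> H.TN \<phi> e"
  using kT' unfolding H.isT_def[OF H.N.df_E0 H.N.df_eq0] num_j by blast

lemma T'_dom: "T' (j u) e ==> \<exists>\<phi>. Form \<phi> \<and> \<phi> \<prec> k \<and> u = num \<phi>"
  using kT' unfolding H.isT_def[OF H.N.df_E0 H.N.df_eq0] num_j by fastforce

text \<open>Compares truth computed in \<open>N\<close>, with assignments of terms, to truth
  computed inside the quotient, with its own assignments. The two kinds of assignment need to match
  only at variables.\<close>

lemma TH_TN: assumes "Form \<phi>"
  shows "(\<And>x. isv x ==> H.N.ap g (j (num x)) = \<kappa> (N.ap e (num x))) ==> H.TN \<phi> g \<longleftrightarrow> TH \<phi> e"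
proof -
  let ?c = "\<lambda>g e. \<forall>x. isv x --> H.N.ap g (j (num x)) = \<kappa> (N.ap e (num x))"
  let ?P = "\<lambda>\<phi>. \<forall>g e. ?c g e --> (H.TN \<phi> g \<longleftrightarrow> TH \<phi> e)"
  have "?P \<phi>"
  proof (rule F_induct[of ?P, OF _ assms])
    have a: "dn (\<lambda>e. N.ap (nm (e (Suc 0))) (num (e 0)))" by (intro mdfs)
    have b: "H.dn (\<lambda>e. H.N.ap (nmH (e (Suc (Suc 0)))) (H.num (e 0)))" by (intro H.mdfs)
    have 1: "df (\<lambda>e. H.N.ap (nmH (e (Suc (Suc 0)))) (H.num (e 0)) = \<kappa> (N.ap (nm (e (Suc 0))) (num (e 0))))"
      by (rule H.dfn2[of "(=)", OF H.N.df_eq0 b dn_k[OF a]])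
    have 2: "df (\<lambda>e. \<forall>a b. (\<forall>x. isv x --> H.N.ap (nmH a) (H.num x) = \<kappa> (N.ap (nm b) (num x))) -->
        (H.TN (e 0) (nmH a) \<longleftrightarrow> TH (e 0) (nm b)))"
      by (intro df_all df_imp df_iff df_TrJ[OF EJ QJ] H.df_TrJ[OF H.N.df_E0 H.N.df_eq0] H.dn_nm dn_nm dt_var
        df_comp1[OF df_isv0] 1)
    have "?P \<phi> \<longleftrightarrow> (\<forall>a b. (\<forall>x. isv x --> H.N.ap (nmH a) (H.num x) = \<kappa> (N.ap (nm b) (num x))) -->
        (H.TN \<phi> (nmH a) \<longleftrightarrow> TH \<phi> (nm b)))" for \<phi>
    proof (intro iffI allI)
      fix a b
      assume "?P \<phi>"
      then have "?c (nmH a) (nm b) --> (H.TN \<phi> (nmH a) \<longleftrightarrow> TH \<phi> (nm b))" by blast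
      then show "(\<forall>x. isv x --> H.N.ap (nmH a) (H.num x) = \<kappa> (N.ap (nm b) (num x))) -->
        (H.TN \<phi> (nmH a) \<longleftrightarrow> TH \<phi> (nm b))" unfolding num_j .
    next
      fix g e
      assume h: "\<forall>a b. (\<forall>x. isv x --> H.N.ap (nmH a) (H.num x) = \<kappa> (N.ap (nm b) (num x))) -->
        (H.TN \<phi> (nmH a) \<longleftrightarrow> TH \<phi> (nm b))"
      obtain a' b' where ab: "nmH a' = g" "nm b' = e" using nm_surj H.nm_surj by blast
      show "?c g e --> (H.TN \<phi> g \<longleftrightarrow> TH \<phi> e)" using h[rule_format, of a' b', unfolded num_j ab] by blast
    qed
    then show "df (\<lambda>e. ?P (e 0))" using 2 by simp
    show "?P (mem x y)" if v: "isv x" "isv y" for x y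
      using v unfolding H.TN_cl(1)[OF v] TH_cl(1)[OF v] num_j by (simp add: k_mem)
    show "?P (eq x y)" if v: "isv x" "isv y" for x y
      using v unfolding H.TN_cl(2)[OF v] TH_cl(2)[OF v] num_j by (simp add: k_eq)
    show "?P (neg \<phi>)" if h: "Form \<phi>" "?P \<phi>" for \<phi>
      using h(2) unfolding H.TN_cl(3)[OF h(1)] TH_cl(3)[OF h(1)] by simp
    show "?P (imp \<phi> \<psi>)" if h: "Form \<phi>" "Form \<psi>" "?P \<phi>" "?P \<psi>" for \<phi> \<psi>
    proof (intro allI impI)
      fix g e assume c: "?c g e"
      have "H.TN \<phi> g \<longleftrightarrow> TH \<phi> e" "H.TN \<psi> g \<longleftrightarrow> TH \<psi> e" using h(3,4) c by blast+
      then show "H.TN (imp \<phi> \<psi>) g \<longleftrightarrow> TH (imp \<phi> \<psi>) e" unfolding H.TN_cl(4)[OF h(1,2)] TH_cl(4)[OF h(1,2)] by simp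
    qed
    show "?P (all x \<phi>)" if h: "isv x" "Form \<phi>" "?P \<phi>" for x \<phi>
    proof (intro allI impI)
      fix g e assume c: "?c g e"
      have "H.TN \<phi> (H.N.upd g (j (num x)) (\<kappa> t)) \<longleftrightarrow> TH \<phi> (N.upd e (num x) t)" for t
      proof -
        have "?c (H.N.upd g (j (num x)) (\<kappa> t)) (N.upd e (num x) t)" using c by simp
        then show ?thesis using h(3) by blast
      qed
      then show "H.TN (all x \<phi>) g \<longleftrightarrow> TH (all x \<phi>) e"
        unfolding H.TN_cl(5)[OF h(1,2)] TH_cl(5)[OF h(1,2)] num_j using k_surj by (metis surjD)
    qed
  qed
  then show "(\<And>x. isv x ==> H.N.ap g (j (num x)) = \<kappa> (N.ap e (num x))) ==> H.TN \<phi> g \<longleftrightarrow> TH \<phi> e" by blast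
qed

text \<open>This set is neither empty nor a pair, so as a term it denotes the new element.\<close>

definition c where "c = N.up N.emp N.emp"

lemma ev_c [simp]: "ev c n = n"
  unfolding c_def by (rule eval_other[OF T]) simp_all

text \<open>Evaluation is repeated inside the term model, with \<open>T'\<close> for
  \<open>T\<close> and the new element for the argument. The critical case is a Skolem term: being a
  counterexample and being smaller are both decided statements, so least witnesses
  correspond.\<close>

lemma eval_j: "H.eval T' (j t) (\<kappa> c) = \<kappa> t"
proof (rule N.lt_induct[of "\<lambda>t. H.eval T' (j t) (\<kappa> c) = \<kappa> t"])
  have "dfH (\<lambda>e. H.eval T' (e 0) (\<kappa> c) = e (Suc 0))"
    by (intro H.N.dfs4 H.dt_eval[OF T'])
  from N.df_comp2[of "\<lambda>x y. H.eval T' (\<kappa> x) (\<kappa> c) = \<kappa> y", OF k_df[OF this], of "\<lambda>e. N.pr N.emp (e 0)" "\<lambda>e. e 0"]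
  show "dfN (\<lambda>e. H.eval T' (j (e 0)) (\<kappa> c) = \<kappa> (e 0))" unfolding j_def by (simp add: dt_j N.dt_var)
  fix t assume IH: "\<And>s. lam EN s t ==> H.eval T' (j s) (\<kappa> c) = \<kappa> s"
  have k_emp: "\<kappa> N.emp = H.N.emp"
    unfolding j_emp[symmetric] j_def by (rule k_eqI) (simp add: evr)
  consider "t = N.emp" | x where "t = N.pr N.emp x" | u m e where "t = N.pr one (N.pr u (N.pr m e))"
    | "t \<noteq> N.emp" "\<forall>x. t \<noteq> N.pr N.emp x" "\<forall>u m e. t \<noteq> N.pr one (N.pr u (N.pr m e))" by blast
  then show "H.eval T' (j t) (\<kappa> c) = \<kappa> t"
  proof cases
    case 1 then show ?thesis by (simp add: j_emp H.eval_emp[OF T'] k_emp)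
  next
    case 2 then show ?thesis by (simp add: j_pr j_emp H.eval_const[OF T']) (simp add: j_def)
  next
    case t: 3
    have IHe: "H.eval T' (j (N.ap e x)) (\<kappa> c) = \<kappa> (N.ap e x)" for x
    proof (cases "N.ap e x = N.emp")
      case True then show ?thesis by (simp add: j_emp H.eval_emp[OF T'] k_emp)
    next
      case False
      then have "lam EN (N.ap e x) e" using ap_lt[OF T, of e x] by blast
      then show ?thesis unfolding t using IH N.lt_trans[OF _ sk_lt[OF T, of e u m]] t by blast
    qed
    let ?a = "\<lambda>s. N.pr u (N.upd e m s)"
    let ?g = "H.N.upd (H.eA T' (j e) (\<kappa> c)) (j m)"
    have hol_sk: "hol (?a s) n \<longleftrightarrow> T u (N.upd (eva e n) m (ev s n))" for s n
      by (simp add: holds_pr[OF T] evr)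
    have ev_t: "ev t n = N.lstd (\<lambda>z. \<not> T u (N.upd (eva e n) m z))" for n unfolding t by (rule eval_sk[OF T])
    have P: "T' (j u) (?g (\<kappa> s)) \<longleftrightarrow> dec (?a s)" for s
    proof (cases "\<exists>\<phi>. Form \<phi> \<and> \<phi> \<prec> k \<and> u = num \<phi>")
      case True
      then obtain \<phi> where f: "Form \<phi>" "\<phi> \<prec> k" "u = num \<phi>" by blast
      have "H.TN \<phi> (?g (\<kappa> s)) \<longleftrightarrow> TH \<phi> (N.upd e m s)"
        by (rule TH_TN[OF f(1)]) (simp add: H.ap_eA[OF T'] j_ap IHe)
      then show ?thesis unfolding f(3) T'_Tr[OF f(1,2)] Los[OF f(1,2)] at_def .
    next
      \<comment> \<open>Here \<open>u\<close> is not the image of a formula below \<open>k\<close>;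
        neither truth predicate accepts it, so both sides are false.\<close>
      case False
      then have "\<not> hol (?a s) n" for n using T_dom unfolding hol_sk by blast
      then have "\<not> dec (?a s)" using agree1[of undefined "?a s"] by blast
      then show ?thesis using False T'_dom by blast
    qed
    have dP: "dfH (\<lambda>a. \<not> T' (j u) (?g (a 0)))" by (rule H.df_skol0[OF T'])
    have "\<kappa> t = H.N.lstd (\<lambda>z. \<not> T' (j u) (?g z))"
    proof (cases "\<exists>s. \<not> dec (?a s)")
      case True
      then obtain s where s: "\<not> dec (?a s)" by blast
      \<comment> \<open>Both facts hold at every \<open>n\<close> where \<open>s\<close> is a
        counterexample, so the decisions inherit them.\<close>
      have least: "\<not> hol (?a t) n \<and> \<not> hol (aL s t) n" if "\<not> hol (?a s) n" for s n
        using N.lstd[OF df_skol0[OF T], where x="ev s n"] that unfolding hol_sk hol_a ev_t by blast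
      have "\<not> dec (?a t)" using agree2[of undefined "?a s" "?a t"] least s by blast
      then have "\<not> T' (j u) (?g (\<kappa> t))" unfolding P .
      moreover have "\<not> lam EH z (\<kappa> t)" if z: "\<not> T' (j u) (?g z)" for z
      proof -
        obtain s where s: "z = \<kappa> s" using k_surj by (metis surjD)
        then show ?thesis using z agree2[of undefined "?a s" "aL s t"] least[of s] unfolding s P k_lam by blast
      qed
      ultimately show ?thesis unfolding H.N.eq_lstd[OF dP] by blast
    next
      case False
      have "hol (aQ t N.emp) n" if "hol (?a t) n" for n
      proof -
        have "\<not> (\<exists>z. \<not> T u (N.upd (eva e n) m z))"
          using N.lstd(1)[OF df_skol0[OF T]] that unfolding hol_sk ev_t by blast
        then show ?thesis unfolding hol_a ev_t by (simp add: evr N.lstd_none)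
      qed
      then have "dec (aQ t N.emp)" using False agree2[of undefined "?a t" "aQ t N.emp"] by blast
      then have "\<kappa> t = H.N.emp" unfolding k_emp[symmetric] k_eq QJ_def .
      moreover have "T' (j u) (?g z)" for z using False P k_surj by (metis surjD)
      ultimately show ?thesis by (simp add: H.N.lstd_none)
    qed
    then show ?thesis by (simp add: t j_pr j_one H.eval_sk[OF T'])
  next
    case 4
    have "H.eval T' (j t) (\<kappa> c) = \<kappa> c"
    proof (rule H.eval_other[OF T'])
      show "j t \<noteq> H.N.emp" using 4 by (simp add: j_emp[symmetric])
      show "j t \<noteq> H.N.pr H.N.emp x" for x
        using 4 j_pr_inv[of H.N.emp x t] by (metis j_emp j_inj)
      show "j t \<noteq> H.N.pr H.one (H.N.pr u (H.N.pr m e))" for u m e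
      proof
        assume "j t = H.N.pr H.one (H.N.pr u (H.N.pr m e))"
        from j_pr_inv[OF this[symmetric]] obtain x y where x: "H.one = j x" "H.N.pr u (H.N.pr m e) = j y" "t = N.pr x y" by blast
        from j_pr_inv[OF x(2)] obtain x' y' where y: "H.N.pr m e = j y'" "y = N.pr x' y'" by blast
        from j_pr_inv[OF y(1)] obtain x'' y'' where "y' = N.pr x'' y''" by blast
        moreover have "x = one" using x(1) unfolding j_one[symmetric] by simp
        ultimately show False using 4(3) x(3) y(2) by blast
      qed
    qed
    also have "\<kappa> c = \<kappa> t" by (rule k_eqI) (simp add: eval_other[OF T] 4)
    finally show ?thesis .
  qed
qed

text \<open>By Replacement the values at \<open>\<kappa> c\<close> of all elements below
  \<open>\<kappa> c\<close> form a set. By \<open>eval_j\<close> each element of the term model is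
  such a value, in particular this set itself.\<close>

lemma absurd: False
proof -
  obtain s where s: "\<And>y. EH y s \<longleftrightarrow> lam EH y (\<kappa> c)" using H.N.seg_ex by blast
  have "H.N.dt (\<lambda>e. H.eval T' (e 0) (\<kappa> c))" by (intro H.N.dfs4 H.dt_eval[OF T'])
  from H.N.image_ex[of "\<lambda>y. H.eval T' y (\<kappa> c)", OF this, of s] obtain b'
    where b': "\<And>y. EH y b' \<longleftrightarrow> (\<exists>x. EH x s \<and> y = H.eval T' x (\<kappa> c))" by blast
  obtain t where t: "b' = \<kappa> t" using k_surj by (metis surjD)
  \<comment> \<open>Only an \<open>n\<close> above \<open>t\<close> has to be inspected: there the
    constant \<open>t\<close> is smaller than the value of the new element.\<close>
  have "dec (aL (N.pr N.emp t) c)"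
    using agree1[of t "aL (N.pr N.emp t) c"] unfolding hol_a by auto
  then have "lam EH (j t) (\<kappa> c)" unfolding j_def k_lam .
  then have "EH b' b'" unfolding b' using s eval_j[of t] t by metis
  then show False using H.N.irrefl by blast
qed

end

lemma absurdH: False
  using H.T_ex[OF H.N.df_E0 H.N.df_eq0, of k] absurd by blast

end

context Main begin

lemma contradiction: False
proof -
  have "\<exists>k. \<forall>\<phi>\<in>{b, cd lamF, cd hfF, cd (Mem 0 1), cd (Eq 0 1)}. \<phi> \<prec> k" by (rule fin_bound) simp
  then obtain k where k: "b \<prec> k" "cd lamF \<prec> k" "cd hfF \<prec> k" "cd (Mem 0 1) \<prec> k" "cd (Eq 0 1) \<prec> k"
    by (metis insertCI)
  obtain T where T: "dfN (\<lambda>e. T (e 0) (e (Suc 0)))" "isT EN (=) k T"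
    using T_ex[OF N.df_E0 N.df_eq0, of k] by blast
  interpret MainT E df lt isv Form mem eq neg imp all fv sv Th EN dfN nm R F b T k
    by unfold_locales (use T k lt_trans[OF F_lt] in auto)
  obtain EH :: "nat => nat => bool" and dfH nmH RH and \<kappa> :: "nat => nat" where H: "L E df lt isv Form mem eq neg imp all fv sv Th EH dfH nmH RH \<and>
    surj \<kappa> \<and> (\<forall>x y. \<kappa> x = \<kappa> y \<longleftrightarrow> QJ x y) \<and> (\<forall>x y. EH (\<kappa> x) (\<kappa> y) \<longleftrightarrow> EJ x y) \<and> (\<forall>a. nmH a = \<kappa> (nm a)) \<and>
    (\<forall>P. dfH P --> dfN (\<lambda>e. P (\<lambda>i. \<kappa> (e i))))"
    using H_L by (elim exE) (rule that)
  interpret H: L E df lt isv Form mem eq neg imp all fv sv Th EH dfH nmH RH using H by (rule conjunct1)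
  interpret MainH E df lt isv Form mem eq neg imp all fv sv Th EN dfN nm R F b T k EH dfH nmH RH \<kappa>
    by unfold_locales (use H in blast)+
  show False by (rule absurdH)
qed

end

section \<open>The standard syntax\<close>

lemma Syn_not_finitely_axiomatizable:
  fixes E :: "nat => nat => bool"
  assumes Syn: "Syn E df lt isv Form mem eq neg imp all fvc sv Th" and con: "\<exists>\<phi>. Form \<phi> \<and> \<not> Th \<phi>"
    and S: "\<And>\<phi>. codes.Sax isv Form mem eq neg imp all fvc sv \<phi> ==> Th \<phi>"
    and F: "\<And>\<phi>. F \<phi> ==> lt \<phi> b" "\<And>\<phi>. F \<phi> ==> Th \<phi>"
    and ind_S: "\<And>P \<phi>. df (\<lambda>e. P (e 0)) ==> logic isv Form mem eq neg imp all fvc sv P ==>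
      (\<And>\<phi>. codes.Sax isv Form mem eq neg imp all fvc sv \<phi> ==> P \<phi>) ==> Th \<phi> ==> P \<phi>"
    and ind_F: "\<And>P \<phi>. df (\<lambda>e. P (e 0)) ==> logic isv Form mem eq neg imp all fvc sv P ==>
      (\<And>\<phi>. F \<phi> ==> P \<phi>) ==> Th \<phi> ==> P \<phi>"
  shows False
proof -
  obtain EN :: "nat => nat => bool" and dfN nm R where "L E df lt isv Form mem eq neg imp all fvc sv Th EN dfN nm R"
    using Syn_to_L[OF Syn con S] by blast
  then interpret L E df lt isv Form mem eq neg imp all fvc sv Th EN dfN nm R .
  interpret Main E df lt isv Form mem eq neg imp all fvc sv Th EN dfN nm R F b
  proof
    show "lt \<phi> b" "Th \<phi>" if "F \<phi>" for \<phi> using F that by blast+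
    show "Th \<phi>" if "Sax \<phi>" for \<phi> using S that by blast
    show "P \<phi>" if "df (\<lambda>e. P (e 0))" "logic isv Form mem eq neg imp all fvc sv P" "\<And>\<phi>. Sax \<phi> ==> P \<phi>" "Th \<phi>" for P \<phi>
      using that by (rule ind_S)
    show "P \<phi>" if "df (\<lambda>e. P (e 0))" "logic isv Form mem eq neg imp all fvc sv P" "\<And>\<phi>. F \<phi> ==> P \<phi>" "Th \<phi>" for P \<phi>
      using that by (rule ind_F)
  qed
  show False by (rule contradiction)
qed

text \<open>The standard hereditarily finite sets, in Ackermann's encoding by natural numbers.\<close>

lemma decode_less: "x \<in> set_decode y ==> x < y"
proof -
  assume "x \<in> set_decode y"
  then have "set_decode (set_encode {x}) \<subseteq> set_decode y" by (subst set_encode_inverse) auto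
  then have "set_encode {x} \<le> y" by (rule subset_decode_imp_le)
  moreover have "set_encode {x} = 2 ^ x" by (simp add: set_encode_def)
  moreover have "x < 2 ^ x" by (rule less_exp)
  ultimately show ?thesis by linarith
qed

text \<open>Every predicate counts as definable, since induction holds without restriction in the
  standard world. Adjunction induction descends because removing an element lowers the Ackermann
  code.\<close>

lemma W_nat: "W (\<lambda>x y. x \<in> set_decode y) (\<lambda>_. True) (<)"
proof unfold_locales
  fix x y a :: nat and P
  show "(\<And>z. z \<in> set_decode x \<longleftrightarrow> z \<in> set_decode y) ==> x = y"
    by (metis set_decode_inverse set_eqI)
  show "\<exists>z. \<forall>x. x \<notin> set_decode z" by (rule exI[of _ 0]) simp
  show "\<exists>v. \<forall>z. z \<in> set_decode v \<longleftrightarrow> z \<in> set_decode x \<or> z = y"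
    by (rule exI[of _ "set_encode (insert y (set_decode x))"]) auto
  show "x < y" if "x \<in> set_decode y" using that by (rule decode_less)
  show "\<exists>s. \<forall>y. y \<in> set_decode s \<longleftrightarrow> y < x" by (rule exI[of _ "set_encode {..<x}"]) auto
  show "P a" if e: "\<And>z. (\<And>x. x \<notin> set_decode z) ==> P z"
    and s: "\<And>x y v. P x ==> P y ==> (\<And>z. z \<in> set_decode v \<longleftrightarrow> z \<in> set_decode x \<or> z = y) ==> P v"
  proof (induction a rule: less_induct)
    case (less a)
    show ?case
    proof (cases "set_decode a = {}")
      case True then show ?thesis using e by blast
    next
      case False
      then obtain y where y: "y \<in> set_decode a" by blast
      let ?x = "set_encode (set_decode a - {y})"
      have "a = set_encode (insert y (set_decode a - {y}))" using y by (simp add: insert_absorb)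
      also have "\<dots> = 2 ^ y + ?x" by (rule set_encode_insert) auto
      finally have "a = 2 ^ y + ?x" .
      moreover have "(0::nat) < 2 ^ y" by simp
      ultimately have "?x < a" by linarith
      moreover have "z \<in> set_decode a \<longleftrightarrow> z \<in> set_decode ?x \<or> z = y" for z using y by auto
      ultimately show ?thesis using s[of ?x y a] less(1) decode_less[OF y] by blast
    qed
  qed
qed auto

text \<open>The residue modulo 5 tells the constructors apart, and the positive summand makes each
  code exceed its components.\<close>

definition cMem0 :: "nat => nat => nat" where "cMem0 x y = 5 * prod_encode (x, y) + 1"
definition cEq0 :: "nat => nat => nat" where "cEq0 x y = 5 * prod_encode (x, y) + 2"
definition cNeg0 :: "nat => nat" where "cNeg0 x = 5 * x + 3"
definition cImp0 :: "nat => nat => nat" where "cImp0 x y = 5 * prod_encode (x, y) + 4"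
definition cAll0 :: "nat => nat => nat" where "cAll0 x y = 5 * prod_encode (x, y) + 5"

lemmas c0_defs = cMem0_def cEq0_def cNeg0_def cImp0_def cAll0_def

lemma c0_inj [simp]:
  "cMem0 x y = cMem0 x' y' \<longleftrightarrow> x = x' \<and> y = y'" "cEq0 x y = cEq0 x' y' \<longleftrightarrow> x = x' \<and> y = y'"
  "cNeg0 x = cNeg0 x' \<longleftrightarrow> x = x'" "cImp0 x y = cImp0 x' y' \<longleftrightarrow> x = x' \<and> y = y'"
  "cAll0 x y = cAll0 x' y' \<longleftrightarrow> x = x' \<and> y = y'"
  by (auto simp: c0_defs prod_encode_eq)

lemma c0_dist: "cMem0 x y \<noteq> cEq0 x' y'" "cMem0 x y \<noteq> cNeg0 c" "cMem0 x y \<noteq> cImp0 c d" "cMem0 x y \<noteq> cAll0 x' c"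
      "cEq0 x y \<noteq> cNeg0 c" "cEq0 x y \<noteq> cImp0 c d" "cEq0 x y \<noteq> cAll0 x' c" "cNeg0 b \<noteq> cImp0 c d" "cNeg0 b \<noteq> cAll0 x' c"
      "cImp0 b a \<noteq> cAll0 x' c"
  unfolding c0_defs by presburger+

lemmas c0_dist' [simp] = c0_dist c0_dist[symmetric]

lemma c0_lt: "x < cMem0 x y" "y < cMem0 x y" "x < cEq0 x y" "y < cEq0 x y" "x < cNeg0 x"
  "x < cImp0 x y" "y < cImp0 x y" "x < cAll0 x y" "y < cAll0 x y"
  unfolding c0_defs using le_prod_encode_1[of x y] le_prod_encode_2[of y x] by linarith+

primrec code :: "fm => nat" where
  "code (Mem x y) = cMem0 x y"
| "code (Eq x y) = cEq0 x y"
| "code (Neg \<phi>) = cNeg0 (code \<phi>)"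
| "code (Imp \<phi> \<psi>) = cImp0 (code \<phi>) (code \<psi>)"
| "code (All x \<phi>) = cAll0 x (code \<phi>)"

lemma code_inj [simp]: "code \<phi> = code \<psi> \<longleftrightarrow> \<phi> = \<psi>"
proof (induction \<phi> arbitrary: \<psi>)
  case (Mem x y) then show ?case by (cases \<psi>) auto
next
  case (Eq x y) then show ?case by (cases \<psi>) auto
next
  case (Neg \<phi>) then show ?case by (cases \<psi>) auto
next
  case (Imp \<phi> \<phi>') then show ?case by (cases \<psi>) auto
next
  case (All x \<phi>) then show ?case by (cases \<psi>) auto
qed

lemma fv_code: "v \<in> fv \<phi> ==> v < code \<phi>"
proof (induction \<phi>)
  case (Neg \<phi>) then show ?case using less_trans[OF _ c0_lt(5)] by simp
next
  case (Imp \<phi> \<psi>) then show ?case using less_trans[OF _ c0_lt(6)] less_trans[OF _ c0_lt(7)] by auto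
next
  case (All x \<phi>) then show ?case using less_trans[OF _ c0_lt(9)] by auto
qed (auto simp: c0_lt)

lemma finite_fv: "finite (fv \<phi>)" by (induction \<phi>) auto

lemma fresh_nat: "finite X ==> finite Y ==> \<exists>v :: nat. v \<notin> X \<and> (\<forall>\<phi>\<in>Y. v \<notin> fv \<phi>)"
  using ex_new_if_finite[of "X \<union> (\<Union>\<phi>\<in>Y. fv \<phi>)"] finite_fv by auto

abbreviation "Form0 \<equiv> \<lambda>c. c \<in> range code"
abbreviation "fv0 \<equiv> \<lambda>c v. \<exists>\<phi>. c = code \<phi> \<and> v \<in> fv \<phi>"
abbreviation "Th0 \<equiv> \<lambda>T c. \<exists>\<phi>. c = code \<phi> \<and> T \<turnstile> \<phi>"

lemma code_Neg: "cNeg0 (code \<phi>) = code (Neg \<phi>)" "cImp0 (code \<phi>) (code \<psi>) = code (Imp \<phi> \<psi>)"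
  "cAll0 x (code \<phi>) = code (All x \<phi>)" "cMem0 x y = code (Mem x y)" "cEq0 x y = code (Eq x y)" by simp_all

lemma codes_nat: "codes (\<lambda>_. True) Form0 cMem0 cEq0 cNeg0 cImp0 cAll0 fv0 (\<lambda>i. i)"
proof unfold_locales
  show "Form0 (cMem0 x y)" "Form0 (cEq0 x y)" for x y using rangeI[of code "Mem x y"] rangeI[of code "Eq x y"] by simp_all
  show "Form0 (cNeg0 c)" if "Form0 c" for c using that rangeI[of code "Neg _"] by auto
  show "Form0 (cImp0 c d)" if "Form0 c" "Form0 d" for c d using that rangeI[of code "Imp _ _"] by auto
  show "Form0 (cAll0 x c)" if "Form0 c" for x c using that rangeI[of code "All _ _"] by auto
  show "fv0 (cMem0 x y) v \<longleftrightarrow> v = x \<or> v = y" "fv0 (cEq0 x y) v \<longleftrightarrow> v = x \<or> v = y" for x y v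
    by (simp only: code_Neg code_inj fv.simps, simp)+
  show "fv0 (cNeg0 c) v \<longleftrightarrow> fv0 c v" if "Form0 c" for c v
    using that by (elim rangeE) (simp only: code_Neg code_inj fv.simps, simp)
  show "fv0 (cImp0 c d) v \<longleftrightarrow> fv0 c v \<or> fv0 d v" if "Form0 c" "Form0 d" for c d v
    using that by (elim rangeE) (simp only: code_Neg code_inj fv.simps, simp)
  show "fv0 (cAll0 x c) v \<longleftrightarrow> fv0 c v \<and> v \<noteq> x" if "Form0 c" for x c v
    using that by (elim rangeE) (simp only: code_Neg code_inj fv.simps, simp)
  show "\<exists>v. True \<and> v \<notin> X \<and> (\<forall>\<phi>\<in>Y. \<not> fv0 \<phi> v)" if f: "finite X" "finite Y" "\<And>\<phi>. \<phi> \<in> Y ==> Form0 \<phi>" for X Y :: "nat set"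
  proof -
    have "finite {\<phi>. code \<phi> \<in> Y}" using f(2) by (rule finite_vimageI[of Y code, unfolded vimage_def]) (simp add: inj_def)
    from fresh_nat[OF f(1) this] show ?thesis by auto
  qed
qed auto

lemma logic_nat: "logic (\<lambda>_. True) Form0 cMem0 cEq0 cNeg0 cImp0 cAll0 fv0 (\<lambda>i. i) (Th0 T)"
proof -
  interpret codes "\<lambda>_. True" Form0 cMem0 cEq0 cNeg0 cImp0 cAll0 fv0 "\<lambda>i. i" by (rule codes_nat)
  show ?thesis
    by unfold_locales
      (auto simp only: image_iff code_Neg code_inj simp_thms ex_simps bex_simps UNIV_I intro: derivable.intros)
qed

lemma Syn_nat: "Syn (\<lambda>x y. x \<in> set_decode y) (\<lambda>_. True) (<) (\<lambda>_. True) Form0 cMem0 cEq0 cNeg0 cImp0 cAll0 fv0 (\<lambda>i. i) (Th0 T)"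
proof -
  interpret W "\<lambda>x y. x \<in> set_decode y" "\<lambda>_. True" "(<)" by (rule W_nat)
  interpret logic "\<lambda>_. True" Form0 cMem0 cEq0 cNeg0 cImp0 cAll0 fv0 "\<lambda>i. i" "Th0 T" by (rule logic_nat)
  show ?thesis
  proof
    show "P c" if "Form0 c" "\<And>x y. True ==> True ==> P (cMem0 x y)" "\<And>x y. True ==> True ==> P (cEq0 x y)"
      "\<And>c. Form0 c ==> P c ==> P (cNeg0 c)" "\<And>c d. Form0 c ==> Form0 d ==> P c ==> P d ==> P (cImp0 c d)"
      "\<And>x c. True ==> Form0 c ==> P c ==> P (cAll0 x c)" for P c
    proof -
      have "P (code \<phi>)" for \<phi> by (induction \<phi>) (use that in auto)
      then show ?thesis using that(1) by auto
    qed
    show "True \<and> v < c" if "fv0 c v" for c v using that fv_code by auto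
    show "\<exists>v. True \<and> b < v" for b :: nat by auto
  qed (auto simp: dt_def c0_lt)
qed

lemma derivable_induct_logic:
  assumes "T \<turnstile> \<phi>" and P: "logic (\<lambda>_. True) Form0 cMem0 cEq0 cNeg0 cImp0 cAll0 fv0 (\<lambda>i. i) P"
    and T: "\<And>\<phi>. \<phi> \<in> T ==> P (code \<phi>)"
  shows "P (code \<phi>)"
proof -
  interpret P: logic "\<lambda>_. True" Form0 cMem0 cEq0 cNeg0 cImp0 cAll0 fv0 "\<lambda>i. i" P by (rule P)
  have F: "Form0 (code \<phi>)" for \<phi> by simp
  show ?thesis using assms(1)
  proof induction
    case (MP \<phi> \<psi>) then show ?case using P.MP[OF F F] by simp
  next
    case (Vacuous x \<phi>) then show ?case using P.Vac[OF TrueI F] by auto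
  qed (use T P.Gen P.L1[OF F F] P.L2[OF F F F] P.L3[OF F F] P.Distr[OF TrueI F F] P.Spec[OF TrueI F] P.ExEq P.EqEq P.EqMemL P.EqMemR
    in simp_all)
qed

lemma cd_nat: "codes.cd cMem0 cEq0 cNeg0 cImp0 cAll0 (\<lambda>i. i) \<phi> = code \<phi>"
proof -
  interpret codes "\<lambda>_. True" Form0 cMem0 cEq0 cNeg0 cImp0 cAll0 fv0 "\<lambda>i. i" by (rule codes_nat)
  show ?thesis by (induction \<phi>) simp_all
qed

lemma Sax_nat: "codes.Sax (\<lambda>_. True) Form0 cMem0 cEq0 cNeg0 cImp0 cAll0 fv0 (\<lambda>i. i) c \<longleftrightarrow> (\<exists>\<phi>\<in>ZF_minus_Inf. c = code \<phi>)"
proof -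
  interpret codes "\<lambda>_. True" Form0 cMem0 cEq0 cNeg0 cImp0 cAll0 fv0 "\<lambda>i. i" by (rule codes_nat)
  have s: "sepc x a b (code \<phi>) = code (separation_ax x a b \<phi>)" for x a b \<phi> unfolding sepc_def separation_ax_def by simp
  have r: "replc x y z a b (code \<phi>) = code (replacement_ax x y z a b \<phi>)" for x y z a b \<phi> unfolding replc_def replacement_ax_def by simp
  have f: "fv0 (code \<phi>) v \<longleftrightarrow> v \<in> fv \<phi>" for \<phi> v by simp
  show ?thesis
  proof
    assume "Sax c"
    then consider \<phi> where "c = code \<phi>" "\<phi> \<in> {extensionality_ax, foundation_ax, pairing_ax, union_ax, power_ax}"
      | x a b \<phi> where "distinct [x, a, b]" "b \<notin> fv \<phi>" "c = code (separation_ax x a b \<phi>)"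
      | x y z a b \<phi> where "distinct [x, y, z, a, b]" "z \<notin> fv \<phi>" "b \<notin> fv \<phi>" "c = code (replacement_ax x y z a b \<phi>)"
      unfolding Sax_def cd_nat using s r f by (elim disjE exE conjE imageE rangeE) (metis, metis, metis)
    then show "\<exists>\<phi>\<in>ZF_minus_Inf. c = code \<phi>" by cases (blast intro: ZF_minus_Inf.intros)+
  next
    assume "\<exists>\<phi>\<in>ZF_minus_Inf. c = code \<phi>"
    then obtain \<phi> where p: "\<phi> \<in> ZF_minus_Inf" "c = code \<phi>" by blast
    from p(1) show "Sax c" unfolding p(2)
    proof cases
      case (Separation x a b \<psi>)
      show "Sax (code \<phi>)" unfolding Sax_def Separation(1) s[symmetric]
        by (rule disjI2, rule disjI1, intro exI[of _ x] exI[of _ a] exI[of _ b] exI[of _ "code \<psi>"]) (use Separation in simp)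
    next
      case (Replacement x y z a b \<psi>)
      show "Sax (code \<phi>)" unfolding Sax_def Replacement(1) r[symmetric]
        by (rule disjI2, rule disjI2, intro exI[of _ x] exI[of _ y] exI[of _ z] exI[of _ a] exI[of _ b]
          exI[of _ "code \<psi>"]) (use Replacement in simp)
    qed (simp_all add: Sax_def cd_nat)
  qed
qed

lemma not_finitely_axiomatizable:
  assumes con: "consistent ZF_minus_Inf" shows "\<not> finitely_axiomatizable ZF_minus_Inf"
proof
  assume "finitely_axiomatizable ZF_minus_Inf"
  then obtain F where F: "finite F" "\<And>\<phi>. F \<turnstile> \<phi> \<longleftrightarrow> ZF_minus_Inf \<turnstile> \<phi>" unfolding finitely_axiomatizable_def by blast
  let ?Th = "Th0 ZF_minus_Inf"
  \<comment> \<open>Finiteness of \<open>F\<close> enters only as a bound on the codes.\<close>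
  obtain b where b: "\<And>\<phi>. \<phi> \<in> F ==> code \<phi> < b"
    using finite_nat_set_iff_bounded[of "code ` F"] F(1) by auto
  show False
  proof (rule Syn_not_finitely_axiomatizable[OF Syn_nat[of ZF_minus_Inf], where F="\<lambda>c. c \<in> code ` F" and b=b])
    show "\<exists>c. Form0 c \<and> \<not> ?Th c" using con unfolding consistent_def by auto
    show "?Th c" if "codes.Sax (\<lambda>_. True) Form0 cMem0 cEq0 cNeg0 cImp0 cAll0 fv0 (\<lambda>i. i) c" for c
      using that unfolding Sax_nat by (auto intro: derivable.Hyp)
    show "c < b" "?Th c" if "c \<in> code ` F" for c
      using that b F(2) derivable.Hyp[of _ F] by auto
    show "P c" if P: "logic (\<lambda>_. True) Form0 cMem0 cEq0 cNeg0 cImp0 cAll0 fv0 (\<lambda>i. i) P" and c: "?Th c"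
      and "\<And>\<phi>. codes.Sax (\<lambda>_. True) Form0 cMem0 cEq0 cNeg0 cImp0 cAll0 fv0 (\<lambda>i. i) \<phi> ==> P \<phi>" for P c
      using c that(3) derivable_induct_logic[OF _ P] unfolding Sax_nat by blast
    show "P c" if P: "logic (\<lambda>_. True) Form0 cMem0 cEq0 cNeg0 cImp0 cAll0 fv0 (\<lambda>i. i) P" and c: "?Th c"
      and "\<And>\<phi>. \<phi> \<in> code ` F ==> P \<phi>" for P c
      using c that(3) derivable_induct_logic[OF _ P, of F] F(2) by blast
  qed
qed

section \<open>Models\<close>

lemma sat_cong: "(\<And>x. x \<in> fv \<phi> ==> e x = e' x) ==> sat E Q e \<phi> = sat E Q e' \<phi>"
proof (induction \<phi> arbitrary: e e')
  case (Imp \<phi> \<psi>)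
  have "sat E Q e \<phi> = sat E Q e' \<phi>" "sat E Q e \<psi> = sat E Q e' \<psi>" by (rule Imp.IH, use Imp.prems in simp)+
  then show ?case by simp
next
  case (All x \<phi>)
  have "sat E Q (e(x := a)) \<phi> = sat E Q (e'(x := a)) \<phi>" for a by (rule All.IH) (use All.prems in auto)
  then show ?case by simp
next
  case (Neg \<phi>)
  have "sat E Q e \<phi> = sat E Q e' \<phi>" by (rule Neg.IH) (use Neg.prems in simp)
  then show ?case by simp
qed simp_all

lemma codes_fm: "codes (\<lambda>_. True) (\<lambda>_. True) Mem Eq Neg Imp All (\<lambda>\<phi> v. v \<in> fv \<phi>) (\<lambda>i. i)"
  by unfold_locales (use fresh_nat in auto)

lemma logic_fm: "logic (\<lambda>_. True) (\<lambda>_. True) Mem Eq Neg Imp All (\<lambda>\<phi> v. v \<in> fv \<phi>) (\<lambda>i. i) (\<lambda>\<phi>. T \<turnstile> \<phi>)"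
proof -
  interpret codes "\<lambda>_. True" "\<lambda>_. True" Mem Eq Neg Imp All "\<lambda>\<phi> v. v \<in> fv \<phi>" "\<lambda>i. i" by (rule codes_fm)
  show ?thesis by unfold_locales (auto intro: derivable.intros)
qed

text \<open>Since \<open>\<alpha>\<close> is closed, it implies its own generalization by
  \<open>Vacuous\<close>; this handles \<open>Gen\<close>.\<close>

lemma deduction:
  assumes \<alpha>: "fv \<alpha> = {}" and d: "insert \<alpha> T \<turnstile> \<phi>" shows "T \<turnstile> Imp \<alpha> \<phi>"
proof -
  interpret logic "\<lambda>_. True" "\<lambda>_. True" Mem Eq Neg Imp All "\<lambda>\<phi> v. v \<in> fv \<phi>" "\<lambda>i. i" "\<lambda>\<phi>. T \<turnstile> \<phi>" by (rule logic_fm)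
  have w: "T \<turnstile> \<phi> ==> T \<turnstile> Imp \<alpha> \<phi>" for \<phi> by (rule derivable.MP[OF _ derivable.P1])
  show ?thesis using d
  proof induction
    case (Hyp \<phi>)
    then show ?case using id0[OF TrueI] w derivable.Hyp[of \<phi> T] by blast
  next
    case (MP \<phi> \<psi>) then show ?case by (blast intro: derivable.MP derivable.P2)
  next
    case (Gen \<phi> x)
    have "T \<turnstile> Imp \<alpha> (All x \<alpha>)" by (rule derivable.Vacuous) (simp add: \<alpha>)
    moreover have "T \<turnstile> Imp (All x \<alpha>) (All x \<phi>)"
      using derivable.MP[OF derivable.Gen[OF Gen.IH, of x] derivable.Distr] .
    ultimately show ?case using derivable.MP[OF _ derivable.MP[OF w derivable.P2]] by blast
  qed (blast intro: w derivable.intros)+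
qed

lemma unprovable_neg:
  assumes \<chi>: "fv \<chi> = {}" and n: "\<not> T \<turnstile> \<chi>" shows "\<not> insert (Neg \<chi>) T \<turnstile> \<chi>"
proof
  interpret logic "\<lambda>_. True" "\<lambda>_. True" Mem Eq Neg Imp All "\<lambda>\<phi> v. v \<in> fv \<phi>" "\<lambda>i. i" "\<lambda>\<phi>. T \<turnstile> \<phi>" by (rule logic_fm)
  assume "insert (Neg \<chi>) T \<turnstile> \<chi>"
  then have "T \<turnstile> Imp (Neg \<chi>) \<chi>" using \<chi> by (intro deduction) auto
  then have "T \<turnstile> \<chi>" by (rule taut1) auto
  then show False using n by blast
qed

text \<open>The Henkin construction over the standard world, for an arbitrary \<open>T\<close>.
  Containing the axioms makes the quotient infinite, so that \<open>nat\<close> can carry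
  it.\<close>

lemma model_existence:
  assumes S: "ZF_minus_Inf \<subseteq> T" and n: "\<not> T \<turnstile> \<chi>"
  shows "\<exists>E :: nat => nat => bool. \<forall>\<phi> e. T \<turnstile> \<phi> --> sat E (=) e \<phi>"
proof -
  interpret Syn "\<lambda>x y. x \<in> set_decode y" "\<lambda>_. True" "(<)" "\<lambda>_. True" Form0 cMem0 cEq0 cNeg0 cImp0 cAll0 fv0 "\<lambda>i. i" "Th0 T"
    by (rule Syn_nat)
  have con: "\<exists>c. Form0 c \<and> \<not> Th0 T c" by (rule exI[of _ "code \<chi>"]) (use n in simp)
  interpret J: FT "\<lambda>_. True" Form0 cMem0 cEq0 cNeg0 cImp0 cAll0 fv0 "\<lambda>i. i" hAsg hlook hmd hTr hE hQ hg0
    by (rule FT_henkin[OF con])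
  have V: "J.valid c" if "Th0 T c" for c
    unfolding J.valid_def using chtD(2)[OF con] that Inv_def[OF con] by blast
  have "J.valid c" if "Sax c" for c using that derivable.Hyp S unfolding Sax_nat by (intro V) blast
  then have inf: "finite A ==> \<exists>y. \<forall>a\<in>A. \<not> hQ a y" for A by (rule J.infinite_classes)
  have "equivp hQ" by (intro equivpI reflpI sympI transpI) (fact J.Q_refl J.Q_sym J.Q_trans)+
  then obtain cls :: "nat => nat" where cls: "surj cls" "\<And>x y. cls x = cls y \<longleftrightarrow> hQ x y"
    using countable_classes[OF _ inf] by blast
  define E where "E u v \<longleftrightarrow> hE (inv cls u) (inv cls v)" for u v
  have "cls (inv cls (cls x)) = cls x" for x using cls(1) by (rule surj_f_inv_f)
  then have "hQ (inv cls (cls x)) x" for x using cls(2) by blast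
  then have Ec: "E (cls x) (cls y) \<longleftrightarrow> hE x y" for x y unfolding E_def using J.E_cong J.Q_sym by blast
  have "sat E (=) e \<phi>" if "T \<turnstile> \<phi>" for \<phi> e
  proof -
    \<comment> \<open>Henkin assignments arise by finitely many changes, so only an initial part of
      \<open>e\<close> is matched; it is chosen to cover the free variables of
      \<open>\<phi>\<close>.\<close>
    have "\<exists>g. hAsg g \<and> (\<forall>i<n. hlook g i = inv cls (e i))" for n
    proof (induction n)
      case 0 then show ?case using J.A_g0 by blast
    next
      case (Suc n)
      then obtain g where "hAsg g" "\<forall>i<n. hlook g i = inv cls (e i)" by blast
      then have "\<forall>i<Suc n. hlook (hmd g n (inv cls (e n))) i = inv cls (e i)" by (auto simp: less_Suc_eq)
      then show ?case using J.A_md[OF \<open>hAsg g\<close> TrueI, of n "inv cls (e n)"] by blast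
    qed
    moreover obtain n where n: "\<forall>i\<in>fv \<phi>. i < n" using finite_nat_set_iff_bounded finite_fv by blast
    ultimately obtain g where g: "hAsg g" "\<forall>i<n. hlook g i = inv cls (e i)" by blast
    have "hTr (cd \<phi>) g" using V[of "code \<phi>"] that g(1) unfolding J.valid_def cd_nat by blast
    then have "sat hE hQ (\<lambda>i. hlook g i) \<phi>" unfolding J.Tr_cd[OF g(1)] .
    then have "sat E (=) (\<lambda>i. cls (hlook g i)) \<phi>" unfolding sat_hom[of cls hQ E hE, OF cls Ec] .
    moreover have "cls (hlook g i) = e i" if "i \<in> fv \<phi>" for i
      using g(2) n that surj_f_inv_f[OF cls(1)] by simp
    ultimately show ?thesis using sat_cong[of \<phi> "\<lambda>i. cls (hlook g i)" e] by blast
  qed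
  then show ?thesis by blast
qed

text \<open>Here \<open>df\<close> consists of the predicates defined by ordinary formulas with
  parameters.\<close>

lemma Z_sat:
  fixes E :: "nat => nat => bool"
  assumes "\<And>\<phi> e. \<phi> \<in> ZF_minus_Inf ==> sat E (=) e \<phi>"
  shows "\<exists>df. Z E df"
proof -
  interpret codes "\<lambda>_. True" "\<lambda>_. True" Mem Eq Neg Imp All "\<lambda>\<phi> v. v \<in> fv \<phi>" "\<lambda>i. i" by (rule codes_fm)
  interpret FT0 "\<lambda>_. True" "\<lambda>_. True" Mem Eq Neg Imp All "\<lambda>\<phi> v. v \<in> fv \<phi>" "\<lambda>i. i"
    "\<lambda>_. True" "\<lambda>g x. g x" "\<lambda>g x a. g(x := a)" "\<lambda>\<phi> g. sat E (=) g \<phi>" E "\<lambda>_. 0"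
  proof unfold_locales
    show "sat E (=) g \<phi> = sat E (=) g' \<phi>" if "\<And>x. True ==> x \<in> fv \<phi> ==> g x = g' x" for \<phi> g g'
      using that by (intro sat_cong) auto
  qed auto
  have cd: "cd \<phi> = \<phi>" for \<phi> by (induction \<phi>) simp_all
  have "Z E df"
  proof (rule Z_df)
    fix \<phi> assume "Sax \<phi>"
    then have "\<phi> \<in> ZF_minus_Inf"
      unfolding Sax_def cd sepc_def replc_def separation_ax_def[symmetric] replacement_ax_def[symmetric]
      by (auto simp del: distinct.simps intro: ZF_minus_Inf.intros)
    then show "valid \<phi>" unfolding valid_def using assms by blast
  qed
  then show ?thesis by blast
qed

section \<open>Evaluation of the formalized notions\<close>

context Z begin

abbreviation "S \<equiv> sat E (=)"

definition tv where
  "tv n e t a \<longleftrightarrow> (\<forall>m e' c. n \<le> m --> c < m --> (\<forall>i<n. e' i = e i) --> (S e' (t c m) \<longleftrightarrow> e' c = a))"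
definition good where "good n e t \<longleftrightarrow> (\<exists>a. tv n e t a)"
definition val where "val n e t = (THE a. tv n e t a)"

lemma tv_unique: assumes "tv n e t a" "tv n e t b" shows "a = b"
proof -
  have "S (e(n := a)) (t n (Suc n)) \<longleftrightarrow> a = a" "S (e(n := a)) (t n (Suc n)) \<longleftrightarrow> a = b"
    using assms[unfolded tv_def, rule_format, of "Suc n" n "e(n := a)"] by simp_all
  then show ?thesis by simp
qed

lemma tvI: assumes "tv n e t a" shows "good n e t" "val n e t = a"
  using assms tv_unique unfolding good_def val_def by blast+

lemma tv_val: "good n e t ==> tv n e t (val n e t)"
  unfolding good_def using tvI(2) by metis

lemma S_term: "good n e t ==> c < n ==> S e (t c n) \<longleftrightarrow> e c = val n e t"
  using tv_val[of n e t] unfolding tv_def by blast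

lemma tv_use: "tv n e t a ==> n \<le> m ==> c < m ==> (\<And>i. i < n ==> e' i = e i) ==> S e' (t c m) \<longleftrightarrow> e' c = a"
  unfolding tv_def by blast

definition rem where "rem A x = (THE s. \<forall>z. E z s \<longleftrightarrow> E z A \<and> z \<noteq> x)"

lemma E_rem [simp]: "E z (rem A x) \<longleftrightarrow> E z A \<and> z \<noteq> x"
  unfolding rem_def by (rule the_set) (rule sep, intro dfs3)

lemma dt_rem: "dt s ==> dt t ==> dt (\<lambda>e. rem (s e) (t e))"
  by (rule dt_comp2) (unfold dt_def eq_set E_rem, intro dfs3)

lemma nat_neq [simp]: "(x::nat) < y ==> (x = y) = False" "(x::nat) < y ==> (y = x) = False" by auto

lemma tv_Var: "x < n ==> tv n e (iVar x) (e x)"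
  unfolding tv_def iVar_def by simp

lemma tv_Empty: "tv n e iEmpty emp"
  unfolding tv_def iEmpty_def by (simp add: eq_emp)

lemma tv_Upair: assumes "tv n e s a" "tv n e t b" shows "tv n e (iUpair s t) (up a b)"
  unfolding tv_def
proof (intro allI impI)
  fix m e' c assume h: "n \<le> m" "c < m" "\<forall>i<n. e' i = e i"
  have "S (e'(m := x, Suc m := y)) (s m (Suc (Suc m))) \<longleftrightarrow> x = a"
    "S (e'(m := x, Suc m := y)) (t (Suc m) (Suc (Suc m))) \<longleftrightarrow> y = b" for x y
    using h by (subst tv_use[OF assms(1)] tv_use[OF assms(2)]; simp)+
  then show "S e' (iUpair s t c m) \<longleftrightarrow> e' c = up a b"
    unfolding iUpair_def using h by (simp add: eq_set[of "e' c"])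
qed

lemma tv_Union: assumes "tv n e s a" "tv n e t b" shows "tv n e (iUnion s t) (un a b)"
  unfolding tv_def
proof (intro allI impI)
  fix m e' c assume h: "n \<le> m" "c < m" "\<forall>i<n. e' i = e i"
  have "S (e'(m := x, Suc m := y)) (s m (Suc (Suc m))) \<longleftrightarrow> x = a"
    "S (e'(m := x, Suc m := y)) (t (Suc m) (Suc (Suc m))) \<longleftrightarrow> y = b" for x y
    using h by (subst tv_use[OF assms(1)] tv_use[OF assms(2)]; simp)+
  then show "S e' (iUnion s t c m) \<longleftrightarrow> e' c = un a b"
    unfolding iUnion_def using h by (simp add: eq_set[of "e' c"])
qed

lemma tv_Remove: assumes "tv n e s a" "tv n e t b" shows "tv n e (iRemove s t) (rem a b)"
  unfolding tv_def
proof (intro allI impI)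
  fix m e' c assume h: "n \<le> m" "c < m" "\<forall>i<n. e' i = e i"
  have "S (e'(m := x, Suc m := y)) (s m (Suc (Suc m))) \<longleftrightarrow> x = a"
    "S (e'(m := x, Suc m := y)) (t (Suc m) (Suc (Suc m))) \<longleftrightarrow> y = b" for x y
    using h by (subst tv_use[OF assms(1)] tv_use[OF assms(2)]; simp)+
  then show "S e' (iRemove s t c m) \<longleftrightarrow> e' c = rem a b"
    unfolding iRemove_def using h by (simp add: eq_set[of "e' c"])
qed

definition succ where "succ x = un x (up x x)"
primrec numv :: "nat => 'a" where "numv 0 = emp" | "numv (Suc k) = succ (numv k)"

definition mMem where "mMem a b = pr (numv 0) (pr a b)"
definition mEq where "mEq a b = pr (numv 1) (pr a b)"
definition mNeg where "mNeg a = pr (numv 2) a"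
definition mImp where "mImp a b = pr (numv 3) (pr a b)"
definition mAll where "mAll a b = pr (numv 4) (pr a b)"

primrec mcode :: "fm => 'a" where
  "mcode (Mem x y) = mMem (numv x) (numv y)"
| "mcode (Eq x y) = mEq (numv x) (numv y)"
| "mcode (Neg \<phi>) = mNeg (mcode \<phi>)"
| "mcode (Imp \<phi> \<psi>) = mImp (mcode \<phi>) (mcode \<psi>)"
| "mcode (All x \<phi>) = mAll (numv x) (mcode \<phi>)"

lemma tv_Pair: "tv n e s a ==> tv n e t b ==> tv n e (iPair s t) (pr a b)"
  unfolding iPair_def pr_def by (intro tv_Upair)
lemma tv_Succ: "tv n e s a ==> tv n e (iSucc s) (succ a)"
  unfolding iSucc_def succ_def by (intro tv_Upair tv_Union)
lemma tv_Numeral: "tv n e (iNumeral k) (numv k)"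
  by (induction k) (auto intro: tv_Empty tv_Succ)
lemma tv_c:
  "tv n e s a ==> tv n e t b ==> tv n e (cMem s t) (mMem a b)"
  "tv n e s a ==> tv n e t b ==> tv n e (cEq s t) (mEq a b)"
  "tv n e s a ==> tv n e (cNeg s) (mNeg a)"
  "tv n e s a ==> tv n e t b ==> tv n e (cImp s t) (mImp a b)"
  "tv n e s a ==> tv n e t b ==> tv n e (cAll s t) (mAll a b)"
  unfolding cMem_def mMem_def cEq_def mEq_def cNeg_def mNeg_def cImp_def mImp_def cAll_def mAll_def
  by (intro tv_Pair tv_Numeral; assumption)+
lemma tv_quote: "tv n e (quote \<phi>) (mcode \<phi>)"
  by (induction \<phi>) (auto intro: tv_c tv_Numeral)

lemma good_val [simp]:
  "x < n ==> good n e (iVar x)" "x < n ==> val n e (iVar x) = e x"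
  "good n e iEmpty" "val n e iEmpty = emp"
  "good n e s ==> good n e t ==> good n e (iUpair s t)"
  "good n e s ==> good n e t ==> val n e (iUpair s t) = up (val n e s) (val n e t)"
  "good n e s ==> good n e t ==> good n e (iUnion s t)"
  "good n e s ==> good n e t ==> val n e (iUnion s t) = un (val n e s) (val n e t)"
  "good n e s ==> good n e t ==> good n e (iRemove s t)"
  "good n e s ==> good n e t ==> val n e (iRemove s t) = rem (val n e s) (val n e t)"
  "good n e s ==> good n e t ==> good n e (iPair s t)"
  "good n e s ==> good n e t ==> val n e (iPair s t) = pr (val n e s) (val n e t)"
  "good n e s ==> good n e (iSucc s)" "good n e s ==> val n e (iSucc s) = succ (val n e s)"
  "good n e s ==> good n e t ==> good n e (cMem s t)"
  "good n e s ==> good n e t ==> val n e (cMem s t) = mMem (val n e s) (val n e t)"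
  "good n e s ==> good n e t ==> good n e (cEq s t)"
  "good n e s ==> good n e t ==> val n e (cEq s t) = mEq (val n e s) (val n e t)"
  "good n e s ==> good n e (cNeg s)" "good n e s ==> val n e (cNeg s) = mNeg (val n e s)"
  "good n e s ==> good n e t ==> good n e (cImp s t)"
  "good n e s ==> good n e t ==> val n e (cImp s t) = mImp (val n e s) (val n e t)"
  "good n e s ==> good n e t ==> good n e (cAll s t)"
  "good n e s ==> good n e t ==> val n e (cAll s t) = mAll (val n e s) (val n e t)"
  "good n e (quote \<phi>)" "val n e (quote \<phi>) = mcode \<phi>"
  by (rule tvI, (rule tv_Var tv_Empty tv_Upair tv_Union tv_Remove tv_Pair tv_Succ tv_c tv_quote; (rule tv_val)?; assumption?))+

lemmas S_terms [simp] = S_term[of _ _ iEmpty] S_term[of _ _ "iVar _"] S_term[of _ _ "iUpair _ _"] S_term[of _ _ "iUnion _ _"]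
  S_term[of _ _ "iRemove _ _"] S_term[of _ _ "iPair _ _"] S_term[of _ _ "iSucc _"] S_term[of _ _ "cMem _ _"] S_term[of _ _ "cEq _ _"]
  S_term[of _ _ "cNeg _"] S_term[of _ _ "cImp _ _"] S_term[of _ _ "cAll _ _"] S_term[of _ _ "quote _"]

definition natp where
  "natp n \<longleftrightarrow> (trn E n \<and> (\<forall>y. E y n --> trn E y)) \<and> (\<forall>m. E m n \<or> m = n --> m = emp \<or> (\<exists>k. m = succ k))"

lemma S_Nat [simp]: "x < n ==> S e (iNat x n) \<longleftrightarrow> natp (e x)"
  by (simp add: iNat_def iOrd_def iTransitive_def natp_def trn_def)

lemma S_At [simp]: "s < n ==> i < n ==> v < n ==> S e (iAt s i v n) \<longleftrightarrow> E (pr (e i) (e v)) (e s)"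
  by (simp add: iAt_def)

definition seqp where
  "seqp s n \<longleftrightarrow> natp n \<and> (\<forall>p. E p s --> (\<exists>i v. E i n \<and> p = pr i v)) \<and>
     (\<forall>i. E i n --> (\<exists>v. E (pr i v) s \<and> (\<forall>w. E (pr i w) s --> w = v)))"

lemma S_Seq [simp]: "s < n ==> x < n ==> S e (iSeq s x n) \<longleftrightarrow> seqp (e s) (e x)"
  by (simp add: iSeq_def seqp_def)

definition finp where
  "finp F \<longleftrightarrow> (\<exists>n s. seqp s n \<and> (\<forall>v. E v F \<longleftrightarrow> (\<exists>i. E i n \<and> E (pr i v) s)) \<and>
     (\<forall>i j v. E (pr i v) s --> E (pr j v) s --> i = j))"

lemma S_Finite [simp]: "x < n ==> S e (iFinite x n) \<longleftrightarrow> finp (e x)"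
  by (simp add: iFinite_def finp_def)

definition gen where
  "gen R x \<longleftrightarrow> (\<exists>n s. seqp s n \<and> (\<exists>i. E i n \<and> E (pr i x) s) \<and>
     (\<forall>i v. E i n --> E (pr i v) s --> R (\<lambda>w. \<exists>j. E j i \<and> E (pr j w) s) v))"

text \<open>Since \<open>R\<close> takes a formula \<open>prev\<close> as argument, the hypothesis
  relates it to an operator \<open>Rs\<close> on predicates, for every \<open>prev\<close> that
  denotes some \<open>Ps\<close> at all later indices.\<close>

lemma S_Generated:
  assumes R: "\<And>m e' v prev Ps. n \<le> m ==> v < m ==> (\<And>i. i < n ==> e' i = e i) ==>
      (\<And>w k e''. m \<le> k ==> w < k ==> (\<And>i. i < m ==> e'' i = e' i) ==> S e'' (prev w k) \<longleftrightarrow> Ps (e'' w)) ==>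
      S e' (R prev v m) \<longleftrightarrow> Rs Ps (e' v)"
    and x: "x < n"
  shows "S e (iGenerated R x n) \<longleftrightarrow> gen Rs (e x)"
proof -
  have "S (e(n := a, Suc n := b, Suc (Suc n) := i, Suc (Suc (Suc n)) := v))
      (R (\<lambda>w. \<^bold>\<exists>j. j \<^bold>\<in> Suc (Suc n) \<^bold>\<and> iAt (Suc n) j w) (Suc (Suc (Suc n))) (Suc (Suc (Suc (Suc n))))) \<longleftrightarrow>
      Rs (\<lambda>w. \<exists>j. E j i \<and> E (pr j w) b) v" for a b i v
    by (subst R[where Ps="\<lambda>w. \<exists>j. E j i \<and> E (pr j w) b"]) simp_all
  then show ?thesis unfolding iGenerated_def gen_def using x by simp
qed

definition FVr where
  "FVr prev q \<longleftrightarrow> (\<exists>c V. q = pr c V \<and>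
     ((\<exists>x y. natp x \<and> natp y \<and> (c = mMem x y \<or> c = mEq x y) \<and> V = up x y) \<or>
      (\<exists>a. prev (pr a V) \<and> c = mNeg a) \<or>
      (\<exists>a A b B. prev (pr a A) \<and> prev (pr b B) \<and> c = mImp a b \<and> V = un A B) \<or>
      (\<exists>x a A. natp x \<and> prev (pr a A) \<and> c = mAll x a \<and> V = rem A x)))"

definition sFV where "sFV c V \<longleftrightarrow> gen FVr (pr c V)"

lemma S_FV [simp]: assumes "c < n" "V < n" shows "S e (iFV c V n) \<longleftrightarrow> sFV (e c) (e V)"
proof -
  let ?R = "\<lambda>prev q. \<^bold>\<exists>c V. iPair (iVar c) (iVar V) q \<^bold>\<and>
       ((\<^bold>\<exists>x y. iNat x \<^bold>\<and> iNat y \<^bold>\<and> (cMem (iVar x) (iVar y) c \<^bold>\<or> cEq (iVar x) (iVar y) c) \<^bold>\<and>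
                iUpair (iVar x) (iVar y) V)
      \<^bold>\<or> (\<^bold>\<exists>a r. iPair (iVar a) (iVar V) r \<^bold>\<and> prev r \<^bold>\<and> cNeg (iVar a) c)
      \<^bold>\<or> (\<^bold>\<exists>a A b B r s. iPair (iVar a) (iVar A) r \<^bold>\<and> prev r \<^bold>\<and> iPair (iVar b) (iVar B) s \<^bold>\<and> prev s \<^bold>\<and>
                cImp (iVar a) (iVar b) c \<^bold>\<and> iUnion (iVar A) (iVar B) V)
      \<^bold>\<or> (\<^bold>\<exists>x a A r. iNat x \<^bold>\<and> iPair (iVar a) (iVar A) r \<^bold>\<and> prev r \<^bold>\<and>
                cAll (iVar x) (iVar a) c \<^bold>\<and> iRemove (iVar A) (iVar x) V))"
  have "S e (iGenerated ?R x m) \<longleftrightarrow> gen FVr (e x)" if "x < m" for e x m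
  proof (rule S_Generated)
    fix k e' v prev Ps
    assume "m \<le> k" "v < k" and prev: "\<And>w l e''. k \<le> l ==> w < l ==> (\<And>i. i < k ==> e'' i = e' i) ==> S e'' (prev w l) \<longleftrightarrow> Ps (e'' w)"
    then show "S e' (?R prev v k) \<longleftrightarrow> FVr Ps (e' v)" by (simp add: FVr_def prev)
  qed (rule that)
  then show ?thesis unfolding iFV_def sFV_def using assms by simp
qed

definition sForm where "sForm c \<longleftrightarrow> (\<exists>V. sFV c V)"
definition sNF where "sNF x c \<longleftrightarrow> (\<exists>V. sFV c V \<and> \<not> E x V)"

lemma S_Form [simp]: "c < n ==> S e (iForm c n) \<longleftrightarrow> sForm (e c)" by (simp add: iForm_def sForm_def)
lemma S_NF [simp]: "x < n ==> c < n ==> S e (iNotFree x c n) \<longleftrightarrow> sNF (e x) (e c)" by (simp add: iNotFree_def sNF_def)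
lemma S_Sentence [simp]: "c < n ==> S e (iSentence c n) \<longleftrightarrow> sFV (e c) emp" by (simp add: iSentence_def)

definition sLog where
  "sLog c \<longleftrightarrow>
    (\<exists>f g. sForm f \<and> sForm g \<and> c = mImp f (mImp g f)) \<or>
    (\<exists>f g h. sForm f \<and> sForm g \<and> sForm h \<and> c = mImp (mImp f (mImp g h)) (mImp (mImp f g) (mImp f h))) \<or>
    (\<exists>f g. sForm f \<and> sForm g \<and> c = mImp (mImp (mNeg f) (mNeg g)) (mImp g f)) \<or>
    (\<exists>x f g. natp x \<and> sForm f \<and> sForm g \<and> c = mImp (mAll x (mImp f g)) (mImp (mAll x f) (mAll x g))) \<or>
    (\<exists>x f. natp x \<and> sForm f \<and> c = mImp (mAll x f) f) \<or>
    (\<exists>x f. natp x \<and> sNF x f \<and> c = mImp f (mAll x f)) \<or>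
    (\<exists>x y. natp x \<and> natp y \<and> c = mNeg (mAll x (mNeg (mEq x y)))) \<or>
    (\<exists>x y z. natp x \<and> natp y \<and> natp z \<and> c = mImp (mEq x y) (mImp (mEq x z) (mEq y z))) \<or>
    (\<exists>x y z. natp x \<and> natp y \<and> natp z \<and> c = mImp (mEq x y) (mImp (mMem x z) (mMem y z))) \<or>
    (\<exists>x y z. natp x \<and> natp y \<and> natp z \<and> c = mImp (mEq x y) (mImp (mMem z x) (mMem z y)))"

lemma S_LogAx [simp]: "c < n ==> S e (iLogAx c n) \<longleftrightarrow> sLog (e c)" by (simp add: iLogAx_def sLog_def)

definition Dr where
  "Dr A prev v \<longleftrightarrow> A v \<or> sLog v \<or> (\<exists>a b. prev a \<and> prev b \<and> b = mImp a v) \<or> (\<exists>x a. natp x \<and> prev a \<and> v = mAll x a)"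
definition sDer where "sDer A = gen (Dr A)"

lemma S_Derivable:
  assumes A: "\<And>m e' v. n \<le> m ==> v < m ==> (\<And>i. i < n ==> e' i = e i) ==> S e' (A v m) \<longleftrightarrow> As (e' v)" and c: "c < n"
  shows "S e (iDerivable A c n) \<longleftrightarrow> sDer As (e c)"
  unfolding iDerivable_def sDer_def
proof (rule S_Generated)
  fix k e' v prev Ps
  assume h: "n \<le> k" "v < k" "\<And>i. i < n ==> e' i = e i"
    and prev: "\<And>w l e''. k \<le> l ==> w < l ==> (\<And>i. i < k ==> e'' i = e' i) ==> S e'' (prev w l) \<longleftrightarrow> Ps (e'' w)"
  have "S e' (A v k) \<longleftrightarrow> As (e' v)" using h by (rule A)
  then show "S e' ((A v \<^bold>\<or> iLogAx v
     \<^bold>\<or> (\<^bold>\<exists>a b. prev a \<^bold>\<and> prev b \<^bold>\<and> cImp (iVar a) (iVar v) b)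
     \<^bold>\<or> (\<^bold>\<exists>x a. iNat x \<^bold>\<and> prev a \<^bold>\<and> cAll (iVar x) (iVar a) v)) k) \<longleftrightarrow> Dr As Ps (e' v)"
    using h by (simp add: Dr_def prev)
qed (rule c)

abbreviation "mAnd s t \<equiv> mNeg (mImp s (mNeg t))"
abbreviation "mIff s t \<equiv> mAnd (mImp s t) (mImp t s)"
abbreviation "mEx x t \<equiv> mNeg (mAll x (mNeg t))"

definition mSep where
  "mSep x a b f = mAll a (mEx b (mAll x (mIff (mMem x b) (mAnd (mMem x a) f))))"
definition mRepl where
  "mRepl x y z a b f = mAll a (mImp (mAll x (mImp (mMem x a) (mEx z (mAll y (mImp f (mEq y z))))))
     (mEx b (mAll y (mIff (mMem y b) (mEx x (mAnd (mMem x a) f))))))"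

definition sZF where
  "sZF c \<longleftrightarrow>
    c = mcode extensionality_ax \<or> c = mcode foundation_ax \<or> c = mcode pairing_ax \<or> c = mcode union_ax \<or> c = mcode power_ax \<or>
    (\<exists>x a b f. natp x \<and> x \<noteq> a \<and> x \<noteq> b \<and> natp a \<and> a \<noteq> b \<and> natp b \<and> sNF b f \<and> c = mSep x a b f) \<or>
    (\<exists>x y z a b f. natp x \<and> x \<noteq> y \<and> x \<noteq> z \<and> x \<noteq> a \<and> x \<noteq> b \<and> natp y \<and> y \<noteq> z \<and> y \<noteq> a \<and> y \<noteq> b \<and>
       natp z \<and> z \<noteq> a \<and> z \<noteq> b \<and> natp a \<and> a \<noteq> b \<and> natp b \<and> sNF z f \<and> sNF b f \<and> c = mRepl x y z a b f)"

lemma S_ZF [simp]: "c < n ==> S e (iZF_minus_Inf c n) \<longleftrightarrow> sZF (e c)"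
  by (simp add: iZF_minus_Inf_def sZF_def mSep_def mRepl_def)

lemma S_main:
  "S e con_imp_not_finitely_axiomatizable \<longleftrightarrow>
    (\<not> (\<exists>c. sDer sZF c \<and> sDer sZF (mNeg c)) -->
     \<not> (\<exists>F. finp F \<and> (\<forall>c. E c F --> sFV c emp) \<and> (\<forall>c. sDer (\<lambda>v. E v F) c \<longleftrightarrow> sDer sZF c)))"
proof -
  have 1: "S e (iDerivable iZF_minus_Inf c n) \<longleftrightarrow> sDer sZF (e c)" if "c < n" for e c n
    by (rule S_Derivable) (use that in auto)
  have 2: "S e (iDerivable (\<lambda>v. v \<^bold>\<in> x) c n) \<longleftrightarrow> sDer (\<lambda>v. E v (e x)) (e c)" if "c < n" "x < n" for e c n x
    by (rule S_Derivable) (use that in auto)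
  show ?thesis
    by (simp add: con_imp_not_finitely_axiomatizable_def iConsistent_def iFinitelyAxiomatizable_def 1 2)
qed

end

section \<open>The formalized syntax in a model\<close>

context Z begin

lemma E_succ [simp]: "E z (succ x) \<longleftrightarrow> E z x \<or> z = x" by (simp add: succ_def)
lemma dt_succ: "dt s ==> dt (\<lambda>e. succ (s e))" unfolding succ_def by (intro dfs3)
lemma succ_ne [simp]: "succ x \<noteq> emp" "emp \<noteq> succ x" by (metis E_succ E_emp)+

lemma df_natp: "dt s ==> df (\<lambda>e. natp (s e))"
  by (rule df_comp1) (unfold natp_def, intro dfs3 dt_succ dt_emp)

lemma natp_emp: "natp emp" by (simp add: natp_def trn_def)

lemma natp_succ: assumes "natp n" shows "natp (succ n)"
proof -
  have t: "trn E n" "\<And>y. E y n ==> trn E y" using assms unfolding natp_def by blast+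
  have "trn E (succ n)" using t(1) unfolding trn_def E_succ by blast
  moreover have "\<And>y. E y (succ n) ==> trn E y" using t unfolding E_succ by blast
  moreover have "m = emp \<or> (\<exists>k. m = succ k)" if "E m (succ n) \<or> m = succ n" for m
    using that assms unfolding natp_def by auto
  ultimately show ?thesis unfolding natp_def by blast
qed

lemma natp_mem: "natp n ==> E k n ==> natp k"
  unfolding natp_def trn_def by blast

lemma natp_trn: "natp n ==> trn E n" unfolding natp_def by blast

lemma natp_cases: assumes "natp n" shows "n = emp \<or> (\<exists>k. natp k \<and> n = succ k)"
proof -
  have "n = emp \<or> (\<exists>k. n = succ k)" using assms unfolding natp_def by blast
  then show ?thesis using natp_mem[OF assms] E_succ by blast
qed

text \<open>A natural number is its own transitive superset, so \<open>mem_induct\<close> applies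
  although the natural numbers need not form a set.\<close>

lemma nat_mem_induct:
  assumes n: "natp n" and P: "df (\<lambda>e. P (e 0))" and s: "\<And>k. natp k ==> (\<And>i. E i k ==> P i) ==> P k" shows "P n"
proof -
  have "natp n --> P n"
  proof (rule mem_induct[of "\<lambda>n. natp n --> P n"])
    show "df (\<lambda>e. natp (e 0) --> P (e 0))" by (intro df_imp df_natp dt_var P)
    show "\<exists>t. trn E t \<and> subs E n t" by (rule exI[of _ n]) (use natp_trn[OF n] in \<open>simp add: subs_def\<close>)
    show "natp x --> P x" if "\<And>y. E y x ==> natp y --> P y" for x using that s[of x] natp_mem by blast
  qed
  then show ?thesis using n by blast
qed

lemma nat_induct0:
  assumes n: "natp n" and P: "df (\<lambda>e. P (e 0))" and e: "P emp" and s: "\<And>k. natp k ==> P k ==> P (succ k)" shows "P n"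
proof (rule nat_mem_induct[of n P, OF n P])
  fix k assume k: "natp k" "\<And>i. E i k ==> P i"
  from natp_cases[OF k(1)] show "P k" using e s k by (elim disjE exE conjE) auto
qed

lemma numv_natp: "natp (numv k)" by (induction k) (simp_all add: natp_emp natp_succ)

lemma numv_lt: "i < j ==> E (numv i) (numv j)"
  by (induction j) (auto simp: less_Suc_eq)

lemma numv_inj [simp]: "numv i = numv j \<longleftrightarrow> i = j"
  using numv_lt[of i j] numv_lt[of j i] irrefl[of "numv i"] by (metis linorder_neqE_nat)

lemma hf_adj': "hf E x ==> hf E y ==> hf E (adj x y)"
  by (rule hf_adj) (simp_all add: isadj_iff)

lemma hf_pr: assumes "hf E a" "hf E b" shows "hf E (pr a b)"
proof -
  have u: "hf E (up a b)" if "hf E a" "hf E b" for a b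
  proof -
    have "hf E emp" by (rule hf_emp) (simp add: isemp_iff)
    from hf_adj'[OF hf_adj'[OF this that(1)] that(2)] have "hf E (adj (adj emp a) b)" .
    moreover have "adj (adj emp a) b = up a b" by (rule ext) auto
    ultimately show ?thesis by simp
  qed
  show ?thesis unfolding pr_def by (intro u assms)
qed

lemma hf_natp: assumes "natp n" shows "hf E n"
proof (rule nat_induct0[of n "hf E", OF assms])
  show "df (\<lambda>e. hf E (e 0))" by (intro dfs)
  show "hf E emp" by (rule hf_emp) (simp add: isemp_iff)
  show "hf E (succ k)" if "hf E k" for k
  proof -
    have "succ k = adj k k" by (rule ext) auto
    then show ?thesis using hf_adj'[OF that that] by simp
  qed
qed

lemma hf_up: "hf E a ==> hf E b ==> hf E (up a b)"
  using hf_elem[OF hf_pr[of a b] pr_elem(3)] .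

section \<open>Inductively generated classes\<close>

definition gsq where
  "gsq R s n \<longleftrightarrow> seqp s n \<and> (\<forall>i v. E i n --> E (pr i v) s --> R (\<lambda>w. \<exists>j. E j i \<and> E (pr j w) s) v)"
definition ent where "ent s n w \<longleftrightarrow> (\<exists>i. E i n \<and> E (pr i w) s)"

lemma gen_gsq: "gen R x \<longleftrightarrow> (\<exists>n s. gsq R s n \<and> ent s n x)"
  unfolding gen_def gsq_def ent_def by blast

lemma gsq_append:
  assumes g: "gsq R s n" and v: "R (ent s n) v"
  shows "\<exists>s'. gsq R s' (succ n) \<and> (\<forall>w. ent s' (succ n) w \<longleftrightarrow> ent s n w \<or> w = v)"
proof -
  have n: "natp n" and dom: "\<And>i w. E (pr i w) s ==> E i n" and s: "seqp s n"
    using g unfolding gsq_def seqp_def by auto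
  let ?s = "adj s (pr n v)"
  have in_s: "E (pr i w) ?s \<longleftrightarrow> (if i = n then w = v else E (pr i w) s)" for i w
    using dom irrefl by auto
  have old: "E (pr j w) ?s \<longleftrightarrow> E (pr j w) s" if "E j n" for j w using that in_s irrefl by auto
  have fn: "\<exists>w. E (pr i w) ?s \<and> (\<forall>x. E (pr i x) ?s --> x = w)" if "E i n \<or> i = n" for i
  proof (cases "i = n")
    case True then show ?thesis unfolding in_s by simp
  next
    case False then show ?thesis using that s unfolding in_s seqp_def by simp
  qed
  have "seqp ?s (succ n)" unfolding seqp_def
  proof (intro conjI allI impI)
    show "natp (succ n)" using n by (rule natp_succ)
    show "\<exists>i w. E i (succ n) \<and> p = pr i w" if "E p ?s" for p
      using that s unfolding seqp_def by auto
    show "\<exists>w. E (pr i w) ?s \<and> (\<forall>x. E (pr i x) ?s --> x = w)" if "E i (succ n)" for i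
      using fn that by simp
  qed
  moreover have "R (\<lambda>w. \<exists>j. E j i \<and> E (pr j w) ?s) x" if h: "E i (succ n)" "E (pr i x) ?s" for i x
  proof (cases "i = n")
    case True
    then have "x = v" using h unfolding in_s by simp
    moreover have "(\<lambda>w. \<exists>j. E j i \<and> E (pr j w) ?s) = ent s n"
      unfolding ent_def True using old by (intro HOL.ext) blast
    ultimately show ?thesis using v by simp
  next
    case False
    then have i: "E i n" "E (pr i x) s" using h unfolding in_s by auto
    have "E j n" if "E j i" for j using that i(1) natp_trn[OF n] unfolding trn_def by blast
    then have "(\<lambda>w. \<exists>j. E j i \<and> E (pr j w) ?s) = (\<lambda>w. \<exists>j. E j i \<and> E (pr j w) s)"
      using old by (intro HOL.ext) blast
    then show ?thesis using g i unfolding gsq_def by simp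
  qed
  ultimately have "gsq R ?s (succ n)" unfolding gsq_def by blast
  moreover have "ent ?s (succ n) w \<longleftrightarrow> ent s n w \<or> w = v" for w
    unfolding ent_def in_s
  proof
    assume "\<exists>i. E i (succ n) \<and> (if i = n then w = v else E (pr i w) s)"
    then obtain i where "E i (succ n)" "if i = n then w = v else E (pr i w) s" by blast
    then show "(\<exists>i. E i n \<and> E (pr i w) s) \<or> w = v" by (cases "i = n") auto
  next
    assume "(\<exists>i. E i n \<and> E (pr i w) s) \<or> w = v"
    then show "\<exists>i. E i (succ n) \<and> (if i = n then w = v else E (pr i w) s)"
    proof (elim disjE exE conjE)
      fix i assume i: "E i n" "E (pr i w) s"
      then have "i \<noteq> n" using irrefl by blast
      then show ?thesis using i by (intro exI[of _ i]) simp
    qed (intro exI[of _ n], simp)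
  qed
  ultimately show ?thesis by blast
qed

text \<open>Monotonicity in the earlier entries is what allows generating sequences to be
  combined.\<close>

definition monoR :: "(('a => bool) => 'a => bool) => bool" where
  "monoR R \<longleftrightarrow> (\<forall>P Q v. (\<forall>w. P w --> Q w) --> R P v --> R Q v)"

context
  fixes R :: "('a => bool) => 'a => bool"
  assumes mono0: "monoR R"
    and dR: "df (\<lambda>e. R (\<lambda>w. \<exists>j. E j (e 0) \<and> E (pr j w) (e (Suc 0))) (e (Suc (Suc 0))))"
begin

lemma mono: "(\<And>w. P w ==> Q w) ==> R P v ==> R Q v"
  using mono0 unfolding monoR_def by blast

lemma df_seqp: "dt s ==> dt t ==> df (\<lambda>e. seqp (s e) (t e))"
  by (rule df_comp2) (unfold seqp_def, intro dfs3 df_natp)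

lemma df_gsq: "dt s ==> dt t ==> df (\<lambda>e. gsq R (s e) (t e))"
  by (rule df_comp2) (unfold gsq_def, intro dfs3 df_seqp df_comp3[of "\<lambda>i s v. R (\<lambda>w. \<exists>j. E j i \<and> E (pr j w) s) v", OF dR])

lemma df_gen: "dt s ==> df (\<lambda>e. gen R (s e))"
  by (rule df_comp1) (unfold gen_gsq ent_def, intro dfs3 df_gsq)

text \<open>The entries of the second sequence are appended one by one, by induction on its length;
  no addition of natural numbers is required.\<close>

lemma gsq_merge:
  assumes a: "gsq R s n" and b: "gsq R t m"
  shows "\<exists>s' n'. gsq R s' n' \<and> (\<forall>w. ent s n w \<or> ent t m w --> ent s' n' w)"
proof -
  have m: "natp m" and t: "seqp t m" using b unfolding gsq_def seqp_def by auto
  let ?K = "\<lambda>j. (E j m \<or> j = m) --> (\<exists>s' n'. gsq R s' n' \<and> (\<forall>w. ent s n w --> ent s' n' w) \<and> (\<forall>i w. E i j --> E (pr i w) t --> ent s' n' w))"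
  have "?K m"
  proof (rule nat_induct0[of m ?K, OF m])
    show "df (\<lambda>e. ?K (e 0))" unfolding ent_def by (intro dfs3 df_gsq dt_const)
    show "?K emp" using a by auto
    fix k assume k: "natp k" "?K k"
    show "?K (succ k)"
    proof
      assume km': "E (succ k) m \<or> succ k = m"
      have km: "E k m" using km' natp_trn[OF m] unfolding trn_def by (metis E_succ)
      then obtain s' n' where s': "gsq R s' n'" "\<And>w. ent s n w ==> ent s' n' w" "\<And>i w. E i k ==> E (pr i w) t ==> ent s' n' w"
        using k(2) by blast
      obtain v where v: "E (pr k v) t" "\<And>w. E (pr k w) t ==> w = v" using t km unfolding seqp_def by blast
      have "R (\<lambda>w. \<exists>j. E j k \<and> E (pr j w) t) v" using b km v(1) unfolding gsq_def by blast
      then have "R (ent s' n') v" by (rule mono[rotated]) (use s'(3) in blast)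
      from gsq_append[OF s'(1) this] obtain s'' where s'': "gsq R s'' (succ n')" "\<And>w. ent s'' (succ n') w \<longleftrightarrow> ent s' n' w \<or> w = v" by blast
      have "ent s'' (succ n') w" if "E i (succ k)" "E (pr i w) t" for i w
        using that s'(3) v(2) unfolding s''(2) E_succ by blast
      then show "\<exists>s' n'. gsq R s' n' \<and> (\<forall>w. ent s n w --> ent s' n' w) \<and> (\<forall>i w. E i (succ k) --> E (pr i w) t --> ent s' n' w)"
        using s'' s'(2) by blast
    qed
  qed
  then show ?thesis unfolding ent_def[of t] by blast
qed

lemma gen2: assumes "gen R a" "gen R b" "R (\<lambda>w. w = a \<or> w = b) v" shows "gen R v"
proof -
  obtain s n t m where g: "gsq R s n" "ent s n a" "gsq R t m" "ent t m b" using assms(1,2) unfolding gen_gsq by blast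
  from gsq_merge[OF g(1,3)] obtain s' n' where s': "gsq R s' n'" "ent s' n' a" "ent s' n' b" using g by blast
  have "R (ent s' n') v" by (rule mono[OF _ assms(3)]) (use s' in blast)
  from gsq_append[OF s'(1) this] show ?thesis unfolding gen_gsq by blast
qed

lemma gen1: assumes "gen R a" "R (\<lambda>w. w = a) v" shows "gen R v"
  by (rule gen2[OF assms(1,1)]) (use assms(2) in simp)

lemma gen0: assumes "R (\<lambda>w. False) v" shows "gen R v"
proof -
  have g: "gsq R emp emp" unfolding gsq_def seqp_def by (simp add: natp_emp)
  have "R (ent emp emp) v" by (rule mono[OF _ assms]) blast
  from gsq_append[OF g this] show ?thesis unfolding gen_gsq by blast
qed

text \<open>Membership induction on the position of an entry in a fixed generating sequence; the
  earlier entries are generated by the same sequence.\<close>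

lemma gen_induct:
  assumes g: "gen R x" and P: "df (\<lambda>e. P (e 0))" and s: "\<And>v. R (\<lambda>w. P w \<and> gen R w) v ==> P v" shows "P x"
proof -
  obtain q n where q: "gsq R q n" "ent q n x" using g unfolding gen_gsq by blast
  then obtain i where i: "E i n" "E (pr i x) q" unfolding ent_def by blast
  have n: "natp n" using q unfolding gsq_def seqp_def by blast
  have "\<forall>v. E i n --> E (pr i v) q --> P v"
  proof (rule nat_mem_induct[of i "\<lambda>i. \<forall>v. E i n --> E (pr i v) q --> P v", OF natp_mem[OF n i(1)]])
    show "df (\<lambda>e. \<forall>v. E (e 0) n --> E (pr (e 0) v) q --> P v)" by (intro dfs3 dt_const df_comp1[OF P])
    fix k assume IH: "\<And>i. E i k ==> \<forall>v. E i n --> E (pr i v) q --> P v"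
    show "\<forall>v. E k n --> E (pr k v) q --> P v"
    proof (intro allI impI)
      fix v assume k: "E k n" "E (pr k v) q"
      have "R (\<lambda>w. \<exists>j. E j k \<and> E (pr j w) q) v" using q k unfolding gsq_def by blast
      moreover have "P w \<and> gen R w" if ex: "\<exists>j. E j k \<and> E (pr j w) q" for w
      proof -
        obtain j where j: "E j k" "E (pr j w) q" using ex by blast
        have "E j n" using j(1) k(1) natp_trn[OF n] unfolding trn_def by blast
        then show ?thesis using IH[OF j(1)] j(2) q(1) unfolding gen_gsq ent_def by blast
      qed
      ultimately show "P v" by (intro s) (rule mono)
    qed
  qed
  then show ?thesis using i by blast
qed

lemma gen_inv: assumes "gen R x" shows "R (gen R) x"
proof -
  obtain q n i where q: "gsq R q n" "E i n" "E (pr i x) q" using assms unfolding gen_gsq ent_def by blast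
  have n: "natp n" using q unfolding gsq_def seqp_def by blast
  have "R (\<lambda>w. \<exists>j. E j i \<and> E (pr j w) q) x" using q unfolding gsq_def by blast
  moreover have "gen R w" if ex: "\<exists>j. E j i \<and> E (pr j w) q" for w
  proof -
    obtain j where j: "E j i" "E (pr j w) q" using ex by blast
    have "E j n" using j(1) q(2) natp_trn[OF n] unfolding trn_def by blast
    then show ?thesis using j(2) q(1) unfolding gen_gsq ent_def by blast
  qed
  ultimately show ?thesis by (rule mono[rotated])
qed

end

lemmas mc_defs = mMem_def mEq_def mNeg_def mImp_def mAll_def
lemma dt_mc:
  "dt s ==> dt t ==> dt (\<lambda>e. mMem (s e) (t e))" "dt s ==> dt t ==> dt (\<lambda>e. mEq (s e) (t e))"
  "dt s ==> dt (\<lambda>e. mNeg (s e))" "dt s ==> dt t ==> dt (\<lambda>e. mImp (s e) (t e))"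
  "dt s ==> dt t ==> dt (\<lambda>e. mAll (s e) (t e))"
  unfolding mc_defs by (intro dt_pr dt_const; assumption)+

lemmas dfs5 = dfs3 df_natp dt_succ dt_emp dt_rem dt_mc

lemma mc_inj [simp]: "mMem x y = mMem x' y' \<longleftrightarrow> x = x' \<and> y = y'" "mEq x y = mEq x' y' \<longleftrightarrow> x = x' \<and> y = y'"
  "mNeg x = mNeg x' \<longleftrightarrow> x = x'" "mImp x y = mImp x' y' \<longleftrightarrow> x = x' \<and> y = y'" "mAll x y = mAll x' y' \<longleftrightarrow> x = x' \<and> y = y'"
  unfolding mc_defs by simp_all
lemma mc_dist: "mMem x y \<noteq> mEq x' y'" "mMem x y \<noteq> mNeg c" "mMem x y \<noteq> mImp c d" "mMem x y \<noteq> mAll x' c"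
  "mEq x y \<noteq> mNeg c" "mEq x y \<noteq> mImp c d" "mEq x y \<noteq> mAll x' c" "mNeg b \<noteq> mImp c d" "mNeg b \<noteq> mAll x' c"
  "mImp b a \<noteq> mAll x' c"
  unfolding mc_defs by (simp_all del: numv.simps)
lemmas mc_dist' [simp] = mc_dist mc_dist[symmetric]

lemma FVr_mono: "monoR FVr"
  unfolding monoR_def
proof (intro allI impI)
  fix P Q v assume m: "\<forall>w. P w --> Q w" and "FVr P v"
  then show "FVr Q v" unfolding FVr_def[of P]
  proof (elim exE conjE disjE)
    show "FVr Q v" if "v = pr c V" "natp x" "natp y" "V = up x y" "c = mMem x y" for c V x y
      unfolding FVr_def using that by blast
    show "FVr Q v" if "v = pr c V" "natp x" "natp y" "V = up x y" "c = mEq x y" for c V x y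
      unfolding FVr_def using that by blast
    show "FVr Q v" if "v = pr c V" "P (pr a V)" "c = mNeg a" for c V a
    proof -
      have "Q (pr a V)" using m that(2) by blast
      then show ?thesis unfolding FVr_def using that by blast
    qed
    show "FVr Q v" if "v = pr c V" "P (pr a A)" "P (pr b B)" "c = mImp a b" "V = un A B" for c V a b A B
    proof -
      have "Q (pr a A)" "Q (pr b B)" using m that(2,3) by blast+
      then show ?thesis unfolding FVr_def using that by blast
    qed
    show "FVr Q v" if "v = pr c V" "natp x" "P (pr a A)" "c = mAll x a" "V = rem A x" for c V x a A
    proof -
      have "Q (pr a A)" using m that(3) by blast
      then show ?thesis unfolding FVr_def using that by blast
    qed
  qed
qed
lemma FVr_df: "df (\<lambda>e. FVr (\<lambda>w. \<exists>j. E j (e 0) \<and> E (pr j w) (e (Suc 0))) (e (Suc (Suc 0))))"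
  unfolding FVr_def by (intro dfs5)

lemmas FV_gen = gen0[of FVr, OF FVr_mono FVr_df] gen1[of FVr, OF FVr_mono FVr_df] gen2[of FVr, OF FVr_mono FVr_df]

lemma df_sFV: "dt s ==> dt t ==> df (\<lambda>e. sFV (s e) (t e))"
  unfolding sFV_def by (intro df_gen[of FVr, OF FVr_mono FVr_df] dfs3)
lemma df_sForm: "dt s ==> df (\<lambda>e. sForm (s e))"
  by (rule df_comp1) (unfold sForm_def, intro dfs5 df_sFV)
lemma df_sNF: "dt s ==> dt t ==> df (\<lambda>e. sNF (s e) (t e))"
  by (rule df_comp2) (unfold sNF_def, intro dfs5 df_sFV)

lemma sFV_iff: "sFV c V \<longleftrightarrow>
     (\<exists>x y. natp x \<and> natp y \<and> (c = mMem x y \<or> c = mEq x y) \<and> V = up x y) \<or>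
      (\<exists>a. sFV a V \<and> c = mNeg a) \<or>
      (\<exists>a A b B. sFV a A \<and> sFV b B \<and> c = mImp a b \<and> V = un A B) \<or>
      (\<exists>x a A. natp x \<and> sFV a A \<and> c = mAll x a \<and> V = rem A x)" (is "_ \<longleftrightarrow> ?r")
proof
  assume "sFV c V"
  from gen_inv[of FVr, OF FVr_mono FVr_df this[unfolded sFV_def]]
  show ?r unfolding FVr_def sFV_def[symmetric] by simp
next
  assume ?r
  then show "sFV c V"
  proof (elim disjE exE conjE)
    show "sFV c V" if "natp x" "natp y" "c = mMem x y" "V = up x y" for x y
      unfolding sFV_def by (rule FV_gen(1)) (unfold FVr_def, use that in blast)
    show "sFV c V" if "natp x" "natp y" "c = mEq x y" "V = up x y" for x y
      unfolding sFV_def by (rule FV_gen(1)) (unfold FVr_def, use that in blast)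
    show "sFV c V" if "sFV a V" "c = mNeg a" for a
      unfolding sFV_def by (rule FV_gen(2)[OF that(1)[unfolded sFV_def]]) (use that in \<open>auto simp: FVr_def\<close>)
    show "sFV c V" if "sFV a A" "sFV b B" "c = mImp a b" "V = un A B" for a A b B
      unfolding sFV_def by (rule FV_gen(3)[OF that(1)[unfolded sFV_def] that(2)[unfolded sFV_def]]) (use that in \<open>auto simp: FVr_def\<close>)
    show "sFV c V" if "natp x" "sFV a A" "c = mAll x a" "V = rem A x" for x a A
      unfolding sFV_def by (rule FV_gen(2)[OF that(2)[unfolded sFV_def]]) (use that in \<open>auto simp: FVr_def\<close>)
  qed
qed

lemma sFV_Mem [simp]: "sFV (mMem x y) V \<longleftrightarrow> natp x \<and> natp y \<and> V = up x y" by (subst sFV_iff) auto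
lemma sFV_Eq [simp]: "sFV (mEq x y) V \<longleftrightarrow> natp x \<and> natp y \<and> V = up x y" by (subst sFV_iff) auto
lemma sFV_Neg [simp]: "sFV (mNeg a) V \<longleftrightarrow> sFV a V" by (subst sFV_iff) auto
lemma sFV_Imp [simp]: "sFV (mImp a b) V \<longleftrightarrow> (\<exists>A B. sFV a A \<and> sFV b B \<and> V = un A B)" by (subst sFV_iff) auto
lemma sFV_All [simp]: "sFV (mAll x a) V \<longleftrightarrow> natp x \<and> (\<exists>A. sFV a A \<and> V = rem A x)" by (subst sFV_iff) auto

lemma sForm_c [simp]:
  "sForm (mMem x y) \<longleftrightarrow> natp x \<and> natp y" "sForm (mEq x y) \<longleftrightarrow> natp x \<and> natp y"
  "sForm (mNeg a) \<longleftrightarrow> sForm a" "sForm (mImp a b) \<longleftrightarrow> sForm a \<and> sForm b" "sForm (mAll x a) \<longleftrightarrow> natp x \<and> sForm a"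
  unfolding sForm_def sFV_Mem sFV_Eq sFV_Neg sFV_Imp sFV_All by blast+

lemma sForm_induct:
  assumes c: "sForm c" and P: "df (\<lambda>e. P (e 0))"
    and s: "\<And>x y. natp x ==> natp y ==> P (mMem x y)" "\<And>x y. natp x ==> natp y ==> P (mEq x y)"
      "\<And>a. sForm a ==> P a ==> P (mNeg a)" "\<And>a b. sForm a ==> sForm b ==> P a ==> P b ==> P (mImp a b)"
      "\<And>x a. natp x ==> sForm a ==> P a ==> P (mAll x a)"
  shows "P c"
proof -
  obtain V where V: "gen FVr (pr c V)" using c unfolding sForm_def sFV_def by blast
  let ?Q = "\<lambda>q. \<forall>c V. q = pr c V --> P c"
  have "?Q (pr c V)"
  proof (rule gen_induct[of FVr "pr c V" ?Q, OF FVr_mono FVr_df V])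
    show "df (\<lambda>e. ?Q (e 0))" by (intro dfs5 df_comp1[OF P])
    fix q assume "FVr (\<lambda>w. ?Q w \<and> gen FVr w) q"
    then obtain c V where q: "q = pr c V" and d: "(\<exists>x y. natp x \<and> natp y \<and> (c = mMem x y \<or> c = mEq x y) \<and> V = up x y) \<or>
      (\<exists>a. (?Q (pr a V) \<and> gen FVr (pr a V)) \<and> c = mNeg a) \<or>
      (\<exists>a A b B. (?Q (pr a A) \<and> gen FVr (pr a A)) \<and> (?Q (pr b B) \<and> gen FVr (pr b B)) \<and> c = mImp a b \<and> V = un A B) \<or>
      (\<exists>x a A. natp x \<and> (?Q (pr a A) \<and> gen FVr (pr a A)) \<and> c = mAll x a \<and> V = rem A x)"
      unfolding FVr_def[of "\<lambda>w. ?Q w \<and> gen FVr w"] by (elim exE conjE)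
    have F: "gen FVr (pr a A) ==> sForm a" for a A unfolding sForm_def sFV_def by blast
    have "P c" using d
    proof (elim disjE exE conjE)
      show "P c" if "natp x" "natp y" "c = mMem x y" for x y using s(1) that by simp
      show "P c" if "natp x" "natp y" "c = mEq x y" for x y using s(2) that by simp
      show "P c" if "?Q (pr a V)" "gen FVr (pr a V)" "c = mNeg a" for a
        using s(3)[OF F[OF that(2)]] that(1,3) by blast
      show "P c" if "?Q (pr a A)" "gen FVr (pr a A)" "?Q (pr b B)" "gen FVr (pr b B)" "c = mImp a b" for a A b B
        using s(4)[OF F[OF that(2)] F[OF that(4)]] that(1,3,5) by blast
      show "P c" if "natp x" "?Q (pr a A)" "gen FVr (pr a A)" "c = mAll x a" for x a A
        using s(5)[OF that(1) F[OF that(3)]] that(2,4) by blast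
    qed
    then show "?Q q" unfolding q by simp
  qed
  then show ?thesis by blast
qed

text \<open>Makes \<open>sNF\<close>, which asks for some set of free variables omitting
  \<open>x\<close>, the plain negation of being free.\<close>

lemma sFV_unique: "sFV c V ==> sFV c V' ==> V = V'"
proof -
  assume h: "sFV c V" "sFV c V'"
  let ?P = "\<lambda>c. \<forall>V V'. sFV c V --> sFV c V' --> V = V'"
  have c: "sForm c" using h(1) unfolding sForm_def by blast
  have "?P c"
  proof (rule sForm_induct[of c ?P, OF c])
    show "df (\<lambda>e. ?P (e 0))" by (intro dfs5 df_sFV)
    show "?P (mImp a b)" if "?P a" "?P b" for a b using that by auto
    show "?P (mAll x a)" if "?P a" for x a using that by auto
  qed auto
  then show ?thesis using h by blast
qed

lemma hf_numv: "hf E (numv k)" by (rule hf_natp[OF numv_natp])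

lemma hf_mc: "hf E a ==> hf E b ==> hf E (mMem a b)" "hf E a ==> hf E b ==> hf E (mEq a b)" "hf E a ==> hf E (mNeg a)"
  "hf E a ==> hf E b ==> hf E (mImp a b)" "hf E a ==> hf E b ==> hf E (mAll a b)"
  unfolding mc_defs by (intro hf_pr hf_numv; assumption)+

text \<open>All internal codes, nonstandard ones included, lie in the world of hereditarily finite
  sets, even if the model has infinite sets.\<close>

lemma hf_sForm: "sForm c ==> hf E c"
  by (rule sForm_induct[of c "hf E"]) (auto intro: hf_mc hf_natp df_hf dt_var)

lemma Dr_mono: "monoR (Dr A)" unfolding monoR_def Dr_def by blast

lemma df_sLog: "dt s ==> df (\<lambda>e. sLog (s e))"
  by (rule df_comp1) (unfold sLog_def, intro dfs5 df_sForm df_sNF)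

lemma df_sZF: "dt s ==> df (\<lambda>e. sZF (s e))"
  by (rule df_comp1) (unfold sZF_def mSep_def mRepl_def, intro dfs5 df_sForm df_sNF dt_const)

context
  fixes A assumes A: "df (\<lambda>e. A (e 0))"
begin

lemma Dr_df: "df (\<lambda>e. Dr A (\<lambda>w. \<exists>j. E j (e 0) \<and> E (pr j w) (e (Suc 0))) (e (Suc (Suc 0))))"
  unfolding Dr_def by (intro dfs5 df_sLog df_comp1[OF A])

lemma df_sDer: "dt s ==> df (\<lambda>e. sDer A (s e))"
  unfolding sDer_def by (intro df_gen[of "Dr A", OF Dr_mono Dr_df])

lemma sDer_rules:
  "A c ==> sDer A c" "sLog c ==> sDer A c" "sDer A a ==> sDer A (mImp a c) ==> sDer A c"
  "natp x ==> sDer A a ==> sDer A (mAll x a)"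
proof -
  note g = gen0[of "Dr A", OF Dr_mono Dr_df] gen1[of "Dr A", OF Dr_mono Dr_df] gen2[of "Dr A", OF Dr_mono Dr_df]
  show "A c ==> sDer A c" unfolding sDer_def by (rule g(1)) (simp add: Dr_def)
  show "sLog c ==> sDer A c" unfolding sDer_def by (rule g(1)) (simp add: Dr_def)
  show "sDer A c" if "sDer A a" "sDer A (mImp a c)"
    unfolding sDer_def by (rule g(3)[OF that[unfolded sDer_def]]) (auto simp: Dr_def)
  show "sDer A (mAll x a)" if "natp x" "sDer A a"
    unfolding sDer_def by (rule g(2)[OF that(2)[unfolded sDer_def]]) (use that in \<open>auto simp: Dr_def\<close>)
qed

lemma sDer_induct:
  assumes c: "sDer A c" and P: "df (\<lambda>e. P (e 0))" and h: "\<And>c. A c ==> P c" "\<And>c. sLog c ==> P c"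
    "\<And>a c. P a ==> P (mImp a c) ==> P c" "\<And>x a. natp x ==> P a ==> P (mAll x a)"
  shows "P c"
proof (rule gen_induct[of "Dr A" c P, OF Dr_mono Dr_df c[unfolded sDer_def] P])
  show "P v" if "Dr A (\<lambda>w. P w \<and> gen (Dr A) w) v" for v using that h unfolding Dr_def by blast
qed

end

lemma sLog_Form: "sLog c ==> sForm c"
proof -
  have "sNF x f ==> sForm f" for x f unfolding sNF_def sForm_def by blast
  then show "sLog c ==> sForm c" unfolding sLog_def by (elim disjE exE conjE) auto
qed

lemma sDer_Form: assumes "df (\<lambda>e. A (e 0))" "\<And>c. A c ==> sForm c" "sDer A c" shows "sForm c"
  by (rule sDer_induct[of A c sForm, OF assms(1) assms(3)])
    (use assms(2) sLog_Form df_sForm dt_var in auto)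

lemma sForm_mcode: "sForm (mcode \<phi>)" by (induction \<phi>) (simp_all add: numv_natp)

lemma sZF_Form: "sZF c ==> sForm c"
proof -
  have "sNF x f ==> sForm f" for x f unfolding sNF_def sForm_def by blast
  then show "sZF c ==> sForm c" unfolding sZF_def mSep_def mRepl_def
    by (elim disjE exE conjE) (auto simp: sForm_mcode)
qed

text \<open>The set is rebuilt by adjunction along its enumeration. Thus an internally finite set of
  codes is an element of the world, and the order bounds its members by it.\<close>

lemma hf_finp: assumes "finp F" "\<And>c. E c F ==> hf E c" shows "hf E F"
proof -
  obtain n s where s: "seqp s n" and F: "\<And>v. E v F \<longleftrightarrow> (\<exists>i. E i n \<and> E (pr i v) s)" using assms(1) unfolding finp_def by blast
  have n: "natp n" using s unfolding seqp_def by blast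
  let ?K = "\<lambda>k. (E k n \<or> k = n) --> (\<exists>G. hf E G \<and> (\<forall>v. E v G \<longleftrightarrow> (\<exists>i. E i k \<and> E (pr i v) s)))"
  have "?K n"
  proof (rule nat_induct0[of n ?K, OF n])
    show "df (\<lambda>e. ?K (e 0))" by (intro dfs5 dt_const)
    show "?K emp" using hf_emp[of emp] by (auto simp: isemp_iff intro!: exI[of _ emp])
    fix k assume k: "?K k"
    show "?K (succ k)"
    proof
      assume "E (succ k) n \<or> succ k = n"
      then have kn: "E k n" using natp_trn[OF n] unfolding trn_def by (metis E_succ)
      then obtain G where G: "hf E G" "\<And>v. E v G \<longleftrightarrow> (\<exists>i. E i k \<and> E (pr i v) s)" using k by blast
      obtain w where w: "E (pr k w) s" "\<And>x. E (pr k x) s ==> x = w" using s kn unfolding seqp_def by blast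
      have "hf E w" using assms(2) F kn w(1) by blast
      then have "hf E (adj G w)" by (rule hf_adj'[OF G(1)])
      moreover have "E v (adj G w) \<longleftrightarrow> (\<exists>i. E i (succ k) \<and> E (pr i v) s)" for v
        unfolding E_adj E_succ G(2) using w by blast
      ultimately show "\<exists>G. hf E G \<and> (\<forall>v. E v G \<longleftrightarrow> (\<exists>i. E i (succ k) \<and> E (pr i v) s))" by blast
    qed
  qed
  then obtain G where "hf E G" "\<And>v. E v G \<longleftrightarrow> E v F" unfolding F by blast
  then show ?thesis using ext[of G F] by metis
qed

end

section \<open>The main theorem\<close>

lemma (in Z) sLogI:
  "sForm f ==> sForm g ==> sLog (mImp f (mImp g f))"
  "sForm f ==> sForm g ==> sForm i ==> sLog (mImp (mImp f (mImp g i)) (mImp (mImp f g) (mImp f i)))"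
  "sForm f ==> sForm g ==> sLog (mImp (mImp (mNeg f) (mNeg g)) (mImp g f))"
  "natp x ==> sForm f ==> sForm g ==> sLog (mImp (mAll x (mImp f g)) (mImp (mAll x f) (mAll x g)))"
  "natp x ==> sForm f ==> sLog (mImp (mAll x f) f)"
  "natp x ==> sNF x f ==> sLog (mImp f (mAll x f))"
  "natp x ==> natp y ==> sLog (mNeg (mAll x (mNeg (mEq x y))))"
  "natp x ==> natp y ==> natp z ==> sLog (mImp (mEq x y) (mImp (mEq x z) (mEq y z)))"
  "natp x ==> natp y ==> natp z ==> sLog (mImp (mEq x y) (mImp (mMem x z) (mMem y z)))"
  "natp x ==> natp y ==> natp z ==> sLog (mImp (mEq x y) (mImp (mMem z x) (mMem z y)))"
proof -
  show "sLog (mImp f (mImp g f))" if "sForm f" "sForm g"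
    unfolding sLog_def by (rule disjI1, use that in blast)
  show "sLog (mImp (mImp f (mImp g i)) (mImp (mImp f g) (mImp f i)))" if "sForm f" "sForm g" "sForm i"
    unfolding sLog_def by (rule disjI2, rule disjI1, use that in blast)
  show "sLog (mImp (mImp (mNeg f) (mNeg g)) (mImp g f))" if "sForm f" "sForm g"
    unfolding sLog_def by (rule disjI2, rule disjI2, rule disjI1, use that in blast)
  show "sLog (mImp (mAll x (mImp f g)) (mImp (mAll x f) (mAll x g)))" if "natp x" "sForm f" "sForm g"
    unfolding sLog_def by (rule disjI2, rule disjI2, rule disjI2, rule disjI1, use that in blast)
  show "sLog (mImp (mAll x f) f)" if "natp x" "sForm f"
    unfolding sLog_def by (rule disjI2, rule disjI2, rule disjI2, rule disjI2, rule disjI1, use that in blast)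
  show "sLog (mImp f (mAll x f))" if "natp x" "sNF x f"
    unfolding sLog_def by (rule disjI2, rule disjI2, rule disjI2, rule disjI2, rule disjI2, rule disjI1, use that in blast)
  show "sLog (mNeg (mAll x (mNeg (mEq x y))))" if "natp x" "natp y"
    unfolding sLog_def by (rule disjI2, rule disjI2, rule disjI2, rule disjI2, rule disjI2, rule disjI2, rule disjI1, use that in blast)
  show "sLog (mImp (mEq x y) (mImp (mEq x z) (mEq y z)))" if "natp x" "natp y" "natp z"
    unfolding sLog_def by (rule disjI2, rule disjI2, rule disjI2, rule disjI2, rule disjI2, rule disjI2, rule disjI2, rule disjI1, use that in blast)
  show "sLog (mImp (mEq x y) (mImp (mMem x z) (mMem y z)))" if "natp x" "natp y" "natp z"
    unfolding sLog_def by (rule disjI2, rule disjI2, rule disjI2, rule disjI2, rule disjI2, rule disjI2, rule disjI2, rule disjI2, rule disjI1, use that in blast)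
  show "sLog (mImp (mEq x y) (mImp (mMem z x) (mMem z y)))" if "natp x" "natp y" "natp z"
    unfolding sLog_def by (rule disjI2, rule disjI2, rule disjI2, rule disjI2, rule disjI2, rule disjI2, rule disjI2, rule disjI2, rule disjI2, use that in blast)
qed

lemma (in W) fin_bound0: "finite X ==> \<exists>b. \<forall>x\<in>X. x \<prec> b"
proof -
  assume "finite X"
  then have "\<exists>b. \<forall>x\<in>X. E x b"
  proof (induction rule: finite_induct)
    case (insert x X)
    then obtain b where "\<forall>y\<in>X. E y b" by blast
    then show ?case by (intro exI[of _ "adj b x"]) auto
  qed simp
  then show ?thesis using E_lt by blast
qed

section \<open>The formalized syntax of a model as a world\<close>

locale internal = Z E df for E :: "nat => nat => bool" and df +
  fixes h :: "nat => nat"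
  assumes inj_h: "inj h" and range_h: "range h = {x. hf E x}"
begin

sublocale r: restr E df h "hf E"
  by unfold_locales (use inj_h range_h in \<open>auto intro: dfs\<close>)

abbreviation "E' \<equiv> r.E'"
abbreviation "df' \<equiv> r.df'"

sublocale w: W E' df' "lam E'" by (rule HFt.W_lam[OF HFt_restr[OF inj_h range_h]])

abbreviation lt' (infix "\<prec>" 50) where "x \<prec> y \<equiv> lam E' x y"

definition hi where "hi = inv h"
lemma h_hi: "hf E c ==> h (hi c) = c" unfolding hi_def using range_h by (intro f_inv_into_f) auto
lemma hi_h [simp]: "hi (h x) = x" unfolding hi_def using inj_h by simp
lemma hf_h [simp]: "hf E (h x)" using range_h by auto
lemma h_inj [simp]: "h x = h y \<longleftrightarrow> x = y" using inj_h by (simp add: inj_eq)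
lemma h_ex: "hf E c ==> \<exists>x. c = h x" using h_hi by metis

definition mem' where "mem' x y = hi (mMem (h x) (h y))"
definition eq' where "eq' x y = hi (mEq (h x) (h y))"
definition neg' where "neg' x = hi (mNeg (h x))"
definition imp' where "imp' x y = hi (mImp (h x) (h y))"
definition all' where "all' x y = hi (mAll (h x) (h y))"
definition isv' where "isv' x \<longleftrightarrow> natp (h x)"
definition Form' where "Form' x \<longleftrightarrow> sForm (h x)"
definition fv' where "fv' c v \<longleftrightarrow> (\<exists>V. sFV (h c) V \<and> E (h v) V)"
definition sv' where "sv' i = hi (numv i)"
definition Th' where "Th' c \<longleftrightarrow> sDer sZF (h c)"

lemmas c'_defs = mem'_def eq'_def neg'_def imp'_def all'_def
lemmas s'_defs = isv'_def Form'_def fv'_def Th'_def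

lemma h_c [simp]: "h (mem' x y) = mMem (h x) (h y)" "h (eq' x y) = mEq (h x) (h y)" "h (neg' x) = mNeg (h x)"
  "h (imp' x y) = mImp (h x) (h y)" "h (all' x y) = mAll (h x) (h y)" "h (sv' i) = numv i"
  unfolding c'_defs sv'_def by (simp_all add: h_hi hf_mc hf_numv)

lemma c'_inj: "mem' x y = mem' x' y' \<longleftrightarrow> x = x' \<and> y = y'" "eq' x y = eq' x' y' \<longleftrightarrow> x = x' \<and> y = y'"
      "neg' \<phi> = neg' \<phi>' \<longleftrightarrow> \<phi> = \<phi>'" "imp' \<phi> \<psi> = imp' \<phi>' \<psi>' \<longleftrightarrow> \<phi> = \<phi>' \<and> \<psi> = \<psi>'"
      "all' x \<phi> = all' x' \<phi>' \<longleftrightarrow> x = x' \<and> \<phi> = \<phi>'"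
  by (metis h_c(1) mc_inj(1) h_inj, metis h_c(2) mc_inj(2) h_inj, metis h_c(3) mc_inj(3) h_inj,
    metis h_c(4) mc_inj(4) h_inj, metis h_c(5) mc_inj(5) h_inj)
lemma c'_dist: "mem' x y \<noteq> eq' x' y'" "mem' x y \<noteq> neg' \<phi>" "mem' x y \<noteq> imp' \<phi> \<psi>" "mem' x y \<noteq> all' x' \<phi>"
      "eq' x y \<noteq> neg' \<phi>" "eq' x y \<noteq> imp' \<phi> \<psi>" "eq' x y \<noteq> all' x' \<phi>" "neg' \<chi> \<noteq> imp' \<phi> \<psi>" "neg' \<chi> \<noteq> all' x' \<phi>"
      "imp' \<chi> \<eta> \<noteq> all' x' \<phi>"
  by (metis h_c mc_dist)+

lemma df'I: "df P ==> df' (\<lambda>e. P (\<lambda>i. h (e i)))" unfolding r.df'_def by blast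

lemma dt'I: assumes "df (\<lambda>e. e 0 = f (e (Suc 0)) (e (Suc (Suc 0))))" "\<And>x y z. x = g y z \<longleftrightarrow> h x = f (h y) (h z)"
  shows "w.dt (\<lambda>e. g (e 0) (e (Suc 0)))"
  unfolding w.dt_def assms(2) using df'I[OF assms(1)] .

lemma E_hi: assumes "E a b" "hf E b" shows "hi a \<prec> hi b"
proof (rule w.E_lt)
  have "hf E a" using hf_elem assms by blast
  then show "E' (hi a) (hi b)" unfolding r.E'_def using assms by (simp add: h_hi)
qed

lemma pr_hi: assumes "hf E a" "hf E b" shows "hi a \<prec> hi (pr a b)" "hi b \<prec> hi (pr a b)"
proof -
  have 1: "hi (up a b) \<prec> hi (pr a b)" by (intro E_hi hf_pr assms pr_elem)
  have "hi a \<prec> hi (up a b)" "hi b \<prec> hi (up a b)" by (intro E_hi hf_up assms pr_elem)+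
  then show "hi a \<prec> hi (pr a b)" "hi b \<prec> hi (pr a b)" using w.lt_trans[OF _ 1] by blast+
qed

lemma sub_lt': "x \<prec> mem' x y" "y \<prec> mem' x y" "x \<prec> eq' x y" "y \<prec> eq' x y" "x \<prec> neg' x"
  "x \<prec> imp' x y" "y \<prec> imp' x y" "x \<prec> all' x y" "y \<prec> all' x y"
proof -
  have 2: "x \<prec> hi (pr (numv k) (h x))" for x k using pr_hi(2)[of "numv k" "h x"] by (simp add: hf_numv)
  have 3: "x \<prec> hi (pr (numv k) (pr (h x) (h y)))" "y \<prec> hi (pr (numv k) (pr (h x) (h y)))" for x y k
  proof -
    have 1: "hi (pr (h x) (h y)) \<prec> hi (pr (numv k) (pr (h x) (h y)))" by (intro pr_hi hf_numv hf_pr hf_h)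
    have "x \<prec> hi (pr (h x) (h y))" "y \<prec> hi (pr (h x) (h y))" using pr_hi[of "h x" "h y"] by simp_all
    then show "x \<prec> hi (pr (numv k) (pr (h x) (h y)))" "y \<prec> hi (pr (numv k) (pr (h x) (h y)))"
      using w.lt_trans[OF _ 1] by blast+
  qed
  show "x \<prec> mem' x y" "y \<prec> mem' x y" "x \<prec> eq' x y" "y \<prec> eq' x y" "x \<prec> neg' x"
    "x \<prec> imp' x y" "y \<prec> imp' x y" "x \<prec> all' x y" "y \<prec> all' x y"
    unfolding c'_defs mc_defs by (rule 2 3)+
qed

lemma pull': assumes "df' (\<lambda>e. P (e 0))" shows "\<exists>Q. df (\<lambda>e. Q (e 0)) \<and> (\<forall>x. P x = Q (h x))"
proof -
  obtain P0 where P0: "df P0" "\<And>e. P (e 0) = P0 (\<lambda>i. h (e i))" using assms unfolding r.df'_def by metis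
  have "df (\<lambda>e. P0 (\<lambda>i. e 0))" using df_re[OF P0(1), of "\<lambda>i. 0"] .
  moreover have "P x = P0 (\<lambda>i. h x)" for x using P0(2)[of "\<lambda>i. x"] .
  ultimately show ?thesis by (intro exI[of _ "\<lambda>c. P0 (\<lambda>i. c)"]) simp
qed

lemma natp_ex: "natp x ==> \<exists>x'. x = h x' \<and> isv' x'" unfolding isv'_def using h_ex[OF hf_natp] by metis
lemma sForm_ex: "sForm c ==> \<exists>c'. c = h c' \<and> Form' c'" unfolding Form'_def using h_ex[OF hf_sForm] by metis

lemma F_induct':
  assumes P: "df' (\<lambda>e. P (e 0))" and F: "Form' \<phi>"
    and s: "\<And>x y. isv' x ==> isv' y ==> P (mem' x y)" "\<And>x y. isv' x ==> isv' y ==> P (eq' x y)"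
      "\<And>\<phi>. Form' \<phi> ==> P \<phi> ==> P (neg' \<phi>)" "\<And>\<phi> \<psi>. Form' \<phi> ==> Form' \<psi> ==> P \<phi> ==> P \<psi> ==> P (imp' \<phi> \<psi>)"
      "\<And>x \<phi>. isv' x ==> Form' \<phi> ==> P \<phi> ==> P (all' x \<phi>)"
  shows "P \<phi>"
proof -
  obtain Q where Q: "df (\<lambda>e. Q (e 0))" "\<And>x. P x = Q (h x)" using pull'[OF P] by blast
  have "Q (h \<phi>)"
  proof (rule sForm_induct[of "h \<phi>" Q, OF F[unfolded Form'_def] Q(1)])
    show "Q (mMem x y)" if n: "natp x" "natp y" for x y
    proof -
      obtain x' y' where "x = h x'" "isv' x'" "y = h y'" "isv' y'" using natp_ex n by metis
      then show ?thesis using s(1)[of x' y'] unfolding Q(2) by simp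
    qed
    show "Q (mEq x y)" if n: "natp x" "natp y" for x y
    proof -
      obtain x' y' where "x = h x'" "isv' x'" "y = h y'" "isv' y'" using natp_ex n by metis
      then show ?thesis using s(2)[of x' y'] unfolding Q(2) by simp
    qed
    show "Q (mNeg a)" if n: "sForm a" "Q a" for a
    proof -
      obtain a' where "a = h a'" "Form' a'" using sForm_ex n by metis
      then show ?thesis using s(3)[of a'] n unfolding Q(2) by simp
    qed
    show "Q (mImp a b)" if n: "sForm a" "sForm b" "Q a" "Q b" for a b
    proof -
      obtain a' b' where "a = h a'" "Form' a'" "b = h b'" "Form' b'" using sForm_ex n by metis
      then show ?thesis using s(4)[of a' b'] n unfolding Q(2) by simp
    qed
    show "Q (mAll x a)" if n: "natp x" "sForm a" "Q a" for x a
    proof -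
      obtain x' a' where "x = h x'" "isv' x'" "a = h a'" "Form' a'" using sForm_ex natp_ex n by metis
      then show ?thesis using s(5)[of x' a'] n unfolding Q(2) by simp
    qed
  qed
  then show ?thesis unfolding Q(2) .
qed

lemma isv'_c: "Form' (mem' x y) \<longleftrightarrow> isv' x \<and> isv' y" "Form' (eq' x y) \<longleftrightarrow> isv' x \<and> isv' y"
  "Form' (neg' \<phi>) \<longleftrightarrow> Form' \<phi>" "Form' (imp' \<phi> \<psi>) \<longleftrightarrow> Form' \<phi> \<and> Form' \<psi>" "Form' (all' x \<phi>) \<longleftrightarrow> isv' x \<and> Form' \<phi>"
  unfolding s'_defs by simp_all

lemma fv'_c:
  "isv' x ==> isv' y ==> fv' (mem' x y) v \<longleftrightarrow> v = x \<or> v = y"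
  "isv' x ==> isv' y ==> fv' (eq' x y) v \<longleftrightarrow> v = x \<or> v = y"
  "fv' (neg' \<phi>) v \<longleftrightarrow> fv' \<phi> v"
  "Form' \<phi> ==> Form' \<psi> ==> fv' (imp' \<phi> \<psi>) v \<longleftrightarrow> fv' \<phi> v \<or> fv' \<psi> v"
  "isv' x ==> fv' (all' x \<phi>) v \<longleftrightarrow> fv' \<phi> v \<and> v \<noteq> x"
proof -
  show "isv' x ==> isv' y ==> fv' (mem' x y) v \<longleftrightarrow> v = x \<or> v = y" unfolding s'_defs by simp
  show "isv' x ==> isv' y ==> fv' (eq' x y) v \<longleftrightarrow> v = x \<or> v = y" unfolding s'_defs by simp
  show "fv' (neg' \<phi>) v \<longleftrightarrow> fv' \<phi> v" unfolding s'_defs by simp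
  show "isv' x ==> fv' (all' x \<phi>) v \<longleftrightarrow> fv' \<phi> v \<and> v \<noteq> x" unfolding s'_defs by auto
  assume "Form' \<phi>" "Form' \<psi>"
  then obtain A B where "sFV (h \<phi>) A" "sFV (h \<psi>) B" unfolding Form'_def sForm_def by blast
  then show "fv' (imp' \<phi> \<psi>) v \<longleftrightarrow> fv' \<phi> v \<or> fv' \<psi> v"
    unfolding fv'_def h_c sFV_Imp using sFV_unique E_un by blast
qed

lemma df'_isv: "df' (\<lambda>e. isv' (e 0))" unfolding isv'_def using df'I[OF df_natp[OF dt_var[of 0]]] .
lemma df'_Form: "df' (\<lambda>e. Form' (e 0))" unfolding Form'_def using df'I[OF df_sForm[OF dt_var[of 0]]] .
lemma df'_fv: "df' (\<lambda>e. fv' (e 0) (e (Suc 0)))"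
proof -
  have "df (\<lambda>e. \<exists>V. sFV (e 0) V \<and> E (e (Suc 0)) V)" by (intro dfs5 df_sFV)
  from df'I[OF this] show ?thesis unfolding fv'_def .
qed
lemma df'_Th: "df' (\<lambda>e. Th' (e 0))" unfolding Th'_def using df'I[OF df_sDer[OF df_sZF[OF dt_var] dt_var[of 0]]] .

lemma fv_lt': "Form' \<phi> ==> fv' \<phi> v ==> isv' v \<and> v \<prec> \<phi>"
proof -
  assume F: "Form' \<phi>"
  let ?P = "\<lambda>\<phi>. \<forall>v. fv' \<phi> v --> isv' v \<and> v \<prec> \<phi>"
  have "?P \<phi>"
  proof (rule F_induct'[of ?P, OF _ F])
    show "df' (\<lambda>e. ?P (e 0))" by (intro w.dfs4 w.df_comp2[OF df'_fv] w.df_comp1[OF df'_isv])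
    show "?P (mem' x y)" "?P (eq' x y)" if "isv' x" "isv' y" for x y using that sub_lt'(1-4) by (auto simp: fv'_c)
    show "?P (neg' \<phi>)" if "?P \<phi>" for \<phi> using that w.lt_trans[OF _ sub_lt'(5)] by (auto simp: fv'_c)
    show "?P (imp' \<phi> \<psi>)" if "Form' \<phi>" "Form' \<psi>" "?P \<phi>" "?P \<psi>" for \<phi> \<psi>
      using that w.lt_trans[OF _ sub_lt'(6)] w.lt_trans[OF _ sub_lt'(7)] by (auto simp: fv'_c)
    show "?P (all' x \<phi>)" if "isv' x" "Form' \<phi>" "?P \<phi>" for x \<phi>
      using that w.lt_trans[OF _ sub_lt'(9)] by (auto simp: fv'_c)
  qed
  then show "fv' \<phi> v ==> isv' v \<and> v \<prec> \<phi>" by blast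
qed

text \<open>Otherwise the natural numbers would form a set inside a segment; its largest element has
  a successor, which is larger.\<close>

lemma isv_unb': "\<exists>v. isv' v \<and> b \<prec> v"
proof (rule ccontr)
  assume n: "\<not> (\<exists>v. isv' v \<and> b \<prec> v)"
  obtain s where s: "\<And>y. E' y s \<longleftrightarrow> y \<prec> b" using w.seg_ex by blast
  obtain N where N: "\<And>x. E' x N \<longleftrightarrow> E' x (w.adj s b) \<and> isv' x" using w.sep[OF df'_isv] by blast
  have all: "E' x N" if "isv' x" for x using n that N s w.lt_total[of x b] by auto
  have "isv' (hi emp)" unfolding isv'_def using h_hi[OF hf_natp[OF natp_emp]] natp_emp by simp
  then obtain m where m: "E' m N" "\<And>y. E' y N ==> \<not> m \<prec> y" using w.max_ex all by blast
  have "natp (h m)" using m(1) N unfolding isv'_def by blast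
  then have k: "natp (succ (h m))" by (rule natp_succ)
  then have "h (hi (succ (h m))) = succ (h m)" by (intro h_hi hf_natp)
  then have "isv' (hi (succ (h m)))" "E' m (hi (succ (h m)))" unfolding isv'_def r.E'_def using k by simp_all
  then show False using m(2) all w.E_lt by blast
qed

lemma codes': "codes isv' Form' mem' eq' neg' imp' all' fv' sv'"
proof
  show "sv' i = sv' j \<longleftrightarrow> i = j" for i j using numv_inj[of i j] h_inj[of "sv' i" "sv' j"] by simp
  show "isv' (sv' i)" for i unfolding isv'_def by (simp add: numv_natp)
  show "\<exists>v. isv' v \<and> v \<notin> X \<and> (\<forall>\<phi>\<in>Y. \<not> fv' \<phi> v)" if f: "finite X" "finite Y" "\<And>\<phi>. \<phi> \<in> Y ==> Form' \<phi>" for X Y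
  proof -
    obtain b where b: "\<And>x. x \<in> X \<union> Y ==> x \<prec> b" using w.fin_bound0[of "X \<union> Y"] f by blast
    obtain v where v: "isv' v" "b \<prec> v" using isv_unb' by blast
    have lt: "x \<prec> v" if "x \<in> X \<union> Y" for x using w.lt_trans[OF b[OF that] v(2)] .
    have "v \<notin> X" using lt[of v] by auto
    moreover have "\<not> fv' \<phi> v" if "\<phi> \<in> Y" for \<phi> using fv_lt'[OF f(3)[OF that], of v] lt[of \<phi>] that w.lt_asym by blast
    ultimately show ?thesis using v by blast
  qed
qed (simp_all add: fv'_c isv'_c)

lemma NF': "Form' \<phi> ==> sNF (h x) (h \<phi>) \<longleftrightarrow> \<not> fv' \<phi> x"
  unfolding sNF_def fv'_def Form'_def sForm_def using sFV_unique by blast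

lemmas Dz = sDer_rules[OF df_sZF[OF dt_var]]

lemma logic': "logic isv' Form' mem' eq' neg' imp' all' fv' sv' Th'"
proof -
  interpret codes isv' Form' mem' eq' neg' imp' all' fv' sv' by (rule codes')
  show ?thesis
  proof
    show "Th' \<phi> ==> Form' \<phi>" for \<phi>
      unfolding Th'_def Form'_def by (rule sDer_Form[OF df_sZF[OF dt_var] sZF_Form])
    show "Th' \<phi> ==> Th' (imp' \<phi> \<psi>) ==> Th' \<psi>" for \<phi> \<psi> unfolding Th'_def h_c by (rule Dz(3))
    show "isv' x ==> Th' \<phi> ==> Th' (all' x \<phi>)" for x \<phi> unfolding Th'_def h_c isv'_def by (rule Dz(4))
    show "isv' x ==> Form' \<phi> ==> \<not> fv' \<phi> x ==> Th' (imp' \<phi> (all' x \<phi>))" for x \<phi>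
      unfolding Th'_def h_c using NF'[of \<phi> x] by (intro Dz(2) sLogI) (simp_all add: isv'_def)
  qed (unfold Th'_def h_c, (intro Dz(2) sLogI; simp add: isv'_def Form'_def)+)
qed

lemma Syn': "Syn E' df' (lam E') isv' Form' mem' eq' neg' imp' all' fv' sv' Th'"
proof -
  interpret lg: logic isv' Form' mem' eq' neg' imp' all' fv' sv' Th' by (rule logic')
  have i: "g = g' \<longleftrightarrow> h g = h g'" for g g' by simp
  show ?thesis
  proof
    show "w.dt (\<lambda>e. mem' (e 0) (e (Suc 0)))" by (rule dt'I[of mMem]) (intro dfs5, simp add: i[of _ "mem' _ _"] del: h_inj)
    show "w.dt (\<lambda>e. eq' (e 0) (e (Suc 0)))" by (rule dt'I[of mEq]) (intro dfs5, simp add: i[of _ "eq' _ _"] del: h_inj)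
    show "w.dt (\<lambda>e. imp' (e 0) (e (Suc 0)))" by (rule dt'I[of mImp]) (intro dfs5, simp add: i[of _ "imp' _ _"] del: h_inj)
    show "w.dt (\<lambda>e. all' (e 0) (e (Suc 0)))" by (rule dt'I[of mAll]) (intro dfs5, simp add: i[of _ "all' _ _"] del: h_inj)
    show "w.dt (\<lambda>e. neg' (e 0))" by (rule dt'I[of "\<lambda>x y. mNeg x" "\<lambda>x y. neg' x"]) (intro dfs5, simp add: i[of _ "neg' _"] del: h_inj)
    show "P \<phi>" if "df' (\<lambda>e. P (e 0))" "Form' \<phi>" "\<And>x y. isv' x ==> isv' y ==> P (mem' x y)" "\<And>x y. isv' x ==> isv' y ==> P (eq' x y)"
      "\<And>\<phi>. Form' \<phi> ==> P \<phi> ==> P (neg' \<phi>)" "\<And>\<phi> \<psi>. Form' \<phi> ==> Form' \<psi> ==> P \<phi> ==> P \<psi> ==> P (imp' \<phi> \<psi>)"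
      "\<And>x \<phi>. isv' x ==> Form' \<phi> ==> P \<phi> ==> P (all' x \<phi>)" for P \<phi> using that by (rule F_induct')
  qed (fact df'_isv df'_Form df'_fv df'_Th sub_lt' isv_unb' c'_inj c'_dist | rule fv_lt', assumption+)+
qed

text \<open>Turns closure under the calculus into induction over formalized derivations:
  \<open>P\<close> is pulled back along \<open>h\<close>, and each internal logical axiom is matched
  with a rule of \<open>logic\<close>.\<close>

lemma ind':
  assumes A: "df (\<lambda>e. A (e 0))" "\<And>c. A c ==> sForm c" and P: "df' (\<lambda>e. P (e 0))"
    and L: "logic isv' Form' mem' eq' neg' imp' all' fv' sv' P" and AP: "\<And>\<phi>. A (h \<phi>) ==> P \<phi>" and D: "sDer A (h \<phi>)"
  shows "P \<phi>"
proof -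
  interpret L: logic isv' Form' mem' eq' neg' imp' all' fv' sv' P by (rule L)
  obtain Q where Q: "df (\<lambda>e. Q (e 0))" "\<And>x. P x = Q (h x)" using pull'[OF P] by blast
  \<comment> \<open>Being a formula is carried along so that each formula in the derivation has the
    form \<open>h x\<close>, where \<open>Q\<close> expresses \<open>P\<close>.\<close>
  have "sForm (h \<phi>) \<and> Q (h \<phi>)"
  proof (rule sDer_induct[of A "h \<phi>" "\<lambda>c. sForm c \<and> Q c", OF A(1) D])
    show "df (\<lambda>e. sForm (e 0) \<and> Q (e 0))" by (intro df_conj df_sForm dt_var Q(1))
    show "sForm c \<and> Q c" if "A c" for c
    proof -
      obtain c' where c: "c = h c'" "Form' c'" using sForm_ex A(2) \<open>A c\<close> by blast
      then show ?thesis using AP[of c'] A(2) that Q(2) by blast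
    qed
    show "sForm c \<and> Q c" if h: "sForm a \<and> Q a" "sForm (mImp a c) \<and> Q (mImp a c)" for a c
    proof -
      obtain a' c' where c: "a = h a'" "Form' a'" "c = h c'" "Form' c'" using sForm_ex h by (metis sForm_c(4))
      have "P a'" "P (imp' a' c')" unfolding Q(2) using h c by simp_all
      then have "P c'" using L.MP c by blast
      then show ?thesis using c h Q(2) by simp
    qed
    show "sForm (mAll x a) \<and> Q (mAll x a)" if h: "natp x" "sForm a \<and> Q a" for x a
    proof -
      obtain x' a' where c: "x = h x'" "isv' x'" "a = h a'" "Form' a'" using sForm_ex natp_ex h by metis
      have "P a'" unfolding Q(2) using h c by simp
      then have "P (all' x' a')" using L.Gen c by blast
      then show ?thesis using c h Q(2) by simp
    qed
    show "sForm c \<and> Q c" if sl: "sLog c" for c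
    proof
      show "sForm c" using sl by (rule sLog_Form)
      have NF: "\<exists>f'. f = h f' \<and> Form' f' \<and> \<not> fv' f' x'" if n: "sNF (h x') f" for x' f
      proof -
        have "sForm f" using n unfolding sNF_def sForm_def by blast
        then obtain f' where "f = h f'" "Form' f'" using sForm_ex by blast
        then show ?thesis using NF' n by blast
      qed
      from sl show "Q c" unfolding sLog_def
      proof (elim disjE exE conjE)
        show "Q c" if "sForm f" "sForm g" "c = mImp f (mImp g f)" for f g
          using sForm_ex[OF that(1)] sForm_ex[OF that(2)] that(3) L.L1 unfolding Q(2) by (elim exE conjE) simp
        show "Q c" if "sForm f" "sForm g" "sForm i" "c = mImp (mImp f (mImp g i)) (mImp (mImp f g) (mImp f i))" for f g i
          using sForm_ex[OF that(1)] sForm_ex[OF that(2)] sForm_ex[OF that(3)] that(4) L.L2 unfolding Q(2) by (elim exE conjE) simp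
        show "Q c" if "sForm f" "sForm g" "c = mImp (mImp (mNeg f) (mNeg g)) (mImp g f)" for f g
          using sForm_ex[OF that(1)] sForm_ex[OF that(2)] that(3) L.L3 unfolding Q(2) by (elim exE conjE) simp
        show "Q c" if "natp x" "sForm f" "sForm g" "c = mImp (mAll x (mImp f g)) (mImp (mAll x f) (mAll x g))" for x f g
          using natp_ex[OF that(1)] sForm_ex[OF that(2)] sForm_ex[OF that(3)] that(4) L.Distr unfolding Q(2) by (elim exE conjE) simp
        show "Q c" if "natp x" "sForm f" "c = mImp (mAll x f) f" for x f
          using natp_ex[OF that(1)] sForm_ex[OF that(2)] that(3) L.Spec unfolding Q(2) by (elim exE conjE) simp
        show "Q c" if n: "natp x" "sNF x f" "c = mImp f (mAll x f)" for x f
        proof -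
          obtain x' where x: "x = h x'" "isv' x'" using natp_ex[OF n(1)] by blast
          obtain f' where f: "f = h f'" "Form' f'" "\<not> fv' f' x'" using NF n(2) x by blast
          show ?thesis using L.Vac[OF x(2) f(2,3)] x f n(3) unfolding Q(2) by simp
        qed
        show "Q c" if "natp x" "natp y" "c = mNeg (mAll x (mNeg (mEq x y)))" for x y
          using natp_ex[OF that(1)] natp_ex[OF that(2)] that(3) L.ExEq unfolding Q(2) by (elim exE conjE) simp
        show "Q c" if "natp x" "natp y" "natp z" "c = mImp (mEq x y) (mImp (mEq x z) (mEq y z))" for x y z
          using natp_ex[OF that(1)] natp_ex[OF that(2)] natp_ex[OF that(3)] that(4) L.EqEq unfolding Q(2) by (elim exE conjE) simp
        show "Q c" if "natp x" "natp y" "natp z" "c = mImp (mEq x y) (mImp (mMem x z) (mMem y z))" for x y z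
          using natp_ex[OF that(1)] natp_ex[OF that(2)] natp_ex[OF that(3)] that(4) L.EqMemL unfolding Q(2) by (elim exE conjE) simp
        show "Q c" if "natp x" "natp y" "natp z" "c = mImp (mEq x y) (mImp (mMem z x) (mMem z y))" for x y z
          using natp_ex[OF that(1)] natp_ex[OF that(2)] natp_ex[OF that(3)] that(4) L.EqMemR unfolding Q(2) by (elim exE conjE) simp
      qed
    qed
  qed
  then show ?thesis unfolding Q(2) by blast
qed

lemma Sax': "codes.Sax isv' Form' mem' eq' neg' imp' all' fv' sv' \<phi> \<longleftrightarrow> sZF (h \<phi>)"
proof -
  interpret codes isv' Form' mem' eq' neg' imp' all' fv' sv' by (rule codes')
  have cd: "h (cd \<chi>) = mcode \<chi>" for \<chi> by (induction \<chi>) simp_all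
  have s: "h (sepc x a b f) = mSep (h x) (h a) (h b) (h f)" for x a b f unfolding sepc_def mSep_def by simp
  have r: "h (replc x y z a b f) = mRepl (h x) (h y) (h z) (h a) (h b) (h f)" for x y z a b f unfolding replc_def mRepl_def by simp
  have NFF: "sNF x f ==> sForm f" for x f unfolding sNF_def sForm_def by blast
  show ?thesis
  proof
    assume "Sax \<phi>"
    then consider \<chi> where "\<phi> = cd \<chi>" "\<chi> \<in> {extensionality_ax, foundation_ax, pairing_ax, union_ax, power_ax}"
      | x a b f where "isv' x" "isv' a" "isv' b" "distinct [x, a, b]" "Form' f" "\<not> fv' f b" "\<phi> = sepc x a b f"
      | x y z a b f where "isv' x" "isv' y" "isv' z" "isv' a" "isv' b" "distinct [x, y, z, a, b]" "Form' f"
          "\<not> fv' f z" "\<not> fv' f b" "\<phi> = replc x y z a b f"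
      unfolding Sax_def by blast
    then show "sZF (h \<phi>)"
    proof cases
      case 1 then show ?thesis unfolding sZF_def by (auto simp: cd)
    next
      case (2 x a b f)
      have "natp (h x) \<and> h x \<noteq> h a \<and> h x \<noteq> h b \<and> natp (h a) \<and> h a \<noteq> h b \<and> natp (h b) \<and> sNF (h b) (h f) \<and>
        h \<phi> = mSep (h x) (h a) (h b) (h f)"
        using 2 NF'[of f b] unfolding isv'_def by (simp add: s)
      then show ?thesis unfolding sZF_def by blast
    next
      case (3 x y z a b f)
      have "natp (h x) \<and> h x \<noteq> h y \<and> h x \<noteq> h z \<and> h x \<noteq> h a \<and> h x \<noteq> h b \<and> natp (h y) \<and> h y \<noteq> h z \<and> h y \<noteq> h a \<and> h y \<noteq> h b \<and>
       natp (h z) \<and> h z \<noteq> h a \<and> h z \<noteq> h b \<and> natp (h a) \<and> h a \<noteq> h b \<and> natp (h b) \<and> sNF (h z) (h f) \<and> sNF (h b) (h f) \<and>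
        h \<phi> = mRepl (h x) (h y) (h z) (h a) (h b) (h f)"
        using 3 NF'[of f b] NF'[of f z] unfolding isv'_def by (simp add: r)
      then show ?thesis unfolding sZF_def by blast
    qed
  next
    assume "sZF (h \<phi>)"
    then consider \<chi> where "h \<phi> = mcode \<chi>" "\<chi> \<in> {extensionality_ax, foundation_ax, pairing_ax, union_ax, power_ax}"
      | x a b f where "natp x" "x \<noteq> a" "x \<noteq> b" "natp a" "a \<noteq> b" "natp b" "sNF b f" "h \<phi> = mSep x a b f"
      | x y z a b f where "natp x" "x \<noteq> y" "x \<noteq> z" "x \<noteq> a" "x \<noteq> b" "natp y" "y \<noteq> z" "y \<noteq> a" "y \<noteq> b"
       "natp z" "z \<noteq> a" "z \<noteq> b" "natp a" "a \<noteq> b" "natp b" "sNF z f" "sNF b f" "h \<phi> = mRepl x y z a b f"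
      unfolding sZF_def by blast
    then show "Sax \<phi>"
    proof cases
      case (1 \<chi>)
      then have "\<phi> = cd \<chi>" unfolding cd[symmetric] by simp
      then show ?thesis using 1 unfolding Sax_def by blast
    next
      case (2 x a b f)
      obtain x' a' b' f' where c: "x = h x'" "isv' x'" "a = h a'" "isv' a'" "b = h b'" "isv' b'" "f = h f'" "Form' f'"
        using natp_ex[OF 2(1)] natp_ex[OF 2(4)] natp_ex[OF 2(6)] sForm_ex[OF NFF[OF 2(7)]] by blast
      then have "\<phi> = sepc x' a' b' f'" using 2(8) unfolding c(1,3,5,7) s[symmetric] by simp
      moreover have "distinct [x', a', b']" using 2 unfolding c(1,3,5) by simp
      moreover have "\<not> fv' f' b'" using NF'[OF c(8)] 2(7) unfolding c(5,7) by blast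
      ultimately show ?thesis unfolding Sax_def using c by blast
    next
      case (3 x y z a b f)
      obtain x' y' z' a' b' f' where c: "x = h x'" "isv' x'" "a = h a'" "isv' a'" "b = h b'" "isv' b'" "f = h f'" "Form' f'"
        "y = h y'" "isv' y'" "z = h z'" "isv' z'"
        using natp_ex[OF 3(1)] natp_ex[OF 3(6)] natp_ex[OF 3(10)] natp_ex[OF 3(13)] natp_ex[OF 3(15)] sForm_ex[OF NFF[OF 3(16)]] by blast
      then have "\<phi> = replc x' y' z' a' b' f'" using 3(18) unfolding c(1,3,5,7,9,11) r[symmetric] by simp
      moreover have "distinct [x', y', z', a', b']" using 3(1-15) unfolding c(1,3,5,9,11) by simp
      moreover have "\<not> fv' f' b'" "\<not> fv' f' z'" using NF'[OF c(8)] 3(16,17) unfolding c(5,7,11) by blast+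
      ultimately show ?thesis unfolding Sax_def using c by blast
    qed
  qed
qed

text \<open>\<open>F\<close> itself provides the bound: as an element of the world it lies above all
  its members in the order.\<close>

lemma not_finitely_axiomatizable':
  assumes con: "\<not> (\<exists>c. sDer sZF c \<and> sDer sZF (mNeg c))"
    and F: "finp F" "\<And>c. E c F ==> sFV c emp" "\<And>c. sDer (\<lambda>v. E v F) c \<longleftrightarrow> sDer sZF c"
  shows False
proof -
  have FF: "sForm c" if "E c F" for c using F(2)[OF that] unfolding sForm_def by blast
  have dF: "df (\<lambda>e. E (e 0) F)" by (intro dfs5 dt_const)
  have hF: "h (hi F) = F" by (intro h_hi hf_finp[OF F(1)] hf_sForm FF)
  show False
  proof (rule Syn_not_finitely_axiomatizable[OF Syn', where F="\<lambda>c. E (h c) F" and b="hi F"])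
    have "Form' (eq' (sv' 0) (sv' 0))" unfolding Form'_def by (simp add: natp_emp)
    moreover have "Form' (neg' (eq' (sv' 0) (sv' 0)))" unfolding Form'_def by (simp add: natp_emp)
    moreover have "\<not> (Th' (eq' (sv' 0) (sv' 0)) \<and> Th' (neg' (eq' (sv' 0) (sv' 0))))"
      using con unfolding Th'_def h_c by blast
    ultimately show "\<exists>\<phi>. Form' \<phi> \<and> \<not> Th' \<phi>" by blast
    show "Th' \<phi>" if "codes.Sax isv' Form' mem' eq' neg' imp' all' fv' sv' \<phi>" for \<phi>
      using that unfolding Sax' Th'_def by (rule Dz(1))
    show "\<phi> \<prec> hi F" if "E (h \<phi>) F" for \<phi> using w.E_lt[of \<phi> "hi F"] that unfolding r.E'_def hF .
    show "Th' \<phi>" if "E (h \<phi>) F" for \<phi>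
      unfolding Th'_def F(3)[symmetric] by (rule sDer_rules(1)[of "\<lambda>v. E v F", OF dF that])
    show "P \<phi>" if "df' (\<lambda>e. P (e 0))" "logic isv' Form' mem' eq' neg' imp' all' fv' sv' P"
      "\<And>\<phi>. codes.Sax isv' Form' mem' eq' neg' imp' all' fv' sv' \<phi> ==> P \<phi>" "Th' \<phi>" for P \<phi>
      by (rule ind'[of sZF, OF df_sZF[OF dt_var] sZF_Form that(1,2)]) (use that(3,4) in \<open>simp_all add: Sax' Th'_def\<close>)
    show "P \<phi>" if "df' (\<lambda>e. P (e 0))" "logic isv' Form' mem' eq' neg' imp' all' fv' sv' P"
      "\<And>\<phi>. E (h \<phi>) F ==> P \<phi>" "Th' \<phi>" for P \<phi>
      by (rule ind'[of "\<lambda>v. E v F", OF dF FF that(1,2)]) (use that(3,4) in \<open>simp_all add: F(3) Th'_def\<close>)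
  qed
qed

end

lemma fv_foldr_All: "fv (foldr All xs \<phi>) = fv \<phi> - set xs" by (induction xs) auto

lemma foldr_All_D: "T \<turnstile> foldr All xs \<phi> ==> T \<turnstile> \<phi>"
  by (induction xs) (auto intro: derivable.MP[OF _ derivable.Spec])

lemma sat_foldr_All: "(\<And>e. sat E Q e \<phi>) ==> sat E Q e (foldr All xs \<phi>)"
  by (induction xs arbitrary: e) auto

theorem theorem2p25:
  shows "(consistent ZF_minus_Inf \<longrightarrow> \<not> finitely_axiomatizable ZF_minus_Inf) \<and>
         ZF_minus_Inf \<turnstile> con_imp_not_finitely_axiomatizable"
proof
  show "consistent ZF_minus_Inf --> \<not> finitely_axiomatizable ZF_minus_Inf"
    using not_finitely_axiomatizable by blast
  let ?\<chi> = con_imp_not_finitely_axiomatizable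
  show "ZF_minus_Inf \<turnstile> ?\<chi>"
  proof (rule ccontr)
    assume n: "\<not> ZF_minus_Inf \<turnstile> ?\<chi>"
    \<comment> \<open>\<open>unprovable_neg\<close> needs a closed formula. Instead of computing the
      free variables, the sentence is replaced by its closure over all indices below
      \<open>k\<close>.\<close>
    obtain k where "\<forall>i\<in>fv ?\<chi>. i < k" using finite_nat_set_iff_bounded finite_fv by blast
    then have cl: "fv (foldr All [0..<k] ?\<chi>) = {}" unfolding fv_foldr_All by auto
    have "\<not> ZF_minus_Inf \<turnstile> foldr All [0..<k] ?\<chi>" using n foldr_All_D by blast
    from model_existence[OF _ unprovable_neg[OF cl this]] obtain E :: "nat => nat => bool"
      where E: "\<And>\<phi> e. insert (Neg (foldr All [0..<k] ?\<chi>)) ZF_minus_Inf \<turnstile> \<phi> ==> sat E (=) e \<phi>" by blast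
    have "\<exists>df. Z E df" by (rule Z_sat) (blast intro: E derivable.Hyp)
    then obtain df where "Z E df" by blast
    then interpret Z E df .
    have "\<not> S e (foldr All [0..<k] ?\<chi>)" for e using E[OF derivable.Hyp, of "Neg (foldr All [0..<k] ?\<chi>)" e] by simp
    then obtain e where "\<not> S e ?\<chi>" using sat_foldr_All by blast
    then have con: "\<not> (\<exists>c. sDer sZF c \<and> sDer sZF (mNeg c))"
      and fin: "\<exists>F. finp F \<and> (\<forall>c. E c F --> sFV c emp) \<and> (\<forall>c. sDer (\<lambda>v. E v F) c \<longleftrightarrow> sDer sZF c)"
      unfolding S_main by blast+
    obtain h :: "nat => nat" where h: "inj h" "range h = {x. hf E x}"
      using hf_infinite countableE_infinite[of "{x. hf E x}"] bij_betw_from_nat_into[of "{x. hf E x}"]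
      unfolding bij_betw_def by auto
    interpret internal E df h by unfold_locales (fact h)+
    show False using fin not_finitely_axiomatizable'[OF con] by blast
  qed
qed

end
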